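(* In the setting fixed in the context ($s>d/2+1$, $N>\frac{3\nu}{2}+s+2$, forcing $f$, frequency $\omega$, and for each $\varepsilon\in(0,\varepsilon_0)$ the quasi-periodic solution $(u_\omega,p_\omega)$ of size at most $C_0\varepsilon$), let $\alpha\in(0,1)$. Then there exist $\delta\in(0,1)$ and $C>0$, depending only on $f,s,\alpha,d,\nu$ (and on the diophantine constant $\gamma$ in case (A)), such that for every $\varepsilon\in(0,\varepsilon_0)$ with $\varepsilon\le\delta$ and every initial datum $u_0\in H^s(\mathbb T^d,\mathbb R^d)$ with $\operatorname{div}u_0=0$ and $$\|u_0-u_\omega(0,\cdot)\|_{H^s_x}\le\delta,\qquad \int_{\mathbb T^d}\big(u_0(x)-u_\omega(0,x)\big)\,dx=0,$$ there exists a unique global classical solution $(u,p)$ of $$\partial_t u-\Delta u+u\cdot\nabla u+\nabla p=\varepsilon f(\omega t,x),\qquad \operatorname{div}u=0,$$ with $u(0,x)=u_0(x)$, which satisfies $$u\in\mathcal C^0_b([0,+\infty),H^s(\mathbb T^d,\mathbb R^d))\cap\mathcal C^1_b([0,+\infty),H^{s-2}(\mathbb T^d,\mathbb R^d)),\qquad p\in\mathcal C^0_b([0,+\infty),H^s_0(\mathbb T^d,\mathbb R)),$$ $$\int_{\mathbb T^d}\big(u(t,x)-u_\omega(t,x)\big)\,dx=0\quad\forall t\ge0,$$ and, for every $t\ge0$, $$\|u(t,\cdot)-u_\omega(t,\cdot)\|_{H^s_x},\quad \|\partial_tu(t,\cdot)-\partial_tu_\omega(t,\cdot)\|_{H^{s-2}_x},\quad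 \|p(t,\cdot)-p_\omega(t,\cdot)\|_{H^s_x}\ \le\ C\delta e^{-\alpha t}.$$
   Context: Notation. $\mathbb T=\mathbb R/2\pi\mathbb Z$; $u\cdot\nabla v$ is the vector field with components $u\cdot\nabla v_i$. $H^s(\mathbb T^d,\mathbb R^n)$ has norm $\|u\|_{H^s_x}=\big(\sum_{\xi\in\mathbb Z^d}\langle\xi\rangle^{2s}|\widehat u(\xi)|^2\big)^{1/2}$, $\langle\xi\rangle=\max\{1,|\xi|\}$, $\widehat u(\xi)=(2\pi)^{-d}\int_{\mathbb T^d} u(x)e^{-ix\cdot\xi}dx$; $H^s_0$ is the subspace of functions with zero average. $\mathcal C^k_b(I,X)$ is the space of $k$-times continuously differentiable functions $I\to X$ with bounded derivatives up to order $k$. $\|U\|_{\mathcal C^0_\varphi X}$ is the sup-norm over $\mathbb T^\nu$, and $\|U\|_{\mathcal C^1_\varphi X}$ is the maximum of the sup-norms of $U$ and its first partial derivatives in $\varphi$. Setting. $d\ge2$, $\nu\ge1$, $s>d/2+1$, $N>\frac{3\nu}2+s+2$ an integer, $f\in\mathcal C^N(\mathbb T^\nu\times\mathbb T^d,\mathbb R^d)$, $\omega\in\mathbb R^\nu$, and one of the following holds: (A) $\int_{\mathbb T^\nu\times\mathbb T^d}f\,d\varphi\,dx=0$ and $\omega$ is diophantine, i.e. for some $\gamma\in(0,1)$, $|\omega\cdot\ell|\ge\gamma|\ell|^{-\nu}$ for all $\ell\in\mathbb Z^\nu\setminus\{0\}$; or (B) $\int_{\mathbb T^d}f(\varphi,x)\,dx=0$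 for all $\varphi\in\mathbb T^\nu$ ($\omega$ arbitrary). There are constants $\varepsilon_0\in(0,1)$, $C_0>0$ depending only on $f,s,d,\nu$ (and $\gamma$ in case (A)) and, for each $\varepsilon\in(0,\varepsilon_0)$, functions $U\in\mathcal C^1(\mathbb T^\nu,H^s(\mathbb T^d,\mathbb R^d))$, $P\in\mathcal C^0(\mathbb T^\nu,H^s(\mathbb T^d,\mathbb R))$ with $\int_{\mathbb T^\nu\times\mathbb T^d}U\,d\varphi\,dx=0$, $\int_{\mathbb T^d}P(\varphi,x)\,dx=0$ for all $\varphi$ (and in case (B) also $\int_{\mathbb T^d}U(\varphi,x)\,dx=0$ for all $\varphi$), $\|U\|_{\mathcal C^1_\varphi H^s_x},\|P\|_{\mathcal C^0_\varphi H^s_x}\le C_0\varepsilon$, such that $u_\omega(t,x)=U(\omega t,x)$, $p_\omega(t,x)=P(\omega t,x)$ solve $\partial_tu_\omega-\Delta u_\omega+u_\omega\cdot\nabla u_\omega+\nabla p_\omega=\varepsilon f(\omega t,x)$, $\operatorname{div}u_\omega=0$. These $\varepsilon_0,C_0,(U,P)$ are fixed (they are provided by the existence theorem for quasi-periodic solutions and may be taken as given). *)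

theory Defs
  imports "HOL-Analysis.Analysis"
begin

text \<open>
  Functions on the torus are functions on \<open>real^'d\<close> that are \<open>2 * pi\<close>-periodic in each
  coordinate. Elements of \<open>L\<^sup>2\<close> and of the Sobolev spaces are represented by Borel functions,
  and equality of such elements is equality almost everywhere.
\<close>

definition torus_periodic :: "(real^'d::finite \<Rightarrow> 'b) \<Rightarrow> bool" where
  "torus_periodic u \<longleftrightarrow> (\<forall>i x. u (x + axis i (2 * pi)) = u x)"

definition torus :: "(real^'d::finite) measure" where
  "torus = restrict_space lborel (cbox 0 (\<chi> i. 2 * pi))"

definition L2_torus :: "(real^'d::finite \<Rightarrow> 'b::euclidean_space) set" where
  "L2_torus = {u \<in> borel_measurable borel.
     torus_periodic u \<and> integrable torus (\<lambda>x. (norm (u x))\<^sup>2)}"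

definition torus_eq :: "(real^'d::finite \<Rightarrow> 'b) \<Rightarrow> (real^'d \<Rightarrow> 'b) \<Rightarrow> bool" where
  "torus_eq u v \<longleftrightarrow> (AE x in torus. u x = v x)"

definition torus_mean_zero :: "(real^'d::finite \<Rightarrow> 'b::euclidean_space) \<Rightarrow> bool" where
  "torus_mean_zero u \<longleftrightarrow> (\<integral>x. u x \<partial>torus) = 0"

definition lattice_vec :: "int^'d::finite \<Rightarrow> real^'d" where
  "lattice_vec \<xi> = (\<chi> i. of_int (\<xi> $ i))"

definition japanese_bracket :: "int^'d::finite \<Rightarrow> real" where
  "japanese_bracket \<xi> = max 1 (norm (lattice_vec \<xi>))"

definition fourier_coeff :: "(real^'d::finite \<Rightarrow> real) \<Rightarrow> int^'d \<Rightarrow> complex" where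
  "fourier_coeff u \<xi> =
     (\<integral>x. of_real (u x) * exp (- \<i> * of_real (x \<bullet> lattice_vec \<xi>)) \<partial>torus) / of_real ((2 * pi) ^ CARD('d))"

text \<open>
  The squared modulus of the vector-valued Fourier coefficient, written over an orthonormal
  basis so that it covers both \<open>real\<close> and \<open>real^'n\<close> as codomain.
\<close>

definition fourier_coeff_norm_sq ::
    "(real^'d::finite \<Rightarrow> 'b::euclidean_space) \<Rightarrow> int^'d \<Rightarrow> real" where
  "fourier_coeff_norm_sq u \<xi> = (\<Sum>b\<in>Basis. (cmod (fourier_coeff (\<lambda>x. u x \<bullet> b) \<xi>))\<^sup>2)"

text \<open>Only exponents \<open>r \<ge> 0\<close> are meant: the elements are functions, not distributions.\<close>

definition sobolev :: "real \<Rightarrow> (real^'d::finite \<Rightarrow> 'b::euclidean_space) set" where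
  "sobolev r = {u \<in> L2_torus.
     (\<lambda>\<xi>. japanese_bracket \<xi> powr (2 * r) * fourier_coeff_norm_sq u \<xi>) summable_on UNIV}"

definition sobolev_norm :: "real \<Rightarrow> (real^'d::finite \<Rightarrow> 'b::euclidean_space) \<Rightarrow> real" where
  "sobolev_norm r u =
     sqrt (\<Sum>\<^sub>\<infinity>\<xi>\<in>UNIV. japanese_bracket \<xi> powr (2 * r) * fourier_coeff_norm_sq u \<xi>)"

text \<open>
  Membership in \<open>sobolev r\<close> is required at every parameter, since \<open>sobolev_norm r\<close> takes a
  meaningless default value outside that space.
\<close>

definition sobolev_continuous_on ::
    "'a::topological_space set \<Rightarrow> real \<Rightarrow> ('a \<Rightarrow> real^'d::finite \<Rightarrow> 'b::euclidean_space) \<Rightarrow> bool" where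
  "sobolev_continuous_on A r u \<longleftrightarrow>
     (\<forall>a\<in>A. u a \<in> sobolev r \<and>
       ((\<lambda>b. sobolev_norm r (\<lambda>x. u b x - u a x)) \<longlongrightarrow> 0) (at a within A))"

definition has_sobolev_deriv ::
    "real \<Rightarrow> real set \<Rightarrow> (real \<Rightarrow> real^'d::finite \<Rightarrow> 'b::euclidean_space) \<Rightarrow> real \<Rightarrow> (real^'d \<Rightarrow> 'b) \<Rightarrow> bool" where
  "has_sobolev_deriv r I u t v \<longleftrightarrow>
     (\<forall>\<tau>\<in>I. u \<tau> \<in> sobolev r) \<and> v \<in> sobolev r \<and>
     ((\<lambda>\<tau>. sobolev_norm r (\<lambda>x. (u \<tau> x - u t x) /\<^sub>R (\<tau> - t) - v x)) \<longlongrightarrow> 0) (at t within I)"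

text \<open>Determined up to equality almost everywhere whenever a derivative exists.\<close>

definition sobolev_deriv ::
    "real \<Rightarrow> real set \<Rightarrow> (real \<Rightarrow> real^'d::finite \<Rightarrow> 'b::euclidean_space) \<Rightarrow> real \<Rightarrow> real^'d \<Rightarrow> 'b" where
  "sobolev_deriv r I u t = (SOME v. has_sobolev_deriv r I u t v)"

definition sobolev_C0b ::
    "real set \<Rightarrow> real \<Rightarrow> (real \<Rightarrow> real^'d::finite \<Rightarrow> 'b::euclidean_space) \<Rightarrow> bool" where
  "sobolev_C0b I r u \<longleftrightarrow>
     sobolev_continuous_on I r u \<and> (\<exists>M. \<forall>t\<in>I. sobolev_norm r (u t) \<le> M)"

definition sobolev_C1b ::
    "real set \<Rightarrow> real \<Rightarrow> (real \<Rightarrow> real^'d::finite \<Rightarrow> 'b::euclidean_space) \<Rightarrow> bool" where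
  "sobolev_C1b I r u \<longleftrightarrow>
     sobolev_C0b I r u \<and> (\<forall>t\<in>I. \<exists>v. has_sobolev_deriv r I u t v) \<and>
     sobolev_C0b I r (sobolev_deriv r I u)"

definition torus_C0 ::
    "real \<Rightarrow> (real^'n::finite \<Rightarrow> real^'d::finite \<Rightarrow> 'b::euclidean_space) \<Rightarrow> bool" where
  "torus_C0 r U \<longleftrightarrow>
     (\<forall>i \<phi>. torus_eq (U (\<phi> + axis i (2 * pi))) (U \<phi>)) \<and> sobolev_continuous_on UNIV r U"

definition sobolev_partial ::
    "real \<Rightarrow> (real^'n::finite \<Rightarrow> real^'d::finite \<Rightarrow> 'b::euclidean_space) \<Rightarrow> 'n \<Rightarrow> real^'n \<Rightarrow> real^'d \<Rightarrow> 'b" where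
  "sobolev_partial r U i \<phi> = sobolev_deriv r UNIV (\<lambda>h. U (\<phi> + h *\<^sub>R axis i 1)) 0"

definition torus_C1 ::
    "real \<Rightarrow> (real^'n::finite \<Rightarrow> real^'d::finite \<Rightarrow> 'b::euclidean_space) \<Rightarrow> bool" where
  "torus_C1 r U \<longleftrightarrow> torus_C0 r U \<and>
     (\<forall>i. (\<forall>\<phi>. \<exists>v. has_sobolev_deriv r UNIV (\<lambda>h. U (\<phi> + h *\<^sub>R axis i 1)) 0 v) \<and>
          sobolev_continuous_on UNIV r (sobolev_partial r U i))"

primrec C_class :: "nat \<Rightarrow> ('a::real_normed_vector \<Rightarrow> 'b::real_normed_vector) \<Rightarrow> bool" where
  "C_class 0 g \<longleftrightarrow> continuous_on UNIV g"
| "C_class (Suc k) g \<longleftrightarrow>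
     (\<forall>x. g differentiable (at x)) \<and> (\<forall>v. C_class k (\<lambda>x. frechet_derivative g (at x) v))"

text \<open>Weak derivatives on the torus: smooth periodic test functions, no boundary condition.\<close>

definition has_weak_partial ::
    "'d \<Rightarrow> (real^'d::finite \<Rightarrow> real) \<Rightarrow> (real^'d \<Rightarrow> real) \<Rightarrow> bool" where
  "has_weak_partial i g h \<longleftrightarrow> h \<in> L2_torus \<and>
     (\<forall>\<psi>::real^'d \<Rightarrow> real. torus_periodic \<psi> \<and> (\<forall>k. C_class k \<psi>) \<longrightarrow>
       (\<integral>x. g x * frechet_derivative \<psi> (at x) (axis i 1) \<partial>torus) = - (\<integral>x. h x * \<psi> x \<partial>torus))"

text \<open>Determined up to equality almost everywhere whenever a weak derivative exists.\<close>

definition weak_partial :: "'d \<Rightarrow> (real^'d::finite \<Rightarrow> real) \<Rightarrow> real^'d \<Rightarrow> real" where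
  "weak_partial i g = (SOME h. has_weak_partial i g h)"

definition grad :: "(real^'d::finite \<Rightarrow> real) \<Rightarrow> real^'d \<Rightarrow> real^'d" where
  "grad p x = (\<chi> i. weak_partial i p x)"

definition divergence :: "(real^'d::finite \<Rightarrow> real^'d) \<Rightarrow> real^'d \<Rightarrow> real" where
  "divergence u x = (\<Sum>i\<in>UNIV. weak_partial i (\<lambda>y. u y $ i) x)"

definition laplacian :: "(real^'d::finite \<Rightarrow> real^'d) \<Rightarrow> real^'d \<Rightarrow> real^'d" where
  "laplacian u x = (\<chi> j. \<Sum>i\<in>UNIV. weak_partial i (weak_partial i (\<lambda>y. u y $ j)) x)"

definition advection ::
    "(real^'d::finite \<Rightarrow> real^'d) \<Rightarrow> (real^'d \<Rightarrow> real^'d) \<Rightarrow> real^'d \<Rightarrow> real^'d" where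
  "advection u v x = (\<chi> j. u x \<bullet> grad (\<lambda>y. v y $ j) x)"

text \<open>
  The equation is required at every time \<open>t \<in> I\<close> as an identity between elements of
  \<open>H\<^sup>r\<close>, i.e. almost everywhere in \<open>x\<close>; \<open>r\<close> is the regularity of the time derivative.
\<close>

definition solves_NS ::
    "real \<Rightarrow> real set \<Rightarrow> (real \<Rightarrow> real^'d::finite \<Rightarrow> real^'d) \<Rightarrow>
     (real \<Rightarrow> real^'d \<Rightarrow> real^'d) \<Rightarrow> (real \<Rightarrow> real^'d \<Rightarrow> real) \<Rightarrow> bool" where
  "solves_NS r I F u p \<longleftrightarrow> (\<forall>t\<in>I.
     torus_eq
       (\<lambda>x. sobolev_deriv r I u t x - laplacian (u t) x + advection (u t) (u t) x + grad (p t) x)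
       (F t) \<and>
     torus_eq (divergence (u t)) (\<lambda>x. 0))"

definition global_classical_solution ::
    "real \<Rightarrow> (real \<Rightarrow> real^'d::finite \<Rightarrow> real^'d) \<Rightarrow> (real^'d \<Rightarrow> real^'d) \<Rightarrow>
     (real \<Rightarrow> real^'d \<Rightarrow> real^'d) \<Rightarrow> (real \<Rightarrow> real^'d \<Rightarrow> real) \<Rightarrow> bool" where
  "global_classical_solution s F u0 u p \<longleftrightarrow>
     sobolev_C0b {0..} s u \<and> sobolev_C1b {0..} (s - 2) u \<and>
     sobolev_C0b {0..} s p \<and> (\<forall>t\<ge>0. torus_mean_zero (p t)) \<and>
     solves_NS (s - 2) {0..} F u p \<and> torus_eq (u 0) u0"

definition torus_C_class ::
    "nat \<Rightarrow> (real^'n::finite \<Rightarrow> real^'d::finite \<Rightarrow> real^'d) \<Rightarrow> bool" where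
  "torus_C_class N f \<longleftrightarrow>
     torus_periodic f \<and> (\<forall>\<phi>. torus_periodic (f \<phi>)) \<and> C_class N (\<lambda>(\<phi>, x). f \<phi> x)"

text \<open>
  The two alternative hypotheses. The diophantine constant is an argument of the first one, so
  that a quantity chosen after the case but before the frequency depends on the frequency only
  through that constant in the first case, and not at all in the second one.
\<close>

datatype forcing_case = Diophantine real | Zero_Space_Average

definition diophantine :: "real \<Rightarrow> real^'n::finite \<Rightarrow> bool" where
  "diophantine \<gamma> \<omega> \<longleftrightarrow>
     (\<forall>l::int^'n. l \<noteq> 0 \<longrightarrow> \<bar>\<omega> \<bullet> lattice_vec l\<bar> \<ge> \<gamma> / norm (lattice_vec l) ^ CARD('n))"

text \<open>
  Space-time averages are iterated integrals: a curve in \<open>H\<^sup>s\<close> given by representatives need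
  not be jointly measurable in \<open>(\<phi>, x)\<close>.
\<close>

definition spacetime_mean_zero ::
    "(real^'n::finite \<Rightarrow> real^'d::finite \<Rightarrow> real^'d) \<Rightarrow> bool" where
  "spacetime_mean_zero U \<longleftrightarrow> (\<integral>\<phi>. (\<integral>x. U \<phi> x \<partial>torus) \<partial>torus) = 0"

primrec admissible_forcing ::
    "forcing_case \<Rightarrow> (real^'n::finite \<Rightarrow> real^'d::finite \<Rightarrow> real^'d) \<Rightarrow> bool" where
  "admissible_forcing (Diophantine \<gamma>) f \<longleftrightarrow> 0 < \<gamma> \<and> \<gamma> < 1 \<and> spacetime_mean_zero f"
| "admissible_forcing Zero_Space_Average f \<longleftrightarrow> (\<forall>\<phi>. torus_mean_zero (f \<phi>))"

primrec admissible_frequency :: "forcing_case \<Rightarrow> real^'n::finite \<Rightarrow> bool" where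
  "admissible_frequency (Diophantine \<gamma>) \<omega> \<longleftrightarrow> diophantine \<gamma> \<omega>"
| "admissible_frequency Zero_Space_Average \<omega> \<longleftrightarrow> True"

text \<open>
  The bounds by \<open>C0 * \<epsilon>\<close> are the bounds on the \<open>C\<^sup>1\<close> norm of \<open>U\<close> and the \<open>C\<^sup>0\<close> norm of \<open>P\<close>,
  with the suprema over \<open>\<phi>\<close> and the maximum over the partial derivatives written out.
\<close>

definition quasi_periodic_solution ::
    "forcing_case \<Rightarrow> real \<Rightarrow> (real^'n::finite \<Rightarrow> real^'d::finite \<Rightarrow> real^'d) \<Rightarrow> real \<Rightarrow> real^'n \<Rightarrow> real \<Rightarrow>
     (real^'n \<Rightarrow> real^'d \<Rightarrow> real^'d) \<Rightarrow> (real^'n \<Rightarrow> real^'d \<Rightarrow> real) \<Rightarrow> bool" where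
  "quasi_periodic_solution c s f C0 \<omega> \<epsilon> U P \<longleftrightarrow>
     torus_C1 s U \<and> torus_C0 s P \<and>
     spacetime_mean_zero U \<and> (\<forall>\<phi>. torus_mean_zero (P \<phi>)) \<and>
     (c = Zero_Space_Average \<longrightarrow> (\<forall>\<phi>. torus_mean_zero (U \<phi>))) \<and>
     (\<forall>\<phi>. sobolev_norm s (U \<phi>) \<le> C0 * \<epsilon>) \<and>
     (\<forall>i \<phi>. sobolev_norm s (sobolev_partial s U i \<phi>) \<le> C0 * \<epsilon>) \<and>
     (\<forall>\<phi>. sobolev_norm s (P \<phi>) \<le> C0 * \<epsilon>) \<and>
     solves_NS (s - 2) UNIV (\<lambda>t x. \<epsilon> *\<^sub>R f (t *\<^sub>R \<omega>) x) (\<lambda>t. U (t *\<^sub>R \<omega>)) (\<lambda>t. P (t *\<^sub>R \<omega>))"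

end

theory Submission
  imports Defs
begin

text \<open>
  A function in \<open>H\<^sup>s\<close> is replaced by its Fourier coefficients weighted by the Japanese bracket, an
  element of \<open>ell2\<close>. Products become a convolution, bounded on \<open>ell2\<close> because \<open>s - 1 > d/2\<close>, and all
  other operations become multipliers. Subtracting the equation of the quasi-periodic solution,
  \<open>w = u - u\<^sub>\<omega>\<close> solves a system in which the forcing no longer appears; after the Leray projection it
  is equivalent to a Duhamel formula, the pressure being recovered from the advection terms.
  The divergence constraint makes the zero mode of the advection vanish, so \<open>w\<close> keeps zero average
  and only modes with \<open>|\<xi>| \<ge> 1\<close> occur; there the heat semigroup decays at least like \<open>exp (- t)\<close>, and
  for \<open>\<alpha> < 1\<close> the weighted unknown \<open>exp (\<alpha> t) w(t)\<close> is the fixed point of a contraction on bounded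
  continuous curves when \<open>\<delta>\<close> is small. Uniqueness for large solutions uses the same Duhamel bound with a growing weight
  \<open>exp (\<beta> t)\<close>, whose constant tends to \<open>0\<close> as \<open>\<beta>\<close> increases. Riesz--Fischer and the
  completeness of the exponentials translate the result back to functions on the torus.
\<close>

section \<open>Square-summable coefficient families\<close>

text \<open>The obstacle is the derivative lost by the advection: two H^s fields produce only an
  H^(s-1) field, so the Duhamel integral must regain one derivative, uniformly in time. Estimating
  the semigroup from H^(s-1) to H^s would bring in a kernel singular at time zero. Instead each mode
  is estimated by Cauchy--Schwarz in time, which pays for the factor \<open>jb \<xi>\<close> with
  the mass \<open>1 / (lam \<xi> - \<alpha>)\<close> of its exponential kernel; one exponential
  independent of \<xi> is kept, so that the sum over modes can be taken under the time integral.
  Smallness enters twice: the perturbation has size \<delta>, and \<epsilon> \<le> \<delta> gives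
  the background size \<open>C0 * \<delta>\<close>, so that the terms linear in \<open>w\<close>
  contract as well as the quadratic one. The time derivative lives only in H^(s-2). It is computed
  mode by mode; continuity of the candidate derivative turns the scalar integral identities into one
  identity in the Banach space, hence into differentiability in norm. For uniqueness, a
  divergence-free curve has a divergence-free derivative, so the pressure is determined by the
  velocity.\<close>

typedef 'a ell2 = "{a :: 'a \<Rightarrow> complex. (\<lambda>i. (cmod (a i))\<^sup>2) summable_on UNIV}"
  morphisms coef Abs_ell2
  by (rule exI[of _ "\<lambda>_. 0"]) simp

setup_lifting type_definition_ell2

lemma ell2_eqI: "(\<And>i. coef a i = coef b i) \<Longrightarrow> a = b"
  by (metis coef_inject ext)

lemma summable_coef: "(\<lambda>i. (cmod (coef a i))\<^sup>2) summable_on UNIV"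
  using coef[of a] by simp

lemma ell2I:
  assumes "\<And>F. finite F \<Longrightarrow> (\<Sum>i\<in>F. (cmod (a i))\<^sup>2) \<le> B"
  shows "a \<in> {a. (\<lambda>i. (cmod (a i))\<^sup>2) summable_on UNIV}"
  by (simp, rule nonneg_bounded_partial_sums_imp_summable_on[where C=B])
    (use assms in \<open>auto intro!: eventually_finite_subsets_at_top_weakI\<close>)

instantiation ell2 :: (type) real_normed_vector
begin

definition norm_ell2 :: "'a ell2 \<Rightarrow> real" where "norm_ell2 a = sqrt (\<Sum>\<^sub>\<infinity>i. (cmod (coef a i))\<^sup>2)"

lemma sum_coef_le: "finite F \<Longrightarrow> (\<Sum>i\<in>F. (cmod (coef (a :: 'a ell2) i))\<^sup>2) \<le> (norm a)\<^sup>2"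
  unfolding norm_ell2_def
  by (subst real_sqrt_pow2) (auto intro!: infsum_nonneg finite_sum_le_infsum summable_coef)

lemma norm_ell2_nonneg: "0 \<le> norm (a :: 'a ell2)"
  unfolding norm_ell2_def by (intro real_sqrt_ge_zero infsum_nonneg) auto

lemma norm_ell2_le:
  fixes a :: "'a ell2"
  assumes "0 \<le> B" "\<And>F. finite F \<Longrightarrow> (\<Sum>i\<in>F. (cmod (coef a i))\<^sup>2) \<le> B\<^sup>2"
  shows "norm a \<le> B"
  unfolding norm_ell2_def
  by (rule real_le_lsqrt[OF assms(1)])
    (use assms summable_coef in \<open>auto intro!: infsum_le_finite_sums\<close>)

lemma L2_set_coef_le: "finite F \<Longrightarrow> L2_set (\<lambda>i. cmod (coef a i)) F \<le> norm (a :: 'a ell2)"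
  unfolding L2_set_def using sum_coef_le[of F a] norm_ell2_nonneg
  by (auto intro!: real_le_lsqrt)

lift_definition zero_ell2 :: "'a ell2" is "\<lambda>_. 0" by simp

text \<open>Minkowski's inequality on finite index sets. It is phrased through \<open>coef\<close>
  because addition on the type is not yet available: the same bound makes addition well defined and
  then gives the triangle inequality.\<close>

lemma add_in_ell2:
  fixes a b :: "'a ell2"
  assumes F: "finite F"
  shows "(\<Sum>i\<in>F. (cmod (coef a i + coef b i))\<^sup>2) \<le> (norm a + norm b)\<^sup>2"
proof -
  have "L2_set (\<lambda>i. cmod (coef a i + coef b i)) F \<le> L2_set (\<lambda>i. cmod (coef a i) + cmod (coef b i)) F"
    by (rule L2_set_mono) (auto intro: norm_triangle_ineq)
  also have "\<dots> \<le> L2_set (\<lambda>i. cmod (coef a i)) F + L2_set (\<lambda>i. cmod (coef b i)) F"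
    by (rule L2_set_triangle_ineq)
  also have "\<dots> \<le> norm a + norm b" by (intro add_mono L2_set_coef_le F)
  finally have "(L2_set (\<lambda>i. cmod (coef a i + coef b i)) F)\<^sup>2 \<le> (norm a + norm b)\<^sup>2"
    by (intro power_mono) auto
  then show ?thesis by (simp add: L2_set_def sum_nonneg)
qed

lemma summable_on_sq_add:
  fixes a b :: "'a \<Rightarrow> complex"
  assumes *: "(\<lambda>i. (cmod (a i))\<^sup>2) summable_on UNIV" "(\<lambda>i. (cmod (b i))\<^sup>2) summable_on UNIV"
  shows "(\<lambda>i. (cmod (a i + b i))\<^sup>2) summable_on UNIV"
proof -
  have "coef (Abs_ell2 a) = a" "coef (Abs_ell2 b) = b" using * by (auto simp: Abs_ell2_inverse)
  then have "(\<lambda>i. a i + b i) \<in> {a. (\<lambda>i. (cmod (a i))\<^sup>2) summable_on UNIV}"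
    using add_in_ell2[of _ "Abs_ell2 a" "Abs_ell2 b"] by (intro ell2I) auto
  then show ?thesis by simp
qed

lift_definition plus_ell2 :: "'a ell2 \<Rightarrow> 'a ell2 \<Rightarrow> 'a ell2" is "\<lambda>a b i. a i + b i"
  by (rule summable_on_sq_add)

lift_definition scaleR_ell2 :: "real \<Rightarrow> 'a ell2 \<Rightarrow> 'a ell2" is "\<lambda>r a i. r *\<^sub>R a i"
  by (simp add: power_mult_distrib summable_on_cmult_right)

lift_definition uminus_ell2 :: "'a ell2 \<Rightarrow> 'a ell2" is "\<lambda>a i. - a i" by simp

definition minus_ell2 :: "'a ell2 \<Rightarrow> 'a ell2 \<Rightarrow> 'a ell2" where "minus_ell2 a b = a + (- b)"

definition sgn_ell2 :: "'a ell2 \<Rightarrow> _" where "sgn_ell2 a = scaleR (inverse (norm a)) a"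
definition dist_ell2 :: "'a ell2 \<Rightarrow> _" where "dist_ell2 a b = norm (a - b)"
definition uniformity_ell2 :: "('a ell2 \<times> 'a ell2) filter" where "uniformity_ell2 = (INF e\<in>{0<..}. principal {(x :: 'a ell2, y). dist x y < e})"
definition open_ell2 :: "'a ell2 set \<Rightarrow> bool" where "open_ell2 U = (\<forall>x\<in>U. \<forall>\<^sub>F (x', y :: 'a ell2) in uniformity. x' = x \<longrightarrow> y \<in> U)"

instance
proof
  fix a b c :: "'a ell2" and r s :: real
  show "a + b + c = a + (b + c)" "a + b = b + a" "0 + a = a" "- a + a = 0"
    "a - b = a + - b" "r *\<^sub>R (a + b) = r *\<^sub>R a + r *\<^sub>R b" "(r + s) *\<^sub>R a = r *\<^sub>R a + s *\<^sub>R a"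
    "r *\<^sub>R s *\<^sub>R a = (r * s) *\<^sub>R a" "1 *\<^sub>R a = a"
    by (rule ell2_eqI; simp add: minus_ell2_def plus_ell2.rep_eq uminus_ell2.rep_eq zero_ell2.rep_eq
        scaleR_ell2.rep_eq algebra_simps)+
  show "dist a b = norm (a - b)" "sgn a = scaleR (inverse (norm a)) a"
    "uniformity = (INF e\<in>{0<..}. principal {(x :: 'a ell2, y). dist x y < e})"
    "\<And>U :: 'a ell2 set. open U = (\<forall>x\<in>U. \<forall>\<^sub>F (x', y) in uniformity. x' = x \<longrightarrow> y \<in> U)"
    by (simp_all add: dist_ell2_def sgn_ell2_def uniformity_ell2_def open_ell2_def)
  show "norm (a + b) \<le> norm a + norm b"
    by (rule norm_ell2_le) (auto simp: plus_ell2.rep_eq norm_ell2_nonneg add_in_ell2)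
  show "norm (r *\<^sub>R a) = \<bar>r\<bar> * norm a"
    by (simp add: norm_ell2_def scaleR_ell2.rep_eq power_mult_distrib infsum_cmult_right' real_sqrt_mult)
  show "norm a = 0 \<longleftrightarrow> a = 0"
  proof
    assume "norm a = 0"
    then have "(cmod (coef a i))\<^sup>2 \<le> 0" for i using sum_coef_le[of "{i}" a] by simp
    then show "a = 0" by (intro ell2_eqI) (simp add: zero_ell2.rep_eq)
  qed (simp add: norm_ell2_def zero_ell2.rep_eq)
qed

end

lemma coef_simps [simp]:
  "coef 0 i = 0" "coef (a + b) i = coef a i + coef b i" "coef (- a) i = - coef a i"
  "coef (r *\<^sub>R a) i = r *\<^sub>R coef a i"
  by (simp_all add: zero_ell2.rep_eq plus_ell2.rep_eq uminus_ell2.rep_eq scaleR_ell2.rep_eq)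

lemma coef_diff [simp]: "coef (a - b) i = coef a i - coef b i"
  using coef_simps(2)[of a "- b" i] by simp

lemma coef_sum [simp]: "coef (\<Sum>j\<in>J. f j) i = (\<Sum>j\<in>J. coef (f j) i)"
  by (induction J rule: infinite_finite_induct) auto

lemma norm_ell2_sq: "(norm a)\<^sup>2 = (\<Sum>\<^sub>\<infinity>i. (cmod (coef a i))\<^sup>2)"
  unfolding norm_ell2_def by (subst real_sqrt_pow2) (auto intro: infsum_nonneg)

lemma norm_coef_le: "cmod (coef a i) \<le> norm a"
  using L2_set_coef_le[of "{i}" a] by simp

lemma coef_Abs_ell2:
  assumes "\<And>F. finite F \<Longrightarrow> (\<Sum>i\<in>F. (cmod (a i))\<^sup>2) \<le> B"
  shows "coef (Abs_ell2 a) = a"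
  using ell2I[OF assms] by (rule Abs_ell2_inverse)

lemma norm_Abs_ell2_le:
  assumes "0 \<le> B" "\<And>F. finite F \<Longrightarrow> (\<Sum>i\<in>F. (cmod (a i))\<^sup>2) \<le> B\<^sup>2"
  shows "norm (Abs_ell2 a) \<le> B"
proof (rule norm_ell2_le[OF assms(1)])
  fix F :: "'a set" assume "finite F"
  then show "(\<Sum>i\<in>F. (cmod (coef (Abs_ell2 a) i))\<^sup>2) \<le> B\<^sup>2"
    using assms(2) by (subst coef_Abs_ell2[OF assms(2)])
qed

lemma bounded_linear_coef: "bounded_linear (\<lambda>a. coef a i)"
  by (rule bounded_linear_intro[of _ 1]) (auto simp: norm_coef_le)

lemmas continuous_on_coef [continuous_intros] = bounded_linear.continuous_on[OF bounded_linear_coef]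
lemmas tendsto_coef [tendsto_intros] = bounded_linear.tendsto[OF bounded_linear_coef]

instance ell2 :: (type) banach
proof
  fix X :: "nat \<Rightarrow> 'a ell2" assume X: "Cauchy X"
  have "Cauchy (\<lambda>n. coef (X n) i)" for i
    by (rule bounded_linear.Cauchy[OF bounded_linear_coef X])
  then have "(\<lambda>n. coef (X n) i) \<longlonglongrightarrow> lim (\<lambda>n. coef (X n) i)" for i
    using Cauchy_convergent convergent_LIMSEQ_iff by blast
  then obtain l where l: "\<And>i. (\<lambda>n. coef (X n) i) \<longlonglongrightarrow> l i"
    by (rule that)
  \<comment> \<open>Finite sums pass to the coordinatewise limit, so the Cauchy bound holds for
    \<open>l\<close> before \<open>l\<close> is known to be square-summable.\<close>
  have key: "(\<Sum>i\<in>F. (cmod (l i - coef (X n) i))\<^sup>2) \<le> e\<^sup>2"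
    if "finite F" "0 \<le> e" "\<And>m. m \<ge> N \<Longrightarrow> norm (X m - X n) \<le> e" for F n N e
  proof (rule LIMSEQ_le_const2)
    show "(\<lambda>m. \<Sum>i\<in>F. (cmod (coef (X m) i - coef (X n) i))\<^sup>2) \<longlonglongrightarrow> (\<Sum>i\<in>F. (cmod (l i - coef (X n) i))\<^sup>2)"
      by (intro tendsto_intros l)
    show "\<exists>N. \<forall>m\<ge>N. (\<Sum>i\<in>F. (cmod (coef (X m) i - coef (X n) i))\<^sup>2) \<le> e\<^sup>2"
    proof (intro exI allI impI)
      fix m assume "m \<ge> N"
      have "(\<Sum>i\<in>F. (cmod (coef (X m) i - coef (X n) i))\<^sup>2) \<le> (norm (X m - X n))\<^sup>2"
        using sum_coef_le[OF that(1), of "X m - X n"] by simp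
      also have "\<dots> \<le> e\<^sup>2" using that(3)[OF \<open>m \<ge> N\<close>] by (intro power_mono) auto
      finally show "(\<Sum>i\<in>F. (cmod (coef (X m) i - coef (X n) i))\<^sup>2) \<le> e\<^sup>2" .
    qed
  qed
  obtain N1 where "\<forall>m\<ge>N1. \<forall>n\<ge>N1. norm (X m - X n) < 1"
    using CauchyD[OF X, of 1] by auto
  then have N1: "norm (X m - X N1) \<le> 1" if "m \<ge> N1" for m
    using that by (intro less_imp_le) auto
  \<comment> \<open>The difference between \<open>l\<close> and \<open>X N1\<close> has norm at most
    1, so it belongs to the type; adding \<open>X N1\<close> back produces the limit.\<close>
  define d where "d = Abs_ell2 (\<lambda>i. l i - coef (X N1) i)"
  have d: "coef d = (\<lambda>i. l i - coef (X N1) i)"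
    unfolding d_def by (rule coef_Abs_ell2[of _ "1\<^sup>2"]) (rule key[OF _ _ N1], auto)
  define L where "L = d + X N1"
  have L: "coef L i = l i" for i by (simp add: L_def d)
  have "X \<longlonglongrightarrow> L"
  proof (rule LIMSEQ_I)
    fix r :: real assume r: "r > 0"
    obtain N where N: "\<And>m n. m \<ge> N \<Longrightarrow> n \<ge> N \<Longrightarrow> norm (X m - X n) < r/2"
      using CauchyD[OF X, of "r/2"] r by auto
    have "norm (X n - L) < r" if n: "n \<ge> N" for n
    proof -
      have "norm (L - X n) \<le> r/2"
        using key[of _ "r/2" N n] N[OF _ n] r L
        by (intro norm_ell2_le) (auto intro: less_imp_le)
      then show ?thesis using r by (simp add: norm_minus_commute)
    qed
    then show "\<exists>no. \<forall>n\<ge>no. norm (X n - L) < r" by auto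
  qed
  then show "convergent X" by (auto simp: convergent_def)
qed

section \<open>Cauchy--Schwarz and multipliers for square-summable families\<close>

lemma summable_on_mult_ell2:
  fixes a b :: "'i \<Rightarrow> complex"
  assumes a: "(\<lambda>i. (cmod (a i))\<^sup>2) summable_on A" and b: "(\<lambda>i. (cmod (b i))\<^sup>2) summable_on A"
  shows "(\<lambda>i. cmod (a i * b i)) summable_on A"
    and "(cmod (\<Sum>\<^sub>\<infinity>i\<in>A. a i * b i))\<^sup>2 \<le> (\<Sum>\<^sub>\<infinity>i\<in>A. (cmod (a i))\<^sup>2) * (\<Sum>\<^sub>\<infinity>i\<in>A. (cmod (b i))\<^sup>2)"
proof -
  let ?P = "(\<Sum>\<^sub>\<infinity>i\<in>A. (cmod (a i))\<^sup>2) * (\<Sum>\<^sub>\<infinity>i\<in>A. (cmod (b i))\<^sup>2)"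
  have P: "0 \<le> ?P" by (intro mult_nonneg_nonneg infsum_nonneg) auto
  have fin: "(\<Sum>i\<in>F. cmod (a i * b i)) \<le> sqrt ?P" if F: "finite F" "F \<subseteq> A" for F
  proof (rule real_le_rsqrt)
    have "(\<Sum>i\<in>F. cmod (a i) * cmod (b i))\<^sup>2 \<le> (\<Sum>i\<in>F. (cmod (a i))\<^sup>2) * (\<Sum>i\<in>F. (cmod (b i))\<^sup>2)"
      by (rule Cauchy_Schwarz_ineq_sum)
    also have "\<dots> \<le> ?P"
      by (intro mult_mono finite_sum_le_infsum a b F) (auto intro: sum_nonneg infsum_nonneg)
    finally show "(\<Sum>i\<in>F. cmod (a i * b i))\<^sup>2 \<le> ?P" by (simp add: norm_mult)
  qed
  show s: "(\<lambda>i. cmod (a i * b i)) summable_on A"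
    by (rule nonneg_bounded_partial_sums_imp_summable_on[where C="sqrt ?P"])
      (use fin in \<open>auto intro!: eventually_finite_subsets_at_top_weakI\<close>)
  have "cmod (\<Sum>\<^sub>\<infinity>i\<in>A. a i * b i) \<le> (\<Sum>\<^sub>\<infinity>i\<in>A. cmod (a i * b i))"
    by (rule norm_infsum_bound[OF s])
  also have "\<dots> \<le> sqrt ?P" by (rule infsum_le_finite_sums[OF s fin])
  finally have "(cmod (\<Sum>\<^sub>\<infinity>i\<in>A. a i * b i))\<^sup>2 \<le> (sqrt ?P)\<^sup>2" by (intro power_mono) auto
  then show "(cmod (\<Sum>\<^sub>\<infinity>i\<in>A. a i * b i))\<^sup>2 \<le> ?P" using P by (simp only: real_sqrt_pow2)
qed

text \<open>A diagonal operator, i.e. a Fourier multiplier when the indices are frequencies. A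
  uniform bound on the symbol keeps the product square-summable, so the facts about
  \<open>mul\<close> carry such a bound as hypothesis.\<close>

definition mul :: "('i \<Rightarrow> complex) \<Rightarrow> 'i ell2 \<Rightarrow> 'i ell2" where
  "mul m a = Abs_ell2 (\<lambda>i. m i * coef a i)"

lemma
  assumes m: "\<And>i. cmod (m i) \<le> M"
  shows coef_mul: "coef (mul m a) = (\<lambda>i. m i * coef a i)"
    and norm_mul_le: "norm (mul m a) \<le> M * norm a"
proof -
  have M: "0 \<le> M" using order_trans[OF norm_ge_zero m] .
  have *: "(\<Sum>i\<in>F. (cmod (m i * coef a i))\<^sup>2) \<le> (M * norm a)\<^sup>2" if "finite F" for F
  proof -
    have "(\<Sum>i\<in>F. (cmod (m i * coef a i))\<^sup>2) \<le> (\<Sum>i\<in>F. M\<^sup>2 * (cmod (coef a i))\<^sup>2)"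
      by (auto intro!: sum_mono mult_right_mono power_mono m simp: norm_mult power_mult_distrib)
    also have "\<dots> \<le> M\<^sup>2 * (norm a)\<^sup>2"
      unfolding sum_distrib_left[symmetric] by (intro mult_left_mono sum_coef_le that) auto
    finally show ?thesis by (simp add: power_mult_distrib)
  qed
  show "coef (mul m a) = (\<lambda>i. m i * coef a i)" unfolding mul_def by (rule coef_Abs_ell2) (rule *)
  show "norm (mul m a) \<le> M * norm a" unfolding mul_def by (rule norm_Abs_ell2_le) (use M * in auto)
qed

lemma bounded_linear_mul:
  assumes m: "\<And>i. cmod (m i) \<le> M"
  shows "bounded_linear (mul m)"
proof (rule bounded_linear_intro[of _ M])
  show "mul m (a + b) = mul m a + mul m b" for a b
    by (rule ell2_eqI) (simp add: coef_mul[OF m] algebra_simps)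
  show "mul m (r *\<^sub>R a) = r *\<^sub>R mul m a" for r a
    by (rule ell2_eqI) (simp add: coef_mul[OF m] scaleR_conv_of_real)
  show "norm (mul m a) \<le> norm a * M" for a
    using norm_mul_le[OF m, where a=a] by (simp add: mult.commute)
qed

section \<open>Lattice weights and convolution\<close>

abbreviation jb :: "int^'d::finite \<Rightarrow> real" where "jb \<equiv> japanese_bracket"

definition lam :: "int^'d::finite \<Rightarrow> real" where "lam \<xi> = (norm (lattice_vec \<xi>))\<^sup>2"

lemma lattice_vec_nth [simp]: "lattice_vec \<xi> $ i = of_int (\<xi> $ i)"
  by (simp add: lattice_vec_def)

lemma lattice_vec_simps [simp]:
  "lattice_vec 0 = 0" "lattice_vec (- \<xi>) = - lattice_vec \<xi>"
  "lattice_vec (\<xi> + \<eta>) = lattice_vec \<xi> + lattice_vec \<eta>"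
  "lattice_vec (\<xi> - \<eta>) = lattice_vec \<xi> - lattice_vec \<eta>"
  by (simp_all add: vec_eq_iff)

lemma jb_ge_1: "1 \<le> jb \<xi>" by (simp add: japanese_bracket_def)

lemma jb_pos [simp]: "0 < jb \<xi>" and jb_nonneg [simp]: "0 \<le> jb \<xi>" and jb_nz [simp]: "jb \<xi> \<noteq> 0"
  using jb_ge_1[of \<xi>] by linarith+

lemma jb_minus [simp]: "jb (- \<xi>) = jb \<xi>" by (simp add: japanese_bracket_def)

lemma norm_lattice_le_jb: "norm (lattice_vec \<xi>) \<le> jb \<xi>" by (simp add: japanese_bracket_def)

lemma abs_nth_le_jb: "\<bar>real_of_int (\<xi> $ i)\<bar> \<le> jb \<xi>"
  using component_le_norm_cart[of "lattice_vec \<xi>" i] norm_lattice_le_jb[of \<xi>] by simp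

lemma jb_triangle: "jb \<xi> \<le> jb (\<xi> - \<eta>) + jb \<eta>"
proof -
  have "norm (lattice_vec \<xi>) \<le> norm (lattice_vec (\<xi> - \<eta>)) + norm (lattice_vec \<eta>)"
    using norm_triangle_ineq[of "lattice_vec (\<xi> - \<eta>)" "lattice_vec \<eta>"] by simp
  then show ?thesis unfolding japanese_bracket_def by linarith
qed

lemma lam_ge_1: assumes "\<xi> \<noteq> 0" shows "1 \<le> lam \<xi>"
proof -
  obtain i where i: "\<xi> $ i \<noteq> 0" using assms by (auto simp: vec_eq_iff)
  then have "1 \<le> \<bar>real_of_int (\<xi> $ i)\<bar>" by linarith
  also have "\<dots> \<le> norm (lattice_vec \<xi>)"
    using component_le_norm_cart[of "lattice_vec \<xi>" i] by simp
  finally show ?thesis by (simp add: lam_def)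
qed

lemma lam_0 [simp]: "lam 0 = 0" by (simp add: lam_def)

lemma lam_minus [simp]: "lam (- \<xi>) = lam \<xi>" by (simp add: lam_def)

lemma lam_nonneg [simp]: "0 \<le> lam \<xi>" by (simp add: lam_def)

lemma lam_eq_sum: "lam \<xi> = (\<Sum>i\<in>UNIV. (real_of_int (\<xi> $ i))\<^sup>2)"
  unfolding lam_def power2_norm_eq_inner inner_vec_def by (simp add: power2_eq_square)

lemma lam_eq_jb: assumes "\<xi> \<noteq> 0" shows "lam \<xi> = (jb \<xi>)\<^sup>2"
proof -
  have "1 \<le> norm (lattice_vec \<xi>)"
    by (rule power2_le_imp_le) (use lam_ge_1[OF assms] in \<open>auto simp: lam_def\<close>)
  then show ?thesis by (simp add: japanese_bracket_def lam_def max_def)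
qed

lemma lam_le_jb: "lam \<xi> \<le> (jb \<xi>)\<^sup>2"
  by (cases "\<xi> = 0") (simp_all add: lam_eq_jb)

section \<open>Summability of powers of the bracket over the lattice\<close>

lemma summable_on_int_powr:
  assumes "q > 1"
  shows "(\<lambda>k::int. (max 1 \<bar>real_of_int k\<bar>) powr (-q)) summable_on UNIV"
proof -
  have "summable (\<lambda>n. real n powr (-q))" using assms by (simp add: summable_real_powr_iff)
  moreover have "\<forall>\<^sub>F n in sequentially. (max 1 (real n)) powr (-q) = real n powr (-q)"
    using eventually_ge_at_top[of 1] by eventually_elim (simp add: max_def)
  ultimately have "summable (\<lambda>n. (max 1 (real n)) powr (-q))"
    using summable_cong by fastforce
  then have n: "(\<lambda>n. (max 1 (real n)) powr (-q)) summable_on UNIV"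
    by (intro summable_nonneg_imp_summable_on) auto
  have 1: "(\<lambda>k::int. (max 1 \<bar>real_of_int k\<bar>) powr (-q)) summable_on range int"
    by (subst summable_on_reindex) (use n in \<open>auto simp: o_def\<close>)
  have 2: "(\<lambda>k::int. (max 1 \<bar>real_of_int k\<bar>) powr (-q)) summable_on range (\<lambda>n. - int n)"
    by (subst summable_on_reindex) (use n in \<open>auto simp: o_def inj_on_def\<close>)
  have "k \<in> range int \<union> range (\<lambda>n. - int n)" for k by (cases k rule: int_cases2) auto
  then have "range int \<union> range (\<lambda>n. - int n) = UNIV" by blast
  then show ?thesis using summable_on_union[OF 1 2] by simp
qed

text \<open>The bracket dominates the one-dimensional bracket of every coordinate. Distributing the
  exponent evenly over the coordinates therefore bounds the term by a product of one-dimensional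
  terms with exponent \<open>q = p / CARD('d) > 1\<close>. A finite set of frequencies lies in a
  cube, over which a sum of products is a product of sums.\<close>

lemma summable_on_jb_powr:
  assumes p: "p > real CARD('d::finite)"
  shows "(\<lambda>\<xi>::int^'d. jb \<xi> powr (-p)) summable_on UNIV"
proof -
  define q where "q = p / real CARD('d)"
  define h where "h k = (max 1 \<bar>real_of_int k\<bar>) powr (-q)" for k :: int
  have q: "q > 1" using p by (simp add: q_def)
  have h: "h summable_on UNIV" unfolding h_def by (rule summable_on_int_powr[OF q])
  have h0: "0 \<le> h k" for k by (simp add: h_def)
  have le: "jb \<xi> powr (-p) \<le> (\<Prod>i\<in>UNIV. h (\<xi> $ i))" for \<xi> :: "int^'d"
  proof -
    have "jb \<xi> powr (-q) \<le> h (\<xi> $ i)" for i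
      unfolding h_def using q abs_nth_le_jb[of \<xi> i] jb_ge_1[of \<xi>] by (intro powr_mono2') auto
    then have "(\<Prod>i\<in>(UNIV::'d set). jb \<xi> powr (-q)) \<le> (\<Prod>i\<in>UNIV. h (\<xi> $ i))"
      by (intro prod_mono) auto
    also have "(\<Prod>i\<in>(UNIV::'d set). jb \<xi> powr (-q)) = jb \<xi> powr (-p)"
      by (simp add: powr_power q_def)
    finally show ?thesis .
  qed
  show ?thesis
  proof (rule nonneg_bounded_partial_sums_imp_summable_on[where C="(infsum h UNIV) ^ CARD('d)"])
    show "\<forall>\<^sub>F F in finite_subsets_at_top UNIV. (\<Sum>\<xi>\<in>F. jb (\<xi>::int^'d) powr (-p)) \<le> (infsum h UNIV) ^ CARD('d)"
    proof (rule eventually_finite_subsets_at_top_weakI)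
      fix F :: "(int^'d) set" assume F: "finite F"
      define B where "B = (\<Union>i\<in>UNIV. (\<lambda>\<xi>. \<xi> $ i) ` F)"
      have B: "finite B" using F by (auto simp: B_def)
      have inj: "inj_on (vec_nth :: int^'d \<Rightarrow> 'd \<Rightarrow> int) F" by (auto simp: inj_on_def vec_nth_inject)
      have sub: "vec_nth ` F \<subseteq> PiE UNIV (\<lambda>_. B)" by (auto simp: B_def)
      have fin: "finite (PiE (UNIV::'d set) (\<lambda>_. B))" using B by (intro finite_PiE) auto
      have "(\<Sum>\<xi>\<in>F. jb \<xi> powr (-p)) \<le> (\<Sum>\<xi>\<in>F. \<Prod>i\<in>UNIV. h (\<xi> $ i))" by (intro sum_mono le)
      also have "\<dots> = (\<Sum>g\<in>vec_nth ` F. \<Prod>i\<in>UNIV. h (g i))"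
        by (simp add: sum.reindex[OF inj] o_def)
      also have "\<dots> \<le> (\<Sum>g\<in>PiE (UNIV::'d set) (\<lambda>_. B). \<Prod>i\<in>UNIV. h (g i))"
        by (intro sum_mono2[OF fin sub] prod_nonneg ballI h0)
      also have "\<dots> = (\<Prod>i\<in>(UNIV::'d set). sum h B)"
        using B by (subst prod_sum_PiE) auto
      also have "\<dots> = (sum h B) ^ CARD('d)" by simp
      also have "\<dots> \<le> (infsum h UNIV) ^ CARD('d)"
        using B h h0 by (intro power_mono finite_sum_le_infsum sum_nonneg) auto
      finally show "(\<Sum>\<xi>\<in>F. jb \<xi> powr (-p)) \<le> (infsum h UNIV) ^ CARD('d)" .
    qed
  qed auto
qed

lemma infsum_finite_sum:
  fixes f :: "'a \<Rightarrow> 'b \<Rightarrow> 'c::{t2_space, topological_comm_monoid_add}"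
  assumes "\<And>i. i \<in> F \<Longrightarrow> f i summable_on A"
  shows "(\<Sum>\<^sub>\<infinity>x\<in>A. \<Sum>i\<in>F. f i x) = (\<Sum>i\<in>F. \<Sum>\<^sub>\<infinity>x\<in>A. f i x)"
    and "(\<lambda>x. \<Sum>i\<in>F. f i x) summable_on A"
proof -
  have "((\<lambda>x. \<Sum>i\<in>F. f i x) has_sum (\<Sum>i\<in>F. \<Sum>\<^sub>\<infinity>x\<in>A. f i x)) A"
    using assms by (induction F rule: infinite_finite_induct) (auto intro!: has_sum_add)
  then show "(\<Sum>\<^sub>\<infinity>x\<in>A. \<Sum>i\<in>F. f i x) = (\<Sum>i\<in>F. \<Sum>\<^sub>\<infinity>x\<in>A. f i x)"
    "(\<lambda>x. \<Sum>i\<in>F. f i x) summable_on A"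
    by (auto simp: infsumI has_sum_imp_summable)
qed

lemma summable_on_diff_iff:
  fixes f :: "int^'d::finite \<Rightarrow> 'b::real_normed_vector"
  shows "(\<lambda>\<eta>. f (\<xi> - \<eta>)) summable_on UNIV \<longleftrightarrow> f summable_on UNIV"
  by (rule summable_on_reindex_bij_witness[of _ "\<lambda>\<eta>. \<xi> - \<eta>" "\<lambda>\<eta>. \<xi> - \<eta>"]) auto

lemma infsum_diff_eq:
  fixes f :: "int^'d::finite \<Rightarrow> 'b::real_normed_vector"
  shows "(\<Sum>\<^sub>\<infinity>\<eta>. f (\<xi> - \<eta>)) = (\<Sum>\<^sub>\<infinity>\<eta>. f \<eta>)"
  by (rule infsum_reindex_bij_witness[of _ "\<lambda>\<eta>. \<xi> - \<eta>" "\<lambda>\<eta>. \<xi> - \<eta>"]) auto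

text \<open>Elements of \<open>(int^'d) ell2\<close> stand for elements of \<open>H\<^sup>r\<close>: the entry at \<open>\<xi>\<close> is the Fourier
  coefficient multiplied by \<open>japanese_bracket \<xi> powr r\<close>. In this encoding \<open>conv r\<close> is the
  multiplication of functions in \<open>H\<^sup>r\<close>.\<close>

definition conv_weight :: "real \<Rightarrow> int^'d::finite \<Rightarrow> int^'d \<Rightarrow> real" where
  "conv_weight r \<xi> \<eta> = jb \<xi> powr r * jb (\<xi> - \<eta>) powr (-r) * jb \<eta> powr (-r)"

definition conv_term :: "real \<Rightarrow> (int^'d::finite) ell2 \<Rightarrow> (int^'d) ell2 \<Rightarrow> int^'d \<Rightarrow> int^'d \<Rightarrow> complex" where
  "conv_term r a b \<xi> \<eta> = (coef a (\<xi> - \<eta>) * coef b \<eta>) * complex_of_real (conv_weight r \<xi> \<eta>)"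

definition conv :: "real \<Rightarrow> (int^'d::finite) ell2 \<Rightarrow> (int^'d) ell2 \<Rightarrow> (int^'d) ell2" where
  "conv r a b = Abs_ell2 (\<lambda>\<xi>. \<Sum>\<^sub>\<infinity>\<eta>. conv_term r a b \<xi> \<eta>)"

lemma powr_square: "(t powr e)\<^sup>2 = t powr (2*e)" for t e :: real
  by (simp add: power2_eq_square flip: powr_add)

text \<open>With \<open>M\<close> the larger of the two brackets,
  \<open>jb \<xi> \<le> 2 * M\<close>, so the growing power is absorbed by the decay in
  \<open>M\<close> at the cost of \<open>2 powr (2*r) = 4 powr r\<close>. Only the decay in the
  smaller bracket is left, and it is at most the sum of both.\<close>

lemma conv_weight_sq_le:
  assumes "r \<ge> 0"
  shows "(conv_weight r \<xi> \<eta>)\<^sup>2 \<le> 4 powr r * (jb \<eta> powr (-2*r) + jb (\<xi> - \<eta>) powr (-2*r))"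
proof -
  let ?x = "jb \<xi>" and ?y = "jb (\<xi> - \<eta>)" and ?z = "jb \<eta>"
  define m M where "m = min ?y ?z" and "M = max ?y ?z"
  have pos: "0 < m" "0 < M" by (auto simp: m_def M_def less_max_iff_disj)
  have x: "?x \<le> 2 * M" using jb_triangle[of \<xi> \<eta>] by (auto simp: M_def)
  have "(conv_weight r \<xi> \<eta>)\<^sup>2 = ?x powr (2*r) * (?y powr (-2*r) * ?z powr (-2*r))"
    by (simp add: power_mult_distrib powr_square conv_weight_def)
  also have "?y powr (-2*r) * ?z powr (-2*r) = m powr (-2*r) * M powr (-2*r)"
    unfolding m_def M_def min_def max_def by (cases "?y \<le> ?z") simp_all
  also have "?x powr (2*r) * (m powr (-2*r) * M powr (-2*r)) \<le> (2*M) powr (2*r) * (m powr (-2*r) * M powr (-2*r))"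
    using x assms by (intro mult_right_mono powr_mono2) auto
  also have "\<dots> = 4 powr r * m powr (-2*r)"
  proof -
    have "(2::real) powr (2*r) = 4 powr r" using powr_powr[of 2 2 r] by simp
    moreover have "M powr (2*r) * M powr (-2*r) = 1" using pos by (simp flip: powr_add)
    ultimately show ?thesis using pos by (simp add: powr_mult)
  qed
  also have "\<dots> \<le> 4 powr r * (?z powr (-2*r) + ?y powr (-2*r))"
    by (intro mult_left_mono) (auto simp: m_def min_def)
  finally show ?thesis .
qed

text \<open>The square is the sum over \<open>\<eta>\<close> of the bound in
  \<open>conv_weight_sq_le\<close>: its two summands have equal sums by the reflection
  \<open>\<eta> \<mapsto> \<xi> - \<eta>\<close>, hence the factor 2.\<close>

definition conv_const :: "real \<Rightarrow> 'd::finite itself \<Rightarrow> real" where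
  "conv_const r _ = sqrt (2 * 4 powr r * (\<Sum>\<^sub>\<infinity>\<xi>::int^'d. jb \<xi> powr (-2*r)))"

lemma conv_const_nonneg: "0 \<le> conv_const r TYPE('d::finite)"
  unfolding conv_const_def by (intro real_sqrt_ge_zero mult_nonneg_nonneg infsum_nonneg) auto

text \<open>Cauchy--Schwarz in \<open>\<eta>\<close> separates the coefficients from the weight. The
  weight is square-summable with a bound independent of \<open>\<xi>\<close>, since
  \<open>2 * r\<close> exceeds the dimension, and the remaining factor is in a form that can still
  be summed over \<open>\<xi>\<close>.\<close>

lemma conv_term_bounds:
  fixes a b :: "(int^'d::finite) ell2"
  assumes r: "r > real CARD('d) / 2"
  shows "(\<lambda>\<eta>. cmod (conv_term r a b \<xi> \<eta>)) summable_on UNIV"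
    and "(\<lambda>\<eta>. (cmod (coef a (\<xi> - \<eta>) * coef b \<eta>))\<^sup>2) summable_on UNIV"
    and "(cmod (\<Sum>\<^sub>\<infinity>\<eta>. conv_term r a b \<xi> \<eta>))\<^sup>2
      \<le> (conv_const r TYPE('d))\<^sup>2 * (\<Sum>\<^sub>\<infinity>\<eta>. (cmod (coef a (\<xi> - \<eta>) * coef b \<eta>))\<^sup>2)"
proof -
  let ?w = "\<lambda>\<eta>. conv_weight r \<xi> \<eta>"
  let ?b = "\<lambda>\<eta>. jb \<eta> powr (-2*r)"
  have S: "(\<lambda>\<xi>::int^'d. jb \<xi> powr (-2*r)) summable_on UNIV"
    using summable_on_jb_powr[where p="2*r" and ?'d='d] r by simp
  have r0: "r \<ge> 0" using r by (rule order.trans[OF _ less_imp_le, rotated]) simp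
  show f: "(\<lambda>\<eta>. (cmod (coef a (\<xi> - \<eta>) * coef b \<eta>))\<^sup>2) summable_on UNIV"
  proof (rule summable_on_comparison_test)
    show "(\<lambda>\<eta>. (norm a)\<^sup>2 * (cmod (coef b \<eta>))\<^sup>2) summable_on UNIV"
      by (intro summable_on_cmult_right summable_coef)
    show "(cmod (coef a (\<xi> - \<eta>) * coef b \<eta>))\<^sup>2 \<le> (norm a)\<^sup>2 * (cmod (coef b \<eta>))\<^sup>2" for \<eta>
      by (auto simp: norm_mult power_mult_distrib intro!: mult_right_mono power_mono norm_coef_le)
  qed auto
  have S': "(\<lambda>\<eta>. ?b (\<xi> - \<eta>)) summable_on UNIV"
    using S summable_on_diff_iff[of ?b \<xi>] by simp
  have up: "(\<lambda>\<eta>. 4 powr r * (?b \<eta> + ?b (\<xi> - \<eta>))) summable_on UNIV"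
    by (intro summable_on_cmult_right summable_on_add S S')
  have w: "(cmod (complex_of_real (?w \<eta>)))\<^sup>2 \<le> 4 powr r * (?b \<eta> + ?b (\<xi> - \<eta>))" for \<eta>
    unfolding norm_of_real power2_abs by (rule conv_weight_sq_le[OF r0])
  have g: "(\<lambda>\<eta>. (cmod (complex_of_real (?w \<eta>)))\<^sup>2) summable_on UNIV"
    by (rule summable_on_comparison_test[OF up w]) simp
  have gle: "(\<Sum>\<^sub>\<infinity>\<eta>. (cmod (complex_of_real (?w \<eta>)))\<^sup>2) \<le> (conv_const r TYPE('d))\<^sup>2"
  proof -
    have "(\<Sum>\<^sub>\<infinity>\<eta>. (cmod (complex_of_real (?w \<eta>)))\<^sup>2) \<le> (\<Sum>\<^sub>\<infinity>\<eta>. 4 powr r * (?b \<eta> + ?b (\<xi> - \<eta>)))"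
      by (rule infsum_mono[OF g up w])
    also have "\<dots> = 4 powr r * ((\<Sum>\<^sub>\<infinity>\<eta>::int^'d. ?b \<eta>) + (\<Sum>\<^sub>\<infinity>\<eta>::int^'d. ?b \<eta>))"
      by (simp only: infsum_cmult_right' infsum_add[OF S S'] infsum_diff_eq[of ?b \<xi>])
    also have "\<dots> = (conv_const r TYPE('d))\<^sup>2"
      unfolding conv_const_def by (subst real_sqrt_pow2) (auto intro!: mult_nonneg_nonneg infsum_nonneg)
    finally show ?thesis .
  qed
  show "(\<lambda>\<eta>. cmod (conv_term r a b \<xi> \<eta>)) summable_on UNIV"
    unfolding conv_term_def by (rule summable_on_mult_ell2[OF f g])
  have "(cmod (\<Sum>\<^sub>\<infinity>\<eta>. conv_term r a b \<xi> \<eta>))\<^sup>2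
      \<le> (\<Sum>\<^sub>\<infinity>\<eta>. (cmod (coef a (\<xi> - \<eta>) * coef b \<eta>))\<^sup>2) * (\<Sum>\<^sub>\<infinity>\<eta>. (cmod (complex_of_real (?w \<eta>)))\<^sup>2)"
    unfolding conv_term_def by (rule summable_on_mult_ell2[OF f g])
  also have "\<dots> \<le> (\<Sum>\<^sub>\<infinity>\<eta>. (cmod (coef a (\<xi> - \<eta>) * coef b \<eta>))\<^sup>2) * (conv_const r TYPE('d))\<^sup>2"
    by (intro mult_left_mono gle infsum_nonneg) simp
  finally show "(cmod (\<Sum>\<^sub>\<infinity>\<eta>. conv_term r a b \<xi> \<eta>))\<^sup>2
      \<le> (conv_const r TYPE('d))\<^sup>2 * (\<Sum>\<^sub>\<infinity>\<eta>. (cmod (coef a (\<xi> - \<eta>) * coef b \<eta>))\<^sup>2)"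
    by (simp only: mult.commute)
qed

text \<open>The space H^r is an algebra for r > d/2. In the double sum left by
  \<open>conv_term_bounds\<close> the sum over \<open>\<xi>\<close> is taken first: for fixed
  \<open>\<eta>\<close> it runs over a translate of \<open>a\<close> and contributes at most
  \<open>(norm a)\<^sup>2\<close>.\<close>

lemma
  fixes a b :: "(int^'d::finite) ell2"
  assumes r: "r > real CARD('d) / 2"
  shows coef_conv: "coef (conv r a b) \<xi> = (\<Sum>\<^sub>\<infinity>\<eta>. conv_term r a b \<xi> \<eta>)"
    and norm_conv_le: "norm (conv r a b) \<le> conv_const r TYPE('d) * norm a * norm b"
proof -
  let ?K = "conv_const r TYPE('d)"
  have *: "(\<Sum>\<xi>\<in>F. (cmod (\<Sum>\<^sub>\<infinity>\<eta>. conv_term r a b \<xi> \<eta>))\<^sup>2) \<le> (?K * norm a * norm b)\<^sup>2" if F: "finite F" for F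
  proof -
    have "(\<Sum>\<xi>\<in>F. (cmod (\<Sum>\<^sub>\<infinity>\<eta>. conv_term r a b \<xi> \<eta>))\<^sup>2)
        \<le> (\<Sum>\<xi>\<in>F. ?K\<^sup>2 * (\<Sum>\<^sub>\<infinity>\<eta>. (cmod (coef a (\<xi> - \<eta>) * coef b \<eta>))\<^sup>2))"
      by (intro sum_mono conv_term_bounds r)
    also have "\<dots> = ?K\<^sup>2 * (\<Sum>\<xi>\<in>F. \<Sum>\<^sub>\<infinity>\<eta>. (cmod (coef a (\<xi> - \<eta>) * coef b \<eta>))\<^sup>2)"
      by (simp only: sum_distrib_left)
    also have "(\<Sum>\<xi>\<in>F. \<Sum>\<^sub>\<infinity>\<eta>. (cmod (coef a (\<xi> - \<eta>) * coef b \<eta>))\<^sup>2)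
        = (\<Sum>\<^sub>\<infinity>\<eta>. \<Sum>\<xi>\<in>F. (cmod (coef a (\<xi> - \<eta>) * coef b \<eta>))\<^sup>2)"
      by (rule infsum_finite_sum(1)[symmetric]) (rule conv_term_bounds(2)[OF r])
    also have "?K\<^sup>2 * \<dots> \<le> ?K\<^sup>2 * (\<Sum>\<^sub>\<infinity>\<eta>. (norm a)\<^sup>2 * (cmod (coef b \<eta>))\<^sup>2)"
    proof (intro mult_left_mono infsum_mono)
      show "(\<lambda>\<eta>. \<Sum>\<xi>\<in>F. (cmod (coef a (\<xi> - \<eta>) * coef b \<eta>))\<^sup>2) summable_on UNIV"
        by (intro infsum_finite_sum(2) conv_term_bounds(2)[OF r])
      show "(\<lambda>\<eta>. (norm a)\<^sup>2 * (cmod (coef b \<eta>))\<^sup>2) summable_on UNIV"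
        by (intro summable_on_cmult_right summable_coef)
      fix \<eta>
      have inj: "inj_on (\<lambda>\<xi>. \<xi> - \<eta>) F" by (auto simp: inj_on_def)
      have "(\<Sum>\<xi>\<in>F. (cmod (coef a (\<xi> - \<eta>) * coef b \<eta>))\<^sup>2) = (\<Sum>\<zeta>\<in>(\<lambda>\<xi>. \<xi> - \<eta>) ` F. (cmod (coef a \<zeta>))\<^sup>2) * (cmod (coef b \<eta>))\<^sup>2"
        by (simp add: sum.reindex[OF inj] norm_mult power_mult_distrib sum_distrib_right)
      also have "\<dots> \<le> (norm a)\<^sup>2 * (cmod (coef b \<eta>))\<^sup>2"
        using F by (intro mult_right_mono sum_coef_le) auto
      finally show "(\<Sum>\<xi>\<in>F. (cmod (coef a (\<xi> - \<eta>) * coef b \<eta>))\<^sup>2) \<le> (norm a)\<^sup>2 * (cmod (coef b \<eta>))\<^sup>2" .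
    qed simp
    also have "\<dots> = (?K * norm a * norm b)\<^sup>2"
      by (simp only: infsum_cmult_right' norm_ell2_sq[of b, symmetric] power_mult_distrib mult.assoc)
    finally show ?thesis .
  qed
  show "coef (conv r a b) \<xi> = (\<Sum>\<^sub>\<infinity>\<eta>. conv_term r a b \<xi> \<eta>)"
    unfolding conv_def by (subst coef_Abs_ell2[OF *]) auto
  show "norm (conv r a b) \<le> ?K * norm a * norm b"
    unfolding conv_def by (rule norm_Abs_ell2_le) (intro mult_nonneg_nonneg conv_const_nonneg norm_ge_zero, rule *)
qed

lemma bounded_bilinear_conv:
  assumes r: "r > real CARD('d::finite) / 2"
  shows "bounded_bilinear (conv r :: (int^'d) ell2 \<Rightarrow> _)"
proof
  have s: "(\<lambda>\<eta>. conv_term r a b \<xi> \<eta>) summable_on UNIV" for a b :: "(int^'d) ell2" and \<xi>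
    by (rule abs_summable_summable[OF conv_term_bounds(1)[OF r]])
  have t: "conv_term r (a + a') b \<xi> \<eta> = conv_term r a b \<xi> \<eta> + conv_term r a' b \<xi> \<eta>"
    "conv_term r a (b + b') \<xi> \<eta> = conv_term r a b \<xi> \<eta> + conv_term r a b' \<xi> \<eta>"
    "conv_term r (c *\<^sub>R a) b \<xi> \<eta> = c *\<^sub>R conv_term r a b \<xi> \<eta>"
    "conv_term r a (c *\<^sub>R b) \<xi> \<eta> = c *\<^sub>R conv_term r a b \<xi> \<eta>"
    for a a' b b' :: "(int^'d) ell2" and \<xi> \<eta> c
    by (simp_all add: conv_term_def ring_distribs)
  fix a a' b b' :: "(int^'d) ell2" and c :: real
  show "conv r (a + a') b = conv r a b + conv r a' b" "conv r a (b + b') = conv r a b + conv r a b'"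
    by (rule ell2_eqI; simp add: coef_conv[OF r] t infsum_add[OF s s])+
  show "conv r (c *\<^sub>R a) b = c *\<^sub>R conv r a b" "conv r a (c *\<^sub>R b) = c *\<^sub>R conv r a b"
    by (rule ell2_eqI; simp add: coef_conv[OF r] t infsum_scaleR_right)+
  have "norm (conv r a b) \<le> norm a * norm b * conv_const r TYPE('d)" for a b :: "(int^'d) ell2"
    using norm_conv_le[OF r, of a b] by (simp only: ac_simps)
  then show "\<exists>K. \<forall>a b. norm (conv r a b :: (int^'d) ell2) \<le> norm a * norm b * K" by blast
qed

text \<open>For r > d/2 the Fourier series of an H^r function converges absolutely. This makes such
  a function bounded and so a legitimate factor of a product in L^2.\<close>

lemma summable_unweighted_coef:
  fixes a :: "(int^'d::finite) ell2"
  assumes r: "r > real CARD('d) / 2"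
  shows "(\<lambda>\<xi>. cmod (complex_of_real (jb \<xi> powr (-r)) * coef a \<xi>)) summable_on UNIV"
proof (rule summable_on_mult_ell2(1))
  have "(jb \<xi> powr (-r))\<^sup>2 = jb \<xi> powr (-(2*r))" for \<xi> :: "int^'d"
    by (simp add: powr_square)
  then show "(\<lambda>\<xi>::int^'d. (cmod (complex_of_real (jb \<xi> powr - r)))\<^sup>2) summable_on UNIV"
    using summable_on_jb_powr[where p="2*r" and ?'d='d] r by simp
qed (rule summable_coef)

section \<open>Duhamel integrals\<close>

text \<open>The integral of \<open>e t * (x t - c)\<^sup>2\<close> is nonnegative for every constant
  \<open>c\<close>, and \<open>c = I1 / I0\<close> gives the claim. If the weight has mass zero, the
  expression is affine in \<open>c\<close> and bounded below, which forces
  \<open>I1 = 0\<close>.\<close>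

lemma weighted_Cauchy_Schwarz_integral:
  fixes e x :: "real \<Rightarrow> real"
  assumes e: "continuous_on {a..b} e" "\<And>t. t \<in> {a..b} \<Longrightarrow> 0 \<le> e t" and x: "continuous_on {a..b} x"
  shows "(integral {a..b} (\<lambda>t. e t * x t))\<^sup>2 \<le> integral {a..b} e * integral {a..b} (\<lambda>t. e t * (x t)\<^sup>2)"
proof -
  define I0 I1 I2 where "I0 = integral {a..b} e" and "I1 = integral {a..b} (\<lambda>t. e t * x t)"
    and "I2 = integral {a..b} (\<lambda>t. e t * (x t)\<^sup>2)"
  have int: "e integrable_on {a..b}" "(\<lambda>t. e t * x t) integrable_on {a..b}"
    "(\<lambda>t. e t * (x t)\<^sup>2) integrable_on {a..b}"
    by (intro integrable_continuous_interval continuous_intros e x)+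
  have quad: "0 \<le> I2 - 2 * c * I1 + c\<^sup>2 * I0" for c
  proof -
    have "((\<lambda>t. e t * (x t)\<^sup>2 - (2 * c) * (e t * x t) + c\<^sup>2 * e t) has_integral I2 - 2 * c * I1 + c\<^sup>2 * I0) {a..b}"
      unfolding I0_def I1_def I2_def
      by (intro has_integral_add has_integral_diff has_integral_mult_right integrable_integral int)
    moreover have "0 \<le> e t * (x t)\<^sup>2 - (2 * c) * (e t * x t) + c\<^sup>2 * e t" if "t \<in> {a..b}" for t
    proof -
      have "e t * (x t)\<^sup>2 - (2 * c) * (e t * x t) + c\<^sup>2 * e t = e t * (x t - c)\<^sup>2"
        by (simp add: power2_eq_square algebra_simps)
      then show ?thesis using e(2)[OF that] by simp
    qed
    ultimately show ?thesis by (rule has_integral_nonneg)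
  qed
  have I0: "0 \<le> I0" unfolding I0_def by (intro integral_nonneg int e)
  show ?thesis
  proof (cases "I0 = 0")
    case True
    have "I1 = 0"
    proof (rule ccontr)
      assume "I1 \<noteq> 0"
      \<comment> \<open>For this value of \<open>c\<close> the quadratic expression equals
        -1.\<close>
      then show False using quad[of "(I2 + 1) / (2 * I1)"] True by (simp add: field_simps)
    qed
    then show ?thesis using True unfolding I0_def I1_def I2_def by simp
  next
    case False
    then have "0 < I0" using I0 by simp
    have "0 \<le> (I2 - 2 * (I1/I0) * I1 + (I1/I0)\<^sup>2 * I0) * I0"
      using quad[of "I1/I0"] I0 by (intro mult_nonneg_nonneg)
    also have "\<dots> = I0 * I2 - I1\<^sup>2" using False by (simp add: field_simps power2_eq_square)
    finally show ?thesis unfolding I0_def I1_def I2_def by simp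
  qed
qed

text \<open>The first bound does not see the length of the interval and serves the estimates global
  in time; the second is small on short intervals and serves continuity in time.\<close>

lemma integral_exp_le:
  fixes a b \<mu> :: real
  assumes "0 \<le> a" "a \<le> b" "0 < \<mu>"
  shows "integral {a..b} (\<lambda>t. exp (- \<mu> * t)) \<le> 1 / \<mu>" "integral {a..b} (\<lambda>t. exp (- \<mu> * t)) \<le> b - a"
proof -
  have "((\<lambda>t. exp (- \<mu> * t)) has_integral (- exp (- \<mu> * b) / \<mu> - (- exp (- \<mu> * a) / \<mu>))) {a..b}"
    by (rule fundamental_theorem_of_calculus[OF assms(2), where f = "\<lambda>t. - exp (- \<mu> * t) / \<mu>"])
      (use assms(3) in \<open>auto intro!: derivative_eq_intros simp: has_real_derivative_iff_has_vector_derivative[symmetric]\<close>)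
  then have "integral {a..b} (\<lambda>t. exp (- \<mu> * t)) = (exp (- \<mu> * a) - exp (- \<mu> * b)) / \<mu>"
    by (simp add: integral_unique diff_divide_distrib)
  also have "\<dots> \<le> 1 / \<mu>"
  proof (intro divide_right_mono)
    have "exp (- \<mu> * a) \<le> 1" using assms by simp
    then show "exp (- \<mu> * a) - exp (- \<mu> * b) \<le> 1" using exp_ge_zero[of "- \<mu> * b"] by linarith
  qed (use assms in simp)
  finally show "integral {a..b} (\<lambda>t. exp (- \<mu> * t)) \<le> 1 / \<mu>" .
  have "integral {a..b} (\<lambda>t. exp (- \<mu> * t)) \<le> integral {a..b} (\<lambda>t. 1)"
    using assms by (intro integral_le integrable_continuous_interval continuous_intros) auto
  then show "integral {a..b} (\<lambda>t. exp (- \<mu> * t)) \<le> b - a" using assms by simp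
qed

text \<open>Cauchy--Schwarz in time against the kernel \<open>exp (- (lam \<xi> - \<alpha>) \<sigma>)\<close>, whose mass is of order
  \<open>1 / lam \<xi>\<close>, recovers the full derivative lost by the advection term.\<close>

definition heat_kernel_term :: "real \<Rightarrow> real \<Rightarrow> real \<Rightarrow> (real \<Rightarrow> (int^'d::finite) ell2) \<Rightarrow> int^'d \<Rightarrow> complex" where
  "heat_kernel_term \<alpha> a b g \<xi> = (if \<xi> = 0 then 0 else
     jb \<xi> *\<^sub>R integral {a..b} (\<lambda>\<sigma>. exp (- (lam \<xi> - \<alpha>) * \<sigma>) *\<^sub>R coef (g \<sigma>) \<xi>))"

text \<open>The best constant in \<open>lam_le_heat_const\<close>: the quotient
  \<open>lam / (lam - \<alpha>)\<close> over \<open>lam \<ge> 1\<close> is largest at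
  \<open>lam = 1\<close> when \<open>\<alpha> \<ge> 0\<close>, and approaches 1 from below when
  \<open>\<alpha> < 0\<close>. Negative \<open>\<alpha>\<close> occurs in the uniqueness
  argument.\<close>

definition heat_const :: "real \<Rightarrow> real" where "heat_const \<alpha> = max 1 (1 / (1 - \<alpha>))"

lemma heat_const_ge_1: "1 \<le> heat_const \<alpha>" by (simp add: heat_const_def)

lemma lam_le_heat_const:
  assumes "\<alpha> < 1" "\<xi> \<noteq> 0"
  shows "lam \<xi> \<le> heat_const \<alpha> * (lam \<xi> - \<alpha>)"
proof -
  note l = lam_ge_1[OF assms(2)]
  show ?thesis
  proof (cases "\<alpha> \<le> 0")
    case True
    then have "lam \<xi> \<le> 1 * (lam \<xi> - \<alpha>)" by simp
    also have "\<dots> \<le> heat_const \<alpha> * (lam \<xi> - \<alpha>)"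
      using l assms by (intro mult_right_mono heat_const_ge_1) auto
    finally show ?thesis .
  next
    case False
    then have "\<alpha> * 1 \<le> \<alpha> * lam \<xi>" using l by (intro mult_left_mono) auto
    then have "lam \<xi> \<le> (1 / (1 - \<alpha>)) * (lam \<xi> - \<alpha>)" using assms by (simp add: field_simps)
    also have "\<dots> \<le> heat_const \<alpha> * (lam \<xi> - \<alpha>)"
      using l assms by (intro mult_right_mono) (auto simp: heat_const_def)
    finally show ?thesis .
  qed
qed

text \<open>Cauchy--Schwarz splits the kernel in two. One copy is integrated and contributes
  \<open>1 / \<mu>\<close>, which together with \<open>(jb \<xi>)\<^sup>2 = lam \<xi>\<close> is
  bounded by \<open>heat_const \<alpha>\<close>. In the other copy the rate \<open>\<mu>\<close> is
  lowered to \<open>1 - \<alpha>\<close>, the value at the lowest nonzero frequencies; the resulting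
  weight no longer depends on \<open>\<xi>\<close>.\<close>

lemma heat_kernel_term_le:
  fixes g :: "real \<Rightarrow> (int^'d::finite) ell2"
  assumes \<alpha>: "\<alpha> < 1" and ab: "0 \<le> a" "a \<le> b" and g: "continuous_on {a..b} g"
  shows "(cmod (heat_kernel_term \<alpha> a b g \<xi>))\<^sup>2
    \<le> heat_const \<alpha> * integral {a..b} (\<lambda>\<sigma>. exp (- (1 - \<alpha>) * \<sigma>) * (cmod (coef (g \<sigma>) \<xi>))\<^sup>2)"
proof (cases "\<xi> = 0")
  case True
  then show ?thesis using heat_const_ge_1[of \<alpha>]
    by (auto simp: heat_kernel_term_def intro!: mult_nonneg_nonneg integral_nonneg
        integrable_continuous_interval continuous_intros g)
next
  case False
  define \<mu> where "\<mu> = lam \<xi> - \<alpha>"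
  define x where "x \<sigma> = cmod (coef (g \<sigma>) \<xi>)" for \<sigma>
  have mu: "1 - \<alpha> \<le> \<mu>" "0 < \<mu>" using lam_ge_1[OF False] \<alpha> by (auto simp: \<mu>_def)
  have cx: "continuous_on {a..b} x" unfolding x_def by (intro continuous_intros g)
  have "cmod (integral {a..b} (\<lambda>\<sigma>. exp (- \<mu> * \<sigma>) *\<^sub>R coef (g \<sigma>) \<xi>)) \<le> integral {a..b} (\<lambda>\<sigma>. exp (- \<mu> * \<sigma>) * x \<sigma>)"
    by (rule integral_norm_bound_integral)
      (auto intro!: integrable_continuous_interval continuous_intros g cx simp: x_def)
  then have "(cmod (integral {a..b} (\<lambda>\<sigma>. exp (- \<mu> * \<sigma>) *\<^sub>R coef (g \<sigma>) \<xi>)))\<^sup>2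
      \<le> (integral {a..b} (\<lambda>\<sigma>. exp (- \<mu> * \<sigma>) * x \<sigma>))\<^sup>2"
    by (intro power_mono) auto
  also have "\<dots> \<le> integral {a..b} (\<lambda>\<sigma>. exp (- \<mu> * \<sigma>)) * integral {a..b} (\<lambda>\<sigma>. exp (- \<mu> * \<sigma>) * (x \<sigma>)\<^sup>2)"
    by (intro weighted_Cauchy_Schwarz_integral continuous_intros cx) auto
  also have "\<dots> \<le> (1 / \<mu>) * integral {a..b} (\<lambda>\<sigma>. exp (- (1 - \<alpha>) * \<sigma>) * (x \<sigma>)\<^sup>2)"
  proof (intro mult_mono integral_exp_le ab mu)
    show "integral {a..b} (\<lambda>\<sigma>. exp (- \<mu> * \<sigma>) * (x \<sigma>)\<^sup>2) \<le> integral {a..b} (\<lambda>\<sigma>. exp (- (1 - \<alpha>) * \<sigma>) * (x \<sigma>)\<^sup>2)"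
    proof (intro integral_le integrable_continuous_interval continuous_intros cx mult_right_mono)
      fix t assume "t \<in> {a..b}"
      then have "(1 - \<alpha>) * t \<le> \<mu> * t" using ab mu by (intro mult_right_mono) auto
      then show "exp (- \<mu> * t) \<le> exp (- (1 - \<alpha>) * t)" by (simp add: algebra_simps)
    qed simp
    show "0 \<le> integral {a..b} (\<lambda>\<sigma>. exp (- \<mu> * \<sigma>) * (x \<sigma>)\<^sup>2)"
      by (intro integral_nonneg integrable_continuous_interval continuous_intros cx) auto
  qed (use mu in auto)
  finally have 1: "(cmod (integral {a..b} (\<lambda>\<sigma>. exp (- \<mu> * \<sigma>) *\<^sub>R coef (g \<sigma>) \<xi>)))\<^sup>2
    \<le> (1 / \<mu>) * integral {a..b} (\<lambda>\<sigma>. exp (- (1 - \<alpha>) * \<sigma>) * (x \<sigma>)\<^sup>2)" (is "_ \<le> _ * ?I") .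
  have I: "0 \<le> ?I" by (intro integral_nonneg integrable_continuous_interval continuous_intros cx) auto
  have "(cmod (heat_kernel_term \<alpha> a b g \<xi>))\<^sup>2 = lam \<xi> * (cmod (integral {a..b} (\<lambda>\<sigma>. exp (- \<mu> * \<sigma>) *\<^sub>R coef (g \<sigma>) \<xi>)))\<^sup>2"
    using False by (simp add: heat_kernel_term_def \<mu>_def power_mult_distrib lam_eq_jb)
  also have "\<dots> \<le> lam \<xi> * ((1 / \<mu>) * ?I)" by (intro mult_left_mono 1) simp
  also have "\<dots> = (lam \<xi> / \<mu>) * ?I" by simp
  also have "\<dots> \<le> heat_const \<alpha> * ?I"
    using lam_le_heat_const[OF \<alpha> False] mu I
    by (intro mult_right_mono) (auto simp: field_simps \<mu>_def)
  finally show ?thesis unfolding x_def .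
qed

text \<open>Because the time weight is the same for all modes, the sum over \<open>F\<close> moves
  under the integral and is bounded there by the square of the norm of \<open>g\<close>. The two
  admissible values of \<open>L\<close> are the two bounds of \<open>integral_exp_le\<close> for the
  rate \<open>1 - \<alpha>\<close>.\<close>

lemma heat_kernel_term_sum_le:
  fixes g :: "real \<Rightarrow> (int^'d::finite) ell2"
  assumes \<alpha>: "\<alpha> < 1" and ab: "0 \<le> a" "a \<le> b" and g: "continuous_on {a..b} g"
    and M: "\<And>\<sigma>. \<sigma> \<in> {a..b} \<Longrightarrow> norm (g \<sigma>) \<le> M" "0 \<le> M" and F: "finite F"
    and L: "L = b - a \<or> L = 1 / (1 - \<alpha>)"
  shows "(\<Sum>\<xi>\<in>F. (cmod (heat_kernel_term \<alpha> a b g \<xi>))\<^sup>2) \<le> (sqrt (heat_const \<alpha> * L) * M)\<^sup>2"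
proof -
  have c: "0 \<le> heat_const \<alpha>" using heat_const_ge_1[of \<alpha>] by simp
  have L0: "0 \<le> L" using L ab \<alpha> by auto
  have "(\<Sum>\<xi>\<in>F. (cmod (heat_kernel_term \<alpha> a b g \<xi>))\<^sup>2)
    \<le> (\<Sum>\<xi>\<in>F. heat_const \<alpha> * integral {a..b} (\<lambda>\<sigma>. exp (- (1 - \<alpha>) * \<sigma>) * (cmod (coef (g \<sigma>) \<xi>))\<^sup>2))"
    by (intro sum_mono heat_kernel_term_le \<alpha> ab g)
  also have "\<dots> = heat_const \<alpha> * integral {a..b} (\<lambda>\<sigma>. \<Sum>\<xi>\<in>F. exp (- (1 - \<alpha>) * \<sigma>) * (cmod (coef (g \<sigma>) \<xi>))\<^sup>2)"
    by (subst integral_sum) (auto intro!: F integrable_continuous_interval continuous_intros g simp: sum_distrib_left)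
  also have "\<dots> \<le> heat_const \<alpha> * integral {a..b} (\<lambda>\<sigma>. exp (- (1 - \<alpha>) * \<sigma>) * M\<^sup>2)"
  proof (intro mult_left_mono c integral_le integrable_continuous_interval continuous_intros g)
    fix t assume t: "t \<in> {a..b}"
    have "(\<Sum>\<xi>\<in>F. (cmod (coef (g t) \<xi>))\<^sup>2) \<le> (norm (g t))\<^sup>2" by (rule sum_coef_le[OF F])
    also have "\<dots> \<le> M\<^sup>2" using M(1)[OF t] by (intro power_mono) auto
    finally show "(\<Sum>\<xi>\<in>F. exp (- (1 - \<alpha>) * t) * (cmod (coef (g t) \<xi>))\<^sup>2) \<le> exp (- (1 - \<alpha>) * t) * M\<^sup>2"
      unfolding sum_distrib_left[symmetric] by (intro mult_left_mono) auto
  qed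
  also have "\<dots> = heat_const \<alpha> * (integral {a..b} (\<lambda>\<sigma>. exp (- (1 - \<alpha>) * \<sigma>)) * M\<^sup>2)"
    by (simp only: integral_mult_left)
  also have "\<dots> \<le> heat_const \<alpha> * (L * M\<^sup>2)"
    using L integral_exp_le[OF ab, of "1 - \<alpha>"] \<alpha> by (intro mult_left_mono c mult_right_mono) auto
  also have "\<dots> = (sqrt (heat_const \<alpha> * L) * M)\<^sup>2"
    using c L0 by (simp add: power_mult_distrib)
  finally show ?thesis .
qed

lemmas heat_kernel_term_sum_le1 = heat_kernel_term_sum_le[OF _ _ _ _ _ _ _ disjI1[OF refl]]
lemmas heat_kernel_term_sum_le2 = heat_kernel_term_sum_le[OF _ _ _ _ _ _ _ disjI2[OF refl]]

text \<open>The input is encoded in H^(s-1) and the output in H^s, which explains the factor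
  \<open>jb \<xi>\<close> in \<open>heat_kernel_term\<close>. The rate is shifted by
  \<open>\<alpha>\<close> because the unknown carries the weight \<open>exp (\<alpha> t)\<close>.
  Integration runs over the elapsed time \<open>\<sigma> = t - \<tau>\<close>, so that the kernel
  does not depend on \<open>t\<close>.\<close>

definition duhamel :: "real \<Rightarrow> (real \<Rightarrow> (int^'d::finite) ell2) \<Rightarrow> real \<Rightarrow> (int^'d) ell2" where
  "duhamel \<alpha> G t = Abs_ell2 (heat_kernel_term \<alpha> 0 t (\<lambda>\<sigma>. G (t - \<sigma>)))"

definition duhamel_const :: "real \<Rightarrow> real" where
  "duhamel_const \<alpha> = sqrt (heat_const \<alpha> * (1 / (1 - \<alpha>)))"

lemma duhamel_const_nonneg: "\<alpha> < 1 \<Longrightarrow> 0 \<le> duhamel_const \<alpha>"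
  using heat_const_ge_1[of \<alpha>] by (simp add: duhamel_const_def)

lemma continuous_on_reflect:
  fixes G :: "real \<Rightarrow> 'a::topological_space"
  assumes "continuous_on {0..t} G" "0 \<le> a" "b \<le> t"
  shows "continuous_on {a..b} (\<lambda>\<sigma>. G (t - \<sigma>))"
  by (rule continuous_on_compose2[OF assms(1)]) (use assms in \<open>auto intro!: continuous_intros\<close>)

lemma continuous_ell2_bounded:
  fixes G :: "real \<Rightarrow> 'a::real_normed_vector"
  assumes "continuous_on {0..t} G"
  obtains M where "0 \<le> M" "\<And>\<tau>. \<tau> \<in> {0..t} \<Longrightarrow> norm (G \<tau>) \<le> M"
proof -
  have "bounded (G ` {0..t})" by (intro compact_imp_bounded compact_continuous_image assms compact_Icc)
  then obtain M where "0 < M" "\<And>x. x \<in> G ` {0..t} \<Longrightarrow> norm x \<le> M" by (auto simp: bounded_pos)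
  then show ?thesis by (intro that[of M]) auto
qed

lemma
  fixes G :: "real \<Rightarrow> (int^'d::finite) ell2"
  assumes \<alpha>: "\<alpha> < 1" and t: "0 \<le> t" and G: "continuous_on {0..t} G"
  shows coef_duhamel: "coef (duhamel \<alpha> G t) \<xi> = heat_kernel_term \<alpha> 0 t (\<lambda>\<sigma>. G (t - \<sigma>)) \<xi>"
    and norm_duhamel_le: "0 \<le> M \<Longrightarrow> (\<And>\<tau>. \<tau> \<in> {0..t} \<Longrightarrow> norm (G \<tau>) \<le> M) \<Longrightarrow> norm (duhamel \<alpha> G t) \<le> duhamel_const \<alpha> * M"
proof -
  note c = continuous_on_reflect[OF G order_refl order_refl]
  have *: "(\<Sum>\<xi>\<in>F. (cmod (heat_kernel_term \<alpha> 0 t (\<lambda>\<sigma>. G (t - \<sigma>)) \<xi>))\<^sup>2) \<le> (duhamel_const \<alpha> * M)\<^sup>2"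
    if "0 \<le> M" "\<And>\<tau>. \<tau> \<in> {0..t} \<Longrightarrow> norm (G \<tau>) \<le> M" "finite F" for M F
    unfolding duhamel_const_def by (rule heat_kernel_term_sum_le2[OF \<alpha> order_refl t c]) (use that in auto)
  obtain M0 where M0: "0 \<le> M0" "\<And>\<tau>. \<tau> \<in> {0..t} \<Longrightarrow> norm (G \<tau>) \<le> M0"
    by (rule continuous_ell2_bounded[OF G]) auto
  show "coef (duhamel \<alpha> G t) \<xi> = heat_kernel_term \<alpha> 0 t (\<lambda>\<sigma>. G (t - \<sigma>)) \<xi>"
    unfolding duhamel_def by (subst coef_Abs_ell2[OF *[OF M0]]) auto
  assume M: "0 \<le> M" "\<And>\<tau>. \<tau> \<in> {0..t} \<Longrightarrow> norm (G \<tau>) \<le> M"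
  show "norm (duhamel \<alpha> G t) \<le> duhamel_const \<alpha> * M"
    unfolding duhamel_def
    by (rule norm_Abs_ell2_le) (use M *[OF M] duhamel_const_nonneg[OF \<alpha>] in auto)
qed

lemma integral_reflect_interval:
  fixes f :: "real \<Rightarrow> 'a::euclidean_space"
  assumes "continuous_on {0..t} f"
  shows "integral {0..t} (\<lambda>\<sigma>. f (t - \<sigma>)) = integral {0..t} f"
proof -
  have "(f has_integral integral {0..t} f) (cbox 0 t)"
    using assms by (simp add: integrable_continuous_interval integrable_integral)
  from has_integral_affinity[OF this, of "-1" t]
  have "((\<lambda>\<sigma>. f (t - \<sigma>)) has_integral integral {0..t} f) ((\<lambda>x. t - x) ` {0..t})"
    by simp
  also have "(\<lambda>x. t - x) ` {0..t} = {0..t}"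
    by (auto simp: image_iff intro!: bexI[of _ "t - x" for x])
  finally show ?thesis by (rule integral_unique)
qed

text \<open>Variation of constants: the solution of \<open>y' = g - \<mu> y\<close> with
  \<open>y 0 = 0\<close>.\<close>

definition voc :: "real \<Rightarrow> (real \<Rightarrow> complex) \<Rightarrow> real \<Rightarrow> complex" where
  "voc \<mu> g t = exp (- \<mu> * t) *\<^sub>R integral {0..t} (\<lambda>\<tau>. exp (\<mu> * \<tau>) *\<^sub>R g \<tau>)"

lemma voc_0 [simp]: "voc \<mu> g 0 = 0" by (simp add: voc_def)

lemma heat_kernel_term_eq_voc:
  assumes G: "continuous_on {0..t} G" and "\<xi> \<noteq> 0"
  shows "heat_kernel_term \<alpha> 0 t (\<lambda>\<sigma>. G (t - \<sigma>)) (\<xi> :: int^'d::finite) = jb \<xi> *\<^sub>R voc (lam \<xi> - \<alpha>) (\<lambda>\<tau>. coef (G \<tau>) \<xi>) t"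
proof -
  let ?\<mu> = "lam \<xi> - \<alpha>"
  have "integral {0..t} (\<lambda>\<sigma>. exp (- ?\<mu> * \<sigma>) *\<^sub>R coef (G (t - \<sigma>)) \<xi>)
      = integral {0..t} (\<lambda>\<sigma>. exp (- ?\<mu> * (t - (t - \<sigma>))) *\<^sub>R coef (G (t - \<sigma>)) \<xi>)" by simp
  also have "\<dots> = integral {0..t} (\<lambda>\<tau>. exp (- ?\<mu> * (t - \<tau>)) *\<^sub>R coef (G \<tau>) \<xi>)"
    by (rule integral_reflect_interval) (intro continuous_intros G)
  also have "(\<lambda>\<tau>. exp (- ?\<mu> * (t - \<tau>)) *\<^sub>R coef (G \<tau>) \<xi>)
      = (\<lambda>\<tau>. exp (- ?\<mu> * t) *\<^sub>R (exp (?\<mu> * \<tau>) *\<^sub>R coef (G \<tau>) \<xi>))"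
    by (simp add: algebra_simps flip: exp_add)
  also have "integral {0..t} \<dots> = voc ?\<mu> (\<lambda>\<tau>. coef (G \<tau>) \<xi>) t"
    unfolding voc_def by (rule integral_cmul)
  finally show ?thesis using assms by (simp add: heat_kernel_term_def)
qed

lemma has_vector_derivative_voc:
  assumes g: "continuous_on {0..} g" and t: "0 \<le> t"
  shows "(voc \<mu> g has_vector_derivative (g t - \<mu> *\<^sub>R voc \<mu> g t)) (at t within {0..})"
proof -
  \<comment> \<open>The interval is prolonged beyond \<open>t\<close>, so that near \<open>t\<close>
    it coincides with the half-line and the derivative may be read within
    \<open>{0..}\<close>.\<close>
  have "((\<lambda>u. integral {0..u} (\<lambda>\<tau>. exp (\<mu> * \<tau>) *\<^sub>R g \<tau>)) has_vector_derivative exp (\<mu> * t) *\<^sub>R g t)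
      (at t within {0..t+1})"
    by (rule integral_has_vector_derivative)
      (use t in \<open>auto intro!: continuous_intros continuous_on_subset[OF g]\<close>)
  also have "at t within {0..t+1} = at t within {0..}"
    by (rule at_within_nhd[of _ "{..<t+1}"]) auto
  finally have I: "((\<lambda>u. integral {0..u} (\<lambda>\<tau>. exp (\<mu> * \<tau>) *\<^sub>R g \<tau>)) has_vector_derivative exp (\<mu> * t) *\<^sub>R g t)
      (at t within {0..})" .
  have "((\<lambda>u. exp (- \<mu> * u) *\<^sub>R integral {0..u} (\<lambda>\<tau>. exp (\<mu> * \<tau>) *\<^sub>R g \<tau>)) has_vector_derivative
      exp (- \<mu> * t) *\<^sub>R (exp (\<mu> * t) *\<^sub>R g t) + (- \<mu> * exp (- \<mu> * t)) *\<^sub>R integral {0..t} (\<lambda>\<tau>. exp (\<mu> * \<tau>) *\<^sub>R g \<tau>))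
      (at t within {0..})"
    by (rule has_vector_derivative_scaleR[OF _ I]) (auto intro!: derivative_eq_intros)
  moreover have "exp (- \<mu> * t) * exp (\<mu> * t) = 1" by (simp flip: exp_add)
  ultimately show ?thesis by (simp add: voc_def[abs_def])
qed

text \<open>The integrating factor \<open>exp (\<mu> * t)\<close> removes the damping term, and the
  fundamental theorem of calculus does the rest.\<close>

lemma voc_unique:
  assumes y: "\<And>t. 0 \<le> t \<Longrightarrow> (y has_vector_derivative (g t - \<mu> *\<^sub>R y t)) (at t within {0..})" and t: "0 \<le> t"
  shows "y t = exp (- \<mu> * t) *\<^sub>R y 0 + voc \<mu> g t"
proof -
  have "((\<lambda>\<tau>. exp (\<mu> * \<tau>) *\<^sub>R g \<tau>) has_integral (exp (\<mu> * t) *\<^sub>R y t - exp (\<mu> * 0) *\<^sub>R y 0)) {0..t}"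
  proof (rule fundamental_theorem_of_calculus[OF t, where f = "\<lambda>\<tau>. exp (\<mu> * \<tau>) *\<^sub>R y \<tau>"])
    fix x assume x: "x \<in> {0..t}"
    have "((\<lambda>\<tau>. exp (\<mu> * \<tau>) *\<^sub>R y \<tau>) has_vector_derivative
        exp (\<mu> * x) *\<^sub>R (g x - \<mu> *\<^sub>R y x) + (\<mu> * exp (\<mu> * x)) *\<^sub>R y x) (at x within {0..})"
      by (rule has_vector_derivative_scaleR[OF _ y]) (use x in \<open>auto intro!: derivative_eq_intros\<close>)
    then have "((\<lambda>\<tau>. exp (\<mu> * \<tau>) *\<^sub>R y \<tau>) has_vector_derivative exp (\<mu> * x) *\<^sub>R g x) (at x within {0..})"
      by (simp add: algebra_simps)
    then show "((\<lambda>\<tau>. exp (\<mu> * \<tau>) *\<^sub>R y \<tau>) has_vector_derivative exp (\<mu> * x) *\<^sub>R g x) (at x within {0..t})"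
      by (rule has_vector_derivative_within_subset) auto
  qed
  then have "integral {0..t} (\<lambda>\<tau>. exp (\<mu> * \<tau>) *\<^sub>R g \<tau>) = exp (\<mu> * t) *\<^sub>R y t - y 0"
    by (simp add: integral_unique)
  moreover have "exp (- \<mu> * t) * exp (\<mu> * t) = 1" by (simp flip: exp_add)
  ultimately show ?thesis by (simp add: voc_def scaleR_diff_right)
qed

lemma duhamel_diff:
  fixes G H :: "real \<Rightarrow> (int^'d::finite) ell2"
  assumes \<alpha>: "\<alpha> < 1" and t: "0 \<le> t" and G: "continuous_on {0..t} G" and H: "continuous_on {0..t} H"
  shows "duhamel \<alpha> (\<lambda>\<tau>. G \<tau> - H \<tau>) t = duhamel \<alpha> G t - duhamel \<alpha> H t"
proof (rule ell2_eqI)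
  fix \<xi>
  note G' = continuous_on_reflect[OF G order_refl order_refl] and H' = continuous_on_reflect[OF H order_refl order_refl]
  have GH: "continuous_on {0..t} (\<lambda>\<tau>. G \<tau> - H \<tau>)" by (intro continuous_intros G H)
  have "integral {0..t} (\<lambda>\<sigma>. exp (- (lam \<xi> - \<alpha>) * \<sigma>) *\<^sub>R coef (G (t - \<sigma>) - H (t - \<sigma>)) \<xi>) =
      integral {0..t} (\<lambda>\<sigma>. exp (- (lam \<xi> - \<alpha>) * \<sigma>) *\<^sub>R coef (G (t - \<sigma>)) \<xi>) -
      integral {0..t} (\<lambda>\<sigma>. exp (- (lam \<xi> - \<alpha>) * \<sigma>) *\<^sub>R coef (H (t - \<sigma>)) \<xi>)"
    unfolding coef_diff scaleR_diff_right
    by (rule integral_diff) (intro integrable_continuous_interval continuous_intros G' H')+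
  then show "coef (duhamel \<alpha> (\<lambda>\<tau>. G \<tau> - H \<tau>) t) \<xi> = coef (duhamel \<alpha> G t - duhamel \<alpha> H t) \<xi>"
    unfolding coef_diff coef_duhamel[OF \<alpha> t GH] coef_duhamel[OF \<alpha> t G] coef_duhamel[OF \<alpha> t H]
    by (simp add: heat_kernel_term_def scaleR_diff_right)
qed

text \<open>In the elapsed-time variable the kernels at \<open>t\<close> and \<open>t'\<close>
  agree. The increment therefore consists of the difference of the sources over
  \<open>{0..t}\<close>, measured by \<open>e\<close>, and of a contribution of the short interval
  \<open>{t..t'}\<close>, estimated by its length.\<close>

lemma duhamel_increment:
  fixes G :: "real \<Rightarrow> (int^'d::finite) ell2"
  assumes \<alpha>: "\<alpha> < 1" and t: "0 \<le> t" "t \<le> t'" and G: "continuous_on {0..t'} G"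
    and M: "0 \<le> M" "\<And>\<tau>. \<tau> \<in> {0..t'} \<Longrightarrow> norm (G \<tau>) \<le> M"
    and e: "0 \<le> e" "\<And>\<sigma>. \<sigma> \<in> {0..t} \<Longrightarrow> norm (G (t' - \<sigma>) - G (t - \<sigma>)) \<le> e"
  shows "norm (duhamel \<alpha> G t' - duhamel \<alpha> G t) \<le> duhamel_const \<alpha> * e + sqrt (heat_const \<alpha> * (t' - t)) * M"
proof -
  have G': "continuous_on {0..t} G" using t by (auto intro: continuous_on_subset[OF G])
  define g where "g \<sigma> = G (t' - \<sigma>) - G (t - \<sigma>)" for \<sigma>
  have cg1: "continuous_on {0..t'} (\<lambda>\<sigma>. G (t' - \<sigma>))" by (rule continuous_on_reflect[OF G order_refl order_refl])
  have cg1': "continuous_on {0..t} (\<lambda>\<sigma>. G (t' - \<sigma>))" "continuous_on {t..t'} (\<lambda>\<sigma>. G (t' - \<sigma>))"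
    using t by (auto intro: continuous_on_subset[OF cg1])
  have cg2: "continuous_on {0..t} (\<lambda>\<sigma>. G (t - \<sigma>))" by (rule continuous_on_reflect[OF G' order_refl order_refl])
  have cg: "continuous_on {0..t} g" unfolding g_def by (intro continuous_intros cg1' cg2)
  define A B where "A = Abs_ell2 (heat_kernel_term \<alpha> 0 t g)"
    and "B = Abs_ell2 (heat_kernel_term \<alpha> t t' (\<lambda>\<sigma>. G (t' - \<sigma>)))"
  have A_sum: "(\<Sum>\<xi>\<in>F. (cmod (heat_kernel_term \<alpha> 0 t g \<xi>))\<^sup>2) \<le> (duhamel_const \<alpha> * e)\<^sup>2" if "finite F" for F
    unfolding duhamel_const_def by (rule heat_kernel_term_sum_le2[OF \<alpha> order_refl t(1) cg _ e(1) that]) (simp add: g_def e)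
  have B_sum: "(\<Sum>\<xi>\<in>F. (cmod (heat_kernel_term \<alpha> t t' (\<lambda>\<sigma>. G (t' - \<sigma>)) \<xi>))\<^sup>2) \<le> (sqrt (heat_const \<alpha> * (t' - t)) * M)\<^sup>2"
    if "finite F" for F
    by (rule heat_kernel_term_sum_le1[OF \<alpha> t cg1'(2) _ M(1) that]) (use M t in auto)
  have hc: "0 \<le> heat_const \<alpha>" using heat_const_ge_1[of \<alpha>] by simp
  have nA: "norm A \<le> duhamel_const \<alpha> * e"
    unfolding A_def by (rule norm_Abs_ell2_le[OF _ A_sum]) (intro mult_nonneg_nonneg duhamel_const_nonneg \<alpha> e)
  have nB: "norm B \<le> sqrt (heat_const \<alpha> * (t' - t)) * M"
    unfolding B_def by (rule norm_Abs_ell2_le[OF _ B_sum]) (use hc t M in auto)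
  have "duhamel \<alpha> G t' - duhamel \<alpha> G t = A + B"
  proof (rule ell2_eqI)
    fix \<xi> :: "int^'d"
    let ?e = "\<lambda>\<sigma>. exp (- (lam \<xi> - \<alpha>) * \<sigma>)"
    have 1: "integral {0..t} (\<lambda>\<sigma>. ?e \<sigma> *\<^sub>R coef (g \<sigma>) \<xi>) =
        integral {0..t} (\<lambda>\<sigma>. ?e \<sigma> *\<^sub>R coef (G (t' - \<sigma>)) \<xi>) - integral {0..t} (\<lambda>\<sigma>. ?e \<sigma> *\<^sub>R coef (G (t - \<sigma>)) \<xi>)"
      unfolding g_def coef_diff scaleR_diff_right
      by (rule integral_diff) (intro integrable_continuous_interval continuous_intros cg1' cg2)+
    have 2: "integral {0..t} (\<lambda>\<sigma>. ?e \<sigma> *\<^sub>R coef (G (t' - \<sigma>)) \<xi>) + integral {t..t'} (\<lambda>\<sigma>. ?e \<sigma> *\<^sub>R coef (G (t' - \<sigma>)) \<xi>)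
        = integral {0..t'} (\<lambda>\<sigma>. ?e \<sigma> *\<^sub>R coef (G (t' - \<sigma>)) \<xi>)"
      by (rule Henstock_Kurzweil_Integration.integral_combine[OF t]) (intro integrable_continuous_interval continuous_intros cg1)
    have "coef (A + B) \<xi> = heat_kernel_term \<alpha> 0 t g \<xi> + heat_kernel_term \<alpha> t t' (\<lambda>\<sigma>. G (t' - \<sigma>)) \<xi>"
      unfolding A_def B_def coef_simps by (simp add: coef_Abs_ell2[OF A_sum] coef_Abs_ell2[OF B_sum])
    also have "\<dots> = heat_kernel_term \<alpha> 0 t' (\<lambda>\<sigma>. G (t' - \<sigma>)) \<xi> - heat_kernel_term \<alpha> 0 t (\<lambda>\<sigma>. G (t - \<sigma>)) \<xi>"
      unfolding heat_kernel_term_def 1 2[symmetric] by (simp add: algebra_simps)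
    also have "\<dots> = coef (duhamel \<alpha> G t' - duhamel \<alpha> G t) \<xi>"
      using t by (simp add: coef_duhamel[OF \<alpha> _ G] coef_duhamel[OF \<alpha> _ G'])
    finally show "coef (duhamel \<alpha> G t' - duhamel \<alpha> G t) \<xi> = coef (A + B) \<xi>" ..
  qed
  then show ?thesis using norm_triangle_ineq[of A B] nA nB by simp
qed

lemma continuous_on_duhamel:
  fixes G :: "real \<Rightarrow> (int^'d::finite) ell2"
  assumes \<alpha>: "\<alpha> < 1" and G: "continuous_on {0..} G"
  shows "continuous_on {0..} (duhamel \<alpha> G)"
proof -
  have "continuous (at t0 within {0..}) (duhamel \<alpha> G)" if t0: "0 \<le> t0" for t0
    unfolding continuous_within_eps_delta
  proof (intro allI impI)
    fix r :: real assume r: "r > 0"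
    have GT: "continuous_on {0..t0+1} G" by (auto intro: continuous_on_subset[OF G])
    obtain M where M: "0 \<le> M" "\<And>\<tau>. \<tau> \<in> {0..t0+1} \<Longrightarrow> norm (G \<tau>) \<le> M"
      by (rule continuous_ell2_bounded[OF GT]) auto
    \<comment> \<open>The two terms of \<open>duhamel_increment\<close> receive \<open>r / 2\<close>
      each: \<open>e\<close> limits the variation of \<open>G\<close>, and \<open>d2\<close> below
      is the length for which the square root equals \<open>r / (2 * (M + 1))\<close>. The added 1
      keeps the denominators positive.\<close>
    define e where "e = r / (2 * (duhamel_const \<alpha> + 1))"
    have dc: "0 \<le> duhamel_const \<alpha>" by (rule duhamel_const_nonneg[OF \<alpha>])
    have e: "0 < e" "duhamel_const \<alpha> * e < r / 2" using r dc by (auto simp: e_def field_simps)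
    have "uniformly_continuous_on {0..t0+1} G" by (rule compact_uniformly_continuous[OF GT compact_Icc])
    then obtain d1 where d1: "0 < d1" "\<And>x x'. x \<in> {0..t0+1} \<Longrightarrow> x' \<in> {0..t0+1} \<Longrightarrow> dist x' x < d1 \<Longrightarrow> dist (G x') (G x) < e"
      using e(1) unfolding uniformly_continuous_on_def by metis
    define d2 where "d2 = (r / (2 * (M + 1)))\<^sup>2 / heat_const \<alpha>"
    have hc: "1 \<le> heat_const \<alpha>" by (rule heat_const_ge_1)
    have d2: "0 < d2" using r M hc by (simp add: d2_def)
    define d where "d = min 1 (min d1 d2)"
    have key: "norm (duhamel \<alpha> G t' - duhamel \<alpha> G t) < r" if tt: "0 \<le> t" "t \<le> t'" "t' \<le> t0 + 1" "t' - t < d" for t t'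
    proof -
      have "norm (duhamel \<alpha> G t' - duhamel \<alpha> G t) \<le> duhamel_const \<alpha> * e + sqrt (heat_const \<alpha> * (t' - t)) * M"
      proof (rule duhamel_increment[OF \<alpha> tt(1,2)])
        show "continuous_on {0..t'} G" using tt by (auto intro: continuous_on_subset[OF G])
        show "norm (G (t' - \<sigma>) - G (t - \<sigma>)) \<le> e" if "\<sigma> \<in> {0..t}" for \<sigma>
          using d1(2)[of "t - \<sigma>" "t' - \<sigma>"] tt that by (auto simp: dist_norm d_def intro: less_imp_le)
      qed (use tt M e in auto)
      also have "sqrt (heat_const \<alpha> * (t' - t)) * M \<le> (r / (2 * (M + 1))) * M"
      proof (intro mult_right_mono M real_le_lsqrt)
        have "heat_const \<alpha> * (t' - t) \<le> heat_const \<alpha> * d2"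
          using tt hc by (intro mult_left_mono) (auto simp: d_def)
        also have "\<dots> = (r / (2 * (M + 1)))\<^sup>2" using hc by (simp add: d2_def)
        finally show "heat_const \<alpha> * (t' - t) \<le> (r / (2 * (M + 1)))\<^sup>2" .
      qed (use r M in auto)
      also have "(r / (2 * (M + 1))) * M \<le> r / 2" using r M by (simp add: field_simps)
      finally show ?thesis using e(2) by linarith
    qed
    show "\<exists>d>0. \<forall>x'\<in>{0..}. dist x' t0 < d \<longrightarrow> dist (duhamel \<alpha> G x') (duhamel \<alpha> G t0) < r"
    proof (intro exI[of _ d] conjI ballI impI)
      show "0 < d" using d1 d2 by (simp add: d_def)
      fix x' :: real assume x: "x' \<in> {0..}" "dist x' t0 < d"
      then have "\<bar>x' - t0\<bar> < d" "x' \<le> t0 + 1" by (auto simp: dist_real_def d_def)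
      then show "dist (duhamel \<alpha> G x') (duhamel \<alpha> G t0) < r"
        using key[of t0 x'] key[of x' t0] x t0
        by (cases "t0 \<le> x'") (auto simp: dist_norm norm_minus_commute)
    qed
  qed
  then show ?thesis by (simp add: continuous_on_eq_continuous_within)
qed

section \<open>Operators on coefficient fields\<close>

type_synonym 'd field = "((int^'d) ell2)^'d"

lemma norm_vec_le_sum: "norm (x :: 'a::real_normed_vector^'n) \<le> (\<Sum>j\<in>UNIV. norm (x $ j))"
  unfolding norm_vec_def by (rule L2_set_le_sum) simp

lemma norm_vec_le_card:
  fixes x :: "'a::real_normed_vector^'n"
  assumes "\<And>j. norm (x $ j) \<le> B"
  shows "norm x \<le> real CARD('n) * B"
  using norm_vec_le_sum[of x] sum_bounded_above[of UNIV "\<lambda>j. norm (x $ j)" B] assms by simp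

lemma continuous_on_vecI:
  fixes f :: "'a::topological_space \<Rightarrow> 'b::topological_space^'n"
  assumes "\<And>j. continuous_on S (\<lambda>t. f t $ j)"
  shows "continuous_on S f"
  using assms unfolding continuous_on_def by (auto intro: vec_tendstoI)

lemma bounded_linear_vecI:
  fixes f :: "'a::real_normed_vector \<Rightarrow> 'b::real_normed_vector^'n"
  assumes "\<And>j. bounded_linear (\<lambda>a. f a $ j)"
  shows "bounded_linear f"
proof -
  have "\<forall>j. \<exists>K. \<forall>a. norm (f a $ j) \<le> norm a * K"
    using assms bounded_linear.bounded by blast
  then obtain K where K: "\<And>j a. norm (f a $ j) \<le> norm a * K j" by metis
  show ?thesis
  proof (rule bounded_linear_intro[of _ "\<Sum>j\<in>UNIV. K j"])
    show "f (a + b) = f a + f b" "f (r *\<^sub>R a) = r *\<^sub>R f a" for a b r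
      using linear_add[OF bounded_linear.linear[OF assms]] linear_scale[OF bounded_linear.linear[OF assms]]
      by (simp_all add: vec_eq_iff)
    show "norm (f a) \<le> norm a * (\<Sum>j\<in>UNIV. K j)" for a
      unfolding sum_distrib_left by (rule order_trans[OF norm_vec_le_sum]) (intro sum_mono K)
  qed
qed

lemma bounded_bilinear_vecI:
  fixes f :: "'a::real_normed_vector \<Rightarrow> 'b::real_normed_vector \<Rightarrow> 'c::real_normed_vector^'n"
  assumes "\<And>j. bounded_bilinear (\<lambda>a b. f a b $ j)"
  shows "bounded_bilinear f"
proof -
  have "\<forall>j. \<exists>K. \<forall>a b. norm (f a b $ j) \<le> norm a * norm b * K"
    using assms bounded_bilinear.bounded by blast
  then obtain K where K: "\<And>j a b. norm (f a b $ j) \<le> norm a * norm b * K j" by metis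
  show ?thesis
  proof
    fix a a' :: 'a and b b' :: 'b and r :: real
    show "f (a + a') b = f a b + f a' b" "f a (b + b') = f a b + f a b'"
      "f (r *\<^sub>R a) b = r *\<^sub>R f a b" "f a (r *\<^sub>R b) = r *\<^sub>R f a b"
      using bounded_bilinear.add_left[OF assms] bounded_bilinear.add_right[OF assms]
        bounded_bilinear.scaleR_left[OF assms] bounded_bilinear.scaleR_right[OF assms]
      by (simp_all add: vec_eq_iff)
    have "norm (f a b) \<le> norm a * norm b * (\<Sum>j\<in>UNIV. K j)" for a b
      unfolding sum_distrib_left by (rule order_trans[OF norm_vec_le_sum]) (intro sum_mono K)
    then show "\<exists>K. \<forall>a b. norm (f a b) \<le> norm a * norm b * K" by blast
  qed
qed

lemma bounded_bilinear_sum: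
  assumes "\<And>i. i \<in> I \<Longrightarrow> bounded_bilinear (f i)"
  shows "bounded_bilinear (\<lambda>a b. \<Sum>i\<in>I. f i a b)"
proof (cases "finite I")
  case True
  have "\<exists>K. \<forall>a b. norm (\<Sum>i\<in>I. f i a b) \<le> norm a * norm b * K"
  proof -
    have "\<forall>i\<in>I. \<exists>K. \<forall>a b. norm (f i a b) \<le> norm a * norm b * K"
      using assms bounded_bilinear.bounded by blast
    then obtain K where K: "\<And>i a b. i \<in> I \<Longrightarrow> norm (f i a b) \<le> norm a * norm b * K i" by metis
    have "norm (\<Sum>i\<in>I. f i a b) \<le> norm a * norm b * (\<Sum>i\<in>I. K i)" for a b
      unfolding sum_distrib_left by (rule order_trans[OF norm_sum]) (intro sum_mono K)
    then show ?thesis by blast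
  qed
  then show ?thesis
    using assms by unfold_locales
      (auto simp: bounded_bilinear.add_left bounded_bilinear.add_right bounded_bilinear.scaleR_left
        bounded_bilinear.scaleR_right sum.distrib scaleR_sum_right)
qed (auto simp: bounded_bilinear_def intro: exI[of _ 0])

text \<open>All operators act on weighted coefficients: \<open>Dm\<close>, \<open>adv\<close>, \<open>gradf\<close> go from \<open>H\<^sup>s\<close> to \<open>H\<^sup>s\<^sup>-\<^sup>1\<close>,
  \<open>prs\<close> goes back, and \<open>Jm\<close> is the inclusion of \<open>H\<^sup>s\<close> into \<open>H\<^sup>s\<^sup>-\<^sup>1\<close>. Hence a time derivative in
  \<open>H\<^sup>s\<^sup>-\<^sup>2\<close> appears as a derivative of \<open>Jf (Jf w)\<close>. \<open>ler\<close> is the Leray projection and \<open>prs\<close> solves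
  for the pressure; their value at \<open>\<xi> = 0\<close> relies on \<open>x / 0 = 0\<close>.\<close>

definition Jmult :: "int^'d::finite \<Rightarrow> complex" where "Jmult \<xi> = complex_of_real (1 / jb \<xi>)"
definition Dmult :: "'d \<Rightarrow> int^'d::finite \<Rightarrow> complex" where
  "Dmult i \<xi> = \<i> * complex_of_real (of_int (\<xi> $ i) / jb \<xi>)"
definition Lapmult :: "int^'d::finite \<Rightarrow> complex" where "Lapmult \<xi> = complex_of_real (- lam \<xi> / (jb \<xi>)\<^sup>2)"
definition Rmult :: "'d \<Rightarrow> 'd \<Rightarrow> int^'d::finite \<Rightarrow> complex" where
  "Rmult i j \<xi> = complex_of_real (of_int (\<xi> $ i) * of_int (\<xi> $ j) / lam \<xi>)"
definition Pmult :: "'d \<Rightarrow> int^'d::finite \<Rightarrow> complex" where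
  "Pmult i \<xi> = \<i> * complex_of_real (of_int (\<xi> $ i) * jb \<xi> / lam \<xi>)"

lemma Jmult_bound: "cmod (Jmult \<xi>) \<le> 1"
  using jb_ge_1[of \<xi>] by (simp add: Jmult_def norm_divide)

lemma Dmult_bound: "cmod (Dmult i \<xi>) \<le> 1"
  using abs_nth_le_jb[of \<xi> i] by (simp add: Dmult_def norm_mult norm_divide abs_mult)

lemma Lapmult_bound: "cmod (Lapmult \<xi>) \<le> 1"
  using lam_le_jb[of \<xi>] by (simp add: Lapmult_def norm_divide norm_power)

lemma Rmult_bound: "cmod (Rmult i j \<xi>) \<le> 1"
proof (cases "\<xi> = 0")
  case False
  have "\<bar>real_of_int (\<xi> $ i)\<bar> * \<bar>real_of_int (\<xi> $ j)\<bar> \<le> jb \<xi> * jb \<xi>"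
    by (intro mult_mono abs_nth_le_jb) auto
  then show ?thesis using lam_ge_1[OF False]
    by (simp add: Rmult_def norm_mult norm_divide abs_mult lam_eq_jb[OF False] power2_eq_square)
qed (simp add: Rmult_def)

lemma Pmult_bound: "cmod (Pmult i \<xi>) \<le> 1"
proof (cases "\<xi> = 0")
  case False
  have "\<bar>real_of_int (\<xi> $ i)\<bar> * jb \<xi> \<le> jb \<xi> * jb \<xi>"
    by (intro mult_right_mono abs_nth_le_jb) auto
  then show ?thesis using lam_ge_1[OF False]
    by (simp add: Pmult_def norm_mult norm_divide abs_mult lam_eq_jb[OF False] power2_eq_square)
qed (simp add: Pmult_def)

abbreviation "Jm \<equiv> mul Jmult"
abbreviation "Dm i \<equiv> mul (Dmult i)"
abbreviation "Lm \<equiv> mul Lapmult"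

lemma coef_mult [simp]:
  "coef (mul Jmult a) \<xi> = Jmult \<xi> * coef a \<xi>" "coef (mul (Dmult i) a) \<xi> = Dmult i \<xi> * coef a \<xi>"
  "coef (mul Lapmult a) \<xi> = Lapmult \<xi> * coef a \<xi>" "coef (mul (Rmult i j) a) \<xi> = Rmult i j \<xi> * coef a \<xi>"
  "coef (mul (Pmult i) a) \<xi> = Pmult i \<xi> * coef a \<xi>"
  by (simp_all add: coef_mul[OF Jmult_bound] coef_mul[OF Dmult_bound] coef_mul[OF Lapmult_bound]
      coef_mul[OF Rmult_bound] coef_mul[OF Pmult_bound])

lemmas bounded_linear_mults = bounded_linear_mul[OF Jmult_bound] bounded_linear_mul[OF Dmult_bound]
  bounded_linear_mul[OF Lapmult_bound] bounded_linear_mul[OF Rmult_bound] bounded_linear_mul[OF Pmult_bound]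

text \<open>The advecting field is first included into H^(s-1), so that both factors lie in the
  algebra in which \<open>conv (s - 1)\<close> multiplies; this is where s - 1 > d/2 enters.\<close>

definition adv :: "real \<Rightarrow> 'd::finite field \<Rightarrow> 'd field \<Rightarrow> 'd field" where
  "adv s a c = (\<chi> j. \<Sum>i\<in>UNIV. conv (s - 1) (Jm (a $ i)) (Dm i (c $ j)))"

definition ler :: "'d::finite field \<Rightarrow> 'd field" where
  "ler n = (\<chi> j. n $ j - (\<Sum>i\<in>UNIV. mul (Rmult i j) (n $ i)))"

definition prs :: "'d::finite field \<Rightarrow> (int^'d) ell2" where
  "prs n = (\<Sum>i\<in>UNIV. mul (Pmult i) (n $ i))"

definition gradf :: "(int^'d::finite) ell2 \<Rightarrow> 'd field" where "gradf q = (\<chi> j. Dm j q)"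
definition Jf :: "'d::finite field \<Rightarrow> 'd field" where "Jf a = (\<chi> j. Jm (a $ j))"
text \<open>Two derivatives are spent, so the result encodes an H^(s-2) field. Terms of first order
  have to pass through \<open>Jf\<close> before they can be added to it.\<close>

definition Lf :: "'d::finite field \<Rightarrow> 'd field" where "Lf a = (\<chi> j. Lm (a $ j))"

lemma bounded_linear_ler: "bounded_linear ler"
  by (rule bounded_linear_vecI) (simp add: ler_def, intro bounded_linear_sub bounded_linear_sum
    bounded_linear_compose[OF bounded_linear_mults(4)] bounded_linear_vec_nth)

lemma bounded_linear_prs: "bounded_linear prs"
  unfolding prs_def[abs_def]
  by (intro bounded_linear_sum bounded_linear_compose[OF bounded_linear_mults(5)] bounded_linear_vec_nth)

lemma bounded_linear_gradf: "bounded_linear gradf"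
  by (rule bounded_linear_vecI) (simp add: gradf_def bounded_linear_mults)

lemma bounded_linear_Jf: "bounded_linear Jf"
  by (rule bounded_linear_vecI) (simp add: Jf_def, intro bounded_linear_compose[OF bounded_linear_mults(1)] bounded_linear_vec_nth)

lemma bounded_linear_Lf: "bounded_linear Lf"
  by (rule bounded_linear_vecI) (simp add: Lf_def, intro bounded_linear_compose[OF bounded_linear_mults(3)] bounded_linear_vec_nth)

lemma bounded_bilinear_adv:
  assumes s: "s > real CARD('d::finite) / 2 + 1"
  shows "bounded_bilinear (adv s :: 'd field \<Rightarrow> _)"
proof (rule bounded_bilinear_vecI)
  fix j :: 'd
  have "bounded_bilinear (\<lambda>a c :: 'd field. conv (s - 1) (Jm (a $ i)) (Dm i (c $ j)))" for i
  proof (rule bounded_bilinear.comp)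
    show "bounded_bilinear (conv (s - 1) :: (int^'d) ell2 \<Rightarrow> _)" by (rule bounded_bilinear_conv) (use s in simp)
    show "bounded_linear (\<lambda>a. Jm (a $ i))" "bounded_linear (\<lambda>c. Dm i (c $ j))"
      by (intro bounded_linear_compose[OF bounded_linear_mults(1)] bounded_linear_compose[OF bounded_linear_mults(2)] bounded_linear_vec_nth)+
  qed
  then show "bounded_bilinear (\<lambda>a c :: 'd field. adv s a c $ j)"
    unfolding adv_def by (simp add: bounded_bilinear_sum)
qed

text \<open>The symmetry characterising the coefficients of real-valued functions.\<close>

definition her :: "(int^'d::finite) ell2 \<Rightarrow> bool" where "her a \<longleftrightarrow> (\<forall>\<xi>. coef a (- \<xi>) = cnj (coef a \<xi>))"
definition herf :: "'d::finite field \<Rightarrow> bool" where "herf a \<longleftrightarrow> (\<forall>j. her (a $ j))"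

lemma her_add: "her a \<Longrightarrow> her b \<Longrightarrow> her (a + b)" and her_diff: "her a \<Longrightarrow> her b \<Longrightarrow> her (a - b)"
  and her_scaleR: "her a \<Longrightarrow> her (r *\<^sub>R a)" and her_0: "her 0"
  by (simp_all add: her_def)

lemma her_sum: "(\<And>i. i \<in> I \<Longrightarrow> her (f i)) \<Longrightarrow> her (\<Sum>i\<in>I. f i)"
  by (induction I rule: infinite_finite_induct) (auto simp: her_0 her_add)

lemma her_mults:
  assumes "her a"
  shows "her (mul Jmult a)" "her (mul (Dmult i) a)" "her (mul Lapmult a)" "her (mul (Rmult i j) a)" "her (mul (Pmult i) a)"
  using assms by (simp_all add: her_def Jmult_def Dmult_def Lapmult_def Rmult_def Pmult_def)

text \<open>The weight is real and even under a joint change of sign, so the substitution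
  \<open>\<eta> \<mapsto> - \<eta>\<close> turns the sum into its conjugate.\<close>

lemma her_conv:
  fixes a b :: "(int^'d::finite) ell2"
  assumes r: "r > real CARD('d) / 2" and a: "her a" and b: "her b"
  shows "her (conv r a b)"
  unfolding her_def
proof
  fix \<xi> :: "int^'d"
  have "conv_weight r (- \<xi>) (- \<eta>) = conv_weight r \<xi> \<eta>" for \<eta>
    using jb_minus[of "\<xi> - \<eta>"] by (simp add: conv_weight_def)
  moreover have "coef a (- \<xi> - - \<eta>) = cnj (coef a (\<xi> - \<eta>))" for \<eta>
    using a by (metis her_def minus_diff_minus)
  ultimately have t: "conv_term r a b (- \<xi>) (- \<eta>) = cnj (conv_term r a b \<xi> \<eta>)" for \<eta>
    using b by (simp add: conv_term_def her_def)
  have "coef (conv r a b) (- \<xi>) = (\<Sum>\<^sub>\<infinity>\<eta>. conv_term r a b (- \<xi>) (- \<eta>))"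
    unfolding coef_conv[OF r] by (rule infsum_reindex_bij_witness[of _ uminus uminus]) auto
  also have "\<dots> = cnj (coef (conv r a b) \<xi>)" unfolding t coef_conv[OF r] by simp
  finally show "coef (conv r a b) (- \<xi>) = cnj (coef (conv r a b) \<xi>)" .
qed

lemma herf_adv:
  assumes "s > real CARD('d::finite) / 2 + 1" "herf a" "herf (c :: 'd field)"
  shows "herf (adv s a c)"
  using assms unfolding herf_def adv_def by (auto intro!: her_sum her_conv her_mults)

lemma herf_ler: "herf n \<Longrightarrow> herf (ler n)"
  unfolding herf_def ler_def by (auto intro!: her_sum her_diff her_mults)

lemma her_prs: "herf n \<Longrightarrow> her (prs n)"
  unfolding herf_def prs_def by (auto intro!: her_sum her_mults)

lemma herf_add: "herf a \<Longrightarrow> herf b \<Longrightarrow> herf (a + b)" and herf_scaleR: "herf a \<Longrightarrow> herf (r *\<^sub>R a)"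
  by (simp_all add: herf_def her_add her_scaleR)

text \<open>The kernel is real and even in the frequency, so the symmetry passes through the
  integral. It is recorded so that the solution found among coefficients comes from real-valued
  functions.\<close>

lemma her_duhamel:
  fixes G :: "real \<Rightarrow> (int^'d::finite) ell2"
  assumes \<alpha>: "\<alpha> < 1" and t: "0 \<le> t" and G: "continuous_on {0..t} G" and her: "\<And>\<tau>. \<tau> \<in> {0..t} \<Longrightarrow> her (G \<tau>)"
  shows "her (duhamel \<alpha> G t)"
  unfolding her_def coef_duhamel[OF \<alpha> t G]
proof
  fix \<xi> :: "int^'d"
  have "integral {0..t} (\<lambda>\<sigma>. exp (- (lam \<xi> - \<alpha>) * \<sigma>) *\<^sub>R coef (G (t - \<sigma>)) (- \<xi>))
      = integral {0..t} (cnj \<circ> (\<lambda>\<sigma>. exp (- (lam \<xi> - \<alpha>) * \<sigma>) *\<^sub>R coef (G (t - \<sigma>)) \<xi>))"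
    by (rule Henstock_Kurzweil_Integration.integral_cong) (use her in \<open>auto simp: her_def scaleR_conv_of_real\<close>)
  also have "\<dots> = cnj (integral {0..t} (\<lambda>\<sigma>. exp (- (lam \<xi> - \<alpha>) * \<sigma>) *\<^sub>R coef (G (t - \<sigma>)) \<xi>))"
    by (rule integral_linear) (intro integrable_continuous_interval continuous_intros
        continuous_on_reflect[OF G order_refl order_refl], rule bounded_linear_cnj)
  finally show "heat_kernel_term \<alpha> 0 t (\<lambda>\<sigma>. G (t - \<sigma>)) (- \<xi>) = cnj (heat_kernel_term \<alpha> 0 t (\<lambda>\<sigma>. G (t - \<sigma>)) \<xi>)"
    by (simp add: heat_kernel_term_def scaleR_conv_of_real)
qed

text \<open>At a given frequency the weight is common to all components, so the condition reads the
  same for weighted and for plain Fourier coefficients.\<close>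

definition divfree :: "'d::finite field \<Rightarrow> bool" where
  "divfree a \<longleftrightarrow> (\<forall>\<xi>. (\<Sum>j\<in>UNIV. of_int (\<xi> $ j) * coef (a $ j) \<xi>) = 0)"

text \<open>Integration by parts, seen at frequency zero: the convolution pairs \<open>a\<close> at
  \<open>- \<eta>\<close> with a derivative falling on \<open>c\<close> at \<open>\<eta>\<close>.
  Summing over the components yields, up to a scalar factor, the divergence of \<open>a\<close> at
  \<open>- \<eta>\<close>.\<close>

lemma coef_adv_0:
  fixes a c :: "'d::finite field"
  assumes s: "s > real CARD('d) / 2 + 1" and a: "divfree a"
  shows "coef (adv s a c $ j) 0 = 0"
proof -
  have r: "s - 1 > real CARD('d) / 2" using s by simp
  let ?t = "\<lambda>i \<eta>. conv_term (s - 1) (Jm (a $ i)) (Dm i (c $ j)) 0 \<eta>"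
  have sm: "?t i summable_on UNIV" for i
    by (rule abs_summable_summable[OF conv_term_bounds(1)[OF r]])
  have "coef (adv s a c $ j) 0 = (\<Sum>\<^sub>\<infinity>\<eta>. \<Sum>i\<in>UNIV. ?t i \<eta>)"
    by (simp add: adv_def coef_conv[OF r] infsum_finite_sum(1)[OF sm])
  also have "(\<lambda>\<eta>. \<Sum>i\<in>UNIV. ?t i \<eta>) = (\<lambda>_. 0)"
  proof
    fix \<eta> :: "int^'d"
    have "(\<Sum>i\<in>UNIV. ?t i \<eta>) = - \<i> * (Jmult \<eta> * coef (c $ j) \<eta> * conv_weight (s - 1) 0 \<eta> / jb \<eta>)
       * (\<Sum>i\<in>UNIV. of_int ((- \<eta>) $ i) * coef (a $ i) (- \<eta>))"
      unfolding sum_distrib_left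
      by (intro sum.cong) (auto simp: conv_term_def Jmult_def Dmult_def field_simps)
    also have "(\<Sum>i\<in>UNIV. of_int ((- \<eta>) $ i) * coef (a $ i) (- \<eta>)) = 0"
      using a unfolding divfree_def by blast
    finally show "(\<Sum>i\<in>UNIV. ?t i \<eta>) = 0" by simp
  qed
  finally show ?thesis by simp
qed

text \<open>\<open>prs n\<close> is the mean-zero solution \<open>q\<close> of
  \<open>- \<Delta> q = div n\<close>, so adding its gradient removes the divergence. In symbols the
  two factors \<open>\<i>\<close> produce the minus sign of the projection, and the brackets cancel
  because \<open>prs\<close> gains the derivative that \<open>gradf\<close> loses.\<close>

lemma ler_eq:
  fixes n :: "'d::finite field"
  shows "ler n = n + gradf (prs n)"
proof (unfold vec_eq_iff, intro allI ell2_eqI)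
  fix j :: 'd and \<xi> :: "int^'d"
  have "Dmult j \<xi> * Pmult i \<xi> = - Rmult i j \<xi>" for i
    by (simp add: Dmult_def Pmult_def Rmult_def field_simps)
  then show "coef (ler n $ j) \<xi> = coef ((n + gradf (prs n)) $ j) \<xi>"
    by (simp add: ler_def gradf_def prs_def sum_distrib_left mult.assoc[symmetric] sum_negf)
qed

lemma of_real_lam_eq: "complex_of_real (lam \<xi>) = (\<Sum>j\<in>UNIV. of_int (\<xi> $ j) * of_int (\<xi> $ j))"
  by (simp add: lam_eq_sum power2_eq_square)

lemma divfree_ler: "divfree (ler n)"
  unfolding divfree_def
proof
  fix \<xi>
  show "(\<Sum>j\<in>UNIV. of_int (\<xi> $ j) * coef (ler n $ j) \<xi>) = 0"
  proof (cases "\<xi> = 0")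
    case False
    have R: "(\<Sum>j\<in>UNIV. of_int (\<xi> $ j) * Rmult i j \<xi>) = of_int (\<xi> $ i)" for i
    proof -
      have "(\<Sum>j\<in>UNIV. of_int (\<xi> $ j) * Rmult i j \<xi>) = of_int (\<xi> $ i) * complex_of_real (lam \<xi>) / complex_of_real (lam \<xi>)"
        unfolding of_real_lam_eq sum_distrib_left sum_divide_distrib
        by (intro sum.cong) (simp_all add: Rmult_def of_real_lam_eq)
      then show ?thesis using lam_ge_1[OF False] by simp
    qed
    have "(\<Sum>j\<in>UNIV. of_int (\<xi> $ j) * (\<Sum>i\<in>UNIV. Rmult i j \<xi> * coef (n $ i) \<xi>))
      = (\<Sum>i\<in>UNIV. (\<Sum>j\<in>UNIV. of_int (\<xi> $ j) * Rmult i j \<xi>) * coef (n $ i) \<xi>)"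
      unfolding sum_distrib_left sum_distrib_right by (subst sum.swap) (simp add: mult.assoc)
    also have "\<dots> = (\<Sum>i\<in>UNIV. of_int (\<xi> $ i) * coef (n $ i) \<xi>)" by (simp only: R)
    finally show ?thesis by (simp add: ler_def right_diff_distrib sum_subtractf)
  qed simp
qed

section \<open>The heat semigroup and the Duhamel operator on vector fields\<close>

lemma norm_vec_mono:
  fixes x y :: "'a::real_normed_vector^'n"
  assumes "\<And>j. norm (x $ j) \<le> norm (y $ j)"
  shows "norm x \<le> norm y"
  unfolding norm_vec_def by (rule L2_set_mono) (auto intro: assms)

text \<open>The heat semigroup multiplied by \<open>exp (\<alpha> * t)\<close>. The zero mode is
  discarded, since for positive \<open>\<alpha>\<close> the formula would grow there; the fields to
  which it is applied have zero mean.\<close>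

definition hmult :: "real \<Rightarrow> real \<Rightarrow> int^'d::finite \<Rightarrow> complex" where
  "hmult \<alpha> t \<xi> = (if \<xi> = 0 then 0 else complex_of_real (exp (- (lam \<xi> - \<alpha>) * t)))"

definition heatf :: "real \<Rightarrow> real \<Rightarrow> 'd::finite field \<Rightarrow> 'd field" where
  "heatf \<alpha> t w = (\<chi> j. mul (hmult \<alpha> t) (w $ j))"

lemma hmult_bound:
  assumes "\<alpha> < 1" "0 \<le> t"
  shows "cmod (hmult \<alpha> t \<xi>) \<le> 1"
proof (cases "\<xi> = 0")
  case False
  then have "0 \<le> (lam \<xi> - \<alpha>) * t" using assms lam_ge_1[OF False] by (intro mult_nonneg_nonneg) auto
  then have "- (lam \<xi> - \<alpha>) * t \<le> 0" by (simp only: mult_minus_left neg_le_0_iff_le)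
  then have "exp (- (lam \<xi> - \<alpha>) * t) \<le> 1" by (simp only: exp_le_one_iff)
  then show ?thesis using False unfolding hmult_def by (simp only: norm_of_real abs_exp_cancel if_False)
qed (simp add: hmult_def)

lemma norm_heatf_le:
  assumes "\<alpha> < 1" "0 \<le> t"
  shows "norm (heatf \<alpha> t w) \<le> norm w"
proof (rule norm_vec_mono)
  fix j
  show "norm (heatf \<alpha> t w $ j) \<le> norm (w $ j)"
    using norm_mul_le[OF hmult_bound[OF assms], where a="w $ j"] by (simp add: heatf_def)
qed

lemma ell2_finite_tail:
  fixes a :: "'i ell2"
  assumes e: "0 < e"
  obtains F where "finite F" "norm (a - mul (\<lambda>i. if i \<in> F then 1 else 0) a) \<le> e"
proof -
  have "((\<lambda>i. (cmod (coef a i))\<^sup>2) has_sum (norm a)\<^sup>2) UNIV"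
    using summable_coef[of a] by (simp add: norm_ell2_sq)
  from has_sum_finite_approximation[OF this, of "e\<^sup>2"] e
  obtain F where F: "finite F" "dist (\<Sum>i\<in>F. (cmod (coef a i))\<^sup>2) ((norm a)\<^sup>2) \<le> e\<^sup>2" by auto
  let ?m = "\<lambda>i. if i \<in> F then 1 else (0::complex)"
  have m: "cmod (?m i) \<le> 1" for i by simp
  have "norm (a - mul ?m a) \<le> e"
  proof (rule norm_ell2_le)
    fix E :: "'i set" assume E: "finite E"
    have "(\<Sum>i\<in>E. (cmod (coef (a - mul ?m a) i))\<^sup>2) = (\<Sum>i\<in>E - F. (cmod (coef a i))\<^sup>2)"
      by (rule sum.mono_neutral_cong_right) (use E in \<open>auto simp: coef_mul[OF m]\<close>)
    also have "\<dots> = (\<Sum>i\<in>(E - F) \<union> F. (cmod (coef a i))\<^sup>2) - (\<Sum>i\<in>F. (cmod (coef a i))\<^sup>2)"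
      using E F by (subst sum.union_disjoint) auto
    also have "\<dots> \<le> (norm a)\<^sup>2 - (\<Sum>i\<in>F. (cmod (coef a i))\<^sup>2)"
      using E F by (intro diff_mono sum_coef_le) auto
    also have "\<dots> \<le> e\<^sup>2" using F by (simp add: dist_real_def)
    finally show "(\<Sum>i\<in>E. (cmod (coef (a - mul ?m a) i))\<^sup>2) \<le> e\<^sup>2" .
  qed (use e in simp)
  with F show ?thesis by (intro that)
qed

text \<open>Multipliers that converge only frequency by frequency are continuous strongly, not in
  operator norm. Cutting \<open>a\<close> off to finitely many indices leaves an error which the
  uniform bound 1 keeps below \<open>e / 4\<close> at both times; on the finite part pointwise
  continuity suffices.\<close>

lemma continuous_on_mul_param:
  fixes m :: "real \<Rightarrow> 'i \<Rightarrow> complex" and a :: "'i ell2"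
  assumes bd: "\<And>t i. t \<in> S \<Longrightarrow> cmod (m t i) \<le> 1" and c: "\<And>i. continuous_on S (\<lambda>t. m t i)"
  shows "continuous_on S (\<lambda>t. mul (m t) a)"
  unfolding continuous_on_iff
proof (intro ballI allI impI)
  fix t e :: real assume t: "t \<in> S" and e: "0 < e"
  obtain F where F: "finite F" "norm (a - mul (\<lambda>i. if i \<in> F then 1 else 0) a) \<le> e / 4"
    by (rule ell2_finite_tail[of "e / 4" a]) (use e in auto)
  define b where "b = mul (\<lambda>i. if i \<in> F then 1 else 0) a"
  have cb: "coef b i = (if i \<in> F then coef a i else 0)" for i
    unfolding b_def by (subst coef_mul[of _ 1]) auto
  have "continuous_on S (\<lambda>r. \<Sum>i\<in>F. cmod (m r i * coef a i - m t i * coef a i))"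
    by (intro continuous_intros c)
  from this[unfolded continuous_on_iff, rule_format, OF t, of "e / 4"] e
  obtain d where d: "0 < d" "\<And>t'. t' \<in> S \<Longrightarrow> dist t' t < d \<Longrightarrow>
      dist (\<Sum>i\<in>F. cmod (m t' i * coef a i - m t i * coef a i)) (\<Sum>i\<in>F. cmod (m t i * coef a i - m t i * coef a i)) < e / 4"
    by auto
  show "\<exists>d>0. \<forall>t'\<in>S. dist t' t < d \<longrightarrow> dist (mul (m t') a) (mul (m t) a) < e"
  proof (intro exI[of _ d] conjI d(1) ballI impI)
    fix t' assume t': "t' \<in> S" "dist t' t < d"
    have l: "mul (m r) a = mul (m r) (a - b) + mul (m r) b" if "r \<in> S" for r
      using bounded_linear.linear[OF bounded_linear_mul[of "m r" 1, OF bd[OF that]]] by (simp add: linear_diff)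
    have n: "norm (mul (m r) (a - b)) \<le> e / 4" if "r \<in> S" for r
      using norm_mul_le[of "m r" 1 "a - b", OF bd[OF that]] F(2) by (simp add: b_def)
    have sm: "(\<Sum>i\<in>F. cmod (m t' i * coef a i - m t i * coef a i)) < e / 4"
      using d(2)[OF t'] by (simp add: dist_real_def sum_nonneg)
    have nb: "norm (mul (m t') b - mul (m t) b) \<le> (\<Sum>i\<in>F. cmod (m t' i * coef a i - m t i * coef a i))"
    proof (rule norm_ell2_le)
      fix E :: "'i set" assume E: "finite E"
      have "(\<Sum>i\<in>E. (cmod (coef (mul (m t') b - mul (m t) b) i))\<^sup>2)
          = (\<Sum>i\<in>E \<inter> F. (cmod (m t' i * coef a i - m t i * coef a i))\<^sup>2)"
        by (rule sum.mono_neutral_cong_right)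
          (use E t t' in \<open>auto simp: coef_mul[OF bd] cb\<close>)
      also have "\<dots> \<le> (\<Sum>i\<in>F. (cmod (m t' i * coef a i - m t i * coef a i))\<^sup>2)"
        using F by (intro sum_mono2) auto
      also have "\<dots> = (L2_set (\<lambda>i. cmod (m t' i * coef a i - m t i * coef a i)) F)\<^sup>2"
        by (simp add: L2_set_def sum_nonneg)
      also have "\<dots> \<le> (\<Sum>i\<in>F. cmod (m t' i * coef a i - m t i * coef a i))\<^sup>2"
        by (intro power_mono L2_set_le_sum) auto
      finally show "(\<Sum>i\<in>E. (cmod (coef (mul (m t') b - mul (m t) b) i))\<^sup>2)
        \<le> (\<Sum>i\<in>F. cmod (m t' i * coef a i - m t i * coef a i))\<^sup>2" .
    qed (simp add: sum_nonneg)
    have eq: "mul (m t') a - mul (m t) a = (mul (m t') (a - b) - mul (m t) (a - b)) + (mul (m t') b - mul (m t) b)"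
      using l[OF t'(1)] l[OF t] by (simp add: algebra_simps)
    show "dist (mul (m t') a) (mul (m t) a) < e"
      unfolding dist_norm eq
      using norm_triangle_ineq[of "mul (m t') (a - b) - mul (m t) (a - b)" "mul (m t') b - mul (m t) b"]
        norm_triangle_ineq4[of "mul (m t') (a - b)" "mul (m t) (a - b)"] n[OF t'(1)] n[OF t] sm nb e by linarith
  qed
qed

lemma continuous_on_heatf:
  assumes "\<alpha> < 1"
  shows "continuous_on {0..} (\<lambda>t. heatf \<alpha> t w)"
proof (rule continuous_on_vecI)
  fix j
  have "continuous_on {0..} (\<lambda>t. hmult \<alpha> t \<xi>)" for \<xi> :: "int^'a"
    by (cases "\<xi> = 0") (auto simp: hmult_def intro!: continuous_intros)
  then show "continuous_on {0..} (\<lambda>t. heatf \<alpha> t w $ j)"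
    unfolding heatf_def by (simp, intro continuous_on_mul_param) (auto intro: hmult_bound assms)
qed

definition duhf :: "real \<Rightarrow> (real \<Rightarrow> 'd::finite field) \<Rightarrow> real \<Rightarrow> 'd field" where
  "duhf \<alpha> G t = (\<chi> j. duhamel \<alpha> (\<lambda>\<tau>. G \<tau> $ j) t)"

lemma continuous_on_duhf: "\<alpha> < 1 \<Longrightarrow> continuous_on {0..} G \<Longrightarrow> continuous_on {0..} (duhf \<alpha> G)"
  by (rule continuous_on_vecI) (simp add: duhf_def continuous_on_duhamel continuous_on_component)

lemma norm_duhf_le:
  fixes G :: "real \<Rightarrow> 'd::finite field"
  assumes \<alpha>: "\<alpha> < 1" and t: "0 \<le> t" and G: "continuous_on {0..} G"
    and M: "0 \<le> M" "\<And>\<tau>. 0 \<le> \<tau> \<Longrightarrow> norm (G \<tau>) \<le> M"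
  shows "norm (duhf \<alpha> G t) \<le> real CARD('d) * (duhamel_const \<alpha> * M)"
proof (rule norm_vec_le_card)
  fix j
  have "continuous_on {0..t} (\<lambda>\<tau>. G \<tau> $ j)"
    by (intro continuous_on_component continuous_on_subset[OF G]) auto
  then show "norm (duhf \<alpha> G t $ j) \<le> duhamel_const \<alpha> * M"
    unfolding duhf_def using M(1)
    by (auto intro!: norm_duhamel_le[OF \<alpha> t] order_trans[OF Finite_Cartesian_Product.norm_nth_le M(2)])
qed

lemma duhf_diff:
  assumes \<alpha>: "\<alpha> < 1" and t: "0 \<le> t" and G: "continuous_on {0..} G" and H: "continuous_on {0..} H"
  shows "duhf \<alpha> (\<lambda>\<tau>. G \<tau> - H \<tau>) t = duhf \<alpha> G t - duhf \<alpha> H t"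
proof -
  have "continuous_on {0..t} (\<lambda>\<tau>. G \<tau> $ j)" "continuous_on {0..t} (\<lambda>\<tau>. H \<tau> $ j)" for j
    by (intro continuous_on_component continuous_on_subset[OF G] continuous_on_subset[OF H]; auto)+
  then show ?thesis by (simp add: duhf_def vec_eq_iff duhamel_diff[OF \<alpha> t])
qed

lemma coef_duhf:
  fixes G :: "real \<Rightarrow> 'd::finite field"
  assumes \<alpha>: "\<alpha> < 1" and t: "0 \<le> t" and G: "continuous_on {0..} G"
  shows "coef (duhf \<alpha> G t $ j) \<xi> =
    (if \<xi> = 0 then 0 else jb \<xi> *\<^sub>R voc (lam \<xi> - \<alpha>) (\<lambda>\<tau>. coef (G \<tau> $ j) \<xi>) t)"
proof -
  have c: "continuous_on {0..t} (\<lambda>\<tau>. G \<tau> $ j)"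
    by (intro continuous_on_component continuous_on_subset[OF G]) auto
  show ?thesis
    using heat_kernel_term_eq_voc[OF c, of \<xi> \<alpha>]
    by (auto simp: duhf_def coef_duhamel[OF \<alpha> t c]) (simp add: heat_kernel_term_def)
qed

lemma coef_heatf: "\<alpha> < 1 \<Longrightarrow> 0 \<le> t \<Longrightarrow> coef (heatf \<alpha> t w $ j) \<xi> = hmult \<alpha> t \<xi> * coef (w $ j) \<xi>"
  by (simp add: heatf_def coef_mul[OF hmult_bound])

lemma herf_heatf: "\<alpha> < 1 \<Longrightarrow> 0 \<le> t \<Longrightarrow> herf w \<Longrightarrow> herf (heatf \<alpha> t w)"
  by (simp add: herf_def her_def coef_heatf hmult_def)

lemma herf_duhf:
  assumes \<alpha>: "\<alpha> < 1" and t: "0 \<le> t" and G: "continuous_on {0..} G" and h: "\<And>\<tau>. 0 \<le> \<tau> \<Longrightarrow> herf (G \<tau>)"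
  shows "herf (duhf \<alpha> G t)"
  unfolding herf_def duhf_def
proof
  fix j
  have "continuous_on {0..t} (\<lambda>\<tau>. G \<tau> $ j)"
    by (intro continuous_on_component continuous_on_subset[OF G]) auto
  then show "her ((\<chi> j. duhamel \<alpha> (\<lambda>\<tau>. G \<tau> $ j) t) $ j)"
    using h by (auto intro!: her_duhamel[OF \<alpha> t] simp: herf_def)
qed

lemma bounded_linear_coef_nth: "bounded_linear (\<lambda>x :: 'd::finite field. coef (x $ j) \<xi>)"
  by (intro bounded_linear_compose[OF bounded_linear_coef] bounded_linear_vec_nth)

text \<open>Derivatives of the individual coefficients do not by themselves give a derivative in
  norm. Integrating them identifies \<open>y\<close> with \<open>y 0\<close> plus the integral of
  \<open>V\<close> in the Banach space, and continuity of \<open>V\<close> then allows the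
  fundamental theorem there.\<close>

lemma has_vector_derivative_fieldI:
  fixes y V :: "real \<Rightarrow> 'd::finite field"
  assumes V: "continuous_on {0..} V"
    and d: "\<And>j \<xi> t. 0 \<le> t \<Longrightarrow> ((\<lambda>\<tau>. coef (y \<tau> $ j) \<xi>) has_vector_derivative coef (V t $ j) \<xi>) (at t within {0..})"
    and t: "0 \<le> t"
  shows "(y has_vector_derivative V t) (at t within {0..})"
proof -
  have y: "y r = y 0 + integral {0..r} V" if r: "0 \<le> r" for r
  proof (unfold vec_eq_iff, intro allI ell2_eqI)
    fix j and \<xi> :: "int^'d"
    have Vr: "V integrable_on {0..r}"
      by (intro integrable_continuous_interval continuous_on_subset[OF V]) auto
    have "((\<lambda>\<tau>. coef (V \<tau> $ j) \<xi>) has_integral (coef (y r $ j) \<xi> - coef (y 0 $ j) \<xi>)) {0..r}"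
      by (rule fundamental_theorem_of_calculus[OF r]) (auto intro!: has_vector_derivative_within_subset[OF d])
    moreover have "((\<lambda>\<tau>. coef (V \<tau> $ j) \<xi>) has_integral coef (integral {0..r} V $ j) \<xi>) {0..r}"
      using has_integral_linear[OF integrable_integral[OF Vr] bounded_linear_coef_nth[of j \<xi>]] by (simp add: o_def)
    ultimately have "coef (y r $ j) \<xi> - coef (y 0 $ j) \<xi> = coef (integral {0..r} V $ j) \<xi>"
      by (rule has_integral_unique)
    then show "coef (y r $ j) \<xi> = coef ((y 0 + integral {0..r} V) $ j) \<xi>" by (simp add: algebra_simps)
  qed
  have "((\<lambda>u. integral {0..u} V) has_vector_derivative V t) (at t within {0..t+1})"
    by (rule integral_has_vector_derivative) (use t in \<open>auto intro: continuous_on_subset[OF V]\<close>)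
  also have "at t within {0..t+1} = at t within {0..}"
    by (rule at_within_nhd[of _ "{..<t+1}"]) auto
  finally have "((\<lambda>u. integral {0..u} V) has_vector_derivative V t) (at t within {0..})" .
  from has_vector_derivative_add[OF has_vector_derivative_const[of "y 0"] this]
  have "((\<lambda>u. y 0 + integral {0..u} V) has_vector_derivative V t) (at t within {0..})" by simp
  then show ?thesis
    by (rule has_vector_derivative_transform[rotated 2]) (use t in simp, rule y, simp)
qed

section \<open>The evolution problem in Fourier coefficients\<close>

text \<open>The mild formula \<open>exp (\<alpha> t) w(t) = heatf w0 - duhf (exp (\<alpha> \<tau>) ler n(\<tau>))\<close> solves the
  linear Stokes system \<open>\<partial>\<^sub>t w = \<Delta> w - ler n\<close>, read coefficientwise.\<close>

lemma coef_mild_deriv: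
  fixes G w :: "real \<Rightarrow> 'd::finite field"
  assumes \<alpha>: "\<alpha> < 1" and G: "continuous_on {0..} G" and "\<xi> \<noteq> 0"
    and w: "\<And>t. 0 \<le> t \<Longrightarrow> w t = exp (- \<alpha> * t) *\<^sub>R (heatf \<alpha> t w0 - duhf \<alpha> G t)"
    and t: "0 \<le> t"
  shows "((\<lambda>\<tau>. coef (w \<tau> $ j) \<xi>) has_vector_derivative
     (- lam \<xi> *\<^sub>R coef (w t $ j) \<xi> - jb \<xi> *\<^sub>R exp (- \<alpha> * t) *\<^sub>R coef (G t $ j) \<xi>)) (at t within {0..})"
proof -
  let ?\<mu> = "lam \<xi> - \<alpha>"
  define g where "g \<tau> = coef (G \<tau> $ j) \<xi>" for \<tau>
  have cg: "continuous_on {0..} g" unfolding g_def by (intro continuous_intros G)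
  have W: "coef (w \<tau> $ j) \<xi> = exp (- \<alpha> * \<tau>) *\<^sub>R (exp (- ?\<mu> * \<tau>) *\<^sub>R coef (w0 $ j) \<xi> - jb \<xi> *\<^sub>R voc ?\<mu> g \<tau>)"
    if "0 \<le> \<tau>" for \<tau>
    using \<open>\<xi> \<noteq> 0\<close>
    by (simp add: w[OF that] coef_heatf[OF \<alpha> that] coef_duhf[OF \<alpha> that G] hmult_def g_def[abs_def] scaleR_conv_of_real)
  have 1: "((\<lambda>\<tau>. exp (- ?\<mu> * \<tau>) *\<^sub>R coef (w0 $ j) \<xi>) has_vector_derivative
      (- ?\<mu> * exp (- ?\<mu> * t)) *\<^sub>R coef (w0 $ j) \<xi>) (at t within {0..})"
    using has_vector_derivative_scaleR[of "\<lambda>\<tau>. exp (- ?\<mu> * \<tau>)" "- ?\<mu> * exp (- ?\<mu> * t)" t "{0..}"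
        "\<lambda>_. coef (w0 $ j) \<xi>" 0] by (auto intro!: derivative_eq_intros)
  have 2: "((\<lambda>\<tau>. jb \<xi> *\<^sub>R voc ?\<mu> g \<tau>) has_vector_derivative jb \<xi> *\<^sub>R (g t - ?\<mu> *\<^sub>R voc ?\<mu> g t)) (at t within {0..})"
    by (rule bounded_linear.has_vector_derivative[OF bounded_linear_scaleR_right has_vector_derivative_voc[OF cg t]])
  have "((\<lambda>\<tau>. exp (- \<alpha> * \<tau>) *\<^sub>R (exp (- ?\<mu> * \<tau>) *\<^sub>R coef (w0 $ j) \<xi> - jb \<xi> *\<^sub>R voc ?\<mu> g \<tau>)) has_vector_derivative
      exp (- \<alpha> * t) *\<^sub>R ((- ?\<mu> * exp (- ?\<mu> * t)) *\<^sub>R coef (w0 $ j) \<xi> - jb \<xi> *\<^sub>R (g t - ?\<mu> *\<^sub>R voc ?\<mu> g t))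
      + (- \<alpha> * exp (- \<alpha> * t)) *\<^sub>R (exp (- ?\<mu> * t) *\<^sub>R coef (w0 $ j) \<xi> - jb \<xi> *\<^sub>R voc ?\<mu> g t)) (at t within {0..})"
    by (rule has_vector_derivative_scaleR[OF _ has_vector_derivative_diff[OF 1 2]]) (auto intro!: derivative_eq_intros)
  also have "exp (- \<alpha> * t) *\<^sub>R ((- ?\<mu> * exp (- ?\<mu> * t)) *\<^sub>R coef (w0 $ j) \<xi> - jb \<xi> *\<^sub>R (g t - ?\<mu> *\<^sub>R voc ?\<mu> g t))
      + (- \<alpha> * exp (- \<alpha> * t)) *\<^sub>R (exp (- ?\<mu> * t) *\<^sub>R coef (w0 $ j) \<xi> - jb \<xi> *\<^sub>R voc ?\<mu> g t)
      = - lam \<xi> *\<^sub>R coef (w t $ j) \<xi> - jb \<xi> *\<^sub>R exp (- \<alpha> * t) *\<^sub>R g t"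
    unfolding W[OF t] by (simp add: scaleR_conv_of_real) (simp add: algebra_simps)
  finally show ?thesis
    unfolding g_def[of t, symmetric]
    by (rule has_vector_derivative_transform[rotated 2]) (use t in simp, rule W, simp)
qed

text \<open>The Laplacian of \<open>w\<close> is available only in H^(s-2), so the differentiated
  curve is the twice included one, where the candidate derivative is continuous. Nonzero modes come
  from the scalar formula; the zero mode is constant since neither the heat part nor the source has
  one.\<close>

lemma mild_has_vector_derivative:
  fixes n w :: "real \<Rightarrow> 'd::finite field"
  assumes \<alpha>: "\<alpha> < 1" and n: "continuous_on {0..} n" and wc: "continuous_on {0..} w"
    and n0: "\<And>t j. 0 \<le> t \<Longrightarrow> coef (n t $ j) 0 = 0"
    and w: "\<And>t. 0 \<le> t \<Longrightarrow> w t = exp (- \<alpha> * t) *\<^sub>R (heatf \<alpha> t w0 - duhf \<alpha> (\<lambda>\<tau>. exp (\<alpha> * \<tau>) *\<^sub>R ler (n \<tau>)) t)"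
    and t: "0 \<le> t"
  shows "((\<lambda>\<tau>. Jf (Jf (w \<tau>))) has_vector_derivative (Lf (w t) - Jf (n t) - Jf (gradf (prs (n t))))) (at t within {0..})"
proof -
  have lc: "continuous_on {0..} (\<lambda>\<tau>. ler (n \<tau>))"
    by (rule bounded_linear.continuous_on[OF bounded_linear_ler n])
  have G: "continuous_on {0..} (\<lambda>\<tau>. exp (\<alpha> * \<tau>) *\<^sub>R ler (n \<tau>))"
    by (intro continuous_intros lc)
  have "((\<lambda>\<tau>. Jf (Jf (w \<tau>))) has_vector_derivative (Lf (w t) - Jf (ler (n t)))) (at t within {0..})"
  proof (rule has_vector_derivative_fieldI[OF _ _ t])
    show "continuous_on {0..} (\<lambda>t. Lf (w t) - Jf (ler (n t)))"
      by (intro continuous_intros bounded_linear.continuous_on[OF bounded_linear_Lf wc]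
          bounded_linear.continuous_on[OF bounded_linear_Jf lc])
    fix j \<xi> and t :: real assume t: "0 \<le> t"
    show "((\<lambda>\<tau>. coef (Jf (Jf (w \<tau>)) $ j) \<xi>) has_vector_derivative coef ((Lf (w t) - Jf (ler (n t))) $ j) \<xi>) (at t within {0..})"
    proof (cases "\<xi> = 0")
      case True
      have "coef (w \<tau> $ j) 0 = 0" if "0 \<le> \<tau>" for \<tau>
        by (simp add: w[OF that] coef_heatf[OF \<alpha> that] coef_duhf[OF \<alpha> that G] hmult_def)
      moreover have "coef (ler (n t) $ j) 0 = 0" using n0[OF t] by (simp add: ler_def Rmult_def)
      ultimately have "((\<lambda>\<tau>. 0) has_vector_derivative coef ((Lf (w t) - Jf (ler (n t))) $ j) \<xi>) (at t within {0..})"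
        using True t by (simp add: Lf_def Jf_def)
      then show ?thesis
        by (rule has_vector_derivative_transform[rotated 2]) (use t True \<open>\<And>\<tau>. 0 \<le> \<tau> \<Longrightarrow> coef (w \<tau> $ j) 0 = 0\<close> in \<open>auto simp: Jf_def\<close>)
    next
      case False
      have e: "exp (- \<alpha> * t) *\<^sub>R exp (\<alpha> * t) *\<^sub>R c = c" for c :: complex by (simp flip: exp_add)
      from coef_mild_deriv[OF \<alpha> G False w t, of j]
      have "((\<lambda>\<tau>. coef (w \<tau> $ j) \<xi>) has_vector_derivative
        (- lam \<xi> *\<^sub>R coef (w t $ j) \<xi> - jb \<xi> *\<^sub>R coef (ler (n t) $ j) \<xi>)) (at t within {0..})"
        unfolding vector_scaleR_component coef_simps e .
      from bounded_linear.has_vector_derivative[OF bounded_linear_mult_right this, of "Jmult \<xi> * Jmult \<xi>"]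
      have "((\<lambda>\<tau>. Jmult \<xi> * Jmult \<xi> * coef (w \<tau> $ j) \<xi>) has_vector_derivative
        Jmult \<xi> * Jmult \<xi> * (- lam \<xi> *\<^sub>R coef (w t $ j) \<xi> - jb \<xi> *\<^sub>R coef (ler (n t) $ j) \<xi>)) (at t within {0..})" .
      also have "Jmult \<xi> * Jmult \<xi> * (- lam \<xi> *\<^sub>R coef (w t $ j) \<xi> - jb \<xi> *\<^sub>R coef (ler (n t) $ j) \<xi>)
        = coef ((Lf (w t) - Jf (ler (n t))) $ j) \<xi>"
        by (simp add: Jmult_def Lf_def Jf_def Lapmult_def scaleR_conv_of_real field_simps power2_eq_square)
      also have "(\<lambda>\<tau>. Jmult \<xi> * Jmult \<xi> * coef (w \<tau> $ j) \<xi>) = (\<lambda>\<tau>. coef (Jf (Jf (w \<tau>)) $ j) \<xi>)"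
        by (simp add: Jf_def mult.assoc)
      finally show ?thesis .
    qed
  qed
  moreover have "Jf (ler (n t)) = Jf (n t) + Jf (gradf (prs (n t)))"
    unfolding ler_eq[of "n t"] by (rule linear_add[OF bounded_linear.linear[OF bounded_linear_Jf]])
  ultimately show ?thesis by (simp add: algebra_simps)
qed

text \<open>At each frequency the heat factor and the time integral act by the same scalar
  operations on all components, so they commute with the pairing with \<open>\<xi>\<close>; the
  datum and the projected source are both divergence free.\<close>

lemma divfree_mild:
  fixes n :: "real \<Rightarrow> 'd::finite field"
  assumes \<alpha>: "\<alpha> < 1" and n: "continuous_on {0..} n" and w0: "divfree w0" and t: "0 \<le> t"
  shows "divfree (c *\<^sub>R (heatf \<alpha> t w0 - duhf \<alpha> (\<lambda>\<tau>. exp (\<alpha> * \<tau>) *\<^sub>R ler (n \<tau>)) t))"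
  unfolding divfree_def
proof
  fix \<xi> :: "int^'d"
  let ?G = "\<lambda>\<tau>. exp (\<alpha> * \<tau>) *\<^sub>R ler (n \<tau>)"
  have G: "continuous_on {0..} ?G"
    by (intro continuous_intros bounded_linear.continuous_on[OF bounded_linear_ler n])
  show "(\<Sum>j\<in>UNIV. of_int (\<xi> $ j) * coef ((c *\<^sub>R (heatf \<alpha> t w0 - duhf \<alpha> ?G t)) $ j) \<xi>) = 0"
  proof (cases "\<xi> = 0")
    case False
    let ?\<mu> = "lam \<xi> - \<alpha>"
    have int: "(\<lambda>\<tau>. of_int (\<xi> $ j) * (exp (?\<mu> * \<tau>) *\<^sub>R coef (?G \<tau> $ j) \<xi>)) integrable_on {0..t}" for j
      by (intro integrable_continuous_interval continuous_intros continuous_on_subset[OF G]) auto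
    have "(\<Sum>j\<in>UNIV. of_int (\<xi> $ j) * integral {0..t} (\<lambda>\<tau>. exp (?\<mu> * \<tau>) *\<^sub>R coef (?G \<tau> $ j) \<xi>))
      = integral {0..t} (\<lambda>\<tau>. \<Sum>j\<in>UNIV. of_int (\<xi> $ j) * (exp (?\<mu> * \<tau>) *\<^sub>R coef (?G \<tau> $ j) \<xi>))"
      unfolding integral_mult_right[symmetric] by (rule integral_sum[symmetric]) (use int in simp_all)
    also have "(\<lambda>\<tau>. \<Sum>j\<in>UNIV. of_int (\<xi> $ j) * (exp (?\<mu> * \<tau>) *\<^sub>R coef (?G \<tau> $ j) \<xi>)) = (\<lambda>_. 0)"
    proof
      fix \<tau>
      have "(\<Sum>j\<in>UNIV. of_int (\<xi> $ j) * (exp (?\<mu> * \<tau>) *\<^sub>R coef (?G \<tau> $ j) \<xi>))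
        = (exp (?\<mu> * \<tau>) * exp (\<alpha> * \<tau>)) *\<^sub>R (\<Sum>j\<in>UNIV. of_int (\<xi> $ j) * coef (ler (n \<tau>) $ j) \<xi>)"
        by (simp add: scaleR_sum_right scaleR_conv_of_real sum_distrib_left mult_ac)
      then show "(\<Sum>j\<in>UNIV. of_int (\<xi> $ j) * (exp (?\<mu> * \<tau>) *\<^sub>R coef (?G \<tau> $ j) \<xi>)) = 0"
        using divfree_ler[of "n \<tau>"] unfolding divfree_def by simp
    qed
    finally have I: "(\<Sum>j\<in>UNIV. of_int (\<xi> $ j) * integral {0..t} (\<lambda>\<tau>. exp (?\<mu> * \<tau>) *\<^sub>R coef (?G \<tau> $ j) \<xi>)) = 0"
      by simp
    have "(\<Sum>j\<in>UNIV. of_int (\<xi> $ j) * coef ((c *\<^sub>R (heatf \<alpha> t w0 - duhf \<alpha> ?G t)) $ j) \<xi>)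
      = c *\<^sub>R (hmult \<alpha> t \<xi> * (\<Sum>j\<in>UNIV. of_int (\<xi> $ j) * coef (w0 $ j) \<xi>) - jb \<xi> *\<^sub>R exp (- ?\<mu> * t) *\<^sub>R
        (\<Sum>j\<in>UNIV. of_int (\<xi> $ j) * integral {0..t} (\<lambda>\<tau>. exp (?\<mu> * \<tau>) *\<^sub>R coef (?G \<tau> $ j) \<xi>)))"
      unfolding vector_scaleR_component vector_minus_component coef_simps coef_diff coef_heatf[OF \<alpha> t] coef_duhf[OF \<alpha> t G] voc_def
      using False by (simp add: scaleR_sum_right sum_distrib_left sum_subtractf[symmetric] scaleR_conv_of_real algebra_simps)
    also have "\<dots> = 0" using w0 unfolding I divfree_def by simp
    finally show ?thesis .
  qed simp
qed

text \<open>Any bounded solution of the equation for the difference of two solutions satisfies the mild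
  formula with rate \<open>-\<beta>\<close>; the constant of the Duhamel bound tends to \<open>0\<close> as \<open>\<beta>\<close> grows.\<close>

lemma divfree_imp_ler_eq:
  fixes n :: "'d::finite field"
  assumes d: "\<And>\<xi>. \<xi> \<noteq> 0 \<Longrightarrow> (\<Sum>j\<in>UNIV. of_int (\<xi> $ j) * coef ((n + gradf q) $ j) \<xi>) = 0"
  shows "n + gradf q = ler n"
proof (unfold vec_eq_iff, intro allI ell2_eqI)
  fix j :: 'd and \<xi> :: "int^'d"
  show "coef ((n + gradf q) $ j) \<xi> = coef (ler n $ j) \<xi>"
  proof (cases "\<xi> = 0")
    case True
    then show ?thesis by (simp add: gradf_def Dmult_def ler_def Rmult_def)
  next
    case False
    define S where "S = (\<Sum>j\<in>UNIV. of_int (\<xi> $ j) * coef (n $ j) \<xi>)"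
    have "(\<Sum>j\<in>UNIV. of_int (\<xi> $ j) * (Dmult j \<xi> * coef q \<xi>)) = \<i> * complex_of_real (lam \<xi>) / jb \<xi> * coef q \<xi>"
      unfolding of_real_lam_eq by (simp add: Dmult_def sum_distrib_left sum_distrib_right sum_divide_distrib mult_ac)
    then have "S + \<i> * complex_of_real (lam \<xi>) / jb \<xi> * coef q \<xi> = 0"
      using d[OF False] by (simp add: gradf_def ring_distribs sum.distrib S_def)
    \<comment> \<open>The constraint determines this mode of the pressure. Inserting it turns the
      gradient into minus the \<open>Rmult\<close> sum of the projection.\<close>
    then have q: "\<i> * coef q \<xi> / jb \<xi> = - S / lam \<xi>"
      using lam_ge_1[OF False] by (simp add: field_simps add_eq_0_iff)
    have "coef ((n + gradf q) $ j) \<xi> = coef (n $ j) \<xi> + of_int (\<xi> $ j) * (\<i> * coef q \<xi> / jb \<xi>)"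
      by (simp add: gradf_def Dmult_def)
    also have "\<dots> = coef (n $ j) \<xi> - (\<Sum>i\<in>UNIV. Rmult i j \<xi> * coef (n $ i) \<xi>)"
      unfolding q S_def by (simp add: Rmult_def sum_distrib_left sum_divide_distrib mult_ac)
    also have "\<dots> = coef (ler n $ j) \<xi>" by (simp add: ler_def)
    finally show ?thesis .
  qed
qed

text \<open>Makes derivatives within the half-line unique at every time, the initial one
  included.\<close>

lemma at_within_Ici_neq_bot: "a \<le> t \<Longrightarrow> at t within {a..} \<noteq> bot" for t :: real
proof
  assume "a \<le> t" and b: "at t within {a..} = bot"
  then have "at_right t \<le> at t within {a..}" by (intro at_le) auto
  with b show False by (simp add: bot_unique)
qed

text \<open>\<open>z\<close> stays divergence free, hence so does its time derivative, and
  \<open>q\<close> is forced to complete \<open>n\<close> to its Leray projection. Every mode then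
  solves a scalar linear equation with zero initial value. Multiplication by
  \<open>exp (- \<beta> * t)\<close> merely raises the rate from \<open>lam \<xi>\<close> to
  \<open>lam \<xi> + \<beta>\<close>.\<close>

lemma difference_eq_mild:
  fixes z n :: "real \<Rightarrow> 'd::finite field" and q :: "real \<Rightarrow> (int^'d) ell2"
  assumes \<beta>: "0 \<le> \<beta>" and zc: "continuous_on {0..} z" and n: "continuous_on {0..} n"
    and n0: "\<And>t j. 0 \<le> t \<Longrightarrow> coef (n t $ j) 0 = 0"
    and zd: "\<And>t. 0 \<le> t \<Longrightarrow> divfree (z t)" and z0: "z 0 = 0"
    and eq: "\<And>t. 0 \<le> t \<Longrightarrow> ((\<lambda>\<tau>. Jf (Jf (z \<tau>))) has_vector_derivative
       (Lf (z t) - Jf (n t) - Jf (gradf (q t)))) (at t within {0..})"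
    and t: "0 \<le> t"
  shows "n t + gradf (q t) = ler (n t)"
    and "exp (- \<beta> * t) *\<^sub>R z t = - duhf (- \<beta>) (\<lambda>\<tau>. exp (- \<beta> * \<tau>) *\<^sub>R ler (n \<tau>)) t"
proof -
  have d: "((\<lambda>\<tau>. coef (z \<tau> $ j) \<xi>) has_vector_derivative
      (- lam \<xi> *\<^sub>R coef (z t $ j) \<xi> - jb \<xi> *\<^sub>R coef ((n t + gradf (q t)) $ j) \<xi>)) (at t within {0..})"
    if t: "0 \<le> t" for t j \<xi>
  proof -
    have "(\<lambda>x::'d field. coef (Jf (Jf x) $ j) \<xi>) = (\<lambda>x. Jmult \<xi> * Jmult \<xi> * coef (x $ j) \<xi>)"
      by (simp add: Jf_def mult.assoc)
    from bounded_linear.has_vector_derivative[OF bounded_linear_coef_nth eq[OF t], of j \<xi>]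
    have "((\<lambda>\<tau>. Jmult \<xi> * Jmult \<xi> * coef (z \<tau> $ j) \<xi>) has_vector_derivative
        coef ((Lf (z t) - Jf (n t) - Jf (gradf (q t))) $ j) \<xi>) (at t within {0..})"
      by (simp add: Jf_def mult.assoc)
    \<comment> \<open>At a single frequency the two inclusions can be undone by multiplying with the
      square of the bracket.\<close>
    from bounded_linear.has_vector_derivative[OF bounded_linear_mult_right this, of "complex_of_real ((jb \<xi>)\<^sup>2)"]
    have "((\<lambda>\<tau>. complex_of_real ((jb \<xi>)\<^sup>2) * (Jmult \<xi> * Jmult \<xi> * coef (z \<tau> $ j) \<xi>)) has_vector_derivative
        complex_of_real ((jb \<xi>)\<^sup>2) * coef ((Lf (z t) - Jf (n t) - Jf (gradf (q t))) $ j) \<xi>) (at t within {0..})" .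
    also have "(\<lambda>\<tau>. complex_of_real ((jb \<xi>)\<^sup>2) * (Jmult \<xi> * Jmult \<xi> * coef (z \<tau> $ j) \<xi>)) = (\<lambda>\<tau>. coef (z \<tau> $ j) \<xi>)"
      by (simp add: Jmult_def power2_eq_square field_simps)
    also have "complex_of_real ((jb \<xi>)\<^sup>2) * coef ((Lf (z t) - Jf (n t) - Jf (gradf (q t))) $ j) \<xi>
      = - lam \<xi> *\<^sub>R coef (z t $ j) \<xi> - jb \<xi> *\<^sub>R coef ((n t + gradf (q t)) $ j) \<xi>"
      by (simp add: Jmult_def Lf_def Jf_def Lapmult_def scaleR_conv_of_real field_simps power2_eq_square)
    finally show ?thesis .
  qed
  have ler_n: "n t + gradf (q t) = ler (n t)" if t: "0 \<le> t" for t
  proof (rule divfree_imp_ler_eq)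
    fix \<xi> :: "int^'d" assume xi: "\<xi> \<noteq> 0"
    have "((\<lambda>\<tau>. \<Sum>j\<in>UNIV. of_int (\<xi> $ j) * coef (z \<tau> $ j) \<xi>) has_vector_derivative
      (\<Sum>j\<in>UNIV. of_int (\<xi> $ j) * (- lam \<xi> *\<^sub>R coef (z t $ j) \<xi> - jb \<xi> *\<^sub>R coef ((n t + gradf (q t)) $ j) \<xi>))) (at t within {0..})"
      by (intro has_vector_derivative_sum bounded_linear.has_vector_derivative[OF bounded_linear_mult_right d[OF t]])
    \<comment> \<open>The same function is identically zero on the half-line, so uniqueness of the
      derivative makes the right-hand side above vanish.\<close>
    moreover have "((\<lambda>\<tau>. \<Sum>j\<in>UNIV. of_int (\<xi> $ j) * coef (z \<tau> $ j) \<xi>) has_vector_derivative 0) (at t within {0..})"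
      by (rule has_vector_derivative_transform[OF _ _ has_vector_derivative_const[of 0]])
        (use t zd in \<open>auto simp: divfree_def\<close>)
    moreover note at_within_Ici_neq_bot[OF t]
    ultimately have "(\<Sum>j\<in>UNIV. of_int (\<xi> $ j) * (- lam \<xi> *\<^sub>R coef (z t $ j) \<xi> - jb \<xi> *\<^sub>R coef ((n t + gradf (q t)) $ j) \<xi>)) = 0"
      using vector_derivative_unique_within by blast
    moreover have "(\<Sum>j\<in>UNIV. of_int (\<xi> $ j) * (- lam \<xi> *\<^sub>R coef (z t $ j) \<xi> - jb \<xi> *\<^sub>R coef ((n t + gradf (q t)) $ j) \<xi>))
      = - lam \<xi> *\<^sub>R (\<Sum>j\<in>UNIV. of_int (\<xi> $ j) * coef (z t $ j) \<xi>) - jb \<xi> *\<^sub>R (\<Sum>j\<in>UNIV. of_int (\<xi> $ j) * coef ((n t + gradf (q t)) $ j) \<xi>)"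
      unfolding scaleR_sum_right sum_subtractf[symmetric] by (intro sum.cong refl) (simp add: algebra_simps)
    ultimately show "(\<Sum>j\<in>UNIV. of_int (\<xi> $ j) * coef ((n t + gradf (q t)) $ j) \<xi>) = 0"
      using zd[OF t] by (simp add: divfree_def)
  qed
  show "n t + gradf (q t) = ler (n t)" by (rule ler_n[OF t])
  have \<beta>1: "- \<beta> < 1" using \<beta> by simp
  let ?G = "\<lambda>\<tau>. exp (- \<beta> * \<tau>) *\<^sub>R ler (n \<tau>)"
  have lc: "continuous_on {0..} (\<lambda>\<tau>. ler (n \<tau>))"
    by (rule bounded_linear.continuous_on[OF bounded_linear_ler n])
  have G: "continuous_on {0..} ?G" by (intro continuous_intros lc)
  show "exp (- \<beta> * t) *\<^sub>R z t = - duhf (- \<beta>) ?G t"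
  proof (unfold vec_eq_iff, intro allI ell2_eqI)
    fix j and \<xi> :: "int^'d"
    let ?L = "\<lambda>\<tau>. coef (ler (n \<tau>) $ j) \<xi>"
    have d': "((\<lambda>\<tau>. coef (z \<tau> $ j) \<xi>) has_vector_derivative
      (- jb \<xi> *\<^sub>R ?L t - lam \<xi> *\<^sub>R coef (z t $ j) \<xi>)) (at t within {0..})" if "0 \<le> t" for t
      by (rule has_vector_derivative_eq_rhs[OF d[OF that]]) (simp only: ler_n[OF that], simp add: algebra_simps)
    have v: "coef (z t $ j) \<xi> = voc (lam \<xi>) (\<lambda>\<tau>. - jb \<xi> *\<^sub>R ?L \<tau>) t"
      using voc_unique[of "\<lambda>\<tau>. coef (z \<tau> $ j) \<xi>" "\<lambda>\<tau>. - jb \<xi> *\<^sub>R ?L \<tau>" "lam \<xi>", OF d' t] z0 by simp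
    show "coef ((exp (- \<beta> * t) *\<^sub>R z t) $ j) \<xi> = coef ((- duhf (- \<beta>) ?G t) $ j) \<xi>"
    proof (cases "\<xi> = 0")
      \<comment> \<open>The zero mode has neither damping nor source and keeps its initial value.
        Equality of the means of two solutions is thus derived from the equation.\<close>
      case True
      have "?L \<tau> = 0" if "0 \<le> \<tau>" for \<tau> using True n0[OF that] by (simp add: ler_def Rmult_def)
      then have "integral {0..t} (\<lambda>\<tau>. exp (lam \<xi> * \<tau>) *\<^sub>R (- jb \<xi> *\<^sub>R ?L \<tau>)) = integral {0..t} (\<lambda>_. 0)"
        by (intro Henstock_Kurzweil_Integration.integral_cong) auto
      then show ?thesis using True v
        unfolding vector_scaleR_component vector_uminus_component coef_simps coef_duhf[OF \<beta>1 t G] by (simp add: voc_def)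
    next
      case False
      have "exp (- \<beta> * t) *\<^sub>R coef (z t $ j) \<xi> = - (jb \<xi> *\<^sub>R voc (lam \<xi> + \<beta>) (\<lambda>\<tau>. coef (?G \<tau> $ j) \<xi>) t)"
      proof -
        have "(\<lambda>\<tau>. exp (lam \<xi> * \<tau>) *\<^sub>R (- jb \<xi> *\<^sub>R ?L \<tau>)) = (\<lambda>\<tau>. - jb \<xi> *\<^sub>R (exp ((lam \<xi> + \<beta>) * \<tau>) *\<^sub>R coef (?G \<tau> $ j) \<xi>))"
          by (simp add: ring_distribs mult_ac flip: exp_add)
        then have "integral {0..t} (\<lambda>\<tau>. exp (lam \<xi> * \<tau>) *\<^sub>R (- jb \<xi> *\<^sub>R ?L \<tau>))
          = - jb \<xi> *\<^sub>R integral {0..t} (\<lambda>\<tau>. exp ((lam \<xi> + \<beta>) * \<tau>) *\<^sub>R coef (?G \<tau> $ j) \<xi>)"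
          by (simp only: integral_cmul)
        moreover have "exp (- \<beta> * t) * exp (- lam \<xi> * t) = exp (- (lam \<xi> + \<beta>) * t)"
          by (simp add: algebra_simps flip: exp_add)
        ultimately show ?thesis unfolding v voc_def by (simp add: mult_ac)
      qed
      then show ?thesis using False
        unfolding vector_scaleR_component vector_uminus_component coef_simps coef_duhf[OF \<beta>1 t G] by simp
    qed
  qed
qed

text \<open>With a negative rate \<open>heat_const\<close> is 1, so the constant is governed by the
  integrated kernel alone and becomes as small as desired for large \<open>\<beta>\<close>.\<close>

lemma duhamel_const_neg: "0 \<le> \<beta> \<Longrightarrow> duhamel_const (- \<beta>) = sqrt (1 / (1 + \<beta>))"
  by (simp add: duhamel_const_def heat_const_def max_def)

text \<open>The equation for \<open>z\<close> is linear with bounded coefficients, and the weight is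
  chosen after their bound \<open>M\<close>, so no smallness of the solutions is involved. In the
  weighted supremum norm the Duhamel formula at least halves \<open>z\<close>, which must therefore
  vanish.\<close>

lemma coefficient_uniqueness:
  fixes z u u' :: "real \<Rightarrow> 'd::finite field" and q :: "real \<Rightarrow> (int^'d) ell2"
  assumes s: "s > real CARD('d) / 2 + 1"
    and cont: "continuous_on {0..} z" "continuous_on {0..} u" "continuous_on {0..} u'"
    and bd: "\<And>t. 0 \<le> t \<Longrightarrow> norm (z t) \<le> M" "\<And>t. 0 \<le> t \<Longrightarrow> norm (u t) \<le> M" "\<And>t. 0 \<le> t \<Longrightarrow> norm (u' t) \<le> M"
    and div: "\<And>t. 0 \<le> t \<Longrightarrow> divfree (z t)" "\<And>t. 0 \<le> t \<Longrightarrow> divfree (u' t)"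
    and z0: "z 0 = 0" and q0: "\<And>t. 0 \<le> t \<Longrightarrow> coef (q t) 0 = 0"
    and eq: "\<And>t. 0 \<le> t \<Longrightarrow> ((\<lambda>\<tau>. Jf (Jf (z \<tau>))) has_vector_derivative
       (Lf (z t) - Jf (adv s (z t) (u t) + adv s (u' t) (z t)) - Jf (gradf (q t)))) (at t within {0..})"
    and t: "0 \<le> t"
  shows "z t = 0" "q t = 0"
proof -
  interpret A: bounded_bilinear "adv s :: 'd field \<Rightarrow> _" by (rule bounded_bilinear_adv[OF s])
  define n where "n t = adv s (z t) (u t) + adv s (u' t) (z t)" for t
  have n: "continuous_on {0..} n" unfolding n_def
    by (intro continuous_intros A.continuous_on cont)
  have n0: "coef (n t $ j) 0 = 0" if "0 \<le> t" for t j
    unfolding n_def using coef_adv_0[OF s div(1)[OF that]] coef_adv_0[OF s div(2)[OF that]] by simp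
  obtain Ka where Ka: "0 < Ka" "\<And>a c :: 'd field. norm (adv s a c) \<le> norm a * norm c * Ka"
    using A.pos_bounded by blast
  obtain Kl where Kl: "0 < Kl" "\<And>a :: 'd field. norm (ler a) \<le> norm a * Kl"
    using bounded_linear.pos_bounded[OF bounded_linear_ler] by blast
  have M: "0 \<le> M" using bd(1)[of 0] norm_ge_zero[of "z 0"] by linarith
  define K where "K = real CARD('d) * (2 * M * Ka * Kl)"
  have K: "0 \<le> K" using Ka Kl M by (simp add: K_def)
  \<comment> \<open>Guarantees \<open>2 * K \<le> sqrt (1 + \<beta>)\<close>, that is, a contraction
    factor of at most one half.\<close>
  define \<beta> where "\<beta> = (2 * K)\<^sup>2 + 1"
  have \<beta>: "0 \<le> \<beta>" by (simp add: \<beta>_def)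
  have small: "sqrt (1 / (1 + \<beta>)) * K \<le> 1 / 2"
  proof -
    have "2 * K \<le> sqrt (1 + \<beta>)" by (rule real_le_rsqrt) (simp add: \<beta>_def)
    then show ?thesis using \<beta> by (simp add: real_sqrt_divide field_simps)
  qed
  \<comment> \<open>A finite supremum: \<open>z\<close> is bounded by \<open>M\<close> and the
    weight is at most 1. Finiteness is what lets \<open>m \<le> m / 2\<close> imply
    \<open>m = 0\<close>.\<close>
  define m where "m = (SUP t\<in>{0..}. norm (exp (- \<beta> * t) *\<^sub>R z t))"
  have zM: "norm (exp (- \<beta> * t) *\<^sub>R z t) \<le> M" if "0 \<le> t" for t
  proof -
    have "norm (exp (- \<beta> * t) *\<^sub>R z t) \<le> 1 * M"
      unfolding norm_scaleR using that \<beta> bd(1)[OF that] by (intro mult_mono) auto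
    then show ?thesis by simp
  qed
  have bdd: "bdd_above ((\<lambda>t. norm (exp (- \<beta> * t) *\<^sub>R z t)) ` {0..})"
    using zM by (intro bdd_aboveI[of _ M]) auto
  have up: "norm (exp (- \<beta> * t) *\<^sub>R z t) \<le> m" if "0 \<le> t" for t
    unfolding m_def using that by (intro cSUP_upper bdd) auto
  have m0: "0 \<le> m" using up[of 0] by (rule order_trans[OF norm_ge_zero]) simp
  have mild: "n t + gradf (q t) = ler (n t)"
    "exp (- \<beta> * t) *\<^sub>R z t = - duhf (- \<beta>) (\<lambda>\<tau>. exp (- \<beta> * \<tau>) *\<^sub>R ler (n \<tau>)) t" if "0 \<le> t" for t
    using difference_eq_mild[where q=q, OF \<beta> cont(1) n _ _ z0 _ that] n0 div(1) eq[folded n_def] by blast+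
  have "norm (exp (- \<beta> * t) *\<^sub>R z t) \<le> m / 2" if t: "0 \<le> t" for t
  proof -
    let ?G = "\<lambda>\<tau>. exp (- \<beta> * \<tau>) *\<^sub>R ler (n \<tau>)"
    have "norm (?G \<tau>) \<le> 2 * M * Ka * Kl * m" if \<tau>: "0 \<le> \<tau>" for \<tau>
    proof -
      have "norm (n \<tau>) \<le> norm (z \<tau>) * norm (u \<tau>) * Ka + norm (u' \<tau>) * norm (z \<tau>) * Ka"
        unfolding n_def by (rule order_trans[OF norm_triangle_ineq]) (intro add_mono Ka)
      also have "\<dots> \<le> norm (z \<tau>) * M * Ka + M * norm (z \<tau>) * Ka"
        using bd(2,3)[OF \<tau>] Ka M by (intro add_mono mult_right_mono mult_left_mono) auto
      finally have "norm (n \<tau>) \<le> 2 * M * Ka * norm (z \<tau>)" by (simp add: algebra_simps)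
      then have "norm (ler (n \<tau>)) \<le> 2 * M * Ka * norm (z \<tau>) * Kl"
        using Kl by (intro order_trans[OF Kl(2)] mult_right_mono) auto
      then have "norm (?G \<tau>) \<le> exp (- \<beta> * \<tau>) * (2 * M * Ka * norm (z \<tau>) * Kl)"
        by simp
      also have "\<dots> = 2 * M * Ka * Kl * norm (exp (- \<beta> * \<tau>) *\<^sub>R z \<tau>)" by simp
      also have "\<dots> \<le> 2 * M * Ka * Kl * m" using M Ka Kl up[OF \<tau>] by (intro mult_left_mono) auto
      finally show ?thesis .
    qed
    then have "norm (duhf (- \<beta>) ?G t) \<le> real CARD('d) * (duhamel_const (- \<beta>) * (2 * M * Ka * Kl * m))"
      using \<beta> M Ka Kl m0 t
      by (intro norm_duhf_le) (auto intro!: continuous_intros bounded_linear.continuous_on[OF bounded_linear_ler n])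
    also have "\<dots> = (sqrt (1 / (1 + \<beta>)) * K) * m" by (simp add: duhamel_const_neg[OF \<beta>] K_def)
    also have "\<dots> \<le> (1/2) * m" by (intro mult_right_mono small m0)
    finally show ?thesis unfolding mild(2)[OF t] norm_minus_cancel by linarith
  qed
  then have "m \<le> m / 2" unfolding m_def[symmetric] by (subst m_def) (rule cSUP_least, auto)
  then have "m = 0" using m0 by simp
  then have z: "z t = 0" if "0 \<le> t" for t using up[OF that] by (simp add: mult_le_0_iff)
  show "z t = 0" by (rule z[OF t])
  have "n t = 0" using z[OF t] by (simp add: n_def A.zero_left A.zero_right)
  then have g: "gradf (q t) = 0" using mild(1)[OF t] linear_0[OF bounded_linear.linear[OF bounded_linear_ler]] by simp
  \<comment> \<open>A vanishing gradient annihilates all nonzero modes; the zero mode is fixed by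
    the normalisation of the pressure.\<close>
  show "q t = 0"
  proof (rule ell2_eqI)
    fix \<xi> :: "int^'d"
    show "coef (q t) \<xi> = coef 0 \<xi>"
    proof (cases "\<xi> = 0")
      case False
      then obtain j where "\<xi> $ j \<noteq> 0" by (auto simp: vec_eq_iff)
      moreover have "coef (gradf (q t) $ j) \<xi> = 0" using g by simp
      ultimately show ?thesis by (simp add: gradf_def Dmult_def)
    qed (simp add: q0[OF t])
  qed
qed

section \<open>Existence by contraction\<close>

lemma mult_mono3:
  fixes x :: real
  assumes "0 \<le> x" "x \<le> x'" "0 \<le> y" "y \<le> y'" "0 \<le> k"
  shows "x * y * k \<le> x' * y' * k"
  using assms by (intro mult_right_mono mult_mono) linarith+

text \<open>\<open>W\<close> stands for the weighted perturbation
  \<open>exp (\<alpha> * t) *\<^sub>R w t\<close>: terms linear in it carry no further weight, and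
  the quadratic one keeps a factor \<open>exp (- \<alpha> * \<tau>)\<close>, which is at most 1. In
  the ball of radius \<open>2 * \<delta>\<close> the free evolution takes \<open>\<delta>\<close>
  and the Duhamel term at most \<open>\<delta> / 2\<close>. Hermitian symmetry is part of the
  complete set on which the map contracts, so the fixed point inherits it.\<close>

lemma mild_fixed_point:
  fixes A :: "real \<Rightarrow> 'd::finite field" and w0 :: "'d field"
  assumes s: "s > real CARD('d) / 2 + 1" and \<alpha>: "0 \<le> \<alpha>" "\<alpha> < 1" and C0: "0 \<le> C0" and \<delta>: "0 < \<delta>"
    and Ka: "0 < Ka" "\<And>a c :: 'd field. norm (adv s a c) \<le> norm a * norm c * Ka"
    and Kl: "0 < Kl" "\<And>a :: 'd field. norm (ler a) \<le> norm a * Kl"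
    and small: "real CARD('d) * (duhamel_const \<alpha> * (Kl * Ka)) * (\<delta> * (4 * C0 + 4)) \<le> 1 / 2"
    and A: "continuous_on {0..} A" "\<And>t. 0 \<le> t \<Longrightarrow> norm (A t) \<le> C0 * \<delta>" "\<And>t. 0 \<le> t \<Longrightarrow> herf (A t)"
    and w0: "norm w0 \<le> \<delta>" "herf w0"
  obtains W where "continuous_on {0..} W" "\<And>t. 0 \<le> t \<Longrightarrow> norm (W t) \<le> 2 * \<delta>" "\<And>t. 0 \<le> t \<Longrightarrow> herf (W t)"
    "\<And>t. 0 \<le> t \<Longrightarrow> W t = heatf \<alpha> t w0 - duhf \<alpha> (\<lambda>\<tau>. ler (adv s (A \<tau>) (W \<tau>) + adv s (W \<tau>) (A \<tau>)
        + exp (- \<alpha> * \<tau>) *\<^sub>R adv s (W \<tau>) (W \<tau>))) t"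
proof -
  interpret B: bounded_bilinear "adv s :: 'd field \<Rightarrow> _" by (rule bounded_bilinear_adv[OF s])
  interpret L: bounded_linear "ler :: 'd field \<Rightarrow> _" by (rule bounded_linear_ler)
  define N where "N W \<tau> = adv s (A \<tau>) (W \<tau>) + adv s (W \<tau>) (A \<tau>) + exp (- \<alpha> * \<tau>) *\<^sub>R adv s (W \<tau>) (W \<tau>)" for W \<tau>
  define \<Phi> where "\<Phi> W t = heatf \<alpha> t w0 - duhf \<alpha> (\<lambda>\<tau>. ler (N W \<tau>)) t" for W t
  have dc: "0 \<le> duhamel_const \<alpha>" by (rule duhamel_const_nonneg[OF \<alpha>(2)])
  let ?K = "real CARD('d) * (duhamel_const \<alpha> * (Kl * Ka))"
  have K: "0 \<le> ?K" using dc Ka(1) Kl(1) by simp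
  have e1: "exp (- \<alpha> * \<tau>) \<le> 1" if "0 \<le> \<tau>" for \<tau> using that \<alpha> by simp
  have e2: "norm (exp (- \<alpha> * \<tau>) *\<^sub>R x) \<le> norm x" if "0 \<le> \<tau>" for \<tau> and x :: "'d field"
    unfolding norm_scaleR abs_exp_cancel using mult_right_mono[OF e1[OF that] norm_ge_zero[of x]] by simp
  have e3: "norm (exp (- \<alpha> * \<tau>) *\<^sub>R (x + y)) \<le> b + c" if "0 \<le> \<tau>" "norm x \<le> b" "norm y \<le> c"
    for \<tau> b c and x y :: "'d field"
    using e2[OF that(1), of "x + y"] norm_triangle_ineq[of x y] that(2,3) by linarith
  have cN: "continuous_on {0..} (\<lambda>\<tau>. ler (N W \<tau>))" if "continuous_on {0..} W" for W
    unfolding N_def by (intro L.continuous_on continuous_intros B.continuous_on A that)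
  have cP: "continuous_on {0..} (\<Phi> W)" if "continuous_on {0..} W" for W
    unfolding \<Phi>_def by (intro continuous_on_diff continuous_on_heatf continuous_on_duhf cN that \<alpha>)
  have nP: "norm (\<Phi> W t) \<le> 2 * \<delta>" if W: "continuous_on {0..} W" "\<And>t. 0 \<le> t \<Longrightarrow> norm (W t) \<le> 2 * \<delta>" and t: "0 \<le> t" for W t
  proof -
    have "norm (ler (N W \<tau>)) \<le> Kl * Ka * (\<delta> * (4 * C0 + 4) * \<delta>)" if \<tau>: "0 \<le> \<tau>" for \<tau>
    proof -
      note b = A(2)[OF \<tau>] W(2)[OF \<tau>]
      have "norm (N W \<tau>) \<le> norm (A \<tau>) * norm (W \<tau>) * Ka + norm (W \<tau>) * norm (A \<tau>) * Ka + norm (W \<tau>) * norm (W \<tau>) * Ka"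
        unfolding N_def
        by (intro order_trans[OF norm_triangle_ineq] add_mono Ka order_trans[OF e2[OF \<tau>] Ka(2)])
      \<comment> \<open>Origin of \<open>4 * C0 + 4\<close>: each of the two linear terms
        contributes \<open>2 * C0\<close> and the quadratic term contributes 4, all times the square
        of \<open>\<delta>\<close>.\<close>
      also have "\<dots> \<le> (C0 * \<delta>) * (2 * \<delta>) * Ka + (2 * \<delta>) * (C0 * \<delta>) * Ka + (2 * \<delta>) * (2 * \<delta>) * Ka"
        by (intro add_mono mult_mono3 b norm_ge_zero less_imp_le[OF Ka(1)])
      also have "\<dots> = Ka * (\<delta> * (4 * C0 + 4) * \<delta>)" by (simp add: algebra_simps)
      finally have "norm (N W \<tau>) * Kl \<le> Ka * (\<delta> * (4 * C0 + 4) * \<delta>) * Kl" using Kl(1) by (intro mult_right_mono) auto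
      then show ?thesis using Kl(2)[of "N W \<tau>"] by (simp add: mult_ac)
    qed
    then have "norm (duhf \<alpha> (\<lambda>\<tau>. ler (N W \<tau>)) t) \<le> real CARD('d) * (duhamel_const \<alpha> * (Kl * Ka * (\<delta> * (4 * C0 + 4) * \<delta>)))"
      using Ka(1) Kl(1) \<delta> C0 by (intro norm_duhf_le \<alpha> t cN W) auto
    also have "\<dots> = (?K * (\<delta> * (4 * C0 + 4))) * \<delta>" by simp
    also have "\<dots> \<le> (1/2) * \<delta>" using \<delta> by (intro mult_right_mono small) auto
    finally have "norm (duhf \<alpha> (\<lambda>\<tau>. ler (N W \<tau>)) t) \<le> \<delta> / 2" by simp
    then show ?thesis
      unfolding \<Phi>_def using norm_triangle_ineq4[of "heatf \<alpha> t w0" "duhf \<alpha> (\<lambda>\<tau>. ler (N W \<tau>)) t"]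
        norm_heatf_le[OF \<alpha>(2) t, of w0] w0 \<delta> by linarith
  qed
  have dP: "norm (\<Phi> W t - \<Phi> V t) \<le> 1/2 * D"
    if W: "continuous_on {0..} W" "\<And>t. 0 \<le> t \<Longrightarrow> norm (W t) \<le> 2 * \<delta>"
      and V: "continuous_on {0..} V" "\<And>t. 0 \<le> t \<Longrightarrow> norm (V t) \<le> 2 * \<delta>"
      and D: "\<And>t. 0 \<le> t \<Longrightarrow> norm (W t - V t) \<le> D" and t: "0 \<le> t" for W V t D
  proof -
    have D0: "0 \<le> D" using D[of 0] norm_ge_zero[of "W 0 - V 0"] by linarith
    have "norm (ler (N W \<tau>) - ler (N V \<tau>)) \<le> Kl * Ka * (\<delta> * (4 * C0 + 4) * D)" if \<tau>: "0 \<le> \<tau>" for \<tau>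
    proof -
      note b = A(2)[OF \<tau>] W(2)[OF \<tau>] V(2)[OF \<tau>] D[OF \<tau>]
      \<comment> \<open>The difference of the quadratic terms is telescoped, so that every term
        contains \<open>W \<tau> - V \<tau>\<close> exactly once.\<close>
      have eq: "N W \<tau> - N V \<tau> = adv s (A \<tau>) (W \<tau> - V \<tau>) + adv s (W \<tau> - V \<tau>) (A \<tau>)
         + exp (- \<alpha> * \<tau>) *\<^sub>R (adv s (W \<tau> - V \<tau>) (W \<tau>) + adv s (V \<tau>) (W \<tau> - V \<tau>))"
        unfolding N_def B.diff_left B.diff_right scaleR_add_right scaleR_diff_right by simp
      have "norm (N W \<tau> - N V \<tau>) \<le> norm (A \<tau>) * norm (W \<tau> - V \<tau>) * Ka + norm (W \<tau> - V \<tau>) * norm (A \<tau>) * Ka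
         + (norm (W \<tau> - V \<tau>) * norm (W \<tau>) * Ka + norm (V \<tau>) * norm (W \<tau> - V \<tau>) * Ka)"
        unfolding eq by (intro order_trans[OF norm_triangle_ineq] add_mono Ka e3[OF \<tau>])
      also have "\<dots> \<le> (C0 * \<delta>) * D * Ka + D * (C0 * \<delta>) * Ka + (D * (2 * \<delta>) * Ka + (2 * \<delta>) * D * Ka)"
        by (intro add_mono mult_mono3 b norm_ge_zero less_imp_le[OF Ka(1)])
      also have "\<dots> = Ka * (\<delta> * (2 * C0 + 4) * D)" by (simp add: algebra_simps)
      \<comment> \<open>The Lipschitz constant \<open>2 * C0 + 4\<close> is enlarged, so that one
        smallness condition serves both the invariance of the ball and the contraction.\<close>
      also have "\<dots> \<le> Ka * (\<delta> * (4 * C0 + 4) * D)"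
        using Ka(1) \<delta> D0 C0 by (intro mult_left_mono mult_right_mono) auto
      finally have "norm (N W \<tau> - N V \<tau>) * Kl \<le> Ka * (\<delta> * (4 * C0 + 4) * D) * Kl" using Kl(1) by (intro mult_right_mono) auto
      then show ?thesis using Kl(2)[of "N W \<tau> - N V \<tau>"] by (simp add: mult_ac L.diff)
    qed
    then have "norm (duhf \<alpha> (\<lambda>\<tau>. ler (N W \<tau>) - ler (N V \<tau>)) t) \<le> real CARD('d) * (duhamel_const \<alpha> * (Kl * Ka * (\<delta> * (4 * C0 + 4) * D)))"
      using Ka(1) Kl(1) \<delta> C0 D0 by (intro norm_duhf_le \<alpha> t continuous_on_diff cN W V) auto
    also have "\<dots> = (?K * (\<delta> * (4 * C0 + 4))) * D" by simp
    also have "\<dots> \<le> (1/2) * D" by (intro mult_right_mono small D0)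
    finally show ?thesis
      unfolding \<Phi>_def duhf_diff[OF \<alpha>(2) t cN[OF W(1)] cN[OF V(1)]]
      by (simp add: norm_minus_commute)
  qed
  have hP: "herf (\<Phi> W t)" if W: "continuous_on {0..} W" "\<And>t. 0 \<le> t \<Longrightarrow> herf (W t)" and t: "0 \<le> t" for W t
  proof -
    have "herf (duhf \<alpha> (\<lambda>\<tau>. ler (N W \<tau>)) t)"
      unfolding N_def
      by (rule herf_duhf[OF \<alpha>(2) t cN[OF W(1), unfolded N_def]])
        (intro herf_ler herf_add herf_scaleR herf_adv s A W)
    then show ?thesis
      unfolding \<Phi>_def using herf_heatf[OF \<alpha>(2) t w0(2)] by (simp add: herf_def her_diff)
  qed
  define X where "X = {W :: real \<Rightarrow>\<^sub>C 'd field. (\<forall>t. norm (apply_bcontfun W t) \<le> 2 * \<delta>) \<and> (\<forall>t. herf (apply_bcontfun W t))}"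
  \<comment> \<open>Bounded continuous functions are taken on the whole real line, so the image is
    frozen at its initial value for negative times.\<close>
  define F where "F W = Bcontfun (\<lambda>t. \<Phi> (apply_bcontfun W) (max 0 t))" for W
  have F: "apply_bcontfun (F W) = (\<lambda>t. \<Phi> (apply_bcontfun W) (max 0 t))" if "W \<in> X" for W
    unfolding F_def
  proof (rule Bcontfun_inverse)
    have "continuous_on UNIV (\<lambda>t. \<Phi> (apply_bcontfun W) (max 0 t))"
      by (rule continuous_on_compose2[OF cP]) (auto intro!: continuous_intros)
    moreover have "bounded (range (\<lambda>t. \<Phi> (apply_bcontfun W) (max 0 t)))"
      using that by (auto simp: bounded_iff X_def intro!: exI[of _ "2 * \<delta>"] nP)
    ultimately show "(\<lambda>t. \<Phi> (apply_bcontfun W) (max 0 t)) \<in> bcontfun" by (simp add: bcontfun_def)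
  qed
  have "closed X"
    unfolding closed_sequential_limits
  proof (intro allI impI, elim conjE)
    fix x l assume x: "\<forall>n. x n \<in> X" and l: "x \<longlonglongrightarrow> l"
    have lim: "(\<lambda>n. apply_bcontfun (x n) t) \<longlonglongrightarrow> apply_bcontfun l t" for t
      by (rule metric_tendsto_imp_tendsto[OF l]) (auto intro!: always_eventually dist_bounded)
    have "norm (apply_bcontfun l t) \<le> 2 * \<delta>" for t
      by (rule LIMSEQ_le_const2[OF tendsto_norm[OF lim]]) (use x in \<open>auto simp: X_def\<close>)
    moreover have "herf (apply_bcontfun l t)" for t
      unfolding herf_def her_def
    proof (intro allI)
      fix j and \<xi> :: "int^'d"
      have c: "(\<lambda>n. coef (apply_bcontfun (x n) t $ j) \<zeta>) \<longlonglongrightarrow> coef (apply_bcontfun l t $ j) \<zeta>" for \<zeta>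
        by (intro tendsto_coef tendsto_vec_nth lim)
      have "(\<lambda>n. coef (apply_bcontfun (x n) t $ j) (- \<xi>)) \<longlonglongrightarrow> cnj (coef (apply_bcontfun l t $ j) \<xi>)"
        using tendsto_cnj[OF c[of \<xi>]] x by (simp add: X_def herf_def her_def)
      with c[of "- \<xi>"] show "coef (apply_bcontfun l t $ j) (- \<xi>) = cnj (coef (apply_bcontfun l t $ j) \<xi>)"
        by (rule LIMSEQ_unique)
    qed
    ultimately show "l \<in> X" by (simp add: X_def)
  qed
  then have "complete X" by (simp add: complete_eq_closed)
  moreover have "0 \<in> X" using \<delta> by (simp add: X_def herf_def her_def)
  then have "X \<noteq> {}" by blast
  moreover have "F ` X \<subseteq> X"
  proof (intro image_subsetI)
    fix W assume W: "W \<in> X"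
    then have "norm (\<Phi> (apply_bcontfun W) (max 0 t)) \<le> 2 * \<delta>" "herf (\<Phi> (apply_bcontfun W) (max 0 t))" for t
      by (auto intro!: nP hP simp: X_def)
    then show "F W \<in> X" using F[OF W] by (simp add: X_def)
  qed
  moreover have "dist (F W) (F V) \<le> 1/2 * dist W V" if "W \<in> X" "V \<in> X" for W V
  proof (rule dist_bound)
    fix t
    have "norm (apply_bcontfun W r - apply_bcontfun V r) \<le> dist W V" for r
      using dist_bounded[of W r V] by (simp add: dist_norm)
    then show "dist (apply_bcontfun (F W) t) (apply_bcontfun (F V) t) \<le> 1/2 * dist W V"
      unfolding F[OF that(1)] F[OF that(2)] dist_norm[of "\<Phi> _ _"]
      by (intro dP) (use that in \<open>auto simp: X_def\<close>)
  qed
  ultimately have "\<exists>!W. W \<in> X \<and> F W = W"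
    by (intro Banach_fix[where c="1/2"]) auto
  then obtain W where W: "W \<in> X" "F W = W" by blast
  show ?thesis
  proof (rule that[of "apply_bcontfun W"])
    fix t :: real assume t: "0 \<le> t"
    show "norm (apply_bcontfun W t) \<le> 2 * \<delta>" "herf (apply_bcontfun W t)" using W by (auto simp: X_def)
    show "apply_bcontfun W t = heatf \<alpha> t w0 - duhf \<alpha> (\<lambda>\<tau>. ler (adv s (A \<tau>) (W \<tau>) + adv s (W \<tau>) (A \<tau>)
        + exp (- \<alpha> * \<tau>) *\<^sub>R adv s (W \<tau>) (W \<tau>))) t"
      using fun_cong[OF F[OF W(1)], of t] t unfolding W(2) by (simp add: \<Phi>_def N_def max_def)
  qed simp
qed

lemma heatf_0:
  assumes "\<alpha> < 1" "\<And>j. coef (w $ j) 0 = 0"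
  shows "heatf \<alpha> 0 w = w"
  unfolding vec_eq_iff
  by (intro allI ell2_eqI) (use assms in \<open>auto simp: coef_heatf hmult_def\<close>)

lemma duhf_0: "\<alpha> < 1 \<Longrightarrow> continuous_on {0..} G \<Longrightarrow> duhf \<alpha> G 0 = 0"
  unfolding vec_eq_iff by (intro allI ell2_eqI) (simp add: coef_duhf)

text \<open>\<open>\<delta>\<close> and \<open>C\<close> are chosen before the background
  \<open>A\<close> and the datum \<open>w0\<close>, so they depend only on \<open>s\<close>,
  \<open>\<alpha>\<close>, \<open>C0\<close> and the dimension; the uniformity of the final theorem
  rests on this order. \<open>V\<close> is the time derivative in H^(s-2), returned explicitly
  because its decay is claimed as well.\<close>

theorem coefficient_existence:
  fixes s \<alpha> C0 :: real
  assumes s: "s > real CARD('d::finite) / 2 + 1" and \<alpha>: "0 < \<alpha>" "\<alpha> < 1" and C0: "0 < C0"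
  shows "\<exists>\<delta> C. 0 < \<delta> \<and> \<delta> < 1 \<and> 0 < C \<and> (\<forall>A (w0 :: 'd field).
    continuous_on {0..} A \<and> (\<forall>t\<ge>0. norm (A t) \<le> C0 * \<delta> \<and> herf (A t) \<and> divfree (A t)) \<and>
    norm w0 \<le> \<delta> \<and> herf w0 \<and> divfree w0 \<and> (\<forall>j. coef (w0 $ j) 0 = 0) \<longrightarrow>
    (\<exists>w q V. w 0 = w0 \<and> continuous_on {0..} w \<and> continuous_on {0..} q \<and> continuous_on {0..} V \<and>
      (\<forall>t\<ge>0. herf (w t) \<and> divfree (w t) \<and> (\<forall>j. coef (w t $ j) 0 = 0) \<and> her (q t) \<and> coef (q t) 0 = 0 \<and>
        norm (w t) \<le> C * \<delta> * exp (- \<alpha> * t) \<and> norm (q t) \<le> C * \<delta> * exp (- \<alpha> * t) \<and>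
        norm (V t) \<le> C * \<delta> * exp (- \<alpha> * t) \<and>
        V t = Lf (w t) - Jf (adv s (A t) (w t) + adv s (w t) (A t) + adv s (w t) (w t)) - Jf (gradf (q t)) \<and>
        ((\<lambda>\<tau>. Jf (Jf (w \<tau>))) has_vector_derivative V t) (at t within {0..}))))"
proof -
  interpret B: bounded_bilinear "adv s :: 'd field \<Rightarrow> _" by (rule bounded_bilinear_adv[OF s])
  interpret L: bounded_linear "ler :: 'd field \<Rightarrow> _" by (rule bounded_linear_ler)
  interpret P: bounded_linear "prs :: 'd field \<Rightarrow> _" by (rule bounded_linear_prs)
  obtain Ka where Ka: "0 < Ka" "\<And>a c :: 'd field. norm (adv s a c) \<le> norm a * norm c * Ka"
    using B.pos_bounded by blast
  obtain Kl where Kl: "0 < Kl" "\<And>a :: 'd field. norm (ler a) \<le> norm a * Kl" using L.pos_bounded by blast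
  obtain Kp where Kp: "0 < Kp" "\<And>a :: 'd field. norm (prs a) \<le> norm a * Kp" using P.pos_bounded by blast
  obtain KJ where KJ: "0 < KJ" "\<And>a :: 'd field. norm (Jf a) \<le> norm a * KJ"
    using bounded_linear.pos_bounded[OF bounded_linear_Jf] by blast
  obtain KL where KL: "0 < KL" "\<And>a :: 'd field. norm (Lf a) \<le> norm a * KL"
    using bounded_linear.pos_bounded[OF bounded_linear_Lf] by blast
  obtain Kg where Kg: "0 < Kg" "\<And>a :: (int^'d) ell2. norm (gradf a) \<le> norm a * Kg"
    using bounded_linear.pos_bounded[OF bounded_linear_gradf] by blast
  define K where "K = real CARD('d) * (duhamel_const \<alpha> * (Kl * Ka))"
  have K: "0 \<le> K" using duhamel_const_nonneg[OF \<alpha>(2)] Ka Kl by (simp add: K_def)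
  \<comment> \<open>Solves \<open>\<delta> * (4 * C0 + 4) = 1 / (2 * (K + 1))\<close>: multiplied by
    \<open>K\<close> this is at most 1/2, and by itself it is below 1, which also yields
    \<open>\<delta> < 1\<close>.\<close>
  define \<delta> where "\<delta> = 1 / (2 * (K + 1)) / (4 * C0 + 4)"
  have \<delta>0: "0 < \<delta>" using K C0 by (simp add: \<delta>_def)
  have \<delta>K: "\<delta> * (4 * C0 + 4) = 1 / (2 * (K + 1))" using C0 by (simp add: \<delta>_def)
  have "\<delta> * 1 \<le> \<delta> * (4 * C0 + 4)" using \<delta>0 C0 by (intro mult_left_mono) auto
  also have "\<dots> < 1" unfolding \<delta>K using K by simp
  finally have \<delta>1: "\<delta> < 1" by simp
  have small: "K * (\<delta> * (4 * C0 + 4)) \<le> 1 / 2" unfolding \<delta>K using K by (simp add: field_simps)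
  \<comment> \<open>Bounds the advection terms by the same count as in the contraction:
    \<open>4 * C0\<close> from the two terms containing \<open>A\<close>, and 4 from the quadratic
    one.\<close>
  define Cn where "Cn = Ka * (4 * C0 + 4)"
  have Cn: "0 < Cn" using Ka C0 by (simp add: Cn_def)
  \<comment> \<open>The three groups bound, in this order, the perturbation of the velocity, of the
    pressure, and of the time derivative.\<close>
  define C where "C = 2 + Cn * Kp + (2 * KL + Cn * KJ + Cn * Kp * Kg * KJ)"
  have C: "0 < C" "2 \<le> C" "Cn * Kp \<le> C" "2 * KL + Cn * KJ + Cn * Kp * Kg * KJ \<le> C"
    using Cn Kp KL KJ Kg by (auto simp: C_def add_pos_pos less_imp_le)
  show ?thesis
  proof (rule exI[of _ \<delta>], rule exI[of _ C], intro conjI \<delta>0 \<delta>1 C(1) allI impI, elim conjE)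
    fix A :: "real \<Rightarrow> 'd field" and w0 :: "'d field"
    assume Ac: "continuous_on {0..} A" and A: "\<forall>t\<ge>0. norm (A t) \<le> C0 * \<delta> \<and> herf (A t) \<and> divfree (A t)"
      and w0: "norm w0 \<le> \<delta>" "herf w0" "divfree w0" "\<forall>j. coef (w0 $ j) 0 = 0"
    obtain W where Wc: "continuous_on {0..} W" and Wn: "\<And>t. 0 \<le> t \<Longrightarrow> norm (W t) \<le> 2 * \<delta>"
      and Wh: "\<And>t. 0 \<le> t \<Longrightarrow> herf (W t)"
      and W: "\<And>t. 0 \<le> t \<Longrightarrow> W t = heatf \<alpha> t w0 - duhf \<alpha> (\<lambda>\<tau>. ler (adv s (A \<tau>) (W \<tau>) + adv s (W \<tau>) (A \<tau>)
        + exp (- \<alpha> * \<tau>) *\<^sub>R adv s (W \<tau>) (W \<tau>))) t"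
      by (rule mild_fixed_point[OF s _ \<alpha>(2) _ \<delta>0 Ka Kl small[unfolded K_def] Ac _ _ w0(1,2)])
        (use A \<alpha> C0 in auto)
    define w where "w t = exp (- \<alpha> * t) *\<^sub>R W t" for t
    define n where "n t = adv s (A t) (w t) + adv s (w t) (A t) + adv s (w t) (w t)" for t
    define q where "q t = prs (n t)" for t
    define V where "V t = Lf (w t) - Jf (n t) - Jf (gradf (q t))" for t
    have wc: "continuous_on {0..} w" unfolding w_def by (intro continuous_intros Wc)
    have nc: "continuous_on {0..} n" unfolding n_def by (intro continuous_intros B.continuous_on Ac wc)
    have qc: "continuous_on {0..} q" unfolding q_def by (intro P.continuous_on nc)
    have Vc: "continuous_on {0..} V" unfolding V_def
      by (intro continuous_intros bounded_linear.continuous_on[OF bounded_linear_Lf wc]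
        bounded_linear.continuous_on[OF bounded_linear_Jf] nc bounded_linear.continuous_on[OF bounded_linear_gradf qc])
    have e: "exp (\<alpha> * \<tau>) * exp (- \<alpha> * \<tau>) = 1" for \<tau> by (simp flip: exp_add)
    have nW: "exp (\<alpha> * \<tau>) *\<^sub>R n \<tau> = adv s (A \<tau>) (W \<tau>) + adv s (W \<tau>) (A \<tau>) + exp (- \<alpha> * \<tau>) *\<^sub>R adv s (W \<tau>) (W \<tau>)" for \<tau>
      unfolding n_def w_def B.scaleR_left B.scaleR_right scaleR_add_right scaleR_scaleR mult.assoc[symmetric] e by simp
    have mild: "w t = exp (- \<alpha> * t) *\<^sub>R (heatf \<alpha> t w0 - duhf \<alpha> (\<lambda>\<tau>. exp (\<alpha> * \<tau>) *\<^sub>R ler (n \<tau>)) t)" if "0 \<le> t" for t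
      unfolding w_def W[OF that] nW[symmetric] L.scaleR ..
    have lc: "continuous_on {0..} (\<lambda>\<tau>. exp (\<alpha> * \<tau>) *\<^sub>R ler (n \<tau>))" by (intro continuous_intros L.continuous_on nc)
    have wd: "divfree (w t)" if "0 \<le> t" for t
      unfolding mild[OF that] by (rule divfree_mild[OF \<alpha>(2) nc w0(3) that])
    have wz: "coef (w t $ j) 0 = 0" if "0 \<le> t" for t j
      by (simp add: mild[OF that] coef_heatf[OF \<alpha>(2) that] coef_duhf[OF \<alpha>(2) that lc] hmult_def)
    have wh: "herf (w t)" if "0 \<le> t" for t unfolding w_def by (intro herf_scaleR Wh that)
    have nh: "herf (n t)" if "0 \<le> t" for t unfolding n_def using A that by (intro herf_add herf_adv s wh) auto
    have nz: "coef (n t $ j) 0 = 0" if "0 \<le> t" for t j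
      unfolding n_def using A that by (simp add: coef_adv_0[OF s] wd)
    have wn: "norm (w t) \<le> 2 * (\<delta> * exp (- \<alpha> * t))" if "0 \<le> t" for t
      using Wn[OF that] by (simp add: w_def mult_ac)
    have nn: "norm (n t) \<le> Cn * (\<delta> * exp (- \<alpha> * t))" if t: "0 \<le> t" for t
    proof -
      let ?e = "exp (- \<alpha> * t)"
      have At: "norm (A t) \<le> C0 * \<delta>" using A t by auto
      have e1: "?e \<le> 1" using \<alpha> t by simp
      have "norm (n t) \<le> norm (A t) * norm (w t) * Ka + norm (w t) * norm (A t) * Ka + norm (w t) * norm (w t) * Ka"
        unfolding n_def by (intro order_trans[OF norm_triangle_ineq] add_mono Ka)
      also have "\<dots> \<le> (C0 * \<delta>) * (2 * (\<delta> * ?e)) * Ka + (2 * (\<delta> * ?e)) * (C0 * \<delta>) * Ka + (2 * (\<delta> * ?e)) * (2 * \<delta>) * Ka"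
      proof (intro add_mono mult_mono3 At wn[OF t] norm_ge_zero less_imp_le[OF Ka(1)])
        have "\<delta> * ?e \<le> \<delta>" using \<delta>0 e1 by (simp add: mult_le_cancel_left1)
        then show "norm (w t) \<le> 2 * \<delta>" using wn[OF t] by linarith
      qed
      also have "\<dots> = \<delta> * (Cn * (\<delta> * ?e))" by (simp add: Cn_def algebra_simps)
      \<comment> \<open>The products are of second order in \<open>\<delta>\<close>; the surplus
        factor is given away by \<open>\<delta> < 1\<close>.\<close>
      also have "\<dots> \<le> 1 * (Cn * (\<delta> * ?e))" using \<delta>1 \<delta>0 Cn by (intro mult_right_mono) auto
      finally show ?thesis by simp
    qed
    have qn: "norm (q t) \<le> Cn * Kp * (\<delta> * exp (- \<alpha> * t))" if "0 \<le> t" for t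
    proof -
      have "norm (q t) \<le> norm (n t) * Kp" unfolding q_def by (rule Kp)
      also have "\<dots> \<le> Cn * (\<delta> * exp (- \<alpha> * t)) * Kp" using Kp by (intro mult_right_mono nn that) auto
      finally show ?thesis by (simp add: mult_ac)
    qed
    have Vn: "norm (V t) \<le> (2 * KL + Cn * KJ + Cn * Kp * Kg * KJ) * (\<delta> * exp (- \<alpha> * t))" if t: "0 \<le> t" for t
    proof -
      have "norm (V t) \<le> norm (Lf (w t)) + norm (Jf (n t)) + norm (Jf (gradf (q t)))"
        unfolding V_def by (intro order_trans[OF norm_triangle_ineq4] add_mono order_refl)
      also have "\<dots> \<le> norm (w t) * KL + norm (n t) * KJ + norm (q t) * Kg * KJ"
        using KJ Kg by (intro add_mono KL KJ order_trans[OF KJ(2)] mult_right_mono Kg) auto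
      also have "\<dots> \<le> (2 * (\<delta> * exp (- \<alpha> * t))) * KL + (Cn * (\<delta> * exp (- \<alpha> * t))) * KJ + (Cn * Kp * (\<delta> * exp (- \<alpha> * t))) * Kg * KJ"
        using KL KJ Kg by (intro add_mono mult_right_mono wn nn qn t) auto
      finally show ?thesis by (simp add: algebra_simps)
    qed
    have final: "x \<le> C * \<delta> * exp (- \<alpha> * t)" if "x \<le> K * (\<delta> * exp (- \<alpha> * t))" "K \<le> C" for x K t
    proof -
      have "K * (\<delta> * exp (- \<alpha> * t)) \<le> C * (\<delta> * exp (- \<alpha> * t))" using that \<delta>0 by (intro mult_right_mono) auto
      then show ?thesis using that by (simp add: mult.assoc)
    qed
    show "\<exists>w q V. w 0 = w0 \<and> continuous_on {0..} w \<and> continuous_on {0..} q \<and> continuous_on {0..} V \<and>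
      (\<forall>t\<ge>0. herf (w t) \<and> divfree (w t) \<and> (\<forall>j. coef (w t $ j) 0 = 0) \<and> her (q t) \<and> coef (q t) 0 = 0 \<and>
        norm (w t) \<le> C * \<delta> * exp (- \<alpha> * t) \<and> norm (q t) \<le> C * \<delta> * exp (- \<alpha> * t) \<and>
        norm (V t) \<le> C * \<delta> * exp (- \<alpha> * t) \<and>
        V t = Lf (w t) - Jf (adv s (A t) (w t) + adv s (w t) (A t) + adv s (w t) (w t)) - Jf (gradf (q t)) \<and>
        ((\<lambda>\<tau>. Jf (Jf (w \<tau>))) has_vector_derivative V t) (at t within {0..}))"
    proof (rule exI[of _ w], rule exI[of _ q], rule exI[of _ V], intro conjI allI impI wc qc Vc)
      show "w 0 = w0" using mild[of 0] heatf_0[OF \<alpha>(2), of w0] w0(4) duhf_0[OF \<alpha>(2) lc] by simp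
      fix t :: real assume t: "0 \<le> t"
      show "herf (w t)" "divfree (w t)" "\<And>j. coef (w t $ j) 0 = 0" by (intro wh wd wz t)+
      show "her (q t)" unfolding q_def by (intro her_prs nh t)
      show "coef (q t) 0 = 0" by (simp add: q_def prs_def Pmult_def)
      show "norm (w t) \<le> C * \<delta> * exp (- \<alpha> * t)" by (rule final[OF wn[OF t] C(2)])
      show "norm (q t) \<le> C * \<delta> * exp (- \<alpha> * t)" by (rule final[OF qn[OF t] C(3)])
      show "norm (V t) \<le> C * \<delta> * exp (- \<alpha> * t)" by (rule final[OF Vn[OF t] C(4)])
      show "V t = Lf (w t) - Jf (adv s (A t) (w t) + adv s (w t) (A t) + adv s (w t) (w t)) - Jf (gradf (q t))"
        by (simp add: V_def n_def)
      show "((\<lambda>\<tau>. Jf (Jf (w \<tau>))) has_vector_derivative V t) (at t within {0..})"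
        unfolding V_def q_def by (rule mild_has_vector_derivative[OF \<alpha>(2) nc wc nz mild t])
    qed
  qed
qed

section \<open>Fourier analysis on the torus\<close>

lemma sets_torus: "cbox 0 (\<chi> i. 2 * pi) \<inter> space lborel \<in> sets (lborel :: (real^'d::finite) measure)" by simp

lemma space_torus: "space (torus :: (real^'d::finite) measure) = cbox 0 (\<chi> i. 2 * pi)"
  by (simp add: torus_def space_restrict_space)

lemma measurable_torus [measurable (raw)]: "f \<in> borel_measurable borel \<Longrightarrow> f \<in> measurable torus borel"
  unfolding torus_def by (rule measurable_restrict_space1) simp

lemma measurable_torus_gen: "f \<in> measurable borel M \<Longrightarrow> f \<in> measurable torus M"
  unfolding torus_def by (rule measurable_restrict_space1) simp

definition tvol :: "'d::finite itself \<Rightarrow> real" where "tvol _ = (2 * pi) ^ CARD('d)"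

lemma tvol_pos: "0 < tvol TYPE('d::finite)" by (simp add: tvol_def)

lemma emeasure_torus: "emeasure (torus :: (real^'d::finite) measure) (space torus) = ennreal (tvol TYPE('d))"
proof -
  have "emeasure lborel (cbox 0 (\<chi> i. 2 * pi) :: (real^'d) set) = ennreal (\<Prod>b\<in>Basis. ((\<chi> i. 2 * pi) - 0) \<bullet> (b :: real^'d))"
    by (rule emeasure_lborel_cbox) (auto simp: Basis_vec_def inner_axis)
  also have "(\<Prod>b\<in>Basis. ((\<chi> i. 2 * pi) - 0) \<bullet> (b :: real^'d)) = (\<Prod>b\<in>(Basis :: (real^'d) set). 2 * pi)"
    by (intro prod.cong) (auto simp: Basis_vec_def inner_axis)
  finally have "emeasure lborel (cbox 0 (\<chi> i. 2 * pi) :: (real^'d) set) = ennreal (tvol TYPE('d))"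
    by (simp add: tvol_def)
  then show ?thesis
    unfolding space_torus unfolding torus_def by (subst emeasure_restrict_space) auto
qed

interpretation torus: finite_measure "torus :: (real^'d::finite) measure"
  by standard (simp add: emeasure_torus)

lemma measure_torus: "measure (torus :: (real^'d::finite) measure) (space torus) = tvol TYPE('d)"
  using emeasure_torus[where ?'d='d] tvol_pos[where ?'d='d] by (simp add: measure_def)

definition ex :: "int^'d::finite \<Rightarrow> real^'d \<Rightarrow> complex" where
  "ex \<xi> x = exp (\<i> * complex_of_real (x \<bullet> lattice_vec \<xi>))"

lemma norm_ex [simp]: "cmod (ex \<xi> x) = 1" by (simp add: ex_def)
lemma ex_0 [simp]: "ex 0 x = 1" by (simp add: ex_def)
lemma ex_add: "ex (\<xi> + \<eta>) x = ex \<xi> x * ex \<eta> x" by (simp add: ex_def inner_add_right ring_distribs exp_add)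
lemma ex_diff: "ex (\<xi> - \<eta>) x = ex \<xi> x * ex (- \<eta>) x" using ex_add[of \<xi> "- \<eta>"] by simp
lemma ex_plus: "ex \<xi> (x + y) = ex \<xi> x * ex \<xi> y" by (simp add: ex_def inner_add_left ring_distribs exp_add)
lemma ex_minus: "ex (- \<xi>) x = cnj (ex \<xi> x)" by (simp add: ex_def exp_cnj)
lemma continuous_ex [continuous_intros]: "continuous_on A f \<Longrightarrow> continuous_on A (\<lambda>x. ex \<xi> (f x))"
  unfolding ex_def by (intro continuous_intros)
lemma measurable_ex [measurable]: "ex \<xi> \<in> borel_measurable borel"
  by (rule borel_measurable_continuous_onI) (intro continuous_intros)

lemma ex_periodic: "ex \<xi> (x + axis i (2 * pi)) = ex \<xi> x"
proof -
  have "ex \<xi> (axis i (2 * pi)) = 1"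
    unfolding ex_def exp_eq_1 by (auto simp: inner_axis' intro!: exI[of _ "\<xi> $ i"])
  then show ?thesis by (simp add: ex_plus)
qed

lemma integral_ex_1d:
  "(\<integral>y. indicator {0..2 * pi} y *\<^sub>R exp (\<i> * of_real (y * of_int k)) \<partial>lborel) = (if k = 0 then of_real (2 * pi) else 0)"
  "integrable lborel (\<lambda>y. indicator {0..2 * pi} y *\<^sub>R exp (\<i> * of_real (y * of_int k)) :: complex)"
proof -
  let ?f = "\<lambda>y. exp (\<i> * complex_of_real (y * of_int k))"
  have c: "continuous_on {0..2*pi} ?f" by (intro continuous_intros)
  have "has_bochner_integral lborel (\<lambda>y. indicator {0..2 * pi} y *\<^sub>R ?f y) (if k = 0 then of_real (2 * pi) else 0)"
  proof (cases "k = 0")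
    case True
    have "has_bochner_integral lborel (\<lambda>y. indicator {0..2 * pi} y *\<^sub>R ?f y) (complex_of_real (2 * pi) - complex_of_real 0)"
      by (rule has_bochner_integral_FTC_Icc[OF _ _ c]) (auto simp: True intro!: derivative_eq_intros)
    then show ?thesis using True by simp
  next
    case False
    let ?F = "\<lambda>y. exp (\<i> * complex_of_real (y * of_int k)) / (\<i> * of_int k)"
    have "has_bochner_integral lborel (\<lambda>y. indicator {0..2 * pi} y *\<^sub>R ?f y) (?F (2 * pi) - ?F 0)"
    proof (rule has_bochner_integral_FTC_Icc[OF _ _ c])
      fix x :: real
      have "((\<lambda>z. exp (\<i> * (z * of_int k)) / (\<i> * of_int k)) has_field_derivative exp (\<i> * (of_real x * of_int k))) (at (of_real x))"
        using False by (auto intro!: derivative_eq_intros simp: mult_ac)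
      from has_vector_derivative_real_field[OF this]
      show "(?F has_vector_derivative ?f x) (at x within {0..2 * pi})" by (simp add: has_vector_derivative_at_within)
    qed simp
    moreover have "exp (\<i> * complex_of_real (2 * pi * of_int k)) = 1"
      unfolding exp_eq_1 by (auto intro!: exI[of _ k])
    ultimately show ?thesis using False by simp
  qed
  then show "(\<integral>y. indicator {0..2 * pi} y *\<^sub>R ?f y \<partial>lborel) = (if k = 0 then of_real (2 * pi) else 0)"
    "integrable lborel (\<lambda>y. indicator {0..2 * pi} y *\<^sub>R ?f y)"
    by (auto simp: has_bochner_integral_iff)
qed

text \<open>Both the indicator of the box and the exponential factor over the coordinates, so Fubini
  reduces to one dimension. Lebesgue measure is the image of a product measure indexed by basis
  vectors rather than by the index type, so frequencies are transported along
  \<open>axis i 1\<close>; this is the purpose of \<open>k\<close>.\<close>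

lemma integral_ex:
  "(\<integral>x. ex \<xi> x \<partial>(torus :: (real^'d::finite) measure)) = (if \<xi> = 0 then of_real (tvol TYPE('d)) else 0)"
proof -
  define k where "k b = \<xi> $ (THE i. b = axis i (1::real))" for b :: "real^'d"
  have k: "k (axis i 1) = \<xi> $ i" for i unfolding k_def by (auto simp: axis_eq_axis)
  define g where "g b y = indicator {0..2 * pi} y *\<^sub>R exp (\<i> * complex_of_real (y * of_int (k b)))" for b y
  interpret product_sigma_finite "\<lambda>_ :: real^'d. lborel :: real measure" by standard
  have B: "(Basis :: (real^'d) set) = (\<lambda>i. axis i 1) ` UNIV" by (auto simp: Basis_vec_def)
  have inj: "inj (\<lambda>i :: 'd. axis i (1::real))" by (auto simp: inj_on_def axis_eq_axis)
  have prod: "indicator (cbox 0 (\<chi> i. 2 * pi)) (\<Sum>b\<in>Basis. f b *\<^sub>R b) *\<^sub>R ex \<xi> (\<Sum>b\<in>Basis. f b *\<^sub>R b) = (\<Prod>b\<in>Basis. g b (f b))"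
    for f :: "real^'d \<Rightarrow> real"
  proof -
    define X where "X = (\<Sum>b\<in>Basis. f b *\<^sub>R b :: real^'d)"
    have x: "X $ i = f (axis i 1)" for i
      unfolding X_def B sum.reindex[OF inj] by (simp add: axis_def if_distrib cong: if_cong)
    have "X \<bullet> lattice_vec \<xi> = (\<Sum>i\<in>UNIV. f (axis i 1) * of_int (\<xi> $ i))" by (simp add: inner_vec_def x)
    then have "ex \<xi> X = (\<Prod>i\<in>UNIV. exp (\<i> * complex_of_real (f (axis i 1) * of_int (\<xi> $ i))))"
      by (simp add: ex_def sum_distrib_left exp_sum)
    moreover have "indicator (cbox 0 (\<chi> i. 2 * pi)) X = (\<Prod>i\<in>UNIV. indicator {0..2*pi} (f (axis i 1)) :: real)"
      by (auto simp: indicator_def mem_box_cart x prod_zero_iff)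
    ultimately show ?thesis
      unfolding X_def[symmetric] unfolding B prod.reindex[OF inj]
      by (simp add: g_def k scaleR_conv_of_real prod.distrib)
  qed
  have ig: "integral\<^sup>L lborel (g b) = (if k b = 0 then of_real (2 * pi) else 0)" for b
    unfolding g_def[abs_def] by (rule integral_ex_1d(1))
  have "(\<integral>x. ex \<xi> x \<partial>(torus :: (real^'d) measure)) = (\<integral>x. indicator (cbox 0 (\<chi> i. 2 * pi)) x *\<^sub>R ex \<xi> x \<partial>lborel)"
    unfolding torus_def by (rule integral_restrict_space[OF sets_torus])
  also have "\<dots> = (\<integral>f. (\<Prod>b\<in>Basis. g b (f b)) \<partial>(\<Pi>\<^sub>M b\<in>(Basis :: (real^'d) set). lborel))"
    by (subst lborel_eq, subst integral_distr) (simp_all add: prod)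
  also have "\<dots> = (\<Prod>b\<in>Basis. integral\<^sup>L lborel (g b))"
    by (rule product_integral_prod) (simp, unfold g_def, rule integral_ex_1d(2))
  also have "\<dots> = (\<Prod>i\<in>(UNIV :: 'd set). if \<xi> $ i = 0 then complex_of_real (2 * pi) else 0)"
    unfolding B prod.reindex[OF inj] o_def ig k ..
  also have "\<dots> = (if \<xi> = 0 then of_real (tvol TYPE('d)) else 0)"
    by (auto simp: tvol_def vec_eq_iff intro: prod_zero)
  finally show ?thesis .
qed

lemma torus_integrable_bounded:
  fixes f :: "real^'d::finite \<Rightarrow> 'b::{banach, second_countable_topology}"
  assumes "f \<in> borel_measurable borel" "\<And>x. norm (f x) \<le> B"
  shows "integrable torus f"
  using assms by (intro torus.integrable_const_bound[where B=B]) auto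

lemma integrable_mult_bounded:
  fixes u T :: "'a \<Rightarrow> 'b::{real_normed_field, banach, second_countable_topology}"
  assumes "integrable M u" "T \<in> borel_measurable M" "\<And>x. norm (T x) \<le> B"
  shows "integrable M (\<lambda>x. u x * T x)"
proof (rule Bochner_Integration.integrable_bound)
  show "integrable M (\<lambda>x. B * norm (u x))" using assms by simp
  have "0 \<le> B" using assms(3)[of undefined] norm_ge_zero order_trans by blast
  then show "AE x in M. norm (u x * T x) \<le> norm (B * norm (u x))"
    using assms(3) by (auto simp: norm_mult mult.commute[of B] abs_mult intro!: mult_left_mono)
qed (use assms in measurable)

section \<open>Trigonometric polynomials and uniform approximation\<close>

inductive trigp :: "(real^'d::finite \<Rightarrow> complex) \<Rightarrow> bool" where
  base: "trigp (\<lambda>x. c * ex \<xi> x)"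
| add: "trigp S \<Longrightarrow> trigp T \<Longrightarrow> trigp (\<lambda>x. S x + T x)"

lemma trigp_const: "trigp (\<lambda>x. c)"
  using trigp.base[of c 0] by simp

lemma trigp_sum: "(\<And>i. i \<in> I \<Longrightarrow> trigp (f i)) \<Longrightarrow> trigp (\<lambda>x. \<Sum>i\<in>I. f i x)"
  by (induction I rule: infinite_finite_induct) (auto intro: trigp_const trigp.add)

lemma trigp_mult:
  assumes "trigp S" "trigp T"
  shows "trigp (\<lambda>x. S x * T x)"
  using assms
proof (induction rule: trigp.induct)
  case (base c \<xi>)
  from base show ?case
  proof (induction rule: trigp.induct)
    case (base d \<eta>)
    show ?case using trigp.base[of "c * d" "\<xi> + \<eta>"] by (simp add: ex_add mult_ac)
  next
    case (add S T)
    then show ?case by (simp add: ring_distribs trigp.add)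
  qed
next
  case (add S S')
  then show ?case by (simp add: ring_distribs trigp.add)
qed

lemma trigp_measurable: "trigp T \<Longrightarrow> T \<in> borel_measurable borel"
  by (induction rule: trigp.induct) auto

lemma trigp_bounded: "trigp T \<Longrightarrow> \<exists>B. \<forall>x. cmod (T x) \<le> B"
proof (induction rule: trigp.induct)
  case (base c \<xi>)
  then show ?case by (auto simp: norm_mult intro!: exI[of _ "cmod c"])
next
  case (add S T)
  then show ?case by (metis add_mono norm_triangle_le)
qed

lemma trigp_integrable: "trigp T \<Longrightarrow> integrable torus T"
  using trigp_bounded trigp_measurable torus_integrable_bounded by blast

text \<open>Realises the torus as a product of unit circles in \<open>complex^'d\<close>.
  \<open>tL\<close> selects angles by \<open>Arg2pi\<close>, hence jumps across the cut; for a
  periodic \<open>u\<close> the composite \<open>u (tL (tE x))\<close> is nevertheless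
  \<open>u x\<close>.\<close>

definition tE :: "real^'d::finite \<Rightarrow> complex^'d" where "tE x = (\<chi> i. exp (\<i> * complex_of_real (x $ i)))"
definition tL :: "complex^'d::finite \<Rightarrow> real^'d" where "tL z = (\<chi> i. Arg2pi (z $ i))"

lemma continuous_tE: "continuous_on A tE"
  unfolding tE_def by (intro continuous_intros)

text \<open>A real-linear functional of \<open>tE x\<close> is a combination of the cosines and
  sines of the coordinates, hence of exponentials with frequencies \<open>axis i 1\<close> and
  \<open>- axis i 1\<close>. Sums and products stay among trigonometric polynomials.\<close>

lemma trigp_tE:
  fixes p :: "complex^'d::finite \<Rightarrow> real"
  assumes "real_polynomial_function p"
  shows "trigp (\<lambda>x. complex_of_real (p (tE x)))"
  using assms
proof (induction rule: real_polynomial_function.induct)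
  case (linear f)
  have "complex_of_real (f (tE x)) = (\<Sum>i\<in>UNIV. (f (axis i 1) / 2 - \<i> * f (axis i \<i>) / 2) * ex (axis i 1) x
      + (f (axis i 1) / 2 + \<i> * f (axis i \<i>) / 2) * ex (- axis i 1) x)" for x :: "real^'d"
  proof -
    have z: "tE x = (\<Sum>i\<in>UNIV. cos (x $ i) *\<^sub>R axis i 1 + sin (x $ i) *\<^sub>R axis i \<i>)"
      by (auto simp: vec_eq_iff tE_def axis_def if_distrib complex_eq_iff Re_exp Im_exp cong: if_cong)
    have e: "ex (axis i 1) x = cos (x $ i) + \<i> * sin (x $ i)" "ex (- axis i 1) x = cos (x $ i) - \<i> * sin (x $ i)" for i
    proof -
      have "lattice_vec (axis i 1) = (axis i 1 :: real^'d)" by (auto simp: vec_eq_iff axis_def)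
      then show "ex (axis i 1) x = cos (x $ i) + \<i> * sin (x $ i)"
        by (simp add: ex_def inner_axis complex_eq_iff Re_exp Im_exp)
      then show "ex (- axis i 1) x = cos (x $ i) - \<i> * sin (x $ i)" by (simp add: ex_minus complex_eq_iff)
    qed
    interpret f: bounded_linear f by fact
    have "f (tE x) = (\<Sum>i\<in>UNIV. cos (x $ i) * f (axis i 1) + sin (x $ i) * f (axis i \<i>))"
      unfolding z f.sum by (simp add: f.add f.scaleR)
    then show ?thesis unfolding e by (simp add: algebra_simps)
  qed
  then show ?case by (simp only:) (intro trigp_sum trigp.add trigp.base)
next
  case (const c)
  then show ?case by (rule trigp_const)
next
  case (add f g)
  then show ?case by (simp add: trigp.add)
next
  case (mult f g)
  then show ?case by (simp add: trigp_mult)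
qed

lemma tE_tL: "(\<And>i. cmod (z $ i) = 1) \<Longrightarrow> tE (tL z) = z"
  using complex_norm_eq_1_exp by (simp add: tE_def tL_def vec_eq_iff)

lemma tE_tL_tE: "tE (tL (tE x)) = tE x"
  by (rule tE_tL) (simp add: tE_def)

lemma torus_periodic_int:
  assumes "torus_periodic u"
  shows "u (x + axis i (2 * pi * of_int n)) = u x"
proof (induction n rule: int_induct[where k=0])
  case base
  then show ?case by (simp add: axis_def zero_vec_def[symmetric] cong: if_cong)
next
  case (step1 n)
  have "x + axis i (2 * pi * of_int (n + 1)) = (x + axis i (2 * pi * of_int n)) + axis i (2 * pi)"
    by (simp add: vec_eq_iff axis_def algebra_simps)
  then show ?case using assms step1 unfolding torus_periodic_def by metis
next
  case (step2 n)
  have "x + axis i (2 * pi * of_int n) = (x + axis i (2 * pi * of_int (n - 1))) + axis i (2 * pi)"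
    by (simp add: vec_eq_iff axis_def algebra_simps)
  then show ?case using assms step2 unfolding torus_periodic_def by metis
qed

lemma torus_periodic_lattice:
  assumes "torus_periodic u"
  shows "u (x + (2 * pi) *\<^sub>R lattice_vec n) = u x"
proof -
  have "u (x + (\<Sum>i\<in>I. axis i (2 * pi * of_int (n $ i)))) = u x" if "finite I" for I
    using that
  proof (induction I)
    case (insert i I)
    have "u (x + (\<Sum>i\<in>I. axis i (2 * pi * of_int (n $ i))) + axis i (2 * pi * of_int (n $ i))) = u x"
      using torus_periodic_int[OF assms] insert by metis
    then show ?case using insert by (simp add: add_ac)
  qed simp
  moreover have "(\<Sum>i\<in>UNIV. axis i (2 * pi * of_int (n $ i))) = (2 * pi) *\<^sub>R lattice_vec n"
    by (simp add: vec_eq_iff axis_def if_distrib cong: if_cong)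
  ultimately show ?thesis by (metis finite_class.finite_UNIV)
qed

lemma periodic_tL_tE:
  assumes "torus_periodic u"
  shows "u (tL (tE x)) = u x"
proof -
  have "\<exists>n::int. x $ i = tL (tE x) $ i + 2 * pi * of_int n" for i
  proof -
    have "exp (\<i> * complex_of_real (x $ i)) = exp (\<i> * complex_of_real (tL (tE x) $ i))"
      using tE_tL_tE[of x] by (simp add: tE_def vec_eq_iff)
    then obtain n :: int where "\<i> * complex_of_real (x $ i) = \<i> * complex_of_real (tL (tE x) $ i) + of_int (2 * n) * (of_real pi * \<i>)"
      by (auto simp: exp_eq)
    then have "Im (\<i> * complex_of_real (x $ i)) = Im (\<i> * complex_of_real (tL (tE x) $ i) + of_int (2 * n) * (of_real pi * \<i>))" by simp
    then show ?thesis by (intro exI[of _ n]) simp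
  qed
  then have "\<exists>n. \<forall>i. x $ i = tL (tE x) $ i + 2 * pi * of_int (n i)" by (intro choice allI)
  then obtain n where n: "\<And>i. x $ i = tL (tE x) $ i + 2 * pi * of_int (n i)" by blast
  have "tL (tE x) + (2 * pi) *\<^sub>R lattice_vec (\<chi> i. n i) = x"
    unfolding vec_eq_iff by (simp add: n[symmetric])
  then show ?thesis using torus_periodic_lattice[OF assms, of "tL (tE x)" "\<chi> i. n i"] by simp
qed

lemma tL_in_torus: "tL z \<in> cbox 0 (\<chi> i. 2 * pi)"
  by (simp add: tL_def mem_box_cart Arg2pi_ge_0 less_imp_le[OF Arg2pi_lt_2pi])

lemma compact_range_tE: "compact (range (tE :: real^'d::finite \<Rightarrow> _))"
proof -
  have "range tE = tE ` (cbox 0 (\<chi> i. 2 * pi) :: (real^'d) set)"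
  proof (intro equalityI subsetI)
    fix z :: "complex^'d" assume "z \<in> range tE"
    then obtain x where "z = tE x" by blast
    then have "z = tE (tL (tE x))" by (simp only: tE_tL_tE)
    then show "z \<in> tE ` cbox 0 (\<chi> i. 2 * pi)" using tL_in_torus by blast
  qed auto
  then show ?thesis by (simp add: compact_continuous_image continuous_tE)
qed

text \<open>Stone--Weierstrass on the compact range of \<open>tE\<close>, applied to
  \<open>\<psi> \<circ> tL\<close>. This composite is continuous although \<open>tL\<close> is not:
  the preimage of a closed set is the image under \<open>tE\<close> of a compact part of the box,
  hence closed.\<close>

lemma periodic_trigp_approx:
  fixes \<psi> :: "real^'d::finite \<Rightarrow> real"
  assumes c: "continuous_on UNIV \<psi>" and p: "torus_periodic \<psi>" and e: "0 < e"
  obtains T where "trigp T" "\<And>x. cmod (complex_of_real (\<psi> x) - T x) < e"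
proof -
  let ?S = "range (tE :: real^'d \<Rightarrow> _)"
  have cl: "closed ?S" by (rule compact_imp_closed[OF compact_range_tE])
  have "continuous_on ?S (\<psi> \<circ> tL)"
    unfolding continuous_on_closed_vimage[OF cl]
  proof (intro allI impI)
    fix C :: "real set" assume C: "closed C"
    have "(\<psi> \<circ> tL) -` C \<inter> ?S = tE ` (cbox 0 (\<chi> i. 2 * pi) \<inter> \<psi> -` C)"
    proof (intro set_eqI iffI)
      fix z assume "z \<in> (\<psi> \<circ> tL) -` C \<inter> ?S"
      then obtain x where x: "z = tE x" "\<psi> (tL z) \<in> C" by auto
      then show "z \<in> tE ` (cbox 0 (\<chi> i. 2 * pi) \<inter> \<psi> -` C)"
        by (intro image_eqI[of _ _ "tL z"]) (auto simp: tE_tL_tE tL_in_torus)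
    qed (auto simp: periodic_tL_tE[OF p])
    moreover have "compact (cbox 0 (\<chi> i. 2 * pi) \<inter> \<psi> -` C :: (real^'d) set)"
      using continuous_closed_vimage[OF C] c by (intro compact_Int_closed) (auto simp: continuous_on_eq_continuous_at)
    ultimately show "closed ((\<psi> \<circ> tL) -` C \<inter> ?S)"
      by (simp add: compact_imp_closed compact_continuous_image continuous_tE)
  qed
  from Stone_Weierstrass_real_polynomial_function[OF compact_range_tE this e]
  obtain g where g: "real_polynomial_function g" "\<And>z. z \<in> ?S \<Longrightarrow> \<bar>(\<psi> \<circ> tL) z - g z\<bar> < e" by blast
  show ?thesis
  proof (rule that[OF trigp_tE[OF g(1)]])
    fix x
    show "cmod (complex_of_real (\<psi> x) - complex_of_real (g (tE x))) < e"
      using g(2)[of "tE x"] by (simp add: periodic_tL_tE[OF p] flip: of_real_diff)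
  qed
qed

section \<open>Translation invariance and integration by parts\<close>

lemma torus_integral_norm_le:
  fixes f :: "real^'d::finite \<Rightarrow> 'b::{banach, second_countable_topology}"
  assumes "f \<in> borel_measurable borel" "\<And>x. norm (f x) \<le> e"
  shows "norm (integral\<^sup>L torus f) \<le> e * tvol TYPE('d)"
proof -
  have "norm (integral\<^sup>L torus f) \<le> (\<integral>x. norm (f x) \<partial>torus)" by (rule integral_norm_bound)
  also have "\<dots> \<le> (\<integral>x. e \<partial>(torus :: (real^'d) measure))"
    using torus_integrable_bounded[OF assms] assms(2) by (intro integral_mono) auto
  finally show ?thesis by (simp add: measure_torus mult.commute)
qed

lemma trigp_translate: "trigp T \<Longrightarrow> (\<integral>x. T (x + h) \<partial>torus) = (\<integral>x. T x \<partial>torus)"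
proof (induction rule: trigp.induct)
  case (base c \<xi>)
  have "(\<lambda>x. c * ex \<xi> (x + h)) = (\<lambda>x. (c * ex \<xi> h) * ex \<xi> x)" by (simp add: ex_plus mult_ac)
  then show ?case by (simp add: integral_ex)
next
  case (add S T)
  have R: "integrable torus (\<lambda>x. R (x + h))" if R: "trigp R" for R :: "real^'a \<Rightarrow> complex"
  proof -
    obtain B where B: "\<And>x. cmod (R x) \<le> B" using trigp_bounded[OF R] by blast
    have "(\<lambda>x. R (x + h)) \<in> borel_measurable borel"
      using trigp_measurable[OF R] by measurable
    then show ?thesis by (rule torus_integrable_bounded[OF _ B])
  qed
  show ?case
    using add.IH by (simp add: Bochner_Integration.integral_add[OF R[OF add.hyps(1)] R[OF add.hyps(2)]]
      Bochner_Integration.integral_add[OF trigp_integrable[OF add.hyps(1)] trigp_integrable[OF add.hyps(2)]])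
qed

text \<open>Translation moves the box, so invariance of Lebesgue measure alone does not suffice. For
  exponentials translation is multiplication by a phase, harmless because only the frequency zero
  has a nonzero integral; uniform approximation extends this to continuous periodic
  functions.\<close>

lemma torus_translate:
  fixes \<psi> :: "real^'d::finite \<Rightarrow> real"
  assumes c: "continuous_on UNIV \<psi>" and p: "torus_periodic \<psi>"
  shows "(\<integral>x. complex_of_real (\<psi> (x + h)) \<partial>torus) = (\<integral>x. complex_of_real (\<psi> x) \<partial>torus)" (is "?a = ?b")
proof (rule ccontr)
  assume "?a \<noteq> ?b"
  let ?V = "tvol TYPE('d)"
  \<comment> \<open>Replacing both integrals by those of \<open>T\<close> costs
    \<open>2 * e * ?V\<close>, two thirds of the assumed difference.\<close>
  define e where "e = cmod (?a - ?b) / (3 * ?V)"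
  have e: "0 < e" using \<open>?a \<noteq> ?b\<close> tvol_pos[where ?'d='d] by (simp add: e_def)
  obtain T where T: "trigp T" "\<And>x. cmod (complex_of_real (\<psi> x) - T x) < e"
    by (rule periodic_trigp_approx[OF c p e]) blast
  have m: "(\<lambda>x. complex_of_real (\<psi> (x + k))) \<in> borel_measurable borel" for k
    by (intro borel_measurable_continuous_onI continuous_intros continuous_on_compose2[OF c]) auto
  have mT: "(\<lambda>x. T (x + k)) \<in> borel_measurable borel" for k
    using trigp_measurable[OF T(1)] by measurable
  obtain B where B: "\<And>x. cmod (T x) \<le> B" using trigp_bounded[OF T(1)] by blast
  have "cmod (complex_of_real (\<psi> x)) \<le> e + B" for x
    using T(2)[of x] B[of x] norm_triangle_sub[of "complex_of_real (\<psi> x)" "T x"] by linarith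
  then have i: "integrable torus (\<lambda>x. complex_of_real (\<psi> (x + k)))" for k
    by (intro torus_integrable_bounded m)
  have iT: "integrable torus (\<lambda>x. T (x + k))" for k by (rule torus_integrable_bounded[OF mT B])
  have d: "cmod ((\<integral>x. complex_of_real (\<psi> (x + k)) \<partial>torus) - (\<integral>x. T (x + k) \<partial>torus)) \<le> e * ?V" for k
    using torus_integral_norm_le[of "\<lambda>x. complex_of_real (\<psi> (x + k)) - T (x + k)" e] m mT i iT T(2)
    by (simp add: less_imp_le)
  have "?a - ?b = (?a - (\<integral>x. T (x + h) \<partial>torus)) - (?b - (\<integral>x. T x \<partial>torus))"
    by (simp add: trigp_translate[OF T(1)])
  then have "cmod (?a - ?b) \<le> e * ?V + e * ?V"
    using d[of h] d[of 0] norm_triangle_ineq4[of "?a - (\<integral>x. T (x + h) \<partial>torus)" "?b - (\<integral>x. T x \<partial>torus)"]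
    by simp
  also have "\<dots> < cmod (?a - ?b)" using \<open>?a \<noteq> ?b\<close> tvol_pos[where ?'d='d] by (simp add: e_def)
  finally show False by simp
qed

lemma periodic_continuous_bounded:
  fixes \<phi> :: "real^'d::finite \<Rightarrow> 'b::real_normed_vector"
  assumes c: "continuous_on UNIV \<phi>" and p: "torus_periodic \<phi>"
  obtains B where "\<And>x. norm (\<phi> x) \<le> B"
proof -
  have "bounded (\<phi> ` cbox 0 (\<chi> i. 2 * pi))"
    by (intro compact_imp_bounded compact_continuous_image continuous_on_subset[OF c]) auto
  then obtain B where B: "\<And>x. x \<in> cbox 0 (\<chi> i. 2 * pi) \<Longrightarrow> norm (\<phi> x) \<le> B" by (auto simp: bounded_iff)
  have "norm (\<phi> x) \<le> B" for x using B[OF tL_in_torus, of "tE x"] by (simp add: periodic_tL_tE[OF p])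
  then show ?thesis by (rule that)
qed

lemma has_vector_derivative_iff_tendsto:
  "(f has_vector_derivative v) (at t within S) \<longleftrightarrow> ((\<lambda>y. (f y - f t) /\<^sub>R (y - t)) \<longlongrightarrow> v) (at t within S)"
proof -
  have e: "\<forall>\<^sub>F y in at t within S. norm ((1 / norm (y - t)) *\<^sub>R (f y - (f t + (y - t) *\<^sub>R v))) = norm ((f y - f t) /\<^sub>R (y - t) - v)"
    unfolding eventually_at_filter
  proof (intro always_eventually allI impI)
    fix y assume "y \<noteq> t"
    then have "(f y - f t) /\<^sub>R (y - t) - v = inverse (y - t) *\<^sub>R (f y - (f t + (y - t) *\<^sub>R v))"
      by (simp add: scaleR_diff_right scaleR_add_right)
    then show "norm ((1 / norm (y - t)) *\<^sub>R (f y - (f t + (y - t) *\<^sub>R v))) = norm ((f y - f t) /\<^sub>R (y - t) - v)"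
      by (simp add: divide_inverse)
  qed
  have "(f has_vector_derivative v) (at t within S) \<longleftrightarrow>
      ((\<lambda>y. norm ((1 / norm (y - t)) *\<^sub>R (f y - (f t + (y - t) *\<^sub>R v)))) \<longlongrightarrow> 0) (at t within S)"
    unfolding tendsto_norm_zero_iff
    by (simp add: has_vector_derivative_def has_derivative_within bounded_linear_scaleR_left)
  also have "\<dots> \<longleftrightarrow> ((\<lambda>y. norm ((f y - f t) /\<^sub>R (y - t) - v)) \<longlongrightarrow> 0) (at t within S)"
    by (rule tendsto_cong[OF e])
  finally show ?thesis by (simp only: tendsto_norm_zero_iff LIM_zero_iff)
qed

lemma torus_translate_complex:
  fixes \<phi> :: "real^'d::finite \<Rightarrow> complex"
  assumes c: "continuous_on UNIV \<phi>" and p: "torus_periodic \<phi>"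
  shows "(\<integral>x. \<phi> (x + h) \<partial>torus) = (\<integral>x. \<phi> x \<partial>torus)"
proof -
  obtain B where B: "\<And>x. cmod (\<phi> x) \<le> B" by (rule periodic_continuous_bounded[OF c p]) blast
  have i: "integrable torus (\<lambda>x. \<phi> (x + k))" for k
    by (rule torus_integrable_bounded[OF _ B])
      (intro borel_measurable_continuous_onI continuous_on_compose2[OF c] continuous_intros, auto)
  have R: "(\<integral>x. complex_of_real (Re (\<phi> (x + h))) \<partial>torus) = (\<integral>x. complex_of_real (Re (\<phi> x)) \<partial>torus)"
    by (rule torus_translate[of "\<lambda>x. Re (\<phi> x)"]) (use p in \<open>auto intro!: continuous_intros c simp: torus_periodic_def\<close>)
  have I: "(\<integral>x. complex_of_real (Im (\<phi> (x + h))) \<partial>torus) = (\<integral>x. complex_of_real (Im (\<phi> x)) \<partial>torus)"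
    by (rule torus_translate[of "\<lambda>x. Im (\<phi> x)"]) (use p in \<open>auto intro!: continuous_intros c simp: torus_periodic_def\<close>)
  have "(\<integral>x. \<phi> (x + k) \<partial>torus) = (\<integral>x. complex_of_real (Re (\<phi> (x + k))) \<partial>torus) + \<i> * (\<integral>x. complex_of_real (Im (\<phi> (x + k))) \<partial>torus)" for k
    using i[of k] by (simp add: complex_eq_iff integral_Re integral_Im)
  from this[of h] this[of 0] show ?thesis using R I by simp
qed

text \<open>The difference quotients integrate to zero by translation invariance. They converge
  pointwise to \<open>D\<close> and are dominated by its supremum through the mean value
  inequality.\<close>

lemma integral_partial_zero:
  fixes \<phi> :: "real^'d::finite \<Rightarrow> complex"
  assumes d: "\<And>x. (\<phi> has_derivative \<phi>' x) (at x)" and D: "\<And>x. D x = \<phi>' x (axis i 1)"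
    and c: "continuous_on UNIV D" and p: "torus_periodic \<phi>" "torus_periodic D"
  shows "(\<integral>x. D x \<partial>torus) = 0"
proof -
  let ?e = "axis i 1 :: real^'d"
  obtain B where B: "\<And>x. cmod (D x) \<le> B" using periodic_continuous_bounded[OF c p(2)] by blast
  have pc: "continuous_on UNIV \<phi>"
    using d has_derivative_continuous by (fastforce simp: continuous_on_eq_continuous_at)
  obtain Bp where Bp: "\<And>x. cmod (\<phi> x) \<le> Bp" using periodic_continuous_bounded[OF pc p(1)] by blast
  have v: "((\<lambda>t. \<phi> (x + t *\<^sub>R ?e)) has_vector_derivative D (x + t *\<^sub>R ?e)) (at t)" for x t
  proof -
    have "((\<lambda>t. x + t *\<^sub>R ?e) has_derivative (\<lambda>t. t *\<^sub>R ?e)) (at t)" by (auto intro!: derivative_eq_intros)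
    from diff_chain_at[OF this d]
    have "((\<lambda>t. \<phi> (x + t *\<^sub>R ?e)) has_derivative (\<lambda>r. \<phi>' (x + t *\<^sub>R ?e) (r *\<^sub>R ?e))) (at t)" by (simp add: o_def)
    then show ?thesis
      unfolding has_vector_derivative_def D
      using linear_scale[OF bounded_linear.linear[OF has_derivative_bounded_linear[OF d]]] by simp
  qed
  have lip: "cmod (\<phi> (x + t *\<^sub>R ?e) - \<phi> x) \<le> B * \<bar>t\<bar>" for x t
  proof -
    have "norm ((\<lambda>t. \<phi> (x + t *\<^sub>R ?e)) t - (\<lambda>t. \<phi> (x + t *\<^sub>R ?e)) 0) \<le> B * norm (t - 0)"
    proof (rule differentiable_bound[of UNIV])
      show "((\<lambda>t. \<phi> (x + t *\<^sub>R ?e)) has_derivative (\<lambda>h. h *\<^sub>R D (x + r *\<^sub>R ?e))) (at r within UNIV)" for r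
        using v[of x r] by (simp add: has_vector_derivative_def)
      show "onorm (\<lambda>h. h *\<^sub>R D (x + r *\<^sub>R ?e)) \<le> B" for r
        by (rule onorm_le) (simp add: mult.commute[of B] mult_left_mono[OF B])
    qed auto
    then show ?thesis by simp
  qed
  define g where "g n x = of_nat (Suc n) * (\<phi> (x + (1 / real (Suc n)) *\<^sub>R ?e) - \<phi> x)" for n x
  have mphi: "(\<lambda>x. \<phi> (x + k)) \<in> borel_measurable borel" for k
    by (intro borel_measurable_continuous_onI continuous_on_compose2[OF pc] continuous_intros) auto
  have iphi: "integrable torus (\<lambda>x. \<phi> (x + k))" for k
    by (rule torus_integrable_bounded[OF mphi Bp])
  have "(\<lambda>n. integral\<^sup>L torus (g n)) \<longlonglongrightarrow> integral\<^sup>L torus D"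
  proof (rule integral_dominated_convergence[where w="\<lambda>_. B"])
    show "D \<in> borel_measurable torus" by (intro measurable_torus borel_measurable_continuous_onI c)
    show "g n \<in> borel_measurable torus" for n
      unfolding g_def using mphi[of "(1 / real (Suc n)) *\<^sub>R ?e"] mphi[of 0, simplified]
      by (intro measurable_torus) measurable
    show "AE x in torus. (\<lambda>n. g n x) \<longlonglongrightarrow> D x"
    proof (rule AE_I2)
      fix x
      have "((\<lambda>t. (\<phi> (x + t *\<^sub>R ?e) - \<phi> x) /\<^sub>R t) \<longlongrightarrow> D x) (at 0)"
        using v[of x 0] by (simp add: has_vector_derivative_iff_tendsto)
      moreover have "filterlim (\<lambda>n. 1 / real (Suc n)) (at 0) sequentially"
        unfolding filterlim_at using lim_inverse_n' LIMSEQ_inverse_real_of_nat by (auto simp: inverse_eq_divide)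
      ultimately have "(\<lambda>n. (\<phi> (x + (1 / real (Suc n)) *\<^sub>R ?e) - \<phi> x) /\<^sub>R (1 / real (Suc n))) \<longlonglongrightarrow> D x"
        by (rule filterlim_compose)
      then show "(\<lambda>n. g n x) \<longlonglongrightarrow> D x" by (simp add: g_def scaleR_conv_of_real)
    qed
    show "AE x in torus. norm (g n x) \<le> B" for n
    proof (rule AE_I2)
      fix x
      have "norm (g n x) = real (Suc n) * cmod (\<phi> (x + (1 / real (Suc n)) *\<^sub>R ?e) - \<phi> x)"
        by (simp add: g_def norm_mult del: of_nat_Suc)
      also have "\<dots> \<le> real (Suc n) * (B * \<bar>1 / real (Suc n)\<bar>)" by (intro mult_left_mono lip) simp
      finally show "norm (g n x) \<le> B" by simp
    qed
  qed simp
  moreover have "integral\<^sup>L torus (g n) = 0" for n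
    unfolding g_def using iphi[of "(1 / real (Suc n)) *\<^sub>R ?e"] iphi[of 0] torus_translate_complex[OF pc p(1)]
    by (simp del: of_nat_Suc)
  ultimately show ?thesis by (simp add: LIMSEQ_const_iff)
qed

lemma frechet_derivative_periodic:
  assumes "torus_periodic \<psi>" "\<And>x. \<psi> differentiable (at x)"
  shows "torus_periodic (\<lambda>x. frechet_derivative \<psi> (at x) v)"
  unfolding torus_periodic_def
proof (intro allI)
  fix i and x :: "real^'a"
  let ?p = "axis i (2 * pi) :: real^'a"
  have "(\<psi> has_derivative frechet_derivative \<psi> (at (x + ?p))) (at (x + ?p))"
    using assms(2) frechet_derivative_works by blast
  moreover have "((\<lambda>x. x + ?p) has_derivative (\<lambda>h. h)) (at x)" by (auto intro!: derivative_eq_intros)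
  ultimately have "(\<psi> \<circ> (\<lambda>x. x + ?p) has_derivative frechet_derivative \<psi> (at (x + ?p)) \<circ> (\<lambda>h. h)) (at x)"
    by (intro diff_chain_at)
  moreover have "\<psi> \<circ> (\<lambda>x. x + ?p) = \<psi>" using assms(1) by (auto simp: torus_periodic_def)
  ultimately have "(\<psi> has_derivative frechet_derivative \<psi> (at (x + ?p))) (at x)" by (simp add: o_def)
  then have "frechet_derivative \<psi> (at (x + ?p)) = frechet_derivative \<psi> (at x)" by (rule frechet_derivative_at)
  then show "frechet_derivative \<psi> (at (x + ?p)) v = frechet_derivative \<psi> (at x) v" by simp
qed

lemma C_class_1D:
  assumes "\<And>k. C_class k \<psi>"
  shows "\<psi> differentiable (at x)" "continuous_on UNIV (\<lambda>x. frechet_derivative \<psi> (at x) v)" "continuous_on UNIV \<psi>"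
  using assms[of "Suc 0"] assms[of 0] by auto

lemma ex_has_derivative: "(ex \<xi> has_derivative (\<lambda>h. \<i> * complex_of_real (h \<bullet> lattice_vec \<xi>) * ex \<xi> x)) (at x)"
proof -
  have "((\<lambda>x. \<i> * complex_of_real (x \<bullet> lattice_vec \<xi>)) has_derivative (\<lambda>h. \<i> * complex_of_real (h \<bullet> lattice_vec \<xi>))) (at x)"
    by (auto intro!: derivative_eq_intros)
  from has_derivative_compose[OF this DERIV_exp[unfolded has_field_derivative_def]]
  show ?thesis unfolding ex_def by (simp add: mult_ac)
qed

text \<open>The product rule for \<open>ex \<xi>\<close> times \<open>\<psi>\<close> gives a
  periodic derivative, whose integral vanishes.\<close>

lemma integral_ex_partial:
  fixes \<psi> :: "real^'d::finite \<Rightarrow> real"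
  assumes p: "torus_periodic \<psi>" and C: "\<And>k. C_class k \<psi>"
  shows "(\<integral>x. ex \<xi> x * of_real (frechet_derivative \<psi> (at x) (axis i 1)) \<partial>torus)
    = - (\<i> * of_int (\<xi> $ i)) * (\<integral>x. ex \<xi> x * of_real (\<psi> x) \<partial>torus)"
proof -
  note c = C_class_1D[OF C]
  let ?D = "\<lambda>x. frechet_derivative \<psi> (at x) (axis i 1)"
  have pD: "torus_periodic ?D" by (rule frechet_derivative_periodic[OF p c(1)])
  have "(\<integral>x. ex \<xi> x * of_real (?D x) + (\<i> * of_int (\<xi> $ i)) * (ex \<xi> x * of_real (\<psi> x)) \<partial>torus) = 0"
  proof (rule integral_partial_zero)
    fix x
    have "(\<psi> has_derivative frechet_derivative \<psi> (at x)) (at x)" using c(1) frechet_derivative_works by blast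
    then show "((\<lambda>x. ex \<xi> x * of_real (\<psi> x)) has_derivative
       (\<lambda>h. ex \<xi> x * of_real (frechet_derivative \<psi> (at x) h) + \<i> * complex_of_real (h \<bullet> lattice_vec \<xi>) * ex \<xi> x * of_real (\<psi> x))) (at x)"
      by (auto intro!: derivative_eq_intros ex_has_derivative)
    show "ex \<xi> x * of_real (?D x) + (\<i> * of_int (\<xi> $ i)) * (ex \<xi> x * of_real (\<psi> x)) =
       ex \<xi> x * of_real (frechet_derivative \<psi> (at x) (axis i 1)) + \<i> * complex_of_real (axis i 1 \<bullet> lattice_vec \<xi>) * ex \<xi> x * of_real (\<psi> x)"
      by (simp add: inner_axis')
  next
    show "continuous_on UNIV (\<lambda>x. ex \<xi> x * of_real (?D x) + (\<i> * of_int (\<xi> $ i)) * (ex \<xi> x * of_real (\<psi> x)))"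
      by (intro continuous_intros c)
    show "torus_periodic (\<lambda>x. ex \<xi> x * complex_of_real (\<psi> x))"
      "torus_periodic (\<lambda>x. ex \<xi> x * of_real (?D x) + (\<i> * of_int (\<xi> $ i)) * (ex \<xi> x * of_real (\<psi> x)))"
      using p pD by (auto simp: torus_periodic_def ex_periodic)
  qed
  moreover have "integrable torus (\<lambda>x. ex \<xi> x * complex_of_real (g x))" if g: "continuous_on UNIV g" "torus_periodic g" for g
  proof -
    obtain B where "\<And>x. norm (g x) \<le> B" by (rule periodic_continuous_bounded[OF g]) blast
    then show ?thesis
      by (intro torus_integrable_bounded[where B=B] borel_measurable_continuous_onI continuous_intros g) (simp add: norm_mult)
  qed
  ultimately show ?thesis using c p pD by (simp add: eq_neg_iff_add_eq_0)
qed

section \<open>Uniqueness of Fourier coefficients\<close>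

lemma fourier_coeff_alt:
  fixes u :: "real^'d::finite \<Rightarrow> real"
  shows "fourier_coeff u \<xi> = (\<integral>x. of_real (u x) * ex (- \<xi>) x \<partial>torus) / of_real (tvol TYPE('d))"
  by (simp add: fourier_coeff_def ex_def tvol_def)

text \<open>Continuous off the closed half-line of nonnegative reals and equal to zero on
  it.\<close>

lemma Arg2pi_measurable [measurable]: "Arg2pi \<in> borel_measurable borel"
proof -
  have c: "closed (\<real>\<^sub>\<ge>\<^sub>0 :: complex set)" by simp
  have m: "(\<lambda>z. indicator (- \<real>\<^sub>\<ge>\<^sub>0) z *\<^sub>R Arg2pi z) \<in> borel_measurable borel"
    by (rule borel_measurable_continuous_on_indicator)
      (auto intro!: continuous_at_imp_continuous_on continuous_at_Arg2pi)
  have "(\<lambda>z. indicator (- \<real>\<^sub>\<ge>\<^sub>0) z *\<^sub>R Arg2pi z) = Arg2pi"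
    by (auto simp: indicator_def complex_nonneg_Reals_iff complex_is_Real_iff Arg2pi_eq_0)
  from m[unfolded this] show ?thesis .
qed

lemma tL_measurable [measurable]: "tL \<in> borel_measurable borel"
proof (subst borel_measurable_euclidean_space, intro ballI)
  fix b :: "real^'a" assume "b \<in> Basis"
  then obtain i where b: "b = axis i 1" by (auto simp: Basis_vec_def)
  have "(\<lambda>z::complex^'a. z $ i) \<in> borel_measurable borel"
    by (intro borel_measurable_continuous_onI continuous_intros)
  then have "(\<lambda>z::complex^'a. Arg2pi (z $ i)) \<in> borel_measurable borel" by measurable
  then show "(\<lambda>z::complex^'a. tL z \<bullet> b) \<in> borel_measurable borel" by (simp add: b inner_axis tL_def)
qed

lemma tE_measurable [measurable]: "tE \<in> borel_measurable borel"
  by (intro borel_measurable_continuous_onI continuous_tE)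

text \<open>\<open>tE\<close> maps the torus onto a compact set on which trigonometric polynomials are the
  polynomial functions, so Stone--Weierstrass applies there.\<close>

lemma fourier_uniqueness_aux:
  fixes u :: "real^'d::finite \<Rightarrow> real"
  assumes u: "integrable torus u" "u \<in> borel_measurable borel" and z: "\<And>\<xi>. fourier_coeff u \<xi> = 0"
    and G: "continuous_on UNIV G"
  shows "(\<integral>x. u x * G (tE x :: complex^'d) \<partial>torus) = 0"
proof (rule ccontr)
  let ?I = "\<integral>x. u x * G (tE x) \<partial>torus"
  assume I: "?I \<noteq> 0"
  define N where "N = (\<integral>x. \<bar>u x\<bar> \<partial>torus)"
  have N: "0 \<le> N" by (simp add: N_def)
  \<comment> \<open>Small enough that \<open>e * N\<close> stays below half of the absolute value of
    the integral; the added 1 covers \<open>N = 0\<close>.\<close>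
  define e where "e = \<bar>?I\<bar> / 2 / (N + 1)"
  have e: "0 < e" using I N by (simp add: e_def)
  from Stone_Weierstrass_real_polynomial_function[OF compact_range_tE continuous_on_subset[OF G] e]
  obtain g where g: "real_polynomial_function g" "\<And>z. z \<in> range tE \<Longrightarrow> \<bar>G z - g z\<bar> < e" by blast
  define T where "T x = complex_of_real (g (tE x))" for x
  have T: "trigp T" unfolding T_def by (rule trigp_tE[OF g(1)])
  have uc: "integrable torus (\<lambda>x. complex_of_real (u x))" using u by simp
  have T0: "(\<integral>x. of_real (u x) * S x \<partial>torus) = 0" if "trigp S" for S
    using that
  proof (induction rule: trigp.induct)
    case (base c \<xi>)
    have "(\<integral>x. of_real (u x) * ex \<xi> x \<partial>torus) = 0"
      using z[of "- \<xi>"] tvol_pos[where ?'d='d] by (simp add: fourier_coeff_alt)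
    moreover have "(\<lambda>x. of_real (u x) * (c * ex \<xi> x)) = (\<lambda>x. c * (of_real (u x) * ex \<xi> x))" by (simp add: mult_ac)
    ultimately show ?case by simp
  next
    case (add S R)
    have "integrable torus (\<lambda>x. of_real (u x) * W x)" if W: "trigp W" for W
    proof -
      obtain B where B: "\<And>x. cmod (W x) \<le> B" using trigp_bounded[OF W] by blast
      show ?thesis by (rule integrable_mult_bounded[OF uc _ B]) (intro measurable_torus trigp_measurable W)
    qed
    from Bochner_Integration.integral_add[OF this[OF add.hyps(1)] this[OF add.hyps(2)]]
    show ?case using add.IH by (simp add: ring_distribs)
  qed
  have mG: "(\<lambda>x. G (tE x)) \<in> borel_measurable borel"
    by (intro borel_measurable_continuous_onI continuous_on_compose2[OF G continuous_tE]) auto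
  have "exp (\<i> * (2 * complex_of_real pi)) = 1" by (auto simp: exp_eq_1 intro!: exI[of _ 1])
  then have pG: "torus_periodic (\<lambda>x. G (tE x))"
    by (auto simp: torus_periodic_def tE_def axis_def vec_eq_iff ring_distribs exp_add intro!: arg_cong[where f=G])
  obtain BG where BG: "\<And>x. norm (G (tE x)) \<le> BG"
    by (rule periodic_continuous_bounded[OF continuous_on_compose2[OF G continuous_tE] pG]) auto
  obtain BT where BT: "\<And>x. cmod (T x) \<le> BT" using trigp_bounded[OF T] by blast
  have i1: "integrable torus (\<lambda>x. u x * G (tE x))"
    by (rule integrable_mult_bounded[OF u(1) measurable_torus[OF mG] BG])
  have mg: "(\<lambda>x. g (tE x)) \<in> borel_measurable borel"
  proof -
    have "(\<lambda>x. Re (T x)) \<in> borel_measurable borel" using trigp_measurable[OF T] by measurable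
    then show ?thesis by (simp add: T_def)
  qed
  have i2: "integrable torus (\<lambda>x. u x * g (tE x))"
    by (rule integrable_mult_bounded[OF u(1) measurable_torus[OF mg]]) (use BT in \<open>simp add: T_def\<close>)
  have "complex_of_real (\<integral>x. u x * g (tE x) \<partial>torus) = 0"
    using T0[OF T] by (simp add: T_def flip: of_real_mult)
  then have g0: "(\<integral>x. u x * g (tE x) \<partial>torus) = 0" by simp
  have "\<bar>?I\<bar> = \<bar>\<integral>x. u x * G (tE x) - u x * g (tE x) \<partial>torus\<bar>"
    using i1 i2 g0 by simp
  also have "\<dots> \<le> (\<integral>x. \<bar>u x * G (tE x) - u x * g (tE x)\<bar> \<partial>torus)" by (rule integral_abs_bound)
  also have "\<dots> \<le> (\<integral>x. e * \<bar>u x\<bar> \<partial>torus)"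
  proof (rule integral_mono)
    show "integrable torus (\<lambda>x. \<bar>u x * G (tE x) - u x * g (tE x)\<bar>)" using i1 i2 by simp
    show "integrable torus (\<lambda>x. e * \<bar>u x\<bar>)" using u by simp
    fix x
    have "\<bar>u x * G (tE x) - u x * g (tE x)\<bar> = \<bar>G (tE x) - g (tE x)\<bar> * \<bar>u x\<bar>"
      by (simp add: abs_mult[symmetric] algebra_simps)
    also have "\<dots> \<le> e * \<bar>u x\<bar>" using g(2)[of "tE x"] by (intro mult_right_mono) auto
    finally show "\<bar>u x * G (tE x) - u x * g (tE x)\<bar> \<le> e * \<bar>u x\<bar>" .
  qed
  also have "\<dots> = e * N" by (simp add: N_def)
  also have "\<dots> < \<bar>?I\<bar>"
  proof -
    have "e * N \<le> e * (N + 1)" using e by simp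
    also have "\<dots> = \<bar>?I\<bar> / 2" using nonzero_eq_divide_eq[of "N + 1" e "\<bar>?I\<bar> / 2"] e_def N by linarith
    finally show ?thesis using I by simp
  qed
  finally show False by simp
qed

text \<open>The indicator of a closed set is the limit of the continuous functions
  \<open>max 0 (1 - n * infdist z K)\<close>, so the orthogonality to continuous functions passes to
  it by dominated convergence.\<close>

lemma fourier_uniqueness_closed:
  fixes u :: "real^'d::finite \<Rightarrow> real"
  assumes u: "integrable torus u" "u \<in> borel_measurable borel" and z: "\<And>\<xi>. fourier_coeff u \<xi> = 0"
    and K: "closed (K :: (complex^'d) set)"
  shows "(\<integral>x. u x * indicator K (tE x) \<partial>torus) = 0"
proof (cases "K = {}")
  case False
  define G where "G n z = max 0 (1 - real n * infdist z K)" for n z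
  have cG: "continuous_on UNIV (G n)" for n unfolding G_def by (intro continuous_intros)
  have G01: "0 \<le> G n z" "G n z \<le> 1" for n z by (auto simp: G_def infdist_nonneg)
  have lim: "(\<lambda>n. G n z) \<longlonglongrightarrow> indicator K z" for z
  proof (cases "z \<in> K")
    case True
    then show ?thesis by (simp add: G_def)
  next
    case False
    then have p: "0 < infdist z K"
      using K \<open>K \<noteq> {}\<close> in_closed_iff_infdist_zero[of K z] infdist_nonneg[of z K] by force
    obtain N :: nat where N: "1 / infdist z K < real N" using reals_Archimedean2 by blast
    have "G n z = 0" if "n \<ge> N" for n
    proof -
      have "1 / infdist z K < real n" using N that by linarith
      then show ?thesis using p by (simp add: G_def field_simps)
    qed
    then have "\<forall>\<^sub>F n in sequentially. G n z = indicator K z"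
      using False by (auto simp: eventually_sequentially)
    then show ?thesis by (rule tendsto_eventually)
  qed
  have mG: "(\<lambda>x. G n (tE x)) \<in> borel_measurable borel" for n
    by (intro borel_measurable_continuous_onI continuous_on_compose2[OF cG continuous_tE]) auto
  have mK: "(\<lambda>x. indicator K (tE x) :: real) \<in> borel_measurable borel"
    using borel_closed[OF K] by measurable
  have "(\<lambda>n. \<integral>x. u x * G n (tE x) \<partial>torus) \<longlonglongrightarrow> (\<integral>x. u x * indicator K (tE x) \<partial>torus)"
  proof (rule integral_dominated_convergence[where w="\<lambda>x. \<bar>u x\<bar>"])
    show "(\<lambda>x. u x * indicator K (tE x)) \<in> borel_measurable torus"
      by (intro measurable_torus borel_measurable_times u mK)
    show "(\<lambda>x. u x * G n (tE x)) \<in> borel_measurable torus" for n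
      by (intro measurable_torus borel_measurable_times u mG)
    show "AE x in torus. (\<lambda>n. u x * G n (tE x)) \<longlonglongrightarrow> u x * indicator K (tE x)"
      by (intro AE_I2 tendsto_intros lim)
    show "AE x in torus. norm (u x * G n (tE x)) \<le> \<bar>u x\<bar>" for n
      using G01 by (intro AE_I2) (simp add: abs_mult mult_left_le)
  qed (use u in simp)
  then show ?thesis by (simp add: fourier_uniqueness_aux[OF u z cG] LIMSEQ_const_iff)
qed simp

text \<open>The positive and the negative part of \<open>u\<close>, taken as densities and pushed
  forward by \<open>tE\<close>, are finite measures that agree on closed sets. Closed sets are
  stable under intersection and generate the Borel sets, so the measures coincide; testing them
  where \<open>u\<close> is positive kills the positive part.\<close>

lemma fourier_uniqueness_pos:
  fixes u :: "real^'d::finite \<Rightarrow> real"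
  assumes u: "integrable torus u" "u \<in> borel_measurable borel" and p: "torus_periodic u"
    and z: "\<And>\<xi>. fourier_coeff u \<xi> = 0"
  shows "AE x in torus. u x \<le> 0"
proof -
  \<comment> \<open>\<open>ennreal\<close> sends negative values to 0, so \<open>M u\<close> and
    \<open>M (\<lambda>x. - u x)\<close> are the images of the two parts of
    \<open>u\<close>.\<close>
  define M where "M v = distr (density torus (\<lambda>x. ennreal (v x))) borel (tE :: real^'d \<Rightarrow> _)" for v :: "real^'d \<Rightarrow> real"
  have mt: "tE \<in> measurable (density torus (\<lambda>x. ennreal (v x))) borel" for v :: "real^'d \<Rightarrow> real"
    using measurable_torus_gen[OF tE_measurable] by simp
  have em: "emeasure (M v) A = (\<integral>\<^sup>+x. ennreal (v x) * indicator A (tE x) \<partial>torus)"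
    if v: "v \<in> borel_measurable borel" and A: "A \<in> sets borel" for v A
  proof -
    have "tE -` A \<inter> space torus \<in> sets torus"
      using measurable_sets[OF measurable_torus_gen[OF tE_measurable] A] .
    then have "emeasure (M v) A = (\<integral>\<^sup>+x. ennreal (v x) * indicator (tE -` A \<inter> space torus) x \<partial>torus)"
      unfolding M_def using A v by (subst emeasure_distr[OF mt A]) (auto simp: emeasure_density)
    also have "\<dots> = (\<integral>\<^sup>+x. ennreal (v x) * indicator A (tE x) \<partial>torus)"
      by (intro nn_integral_cong) (auto simp: indicator_def)
    finally show ?thesis .
  qed
  have u': "(\<lambda>x. - u x) \<in> borel_measurable borel" using u by measurable
  have eqc: "emeasure (M u) K = emeasure (M (\<lambda>x. - u x)) K" if K: "closed K" for K
  proof -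
    have KB: "K \<in> sets borel" using K by simp
    have mK: "(\<lambda>x. indicator K (tE x) :: real) \<in> borel_measurable borel" using KB by measurable
    define f where "f x = u x * indicator K (tE x)" for x
    have f: "integrable torus f"
      unfolding f_def by (rule integrable_mult_bounded[OF u(1) measurable_torus[OF mK], of 1]) (simp add: indicator_def)
    have p: "(\<integral>\<^sup>+x. ennreal (f x) \<partial>torus) = emeasure (M u) K"
      unfolding em[OF u(2) KB] by (intro nn_integral_cong) (auto simp: f_def indicator_def)
    have n: "(\<integral>\<^sup>+x. ennreal (- f x) \<partial>torus) = emeasure (M (\<lambda>x. - u x)) K"
      unfolding em[OF u' KB] by (intro nn_integral_cong) (auto simp: f_def indicator_def)
    have fin: "(\<integral>\<^sup>+x. ennreal (f x) \<partial>torus) \<noteq> \<infinity>" "(\<integral>\<^sup>+x. ennreal (- f x) \<partial>torus) \<noteq> \<infinity>"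
      using f by (auto simp: real_integrable_def)
    have "enn2real (\<integral>\<^sup>+x. ennreal (f x) \<partial>torus) - enn2real (\<integral>\<^sup>+x. ennreal (- f x) \<partial>torus) = 0"
      using fourier_uniqueness_closed[OF u z K] unfolding f_def[symmetric] real_lebesgue_integral_def[OF f] .
    then show ?thesis using fin unfolding p n
      by (metis ennreal_enn2real eq_iff_diff_eq_0 infinity_ennreal_def less_top)
  qed
  have fin: "emeasure (M u) UNIV \<noteq> \<infinity>"
  proof -
    have "UNIV \<in> sets (borel :: (complex^'d) measure)" by simp
    from em[OF u(2) this] show ?thesis using u by (simp add: real_integrable_def)
  qed
  have "M u = M (\<lambda>x. - u x)"
  proof (rule measure_eqI_generator_eq[where E="Collect closed" and \<Omega>=UNIV and A="\<lambda>_. UNIV"])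
    show "Int_stable (Collect closed :: (complex^'d) set set)" by (auto simp: Int_stable_def)
    show "sets (M u) = sigma_sets UNIV (Collect closed)" "sets (M (\<lambda>x. - u x)) = sigma_sets UNIV (Collect closed)"
      by (simp_all add: M_def borel_eq_closed)
  qed (use eqc fin in auto)
  \<comment> \<open>Measurability of \<open>tL\<close> makes this set Borel, and periodicity makes
    \<open>tE x \<in> A\<close> equivalent to \<open>0 < u x\<close>. The negative part therefore
    has no mass on it.\<close>
  moreover define A where "A = tL -` {x. 0 < u x}"
  have A: "A \<in> sets borel"
  proof -
    have "{x. 0 < u x} \<in> sets borel" using u by measurable
    from measurable_sets[OF tL_measurable this] show ?thesis by (simp add: A_def)
  qed
  have Au: "tE x \<in> A \<longleftrightarrow> 0 < u x" for x by (simp add: A_def periodic_tL_tE[OF p])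
  have "emeasure (M (\<lambda>x. - u x)) A = 0"
  proof -
    have "emeasure (M (\<lambda>x. - u x)) A = (\<integral>\<^sup>+x. 0 \<partial>(torus :: (real^'d) measure))"
      unfolding em[OF u' A] by (intro nn_integral_cong) (auto simp: indicator_def Au ennreal_neg)
    then show ?thesis by simp
  qed
  ultimately have "emeasure (M u) A = 0" by simp
  moreover have "emeasure (M u) A = (\<integral>\<^sup>+x. ennreal (u x) \<partial>torus)"
    unfolding em[OF u(2) A] by (intro nn_integral_cong) (auto simp: indicator_def Au ennreal_neg)
  ultimately have "(\<integral>\<^sup>+x. ennreal (u x) \<partial>torus) = 0" by simp
  then have "AE x in torus. ennreal (u x) = 0"
    using u by (subst (asm) nn_integral_0_iff_AE) auto
  then show ?thesis by eventually_elim (simp add: ennreal_eq_0_iff)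
qed

theorem fourier_uniqueness:
  fixes u :: "real^'d::finite \<Rightarrow> real"
  assumes u: "integrable torus u" "u \<in> borel_measurable borel" and p: "torus_periodic u"
    and z: "\<And>\<xi>. fourier_coeff u \<xi> = 0"
  shows "AE x in torus. u x = 0"
proof -
  have "fourier_coeff (\<lambda>x. - u x) \<xi> = 0" for \<xi>
    using z[of \<xi>] by (simp add: fourier_coeff_alt)
  then have "AE x in torus. - u x \<le> 0"
    using u p by (intro fourier_uniqueness_pos) (auto simp: torus_periodic_def)
  moreover have "AE x in torus. u x \<le> 0" by (rule fourier_uniqueness_pos[OF assms])
  ultimately show ?thesis by eventually_elim simp
qed

section \<open>The Riesz--Fischer theorem\<close>

definition tsum :: "(int^'d::finite \<Rightarrow> complex) \<Rightarrow> (int^'d) set \<Rightarrow> real^'d \<Rightarrow> complex" where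
  "tsum a F x = (\<Sum>\<xi>\<in>F. a \<xi> * ex \<xi> x)"

lemma measurable_tsum [measurable]: "tsum a F \<in> borel_measurable borel"
  unfolding tsum_def[abs_def] by measurable

lemma norm_tsum_le: "cmod (tsum a F x) \<le> (\<Sum>\<xi>\<in>F. cmod (a \<xi>))"
  unfolding tsum_def by (rule order_trans[OF norm_sum]) (simp add: norm_mult)

lemma tsum_periodic: "tsum a F (x + axis i (2 * pi)) = tsum a F x"
  by (simp add: tsum_def ex_periodic)

lemma integral_tsum_sq:
  fixes a :: "int^'d::finite \<Rightarrow> complex"
  assumes F: "finite F"
  shows "(\<integral>x. (cmod (tsum a F x))\<^sup>2 \<partial>torus) = tvol TYPE('d) * (\<Sum>\<xi>\<in>F. (cmod (a \<xi>))\<^sup>2)"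
proof -
  have e: "complex_of_real ((cmod (tsum a F x))\<^sup>2) = (\<Sum>\<xi>\<in>F. \<Sum>\<eta>\<in>F. (a \<xi> * cnj (a \<eta>)) * ex (\<xi> - \<eta>) x)" for x
    unfolding complex_norm_square tsum_def
    by (simp add: sum_product cnj_sum ex_diff ex_minus mult_ac)
  have i: "integrable torus (ex \<zeta>)" for \<zeta> :: "int^'d" by (rule torus_integrable_bounded[of _ 1]) auto
  have "complex_of_real (\<integral>x. (cmod (tsum a F x))\<^sup>2 \<partial>torus) = (\<integral>x. complex_of_real ((cmod (tsum a F x))\<^sup>2) \<partial>torus)"
    by (rule integral_complex_of_real[symmetric])
  also have "\<dots> = (\<Sum>\<xi>\<in>F. \<Sum>\<eta>\<in>F. (a \<xi> * cnj (a \<eta>)) * (\<integral>x. ex (\<xi> - \<eta>) x \<partial>(torus :: (real^'d) measure)))"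
    unfolding e by (simp add: Bochner_Integration.integral_sum i)
  also have "\<dots> = (\<Sum>\<xi>\<in>F. (a \<xi> * cnj (a \<xi>)) * of_real (tvol TYPE('d)))"
    using F by (intro sum.cong refl) (simp add: integral_ex if_distrib cong: if_cong)
  also have "\<dots> = complex_of_real (tvol TYPE('d) * (\<Sum>\<xi>\<in>F. (cmod (a \<xi>))\<^sup>2))"
    by (simp add: complex_norm_square[symmetric] sum_distrib_left mult.commute)
  finally show ?thesis by (simp only: of_real_eq_iff)
qed

text \<open>The variance of \<open>f\<close> about its mean \<open>m / ?V\<close> is
  nonnegative.\<close>

lemma integral_sq_le:
  fixes f :: "real^'d::finite \<Rightarrow> real"
  assumes f: "integrable torus f" "integrable torus (\<lambda>x. (f x)\<^sup>2)"
  shows "(\<integral>x. f x \<partial>torus)\<^sup>2 \<le> tvol TYPE('d) * (\<integral>x. (f x)\<^sup>2 \<partial>torus)"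
proof -
  let ?V = "tvol TYPE('d)"
  define m where "m = (\<integral>x. f x \<partial>torus)"
  define S where "S = (\<integral>x. (f x)\<^sup>2 \<partial>torus)"
  have V: "0 < ?V" by (rule tvol_pos)
  have "0 \<le> (\<integral>x. (f x - m / ?V)\<^sup>2 \<partial>torus)" by (rule Bochner_Integration.integral_nonneg) simp
  also have "(\<lambda>x. (f x - m / ?V)\<^sup>2) = (\<lambda>x. (f x)\<^sup>2 - (2 * (m / ?V)) * f x + (m / ?V)\<^sup>2)"
    by (simp add: power2_eq_square algebra_simps)
  also have "(\<integral>x. (f x)\<^sup>2 - (2 * (m / ?V)) * f x + (m / ?V)\<^sup>2 \<partial>torus) = S - 2 * (m / ?V) * m + (m / ?V)\<^sup>2 * ?V"
    using f by (simp add: m_def S_def measure_torus)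
  also have "\<dots> = S - m\<^sup>2 / ?V" using V by (simp add: power2_eq_square field_simps)
  finally have "m\<^sup>2 / ?V \<le> S" by simp
  then show ?thesis using V by (simp add: m_def S_def field_simps)
qed

lemma integral_norm_tsum_le:
  fixes a :: "int^'d::finite \<Rightarrow> complex"
  assumes F: "finite F"
  shows "(\<integral>x. cmod (tsum a F x) \<partial>torus) \<le> tvol TYPE('d) * sqrt (\<Sum>\<xi>\<in>F. (cmod (a \<xi>))\<^sup>2)"
proof -
  have i: "integrable torus (\<lambda>x. cmod (tsum a F x))"
    by (rule torus_integrable_bounded[where B="\<Sum>\<xi>\<in>F. cmod (a \<xi>)"]) (auto simp: norm_tsum_le)
  have i2: "integrable torus (\<lambda>x. (cmod (tsum a F x))\<^sup>2)"
  proof (rule torus_integrable_bounded[where B="(\<Sum>\<xi>\<in>F. cmod (a \<xi>))\<^sup>2"])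
    show "norm ((cmod (tsum a F x))\<^sup>2) \<le> (\<Sum>\<xi>\<in>F. cmod (a \<xi>))\<^sup>2" for x
      using power_mono[OF norm_tsum_le[of a F x]] by simp
  qed measurable
  have "(\<integral>x. cmod (tsum a F x) \<partial>torus)\<^sup>2 \<le> (tvol TYPE('d))\<^sup>2 * (\<Sum>\<xi>\<in>F. (cmod (a \<xi>))\<^sup>2)"
    using integral_sq_le[OF i i2] integral_tsum_sq[OF F, of a] by (simp add: power2_eq_square mult.assoc)
  then have "(\<integral>x. cmod (tsum a F x) \<partial>torus) \<le> sqrt ((tvol TYPE('d))\<^sup>2 * (\<Sum>\<xi>\<in>F. (cmod (a \<xi>))\<^sup>2))"
    by (rule real_le_rsqrt)
  then show ?thesis using tvol_pos[where ?'d='d] by (simp add: real_sqrt_mult)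
qed

lemma tsum_diff:
  assumes "finite F" "finite G"
  shows "tsum a F x - tsum a G x = tsum a (F - G) x - tsum a (G - F) x"
  unfolding tsum_def using assms
  by (simp add: sum_diff[of F "F \<inter> G", symmetric] sum_diff1 algebra_simps Diff_Int_distrib
      sum.Int_Diff[of F _ G] sum.Int_Diff[of G _ F] Int_commute)

text \<open>Along index sets whose complements carry at most \<open>(1/4)^n\<close> of the square
  sum, successive partial sums differ in L^1 by a summable amount and hence converge almost
  everywhere. Fatou's lemma bounds the limit in L^2 and its L^1 distance to the partial sums. The
  almost everywhere convergence is kept in the conclusion, since the product formula needs pointwise
  bounds.\<close>

theorem Riesz_Fischer:
  fixes a :: "int^'d::finite \<Rightarrow> complex"
  assumes a: "(\<lambda>\<xi>. (cmod (a \<xi>))\<^sup>2) summable_on UNIV"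
  obtains g Fn where "g \<in> borel_measurable borel" "\<And>i x. g (x + axis i (2 * pi)) = g x"
    "integrable torus (\<lambda>x. (cmod (g x))\<^sup>2)" "integrable torus g"
    "((\<lambda>F. \<integral>x. cmod (g x - tsum a F x) \<partial>torus) \<longlongrightarrow> 0) (finite_subsets_at_top UNIV)"
    "filterlim Fn (finite_subsets_at_top UNIV) sequentially"
    "AE x in torus. (\<lambda>n. tsum a (Fn n) x) \<longlonglongrightarrow> g x"
proof -
  let ?V = "tvol TYPE('d)"
  define A where "A = (\<Sum>\<^sub>\<infinity>\<xi>. (cmod (a \<xi>))\<^sup>2)"
  have hs: "((\<lambda>\<xi>. (cmod (a \<xi>))\<^sup>2) has_sum A) UNIV" using a by (simp add: A_def)
  have fin_le: "(\<Sum>\<xi>\<in>F. (cmod (a \<xi>))\<^sup>2) \<le> A" if "finite F" for F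
    unfolding A_def using that by (intro finite_sum_le_infsum a) auto
  have "\<exists>F. finite F \<and> (\<forall>G. finite G \<and> G \<inter> F = {} \<longrightarrow> (\<Sum>\<xi>\<in>G. (cmod (a \<xi>))\<^sup>2) \<le> (1/4)^n)" for n
  proof -
    obtain F where F: "finite F" "dist (\<Sum>\<xi>\<in>F. (cmod (a \<xi>))\<^sup>2) A \<le> (1/4)^n"
      using has_sum_finite_approximation[OF hs, of "(1/4)^n"] by auto
    have "(\<Sum>\<xi>\<in>G. (cmod (a \<xi>))\<^sup>2) \<le> (1/4)^n" if G: "finite G" "G \<inter> F = {}" for G
      using fin_le[of "G \<union> F"] F G by (simp add: sum.union_disjoint dist_real_def)
    then show ?thesis using F(1) by blast
  qed
  then have "\<exists>H. \<forall>n. finite (H n) \<and> (\<forall>G. finite G \<and> G \<inter> H n = {} \<longrightarrow> (\<Sum>\<xi>\<in>G. (cmod (a \<xi>))\<^sup>2) \<le> (1/4)^n)"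
    by (intro choice allI)
  then obtain H where H: "\<And>n. finite (H n)" "\<And>n G. finite G \<Longrightarrow> G \<inter> H n = {} \<Longrightarrow> (\<Sum>\<xi>\<in>G. (cmod (a \<xi>))\<^sup>2) \<le> (1/4)^n"
    by blast
  \<comment> \<open>The union makes the sets increasing; the enumerated frequencies make them
    exhaust the lattice even where \<open>a\<close> vanishes.\<close>
  define Fn where "Fn n = (\<Union>k\<le>n. H k) \<union> from_nat ` {..n}" for n
  have Fn: "finite (Fn n)" "H n \<subseteq> Fn n" for n using H by (auto simp: Fn_def)
  have Fmono: "Fn m \<subseteq> Fn n" if "m \<le> n" for m n using that by (fastforce simp: Fn_def)
  have Flim: "filterlim Fn (finite_subsets_at_top UNIV) sequentially"
    unfolding filterlim_finite_subsets_at_top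
  proof (intro allI impI)
    fix X :: "(int^'d) set" assume X: "finite X \<and> X \<subseteq> UNIV"
    define N where "N = Max (to_nat ` X)"
    have "X \<subseteq> Fn n" if "n \<ge> N" for n
    proof
      fix x assume x: "x \<in> X"
      have "to_nat x \<le> N" unfolding N_def by (rule Max_ge) (use X x in auto)
      then have "x \<in> from_nat ` {..n}" using that by (intro image_eqI[of _ _ "to_nat x"]) simp_all
      then show "x \<in> Fn n" by (simp add: Fn_def)
    qed
    then show "\<forall>\<^sub>F n in sequentially. finite (Fn n) \<and> X \<subseteq> Fn n \<and> Fn n \<subseteq> UNIV"
      using Fn by (auto simp: eventually_sequentially)
  qed
  have tail: "(\<Sum>\<xi>\<in>G. (cmod (a \<xi>))\<^sup>2) \<le> (1/4)^n" if "finite G" "G \<inter> Fn n = {}" for G n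
    using that Fn(2)[of n] by (intro H(2)) auto
  have sq: "sqrt ((1/4)^n) = (1/2)^n" for n
    by (simp add: real_sqrt_power real_sqrt_divide)
  have L1: "(\<integral>x. cmod (tsum a G x) \<partial>torus) \<le> ?V * (1/2)^n" if "finite G" "G \<inter> Fn n = {}" for G n
  proof -
    have "(\<integral>x. cmod (tsum a G x) \<partial>torus) \<le> ?V * sqrt (\<Sum>\<xi>\<in>G. (cmod (a \<xi>))\<^sup>2)" by (rule integral_norm_tsum_le[OF that(1)])
    also have "\<dots> \<le> ?V * sqrt ((1/4)^n)" using tvol_pos[where ?'d='d] by (intro mult_left_mono real_sqrt_le_mono tail that) auto
    finally show ?thesis by (simp only: sq)
  qed
  have it: "integrable torus (\<lambda>x. cmod (tsum a G x))" for G
    by (rule torus_integrable_bounded[where B="\<Sum>\<xi>\<in>G. cmod (a \<xi>)"]) (auto simp: norm_tsum_le)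
  have itc: "integrable torus (tsum a G)" for G
    by (rule torus_integrable_bounded[where B="\<Sum>\<xi>\<in>G. cmod (a \<xi>)"]) (auto simp: norm_tsum_le)
  have L1n: "(\<integral>\<^sup>+x. ennreal (cmod (tsum a G x)) \<partial>torus) \<le> ennreal (?V * (1/2)^n)" if "finite G" "G \<inter> Fn n = {}" for G n
    using L1[OF that] by (subst nn_integral_eq_integral[OF it]) (auto simp: ennreal_leI)
  define d where "d n x = tsum a (Fn (Suc n) - Fn n) x" for n x
  have dsum: "(\<Sum>k<n. d k x) = tsum a (Fn n) x - tsum a (Fn 0) x" for n x
  proof (induction n)
    case (Suc n)
    have "tsum a (Fn (Suc n)) x = tsum a (Fn (Suc n) - Fn n) x + tsum a (Fn n) x"
      unfolding tsum_def using Fn(1) Fmono[of n "Suc n"] by (subst sum.subset_diff[of "Fn n" "Fn (Suc n)"]) auto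
    then show ?case using Suc by (simp add: d_def)
  qed simp
  have "(\<integral>\<^sup>+x. (\<Sum>n. ennreal (cmod (d n x))) \<partial>torus) = (\<Sum>n. \<integral>\<^sup>+x. ennreal (cmod (d n x)) \<partial>torus)"
    unfolding d_def by (rule nn_integral_suminf) (intro measurable_torus_gen, measurable)
  also have "\<dots> \<le> (\<Sum>n. ennreal (?V * (1/2)^n))"
    unfolding d_def by (intro suminf_le L1n) (auto simp: Fn)
  also have "\<dots> = ennreal (\<Sum>n. ?V * (1/2)^n)"
    using tvol_pos[where ?'d='d] by (intro suminf_ennreal2) (auto intro!: summable_mult summable_geometric)
  also have "\<dots> < \<infinity>" by simp
  finally have "(\<integral>\<^sup>+x. (\<Sum>n. ennreal (cmod (d n x))) \<partial>torus) \<noteq> \<infinity>" by simp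
  moreover have "(\<lambda>x. \<Sum>n. ennreal (cmod (d n x))) \<in> borel_measurable torus"
    unfolding d_def by (intro measurable_torus_gen) measurable
  ultimately have "AE x in torus. (\<Sum>n. ennreal (cmod (d n x))) \<noteq> \<infinity>"
    by (intro nn_integral_PInf_AE)
  then have conv: "AE x in torus. convergent (\<lambda>n. tsum a (Fn n) x)"
  proof eventually_elim
    case (elim x)
    then have "summable (\<lambda>n. cmod (d n x))"
      by (intro summable_suminf_not_top) (auto simp: infinity_ennreal_def)
    then have "summable (\<lambda>n. d n x)" by (rule summable_norm_cancel)
    then have "convergent (\<lambda>n. tsum a (Fn 0) x + (\<Sum>k<n. d k x))"
      by (intro convergent_add convergent_const) (simp add: summable_iff_convergent)
    then show ?case by (simp add: dsum)
  qed
  \<comment> \<open>Defined by \<open>lim\<close> at every point, convergent or not: the partial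
    sums are exactly periodic, so \<open>g\<close> is periodic everywhere and not just almost
    everywhere.\<close>
  define g where "g x = lim (\<lambda>n. tsum a (Fn n) x)" for x
  have mg: "g \<in> borel_measurable borel" unfolding g_def[abs_def] by (rule borel_measurable_lim_metric) simp
  have lim: "AE x in torus. (\<lambda>n. tsum a (Fn n) x) \<longlonglongrightarrow> g x"
    using conv by eventually_elim (simp add: g_def convergent_LIMSEQ_iff)
  have per: "g (x + axis i (2 * pi)) = g x" for i x by (simp add: g_def tsum_periodic)
  have "(\<integral>\<^sup>+x. ennreal ((cmod (g x))\<^sup>2) \<partial>torus) = (\<integral>\<^sup>+x. liminf (\<lambda>n. ennreal ((cmod (tsum a (Fn n) x))\<^sup>2)) \<partial>torus)"
  proof (rule nn_integral_cong_AE)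
    show "AE x in torus. ennreal ((cmod (g x))\<^sup>2) = liminf (\<lambda>n. ennreal ((cmod (tsum a (Fn n) x))\<^sup>2))"
      using lim
    proof eventually_elim
      case (elim x)
      have "(\<lambda>n. ennreal ((cmod (tsum a (Fn n) x))\<^sup>2)) \<longlonglongrightarrow> ennreal ((cmod (g x))\<^sup>2)"
        by (intro tendsto_ennrealI tendsto_intros elim)
      from lim_imp_Liminf[OF sequentially_bot this] show ?case by (rule sym)
    qed
  qed
  also have "\<dots> \<le> liminf (\<lambda>n. \<integral>\<^sup>+x. ennreal ((cmod (tsum a (Fn n) x))\<^sup>2) \<partial>torus)"
    by (rule nn_integral_liminf) (intro measurable_torus_gen, measurable)
  also have "\<dots> \<le> liminf (\<lambda>n. ennreal (?V * A))"
  proof (intro Liminf_mono always_eventually allI)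
    fix n
    have i2: "integrable torus (\<lambda>x. (cmod (tsum a (Fn n) x))\<^sup>2)"
    proof (rule torus_integrable_bounded[where B="(\<Sum>\<xi>\<in>Fn n. cmod (a \<xi>))\<^sup>2"])
      show "norm ((cmod (tsum a (Fn n) x))\<^sup>2) \<le> (\<Sum>\<xi>\<in>Fn n. cmod (a \<xi>))\<^sup>2" for x
        using power_mono[OF norm_tsum_le[of a "Fn n" x]] by simp
    qed measurable
    show "(\<integral>\<^sup>+x. ennreal ((cmod (tsum a (Fn n) x))\<^sup>2) \<partial>torus) \<le> ennreal (?V * A)"
      using tvol_pos[where ?'d='d] fin_le[OF Fn(1)]
      by (subst nn_integral_eq_integral[OF i2]) (auto simp: integral_tsum_sq[OF Fn(1)] intro!: ennreal_leI mult_left_mono)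
  qed
  also have "\<dots> < \<infinity>" by (simp add: Liminf_const)
  finally have fin: "(\<integral>\<^sup>+x. ennreal ((cmod (g x))\<^sup>2) \<partial>torus) < \<infinity>" .
  have g2: "integrable torus (\<lambda>x. (cmod (g x))\<^sup>2)"
  proof (rule integrableI_bounded)
    show "(\<lambda>x. (cmod (g x))\<^sup>2) \<in> borel_measurable torus" using mg by (intro measurable_torus) measurable
    show "(\<integral>\<^sup>+x. ennreal (norm ((cmod (g x))\<^sup>2)) \<partial>torus) < \<infinity>"
      unfolding real_norm_def abs_power2 by (rule fin)
  qed
  have "integrable torus (\<lambda>x. cmod (g x))"
    by (rule torus.square_integrable_imp_integrable[OF _ g2]) (intro measurable_torus, use mg in measurable)
  then have gi: "integrable torus g"
    by (rule integrable_norm_cancel) (intro measurable_torus mg)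
  \<comment> \<open>Fatou along \<open>Fn\<close> reduces this to the distance of two partial sums.
    Their index sets differ by two pieces that both avoid \<open>Fn n\<close>, hence the factor
    2.\<close>
  have gF: "(\<integral>x. cmod (g x - tsum a F x) \<partial>torus) \<le> 2 * ?V * (1/2)^n" if F: "finite F" "Fn n \<subseteq> F" for F n
  proof -
    have "(\<integral>\<^sup>+x. ennreal (cmod (g x - tsum a F x)) \<partial>torus) = (\<integral>\<^sup>+x. liminf (\<lambda>m. ennreal (cmod (tsum a (Fn m) x - tsum a F x))) \<partial>torus)"
    proof (rule nn_integral_cong_AE)
      show "AE x in torus. ennreal (cmod (g x - tsum a F x)) = liminf (\<lambda>m. ennreal (cmod (tsum a (Fn m) x - tsum a F x)))"
        using lim
      proof eventually_elim
        case (elim x)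
        have "(\<lambda>m. ennreal (cmod (tsum a (Fn m) x - tsum a F x))) \<longlonglongrightarrow> ennreal (cmod (g x - tsum a F x))"
          by (intro tendsto_ennrealI tendsto_intros elim)
        from lim_imp_Liminf[OF sequentially_bot this] show ?case by (rule sym)
      qed
    qed
    also have "\<dots> \<le> liminf (\<lambda>m. \<integral>\<^sup>+x. ennreal (cmod (tsum a (Fn m) x - tsum a F x)) \<partial>torus)"
      by (rule nn_integral_liminf) (intro measurable_torus_gen, measurable)
    also have "\<dots> \<le> liminf (\<lambda>m. ennreal (2 * ?V * (1/2)^n))"
    proof (rule Liminf_mono)
      show "\<forall>\<^sub>F m in sequentially. (\<integral>\<^sup>+x. ennreal (cmod (tsum a (Fn m) x - tsum a F x)) \<partial>torus) \<le> ennreal (2 * ?V * (1/2)^n)"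
        using eventually_ge_at_top[of n]
      proof eventually_elim
        case (elim m)
        have "(\<integral>\<^sup>+x. ennreal (cmod (tsum a (Fn m) x - tsum a F x)) \<partial>torus)
          \<le> (\<integral>\<^sup>+x. ennreal (cmod (tsum a (Fn m - F) x)) + ennreal (cmod (tsum a (F - Fn m) x)) \<partial>torus)"
        proof (rule nn_integral_mono)
          fix x
          have "cmod (tsum a (Fn m) x - tsum a F x) \<le> cmod (tsum a (Fn m - F) x) + cmod (tsum a (F - Fn m) x)"
            unfolding tsum_diff[OF Fn(1) F(1)] by (rule norm_triangle_ineq4)
          from ennreal_leI[OF this]
          show "ennreal (cmod (tsum a (Fn m) x - tsum a F x)) \<le> ennreal (cmod (tsum a (Fn m - F) x)) + ennreal (cmod (tsum a (F - Fn m) x))"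
            by (simp only: ennreal_plus[OF norm_ge_zero norm_ge_zero])
        qed
        also have "\<dots> = (\<integral>\<^sup>+x. ennreal (cmod (tsum a (Fn m - F) x)) \<partial>torus) + (\<integral>\<^sup>+x. ennreal (cmod (tsum a (F - Fn m) x)) \<partial>torus)"
          by (rule nn_integral_add) (intro measurable_torus_gen, measurable)+
        also have "\<dots> \<le> ennreal (?V * (1/2)^n) + ennreal (?V * (1/2)^n)"
          using F Fn(1) Fmono[OF elim] by (intro add_mono L1n) auto
        also have "\<dots> = ennreal (2 * ?V * (1/2)^n)"
          using tvol_pos[where ?'d='d] by (subst ennreal_plus[symmetric]) auto
        finally show ?case .
      qed
    qed
    also have "\<dots> = ennreal (2 * ?V * (1/2)^n)" by (simp add: Liminf_const)
    finally have le: "(\<integral>\<^sup>+x. ennreal (cmod (g x - tsum a F x)) \<partial>torus) \<le> ennreal (2 * ?V * (1/2)^n)" .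
    have i: "integrable torus (\<lambda>x. cmod (g x - tsum a F x))"
      by (intro integrable_norm Bochner_Integration.integrable_diff gi itc)
    have "ennreal (\<integral>x. cmod (g x - tsum a F x) \<partial>torus) \<le> ennreal (2 * ?V * (1/2)^n)"
      using le unfolding nn_integral_eq_integral[OF i AE_I2[OF norm_ge_zero]] .
    moreover have "0 \<le> 2 * ?V * (1/2)^n" using less_imp_le[OF tvol_pos[where ?'d='d]] by simp
    ultimately show ?thesis by (simp only: ennreal_le_iff)
  qed
  have L: "((\<lambda>F. \<integral>x. cmod (g x - tsum a F x) \<partial>torus) \<longlongrightarrow> 0) (finite_subsets_at_top UNIV)"
    unfolding tendsto_iff
  proof (intro allI impI)
    fix e :: real assume e: "0 < e"
    have "(\<lambda>n. 2 * ?V * (1/2)^n) \<longlonglongrightarrow> 0"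
      by (intro tendsto_mult_right_zero LIMSEQ_power_zero) simp
    from order_tendstoD(2)[OF this e] obtain n where n: "2 * ?V * (1/2)^n < e"
      unfolding eventually_sequentially by blast
    have "\<forall>\<^sub>F F in finite_subsets_at_top UNIV. finite F \<and> Fn n \<subseteq> F"
      unfolding eventually_finite_subsets_at_top using Fn(1)[of n] by auto
    then show "\<forall>\<^sub>F F in finite_subsets_at_top UNIV. dist (\<integral>x. cmod (g x - tsum a F x) \<partial>torus) 0 < e"
    proof eventually_elim
      case (elim F)
      then show ?case using gF[of F n] n by (simp add: dist_real_def)
    qed
  qed
  show ?thesis by (rule that[OF mg per g2 gi L Flim lim])
qed

definition cfc :: "(real^'d::finite \<Rightarrow> complex) \<Rightarrow> int^'d \<Rightarrow> complex" where
  "cfc u \<xi> = (\<integral>x. u x * ex (- \<xi>) x \<partial>torus) / of_real (tvol TYPE('d))"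

lemma fourier_coeff_cfc: "fourier_coeff u \<xi> = cfc (\<lambda>x. of_real (u x)) \<xi>"
  by (simp add: fourier_coeff_alt cfc_def)

lemma integrable_mult_ex: "integrable torus u \<Longrightarrow> integrable torus (\<lambda>x. u x * ex \<xi> x)"
  by (rule integrable_mult_bounded[where B=1]) (auto intro: measurable_torus)

lemma cfc_cnj: "cfc (\<lambda>x. cnj (u x)) \<xi> = cnj (cfc u (- \<xi>))"
proof -
  have "(\<integral>x. cnj (u x) * ex (- \<xi>) x \<partial>torus) = (\<integral>x. cnj (u x * ex (- (- \<xi>)) x) \<partial>torus)"
    by (simp add: ex_minus)
  also have "\<dots> = cnj (\<integral>x. u x * ex (- (- \<xi>)) x \<partial>torus)" by (rule Bochner_Integration.integral_cnj)
  finally show ?thesis by (simp add: cfc_def)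
qed

lemma fourier_coeff_minus: "fourier_coeff u (- \<xi>) = cnj (fourier_coeff u \<xi>)"
  using cfc_cnj[of "\<lambda>x. of_real (u x)" "- \<xi>"] by (simp add: fourier_coeff_cfc)

lemma fourier_coeff_cong_AE:
  assumes "AE x in torus. u x = v x" "u \<in> borel_measurable borel" "v \<in> borel_measurable borel"
  shows "fourier_coeff u \<xi> = fourier_coeff v \<xi>"
proof -
  have "(\<integral>x. of_real (u x) * ex (- \<xi>) x \<partial>torus) = (\<integral>x. of_real (v x) * ex (- \<xi>) x \<partial>torus)"
  proof (rule integral_cong_AE)
    show "(\<lambda>x. of_real (u x) * ex (- \<xi>) x) \<in> borel_measurable torus" "(\<lambda>x. of_real (v x) * ex (- \<xi>) x) \<in> borel_measurable torus"
      using assms by (intro measurable_torus; measurable)+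
  qed (use assms(1) in \<open>eventually_elim, simp\<close>)
  then show ?thesis by (simp add: fourier_coeff_alt)
qed

lemma fourier_coeff_linear:
  assumes "integrable torus u" "integrable torus v"
  shows "fourier_coeff (\<lambda>x. u x + v x) \<xi> = fourier_coeff u \<xi> + fourier_coeff v \<xi>"
    and "fourier_coeff (\<lambda>x. u x - v x) \<xi> = fourier_coeff u \<xi> - fourier_coeff v \<xi>"
    and "fourier_coeff (\<lambda>x. c * u x) \<xi> = of_real c * fourier_coeff u \<xi>"
proof -
  have i: "integrable torus (\<lambda>x. of_real (u x) * ex (- \<xi>) x)" "integrable torus (\<lambda>x. of_real (v x) * ex (- \<xi>) x)"
    using assms by (intro integrable_mult_ex; simp)+
  show "fourier_coeff (\<lambda>x. u x + v x) \<xi> = fourier_coeff u \<xi> + fourier_coeff v \<xi>"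
    "fourier_coeff (\<lambda>x. u x - v x) \<xi> = fourier_coeff u \<xi> - fourier_coeff v \<xi>"
    using i by (simp_all add: fourier_coeff_alt ring_distribs add_divide_distrib diff_divide_distrib)
  show "fourier_coeff (\<lambda>x. c * u x) \<xi> = of_real c * fourier_coeff u \<xi>"
    by (simp add: fourier_coeff_alt mult.assoc)
qed

lemma fourier_coeff_0: "fourier_coeff u 0 = of_real ((\<integral>x. u x \<partial>torus) / tvol TYPE('d))" for u :: "real^'d::finite \<Rightarrow> real"
  by (simp add: fourier_coeff_alt)

lemma norm_fourier_coeff_le:
  fixes u :: "real^'d::finite \<Rightarrow> real"
  shows "cmod (fourier_coeff u \<xi>) \<le> (\<integral>x. \<bar>u x\<bar> \<partial>torus) / tvol TYPE('d)"
proof -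
  have "cmod (\<integral>x. of_real (u x) * ex (- \<xi>) x \<partial>torus) \<le> (\<integral>x. cmod (of_real (u x) * ex (- \<xi>) x) \<partial>torus)"
    by (rule integral_norm_bound)
  then have "cmod (\<integral>x. of_real (u x) * ex (- \<xi>) x \<partial>torus) \<le> (\<integral>x. \<bar>u x\<bar> \<partial>torus)"
    by (simp add: norm_mult)
  then show ?thesis using tvol_pos[where ?'d='d] by (simp add: fourier_coeff_alt norm_divide divide_right_mono)
qed

lemma L2_torusD:
  fixes u :: "real^'d::finite \<Rightarrow> real"
  assumes "u \<in> L2_torus"
  shows "u \<in> borel_measurable borel" "torus_periodic u" "integrable torus (\<lambda>x. (u x)\<^sup>2)" "integrable torus u"
proof -
  show *: "u \<in> borel_measurable borel" "torus_periodic u" "integrable torus (\<lambda>x. (u x)\<^sup>2)"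
    using assms by (auto simp: L2_torus_def)
  show "integrable torus u"
    by (rule torus.square_integrable_imp_integrable[OF measurable_torus[OF *(1)] *(3)])
qed

lemma integrable_sq_diff:
  assumes "u \<in> L2_torus" "v \<in> L2_torus"
  shows "(\<lambda>x. u x - v x :: real) \<in> L2_torus"
proof -
  note u = L2_torusD[OF assms(1)] and v = L2_torusD[OF assms(2)]
  have "integrable torus (\<lambda>x. (u x - v x)\<^sup>2)"
  proof (rule Bochner_Integration.integrable_bound)
    show "integrable torus (\<lambda>x. 2 * (u x)\<^sup>2 + 2 * (v x)\<^sup>2)" using u v by simp
    have "(u x - v x)\<^sup>2 \<le> 2 * (u x)\<^sup>2 + 2 * (v x)\<^sup>2" for x
      using zero_le_power2[of "u x + v x"] by (simp add: power2_eq_square algebra_simps)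
    then show "AE x in torus. norm ((u x - v x)\<^sup>2) \<le> norm (2 * (u x)\<^sup>2 + 2 * (v x)\<^sup>2)" by simp
  qed (use u(1) v(1) in \<open>intro measurable_torus, measurable\<close>)
  then show ?thesis using u v by (auto simp: L2_torus_def torus_periodic_def)
qed

lemma L2_torus_scale: "u \<in> L2_torus \<Longrightarrow> (\<lambda>x. c * u x :: real) \<in> L2_torus"
  by (auto simp: L2_torus_def torus_periodic_def power_mult_distrib)

lemma L2_torus_add: "u \<in> L2_torus \<Longrightarrow> v \<in> L2_torus \<Longrightarrow> (\<lambda>x. u x + v x :: real) \<in> L2_torus"
  using integrable_sq_diff[of u "\<lambda>x. - v x"] L2_torus_scale[of v "-1"] by simp

lemma L2_torus_0: "(\<lambda>x. 0 :: real) \<in> L2_torus"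
  by (simp add: L2_torus_def torus_periodic_def)

lemma L2_eqI:
  assumes "u \<in> L2_torus" "v \<in> L2_torus" "\<And>\<xi>. fourier_coeff u \<xi> = fourier_coeff v \<xi>"
  shows "torus_eq u (v :: real^'d::finite \<Rightarrow> real)"
proof -
  note d = L2_torusD[OF integrable_sq_diff[OF assms(1,2)]]
  have "AE x in torus. u x - v x = 0"
    by (rule fourier_uniqueness[OF d(4,1,2)])
      (simp add: fourier_coeff_linear(2)[OF L2_torusD(4)[OF assms(1)] L2_torusD(4)[OF assms(2)]] assms(3))
  then show ?thesis unfolding torus_eq_def by eventually_elim simp
qed

text \<open>Convergence in mean suffices against bounded functions: exponentials when coefficients
  are read off, and smooth test functions together with their derivatives for weak
  differentiation.\<close>

lemma cfc_limit:
  fixes a :: "int^'d::finite \<Rightarrow> complex"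
  assumes g: "integrable torus g" and L: "((\<lambda>F. \<integral>x. cmod (g x - tsum a F x) \<partial>torus) \<longlongrightarrow> 0) (finite_subsets_at_top UNIV)"
    and T: "T \<in> borel_measurable borel" "\<And>x. cmod (T x) \<le> B"
  shows "((\<lambda>F. \<integral>x. tsum a F x * T x \<partial>torus) \<longlongrightarrow> (\<integral>x. g x * T x \<partial>torus)) (finite_subsets_at_top UNIV)"
proof -
  have B: "0 \<le> B" using T(2)[of 0] norm_ge_zero order_trans by blast
  have it: "integrable torus (tsum a F)" for F
    by (rule torus_integrable_bounded[where B="\<Sum>\<xi>\<in>F. cmod (a \<xi>)"]) (auto simp: norm_tsum_le)
  have i1: "integrable torus (\<lambda>x. g x * T x)" by (rule integrable_mult_bounded[OF g measurable_torus[OF T(1)] T(2)])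
  have i2: "integrable torus (\<lambda>x. tsum a F x * T x)" for F by (rule integrable_mult_bounded[OF it measurable_torus[OF T(1)] T(2)])
  have le: "dist (\<integral>x. tsum a F x * T x \<partial>torus) (\<integral>x. g x * T x \<partial>torus) \<le> (\<integral>x. cmod (g x - tsum a F x) \<partial>torus) * B" for F
  proof -
    have "dist (\<integral>x. tsum a F x * T x \<partial>torus) (\<integral>x. g x * T x \<partial>torus) = cmod (\<integral>x. (g x * T x - tsum a F x * T x) \<partial>torus)"
      using i1 i2[of F] by (simp add: dist_norm norm_minus_commute)
    also have "\<dots> \<le> (\<integral>x. cmod (g x * T x - tsum a F x * T x) \<partial>torus)" by (rule integral_norm_bound)
    also have "\<dots> \<le> (\<integral>x. cmod (g x - tsum a F x) * B \<partial>torus)"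
    proof (rule integral_mono)
      show "integrable torus (\<lambda>x. cmod (g x * T x - tsum a F x * T x))" "integrable torus (\<lambda>x. cmod (g x - tsum a F x) * B)"
        by (intro integrable_norm integrable_mult_left Bochner_Integration.integrable_diff i1 i2 g it)+
      show "cmod (g x * T x - tsum a F x * T x) \<le> cmod (g x - tsum a F x) * B" for x
        unfolding left_diff_distrib[symmetric] norm_mult by (intro mult_left_mono T) simp
    qed
    finally show ?thesis by simp
  qed
  have "((\<lambda>F. (\<integral>x. cmod (g x - tsum a F x) \<partial>torus) * B) \<longlongrightarrow> 0) (finite_subsets_at_top UNIV)"
    using tendsto_mult_left_zero[OF L] .
  then show ?thesis
    unfolding tendsto_dist_iff[of _ "\<integral>x. g x * T x \<partial>torus"]
    by (rule tendsto_sandwich[OF _ _ tendsto_const, rotated 2]) (auto intro!: always_eventually le)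
qed

lemma cfc_tsum:
  fixes a :: "int^'d::finite \<Rightarrow> complex"
  assumes "finite F"
  shows "cfc (tsum a F) \<xi> = (if \<xi> \<in> F then a \<xi> else 0)"
proof -
  have i: "integrable torus (ex \<zeta>)" for \<zeta> :: "int^'d" by (rule torus_integrable_bounded[of _ 1]) auto
  have "(\<lambda>x. tsum a F x * ex (- \<xi>) x) = (\<lambda>x. \<Sum>\<eta>\<in>F. a \<eta> * ex (\<eta> - \<xi>) x)"
    by (simp add: tsum_def sum_distrib_right ex_diff mult.assoc)
  then have "(\<integral>x. tsum a F x * ex (- \<xi>) x \<partial>torus) = (\<Sum>\<eta>\<in>F. a \<eta> * (\<integral>x. ex (\<eta> - \<xi>) x \<partial>(torus :: (real^'d) measure)))"
    by (simp add: Bochner_Integration.integral_sum i)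
  also have "\<dots> = (if \<xi> \<in> F then a \<xi> * of_real (tvol TYPE('d)) else 0)"
    using assms by (simp add: integral_ex if_distrib cong: if_cong)
  finally show ?thesis using tvol_pos[where ?'d='d] by (simp add: cfc_def)
qed

text \<open>By the symmetry of \<open>a\<close> the limit and its conjugate have equal coefficients.
  The imaginary part thus has none, vanishes almost everywhere by uniqueness, and the real part is
  the desired function.\<close>

theorem Riesz_Fischer_real:
  fixes a :: "int^'d::finite \<Rightarrow> complex"
  assumes a: "(\<lambda>\<xi>. (cmod (a \<xi>))\<^sup>2) summable_on UNIV" and h: "\<And>\<xi>. a (- \<xi>) = cnj (a \<xi>)"
  obtains u Fn where "u \<in> L2_torus" "\<And>\<xi>. fourier_coeff u \<xi> = a \<xi>"
    "((\<lambda>F. \<integral>x. cmod (complex_of_real (u x) - tsum a F x) \<partial>torus) \<longlongrightarrow> 0) (finite_subsets_at_top UNIV)"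
    "filterlim Fn (finite_subsets_at_top UNIV) sequentially"
    "AE x in torus. (\<lambda>n. tsum a (Fn n) x) \<longlonglongrightarrow> complex_of_real (u x)"
proof -
  obtain g Fn where g: "g \<in> borel_measurable borel" "\<And>i x. g (x + axis i (2 * pi)) = g x"
    "integrable torus (\<lambda>x. (cmod (g x))\<^sup>2)" "integrable torus g"
    and L: "((\<lambda>F. \<integral>x. cmod (g x - tsum a F x) \<partial>torus) \<longlongrightarrow> 0) (finite_subsets_at_top UNIV)"
    and Fn: "filterlim Fn (finite_subsets_at_top UNIV) sequentially"
    and lim: "AE x in torus. (\<lambda>n. tsum a (Fn n) x) \<longlonglongrightarrow> g x"
    by (rule Riesz_Fischer[OF a]) blast
  have ca: "cfc g \<xi> = a \<xi>" for \<xi>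
  proof -
    have "((\<lambda>F. cfc (tsum a F) \<xi>) \<longlongrightarrow> cfc g \<xi>) (finite_subsets_at_top UNIV)"
      unfolding cfc_def
      by (intro tendsto_divide cfc_limit[OF g(4) L, where B=1] tendsto_const) (use tvol_pos[where ?'d='d] in auto)
    moreover have "\<forall>\<^sub>F F in finite_subsets_at_top UNIV. finite F \<and> {\<xi>} \<subseteq> F"
      unfolding eventually_finite_subsets_at_top by (rule exI[of _ "{\<xi>}"]) auto
    then have "\<forall>\<^sub>F F in finite_subsets_at_top UNIV. cfc (tsum a F) \<xi> = a \<xi>"
      by eventually_elim (simp add: cfc_tsum)
    then have "((\<lambda>F. cfc (tsum a F) \<xi>) \<longlongrightarrow> a \<xi>) (finite_subsets_at_top UNIV)" by (rule tendsto_eventually)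
    ultimately show ?thesis using tendsto_unique[OF finite_subsets_at_top_neq_bot] by blast
  qed
  have L2: "(\<lambda>x. f (g x)) \<in> L2_torus" if f: "f \<in> borel_measurable borel" "\<And>z. \<bar>f z\<bar> \<le> cmod z" for f :: "complex \<Rightarrow> real"
  proof -
    have m: "(\<lambda>x. f (g x)) \<in> borel_measurable borel" using f(1) g(1) by measurable
    have "integrable torus (\<lambda>x. (f (g x))\<^sup>2)"
    proof (rule Bochner_Integration.integrable_bound[OF g(3)])
      show "(\<lambda>x. (f (g x))\<^sup>2) \<in> borel_measurable torus" using m by (intro measurable_torus) measurable
      have "(f (g x))\<^sup>2 \<le> (cmod (g x))\<^sup>2" for x using power_mono[OF f(2)[of "g x"], of 2] by simp
      then show "AE x in torus. norm ((f (g x))\<^sup>2) \<le> norm ((cmod (g x))\<^sup>2)" by simp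
    qed
    then show ?thesis using m g(2) by (simp add: L2_torus_def torus_periodic_def)
  qed
  have LR: "(\<lambda>x. Re (g x)) \<in> L2_torus" and LI: "(\<lambda>x. Im (g x)) \<in> L2_torus"
    by (rule L2; auto simp: abs_Re_le_cmod abs_Im_le_cmod)+
  have cc: "cfc (\<lambda>x. cnj (g x)) \<xi> = a \<xi>" for \<xi> using cfc_cnj[of g \<xi>] ca h[of \<xi>] by simp
  have ig: "integrable torus (\<lambda>x. g x * ex (- \<xi>) x)" "integrable torus (\<lambda>x. cnj (g x) * ex (- \<xi>) x)" for \<xi>
    using g(4) by (intro integrable_mult_ex; simp)+
  have "fourier_coeff (\<lambda>x. Re (g x)) \<xi> = (cfc g \<xi> + cfc (\<lambda>x. cnj (g x)) \<xi>) / 2" for \<xi>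
  proof -
    have "complex_of_real (Re (g x)) * ex (- \<xi>) x = (g x * ex (- \<xi>) x + cnj (g x) * ex (- \<xi>) x) / 2" for x
      by (simp add: complex_add_cnj ring_distribs[symmetric])
    then show ?thesis using ig[of \<xi>] by (simp add: fourier_coeff_alt cfc_def add_divide_distrib mult.commute)
  qed
  then have cR: "fourier_coeff (\<lambda>x. Re (g x)) \<xi> = a \<xi>" for \<xi> by (simp add: ca cc)
  have "fourier_coeff (\<lambda>x. Im (g x)) \<xi> = (cfc g \<xi> - cfc (\<lambda>x. cnj (g x)) \<xi>) / (2 * \<i>)" for \<xi>
  proof -
    have "complex_of_real (Im (g x)) * ex (- \<xi>) x = (g x * ex (- \<xi>) x - cnj (g x) * ex (- \<xi>) x) / (2 * \<i>)" for x
      by (simp add: complex_diff_cnj left_diff_distrib[symmetric] mult_ac)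
    then show ?thesis using ig[of \<xi>] by (simp add: fourier_coeff_alt cfc_def diff_divide_distrib right_diff_distrib mult.commute[of _ 2])
  qed
  then have "fourier_coeff (\<lambda>x. Im (g x)) \<xi> = 0" for \<xi> by (simp add: ca cc)
  then have "AE x in torus. Im (g x) = 0"
    using fourier_uniqueness[OF L2_torusD(4,1,2)[OF LI]] by blast
  then have gR: "AE x in torus. g x = complex_of_real (Re (g x))"
    by eventually_elim (simp add: complex_eq_iff)
  show ?thesis
  proof (rule that[OF LR cR _ Fn])
    have "(\<integral>x. cmod (complex_of_real (Re (g x)) - tsum a F x) \<partial>torus) = (\<integral>x. cmod (g x - tsum a F x) \<partial>torus)" for F
    proof (rule integral_cong_AE)
      show "(\<lambda>x. cmod (complex_of_real (Re (g x)) - tsum a F x)) \<in> borel_measurable torus"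
        "(\<lambda>x. cmod (g x - tsum a F x)) \<in> borel_measurable torus"
        using g(1) by (intro measurable_torus; measurable)+
    qed (use gR in \<open>eventually_elim, simp\<close>)
    then show "((\<lambda>F. \<integral>x. cmod (complex_of_real (Re (g x)) - tsum a F x) \<partial>torus) \<longlongrightarrow> 0) (finite_subsets_at_top UNIV)"
      using L by simp
    show "AE x in torus. (\<lambda>n. tsum a (Fn n) x) \<longlonglongrightarrow> complex_of_real (Re (g x))"
      using lim gR by eventually_elim simp
  qed
qed

text \<open>Absolute summability of the coefficients bounds all partial sums of \<open>u\<close> by
  \<open>A\<close>, and so \<open>u\<close> itself almost everywhere. For a partial sum the
  coefficient of the product is a finite convolution; dominated convergence with majorant
  \<open>A * \<bar>v x\<bar>\<close> passes to the limit.\<close>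

lemma fourier_coeff_product:
  fixes u v :: "real^'d::finite \<Rightarrow> real"
  assumes u: "u \<in> L2_torus" and v: "v \<in> L2_torus"
    and s2: "(\<lambda>\<xi>. (cmod (fourier_coeff u \<xi>))\<^sup>2) summable_on UNIV" and s1: "(\<lambda>\<xi>. cmod (fourier_coeff u \<xi>)) summable_on UNIV"
  shows "(\<lambda>x. u x * v x) \<in> L2_torus"
    and "fourier_coeff (\<lambda>x. u x * v x) \<xi> = (\<Sum>\<^sub>\<infinity>\<eta>. fourier_coeff u (\<xi> - \<eta>) * fourier_coeff v \<eta>)"
proof -
  let ?a = "fourier_coeff u"
  let ?V = "tvol TYPE('d)"
  define A where "A = (\<Sum>\<^sub>\<infinity>\<xi>. cmod (?a \<xi>))"
  obtain w Fn where w: "w \<in> L2_torus" "\<And>\<xi>. fourier_coeff w \<xi> = ?a \<xi>"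
    and Fn: "filterlim Fn (finite_subsets_at_top UNIV) sequentially"
    and lim: "AE x in torus. (\<lambda>n. tsum ?a (Fn n) x) \<longlonglongrightarrow> complex_of_real (w x)"
    by (rule Riesz_Fischer_real[OF s2 fourier_coeff_minus]) blast
  \<comment> \<open>The constructed \<open>w\<close> has the coefficients of \<open>u\<close>, so by
    uniqueness the partial sums converge almost everywhere to \<open>u\<close> itself.\<close>
  have "torus_eq w u" by (rule L2_eqI[OF w(1) u w(2)])
  with lim have limu: "AE x in torus. (\<lambda>n. tsum ?a (Fn n) x) \<longlonglongrightarrow> complex_of_real (u x)"
    unfolding torus_eq_def by eventually_elim simp
  have bF: "cmod (tsum ?a F x) \<le> A" for F x
  proof (cases "finite F")
    case True
    then show ?thesis unfolding A_def
      by (intro order_trans[OF norm_tsum_le] finite_sum_le_infsum s1) auto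
  next
    case False
    then show ?thesis by (auto simp: tsum_def A_def intro: infsum_nonneg)
  qed
  have A0: "0 \<le> A" unfolding A_def by (intro infsum_nonneg) auto
  have bu: "AE x in torus. \<bar>u x\<bar> \<le> A"
    using limu
  proof eventually_elim
    case (elim x)
    have "cmod (complex_of_real (u x)) \<le> A"
      by (rule LIMSEQ_le_const2[OF tendsto_norm[OF elim]]) (auto intro: bF)
    then show ?case by simp
  qed
  note u' = L2_torusD[OF u] and v' = L2_torusD[OF v]
  have m: "(\<lambda>x. u x * v x) \<in> borel_measurable borel" by (rule borel_measurable_times[OF u'(1) v'(1)])
  have "integrable torus (\<lambda>x. (u x * v x)\<^sup>2)"
  proof (rule Bochner_Integration.integrable_bound)
    show "integrable torus (\<lambda>x. A\<^sup>2 * (v x)\<^sup>2)" using v' by simp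
    show "(\<lambda>x. (u x * v x)\<^sup>2) \<in> borel_measurable torus" by (intro measurable_torus borel_measurable_power m)
    show "AE x in torus. norm ((u x * v x)\<^sup>2) \<le> norm (A\<^sup>2 * (v x)\<^sup>2)"
      using bu
    proof eventually_elim
      case (elim x)
      have "(u x)\<^sup>2 \<le> A\<^sup>2" using power_mono[OF elim, of 2] by simp
      then show ?case by (simp add: power_mult_distrib abs_mult mult_right_mono)
    qed
  qed
  then show "(\<lambda>x. u x * v x) \<in> L2_torus" using m u'(2) v'(2) by (simp add: L2_torus_def torus_periodic_def)
  have mu: "(\<lambda>x. complex_of_real (u x)) \<in> borel_measurable borel" using u'(1) by measurable
  have mv: "(\<lambda>x. complex_of_real (v x) * ex (- \<xi>) x) \<in> borel_measurable borel" using v'(1) by measurable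
  have lm: "(\<lambda>n. \<integral>x. tsum ?a (Fn n) x * (of_real (v x) * ex (- \<xi>) x) \<partial>torus) \<longlonglongrightarrow>
      (\<integral>x. complex_of_real (u x) * (of_real (v x) * ex (- \<xi>) x) \<partial>torus)"
  proof (rule integral_dominated_convergence[where w="\<lambda>x. A * \<bar>v x\<bar>"])
    show "(\<lambda>x. complex_of_real (u x) * (of_real (v x) * ex (- \<xi>) x)) \<in> borel_measurable torus"
      by (intro measurable_torus borel_measurable_times mu mv)
    show "(\<lambda>x. tsum ?a (Fn n) x * (of_real (v x) * ex (- \<xi>) x)) \<in> borel_measurable torus" for n
      using v'(1) measurable_ex[of "- \<xi>"] by (intro measurable_torus) measurable
    show "AE x in torus. (\<lambda>n. tsum ?a (Fn n) x * (of_real (v x) * ex (- \<xi>) x)) \<longlonglongrightarrow> complex_of_real (u x) * (of_real (v x) * ex (- \<xi>) x)"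
      using limu by eventually_elim (intro tendsto_intros)
    show "AE x in torus. norm (tsum ?a (Fn n) x * (of_real (v x) * ex (- \<xi>) x)) \<le> A * \<bar>v x\<bar>" for n
      by (intro AE_I2) (simp add: norm_mult mult_right_mono[OF bF])
  qed (use v' in simp)
  have fin: "(\<integral>x. tsum ?a F x * (of_real (v x) * ex (- \<xi>) x) \<partial>torus) = of_real ?V * (\<Sum>\<eta>\<in>F. ?a \<eta> * fourier_coeff v (\<xi> - \<eta>))" for F
  proof -
    have i: "integrable torus (\<lambda>x. of_real (v x) * ex \<zeta> x)" for \<zeta> using v' by (intro integrable_mult_ex) simp
    have "tsum ?a F x * (of_real (v x) * ex (- \<xi>) x) = (\<Sum>\<eta>\<in>F. ?a \<eta> * (of_real (v x) * ex (- (\<xi> - \<eta>)) x))" for x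
      using ex_diff[of _ \<xi> x] by (simp add: tsum_def sum_distrib_right sum_distrib_left mult_ac)
    then have "(\<integral>x. tsum ?a F x * (of_real (v x) * ex (- \<xi>) x) \<partial>torus) = (\<Sum>\<eta>\<in>F. ?a \<eta> * (\<integral>x. of_real (v x) * ex (- (\<xi> - \<eta>)) x \<partial>torus))"
      by (simp only: Bochner_Integration.integral_sum integrable_mult_right i integral_mult_right_zero)
    also have "\<dots> = (\<Sum>\<eta>\<in>F. ?a \<eta> * (of_real ?V * fourier_coeff v (\<xi> - \<eta>)))"
      using tvol_pos[where ?'d='d] by (simp add: fourier_coeff_alt)
    finally show ?thesis by (simp add: sum_distrib_left mult_ac)
  qed
  have sm: "(\<lambda>\<eta>. ?a \<eta> * fourier_coeff v (\<xi> - \<eta>)) summable_on UNIV"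
  proof (rule abs_summable_summable, rule summable_on_comparison_test)
    show "(\<lambda>\<eta>. cmod (?a \<eta>) * ((\<integral>x. \<bar>v x\<bar> \<partial>torus) / ?V)) summable_on UNIV" by (intro summable_on_cmult_left s1)
    show "norm (?a \<eta> * fourier_coeff v (\<xi> - \<eta>)) \<le> cmod (?a \<eta>) * ((\<integral>x. \<bar>v x\<bar> \<partial>torus) / ?V)" for \<eta>
      unfolding norm_mult by (intro mult_left_mono norm_fourier_coeff_le) simp
  qed auto
  then have "((\<lambda>F. \<Sum>\<eta>\<in>F. ?a \<eta> * fourier_coeff v (\<xi> - \<eta>)) \<longlongrightarrow> (\<Sum>\<^sub>\<infinity>\<eta>. ?a \<eta> * fourier_coeff v (\<xi> - \<eta>))) (finite_subsets_at_top UNIV)"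
    by (rule infsum_tendsto)
  from filterlim_compose[OF this Fn]
  have "(\<lambda>n. of_real ?V * (\<Sum>\<eta>\<in>Fn n. ?a \<eta> * fourier_coeff v (\<xi> - \<eta>))) \<longlonglongrightarrow> of_real ?V * (\<Sum>\<^sub>\<infinity>\<eta>. ?a \<eta> * fourier_coeff v (\<xi> - \<eta>))"
    by (intro tendsto_mult tendsto_const)
  with lm have "(\<integral>x. complex_of_real (u x) * (of_real (v x) * ex (- \<xi>) x) \<partial>torus) = of_real ?V * (\<Sum>\<^sub>\<infinity>\<eta>. ?a \<eta> * fourier_coeff v (\<xi> - \<eta>))"
    unfolding fin by (rule LIMSEQ_unique)
  then have "fourier_coeff (\<lambda>x. u x * v x) \<xi> = (\<Sum>\<^sub>\<infinity>\<eta>. ?a \<eta> * fourier_coeff v (\<xi> - \<eta>))"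
    using tvol_pos[where ?'d='d] by (simp add: fourier_coeff_alt mult.assoc)
  also have "\<dots> = (\<Sum>\<^sub>\<infinity>\<eta>. ?a (\<xi> - \<eta>) * fourier_coeff v \<eta>)"
    using infsum_diff_eq[of "\<lambda>\<eta>. ?a \<eta> * fourier_coeff v (\<xi> - \<eta>)" \<xi>] by simp
  finally show "fourier_coeff (\<lambda>x. u x * v x) \<xi> = (\<Sum>\<^sub>\<infinity>\<eta>. ?a (\<xi> - \<eta>) * fourier_coeff v \<eta>)" .
qed

section \<open>Sobolev functions and their coefficients\<close>

lemma trig_test_derivative:
  "((\<lambda>x::real^'d::finite. c1 * cos (x \<bullet> v) + c2 * sin (x \<bullet> v)) has_derivative
    (\<lambda>h. (h \<bullet> v) * (c2 * cos (x \<bullet> v) - c1 * sin (x \<bullet> v)))) (at x)"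
  by (auto intro!: derivative_eq_intros simp: algebra_simps)

lemma trig_test_frechet:
  "frechet_derivative (\<lambda>x::real^'d::finite. c1 * cos (x \<bullet> v) + c2 * sin (x \<bullet> v)) (at x) w
    = (w \<bullet> v) * (c2 * cos (x \<bullet> v) - c1 * sin (x \<bullet> v))"
  by (rule fun_cong[OF frechet_derivative_at[OF trig_test_derivative], symmetric])

text \<open>The family with arbitrary amplitudes is closed under directional derivatives, so the
  induction keeps \<open>c1\<close> and \<open>c2\<close> general.\<close>

lemma trig_test_C_class: "C_class k (\<lambda>x::real^'d::finite. c1 * cos (x \<bullet> v) + c2 * sin (x \<bullet> v))"
proof (induction k arbitrary: c1 c2)
  case 0
  show ?case by (auto intro!: continuous_intros)
next
  case (Suc k)
  have "C_class k (\<lambda>x. (w \<bullet> v) * (c2 * cos (x \<bullet> v) - c1 * sin (x \<bullet> v)))" for w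
    using Suc[of "(w \<bullet> v) * c2" "- (w \<bullet> v) * c1"] by (simp add: algebra_simps)
  moreover have "(\<lambda>x. c1 * cos (x \<bullet> v) + c2 * sin (x \<bullet> v)) differentiable (at x)" for x
    by (rule differentiableI[OF trig_test_derivative])
  ultimately show ?case by (simp add: trig_test_frechet)
qed

lemma cos_sin_ex: "cos (x \<bullet> lattice_vec \<xi>) = Re (ex \<xi> x)" "sin (x \<bullet> lattice_vec \<xi>) = Im (ex \<xi> x)"
  by (simp_all add: ex_def Re_exp Im_exp)

text \<open>Test functions are real, so the exponential is tested through its cosine and sine
  separately; the two real identities recombine into the complex one.\<close>

lemma weak_partial_coeff:
  fixes g h :: "real^'d::finite \<Rightarrow> real"
  assumes g: "g \<in> L2_torus" and w: "has_weak_partial i g h"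
  shows "fourier_coeff h \<xi> = \<i> * of_int (\<xi> $ i) * fourier_coeff g \<xi>"
proof -
  let ?v = "lattice_vec \<xi> :: real^'d"
  have h: "h \<in> L2_torus" using w by (simp add: has_weak_partial_def)
  have test: "(\<integral>x. g x * (of_int (\<xi> $ i) * (c2 * cos (x \<bullet> ?v) - c1 * sin (x \<bullet> ?v))) \<partial>torus)
     = - (\<integral>x. h x * (c1 * cos (x \<bullet> ?v) + c2 * sin (x \<bullet> ?v)) \<partial>torus)" for c1 c2
  proof -
    have "torus_periodic (\<lambda>x. c1 * cos (x \<bullet> ?v) + c2 * sin (x \<bullet> ?v))"
      unfolding torus_periodic_def cos_sin_ex ex_periodic by simp
    with w trig_test_C_class[of _ c1 ?v c2]
    have "(\<integral>x. g x * frechet_derivative (\<lambda>x. c1 * cos (x \<bullet> ?v) + c2 * sin (x \<bullet> ?v)) (at x) (axis i 1) \<partial>torus)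
       = - (\<integral>x. h x * (c1 * cos (x \<bullet> ?v) + c2 * sin (x \<bullet> ?v)) \<partial>torus)"
      unfolding has_weak_partial_def by blast
    then show ?thesis unfolding trig_test_frechet by (simp add: inner_axis')
  qed
  define I where "I f = (\<integral>x. f x * cos (x \<bullet> ?v) \<partial>torus)" for f :: "real^'d \<Rightarrow> real"
  define J where "J f = (\<integral>x. f x * sin (x \<bullet> ?v) \<partial>torus)" for f :: "real^'d \<Rightarrow> real"
  have t1: "of_int (\<xi> $ i) * J g = I h"
    using test[of 0 1] by (simp add: I_def J_def mult.left_commute[of _ "of_int _"])
  have t2: "of_int (\<xi> $ i) * I g = - J h"
    using test[of 1 0] by (simp add: I_def J_def mult.left_commute[of _ "of_int _"])
  have c: "fourier_coeff f \<xi> = (of_real (I f) - \<i> * of_real (J f)) / of_real (tvol TYPE('d))" if f: "f \<in> L2_torus" for f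
  proof -
    have "integrable torus (\<lambda>x. complex_of_real (f x) * ex (- \<xi>) x)"
      using L2_torusD(4)[OF f] by (intro integrable_mult_ex) simp
    then have "(\<integral>x. complex_of_real (f x) * ex (- \<xi>) x \<partial>torus) = of_real (I f) - \<i> * of_real (J f)"
      unfolding I_def J_def cos_sin_ex
      by (simp add: complex_eq_iff integral_Re[symmetric] integral_Im[symmetric] ex_minus)
    then show ?thesis by (simp add: fourier_coeff_alt)
  qed
  have "of_real (I h) - \<i> * of_real (J h) = \<i> * of_int (\<xi> $ i) * (of_real (I g) - \<i> * of_real (J g))"
    using t1 t2 by (simp add: complex_eq_iff)
  then show ?thesis by (simp add: c[OF g] c[OF h])
qed

text \<open>The candidate has the coefficients of the formal derivative. For partial sums the
  defining identity is ordinary integration by parts, and both sides pass to the limit in mean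
  because \<open>\<psi>\<close> and its derivative are bounded.\<close>

lemma has_weak_partial_exists:
  fixes g :: "real^'d::finite \<Rightarrow> real"
  assumes g: "g \<in> L2_torus" and sa: "(\<lambda>\<xi>. (cmod (fourier_coeff g \<xi>))\<^sup>2) summable_on UNIV"
    and sb: "(\<lambda>\<xi>. (cmod (of_int (\<xi> $ i) * fourier_coeff g \<xi>))\<^sup>2) summable_on UNIV"
  shows "\<exists>h. has_weak_partial i g h"
proof -
  define a where "a = fourier_coeff g"
  define b where "b \<xi> = \<i> * of_int (\<xi> $ i) * a \<xi>" for \<xi>
  have sb': "(\<lambda>\<xi>. (cmod (b \<xi>))\<^sup>2) summable_on UNIV" using sb by (simp add: b_def a_def norm_mult)
  have hb: "b (- \<xi>) = cnj (b \<xi>)" for \<xi> by (simp add: b_def a_def fourier_coeff_minus)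
  obtain u where u: "u \<in> L2_torus" "\<And>\<xi>. fourier_coeff u \<xi> = a \<xi>"
    and Lu: "((\<lambda>F. \<integral>x. cmod (complex_of_real (u x) - tsum a F x) \<partial>torus) \<longlongrightarrow> 0) (finite_subsets_at_top UNIV)"
    unfolding a_def by (rule Riesz_Fischer_real[OF sa fourier_coeff_minus]) blast
  obtain h where h: "h \<in> L2_torus"
    and Lh: "((\<lambda>F. \<integral>x. cmod (complex_of_real (h x) - tsum b F x) \<partial>torus) \<longlongrightarrow> 0) (finite_subsets_at_top UNIV)"
    by (rule Riesz_Fischer_real[OF sb' hb]) blast
  have ug: "torus_eq u g" by (rule L2_eqI[OF u(1) g]) (simp add: u(2) a_def)
  have "has_weak_partial i g h"
    unfolding has_weak_partial_def
  proof (intro conjI h allI impI, elim conjE)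
    fix \<psi> :: "real^'d \<Rightarrow> real" assume p: "torus_periodic \<psi>" and C: "\<forall>k. C_class k \<psi>"
    let ?D = "\<lambda>x. frechet_derivative \<psi> (at x) (axis i 1)"
    note c = C_class_1D[OF C[rule_format]]
    have pD: "torus_periodic ?D" by (rule frechet_derivative_periodic[OF p c(1)])
    obtain B1 where B1: "\<And>x. norm (\<psi> x) \<le> B1" by (rule periodic_continuous_bounded[OF c(3) p]) blast
    obtain B2 where B2: "\<And>x. norm (?D x) \<le> B2" by (rule periodic_continuous_bounded[OF c(2) pD]) blast
    have mp: "\<psi> \<in> borel_measurable borel" "?D \<in> borel_measurable borel"
      using c by (auto intro: borel_measurable_continuous_onI)
    have mp': "(\<lambda>x. complex_of_real (\<psi> x)) \<in> borel_measurable borel" "(\<lambda>x. complex_of_real (?D x)) \<in> borel_measurable borel"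
      using mp by measurable
    have iu: "integrable torus (\<lambda>x. complex_of_real (u x))" "integrable torus (\<lambda>x. complex_of_real (h x))"
      using L2_torusD(4)[OF u(1)] L2_torusD(4)[OF h] by auto
    have l1: "((\<lambda>F. \<integral>x. tsum a F x * of_real (?D x) \<partial>torus) \<longlongrightarrow> (\<integral>x. complex_of_real (u x) * of_real (?D x) \<partial>torus)) (finite_subsets_at_top UNIV)"
      by (rule cfc_limit[OF iu(1) Lu mp'(2), of B2]) (use B2 in simp)
    have l2: "((\<lambda>F. \<integral>x. tsum b F x * of_real (\<psi> x) \<partial>torus) \<longlongrightarrow> (\<integral>x. complex_of_real (h x) * of_real (\<psi> x) \<partial>torus)) (finite_subsets_at_top UNIV)"
      by (rule cfc_limit[OF iu(2) Lh mp'(1), of B1]) (use B1 in simp)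
    have eq: "(\<integral>x. tsum a F x * of_real (?D x) \<partial>torus) = - (\<integral>x. tsum b F x * of_real (\<psi> x) \<partial>torus)" for F
    proof -
      have i1: "integrable torus (\<lambda>x. ex \<xi> x * complex_of_real (f x))" if "\<And>x. norm (f x) \<le> B" "f \<in> borel_measurable borel"
        for f :: "real^'d \<Rightarrow> real" and B \<xi>
        by (rule torus_integrable_bounded[of _ B]) (use that in \<open>auto simp: norm_mult\<close>)
      have "(\<integral>x. tsum a F x * of_real (?D x) \<partial>torus) = (\<Sum>\<xi>\<in>F. a \<xi> * (\<integral>x. ex \<xi> x * of_real (?D x) \<partial>torus))"
        using i1[OF B2 mp(2)] by (simp add: tsum_def sum_distrib_right mult.assoc)
      also have "\<dots> = - (\<Sum>\<xi>\<in>F. b \<xi> * (\<integral>x. ex \<xi> x * of_real (\<psi> x) \<partial>torus))"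
        unfolding integral_ex_partial[OF p C[rule_format]] by (simp add: b_def sum_negf[symmetric] mult_ac)
      also have "(\<Sum>\<xi>\<in>F. b \<xi> * (\<integral>x. ex \<xi> x * of_real (\<psi> x) \<partial>torus)) = (\<integral>x. tsum b F x * of_real (\<psi> x) \<partial>torus)"
        using i1[OF B1 mp(1)] by (simp add: tsum_def sum_distrib_right mult.assoc)
      finally show ?thesis .
    qed
    have "(\<integral>x. complex_of_real (u x) * of_real (?D x) \<partial>torus) = - (\<integral>x. complex_of_real (h x) * of_real (\<psi> x) \<partial>torus)"
      using tendsto_unique[OF finite_subsets_at_top_neq_bot l1] tendsto_minus[OF l2] unfolding eq by blast
    then have "complex_of_real (\<integral>x. u x * ?D x \<partial>torus) = complex_of_real (- (\<integral>x. h x * \<psi> x \<partial>torus))"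
      by (simp flip: of_real_mult)
    then have "(\<integral>x. u x * ?D x \<partial>torus) = - (\<integral>x. h x * \<psi> x \<partial>torus)" by (simp only: of_real_eq_iff)
    moreover have "(\<integral>x. g x * ?D x \<partial>torus) = (\<integral>x. u x * ?D x \<partial>torus)"
    proof (rule integral_cong_AE)
      show "(\<lambda>x. g x * ?D x) \<in> borel_measurable torus" "(\<lambda>x. u x * ?D x) \<in> borel_measurable torus"
        by (intro measurable_torus borel_measurable_times L2_torusD(1) g u mp)+
      show "AE x in torus. g x * ?D x = u x * ?D x"
        using ug unfolding torus_eq_def by eventually_elim simp
    qed
    ultimately show "(\<integral>x. g x * ?D x \<partial>torus) = - (\<integral>x. h x * \<psi> x \<partial>torus)" by simp
  qed
  then show ?thesis by blast
qed

section \<open>Scalar Sobolev functions as square-summable families\<close>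

definition emb :: "real \<Rightarrow> (real^'d::finite \<Rightarrow> real) \<Rightarrow> (int^'d) ell2" where
  "emb r u = Abs_ell2 (\<lambda>\<xi>. complex_of_real (jb \<xi> powr r) * fourier_coeff u \<xi>)"

lemma weighted_norm_sq: "(cmod (complex_of_real (jb \<xi> powr r) * c))\<^sup>2 = jb \<xi> powr (2 * r) * (cmod c)\<^sup>2"
  by (simp add: norm_mult power_mult_distrib powr_square)

lemma sobolev_real_iff:
  fixes u :: "real^'d::finite \<Rightarrow> real"
  shows "u \<in> sobolev r \<longleftrightarrow> u \<in> L2_torus \<and> (\<lambda>\<xi>. (cmod (complex_of_real (jb \<xi> powr r) * fourier_coeff u \<xi>))\<^sup>2) summable_on UNIV"
  by (simp add: sobolev_def fourier_coeff_norm_sq_def weighted_norm_sq)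

lemma sobolev_L2: "u \<in> sobolev r \<Longrightarrow> u \<in> L2_torus" by (simp add: sobolev_def)

lemma coef_emb:
  fixes u :: "real^'d::finite \<Rightarrow> real"
  assumes "u \<in> sobolev r"
  shows "coef (emb r u) = (\<lambda>\<xi>. complex_of_real (jb \<xi> powr r) * fourier_coeff u \<xi>)"
  using assms unfolding emb_def sobolev_real_iff by (intro Abs_ell2_inverse) simp

lemma norm_emb:
  fixes u :: "real^'d::finite \<Rightarrow> real"
  assumes "u \<in> sobolev r"
  shows "norm (emb r u) = sobolev_norm r u"
  unfolding norm_ell2_def coef_emb[OF assms] sobolev_norm_def
  by (simp add: fourier_coeff_norm_sq_def weighted_norm_sq)

lemma sobolevI_coef:
  fixes u :: "real^'d::finite \<Rightarrow> real"
  assumes "u \<in> L2_torus" "\<And>\<xi>. complex_of_real (jb \<xi> powr r) * fourier_coeff u \<xi> = coef a \<xi>"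
  shows "u \<in> sobolev r" "emb r u = a"
  using assms summable_coef[of a] by (simp_all add: sobolev_real_iff emb_def coef_inverse)

lemma sobolev_linear:
  fixes u v :: "real^'d::finite \<Rightarrow> real"
  assumes u: "u \<in> sobolev r" and v: "v \<in> sobolev r"
  shows "(\<lambda>x. u x + v x) \<in> sobolev r" "emb r (\<lambda>x. u x + v x) = emb r u + emb r v"
    and "(\<lambda>x. u x - v x) \<in> sobolev r" "emb r (\<lambda>x. u x - v x) = emb r u - emb r v"
    and "(\<lambda>x. c * u x) \<in> sobolev r" "emb r (\<lambda>x. c * u x) = c *\<^sub>R emb r u"
proof -
  note l = fourier_coeff_linear[OF L2_torusD(4)[OF sobolev_L2[OF u]] L2_torusD(4)[OF sobolev_L2[OF v]]]
  note L2 = sobolev_L2[OF u] sobolev_L2[OF v]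
  show "(\<lambda>x. u x + v x) \<in> sobolev r" "emb r (\<lambda>x. u x + v x) = emb r u + emb r v"
    by (rule sobolevI_coef[where a="emb r u + emb r v"]; simp add: l coef_emb[OF u] coef_emb[OF v] ring_distribs L2_torus_add L2)+
  show "(\<lambda>x. u x - v x) \<in> sobolev r" "emb r (\<lambda>x. u x - v x) = emb r u - emb r v"
    by (rule sobolevI_coef[where a="emb r u - emb r v"]; simp add: l coef_emb[OF u] coef_emb[OF v] ring_distribs integrable_sq_diff L2)+
  show "(\<lambda>x. c * u x) \<in> sobolev r" "emb r (\<lambda>x. c * u x) = c *\<^sub>R emb r u"
    by (rule sobolevI_coef[where a="c *\<^sub>R emb r u"]; simp add: l coef_emb[OF u] scaleR_conv_of_real L2_torus_scale L2)+
qed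

lemma sobolev_0: "(\<lambda>x. 0 :: real) \<in> sobolev r" "emb r (\<lambda>x. 0 :: real) = 0"
  by (rule sobolevI_coef[where a=0]; simp add: L2_torus_0 fourier_coeff_alt)+

lemma sobolev_sum:
  fixes f :: "'i \<Rightarrow> real^'d::finite \<Rightarrow> real"
  assumes "\<And>i. i \<in> I \<Longrightarrow> f i \<in> sobolev r"
  shows "(\<lambda>x. \<Sum>i\<in>I. f i x) \<in> sobolev r \<and> emb r (\<lambda>x. \<Sum>i\<in>I. f i x) = (\<Sum>i\<in>I. emb r (f i))"
  using assms
  by (induction I rule: infinite_finite_induct) (auto simp: sobolev_0 sobolev_linear)

lemma her_emb: "u \<in> sobolev r \<Longrightarrow> her (emb r u)"
  by (simp add: her_def coef_emb fourier_coeff_minus)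

lemma emb_eq_imp:
  fixes u v :: "real^'d::finite \<Rightarrow> real"
  assumes "u \<in> sobolev r" "v \<in> sobolev r" "emb r u = emb r v"
  shows "torus_eq u v"
proof (rule L2_eqI)
  fix \<xi> :: "int^'d"
  have "jb \<xi> powr r \<noteq> 0" by simp
  then show "fourier_coeff u \<xi> = fourier_coeff v \<xi>"
    using arg_cong[OF assms(3), of "\<lambda>a. coef a \<xi>"] by (simp add: coef_emb assms(1,2))
qed (use assms sobolev_L2 in auto)

lemma emb_cong:
  fixes u v :: "real^'d::finite \<Rightarrow> real"
  assumes "torus_eq u v" "u \<in> L2_torus" "v \<in> L2_torus"
  shows "emb r u = emb r v"
  unfolding emb_def using fourier_coeff_cong_AE[of u v] assms by (simp add: torus_eq_def L2_torusD(1))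

text \<open>For \<open>r \<ge> 0\<close> removing the weight only decreases the family, so
  Riesz--Fischer yields a function in L^2; \<open>her\<close> makes it real.\<close>

lemma emb_surj:
  fixes a :: "(int^'d::finite) ell2"
  assumes r: "0 \<le> r" and h: "her a"
  obtains u where "u \<in> sobolev r" "emb r u = a"
proof -
  define b where "b \<xi> = complex_of_real (jb \<xi> powr (- r)) * coef a \<xi>" for \<xi>
  have le: "jb \<xi> powr (- r) \<le> 1" for \<xi> :: "int^'d"
    using powr_mono[of "- r" 0 "jb \<xi>"] jb_ge_1[of \<xi>] r by simp
  have "(\<lambda>\<xi>. (cmod (b \<xi>))\<^sup>2) summable_on UNIV"
  proof (rule summable_on_comparison_test[OF summable_coef[of a]])
    show "(cmod (b \<xi>))\<^sup>2 \<le> (cmod (coef a \<xi>))\<^sup>2" for \<xi>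
      unfolding b_def norm_mult using mult_right_mono[OF le[of \<xi>] norm_ge_zero[of "coef a \<xi>"]] by (intro power_mono) auto
  qed auto
  moreover have "b (- \<xi>) = cnj (b \<xi>)" for \<xi> using h by (simp add: b_def her_def)
  ultimately obtain u where u: "u \<in> L2_torus" "\<And>\<xi>. fourier_coeff u \<xi> = b \<xi>"
    by (rule Riesz_Fischer_real) blast
  have "complex_of_real (jb \<xi> powr r) * b \<xi> = coef a \<xi>" for \<xi>
  proof -
    have "complex_of_real (jb \<xi> powr r) * complex_of_real (jb \<xi> powr (- r)) = 1"
      by (simp flip: of_real_mult powr_add)
    then show ?thesis by (simp add: b_def mult.assoc[symmetric])
  qed
  then have "complex_of_real (jb \<xi> powr r) * fourier_coeff u \<xi> = coef a \<xi>" for \<xi> by (simp add: u(2))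
  from sobolevI_coef[OF u(1) this] show ?thesis by (rule that)
qed

lemma jb_powr_shift: "complex_of_real (jb \<xi> powr (r - 1)) = complex_of_real (jb \<xi> powr r) / complex_of_real (jb \<xi>)"
  by (simp add: powr_diff)

lemma sobolev_shift:
  fixes u :: "real^'d::finite \<Rightarrow> real"
  assumes "u \<in> sobolev r"
  shows "u \<in> sobolev (r - 1)" "emb (r - 1) u = Jm (emb r u)"
  by (rule sobolevI_coef[OF sobolev_L2[OF assms], where a="Jm (emb r u)"]; simp add: coef_emb[OF assms] Jmult_def jb_powr_shift)+

lemma sobolev_shift2:
  fixes u :: "real^'d::finite \<Rightarrow> real"
  assumes "u \<in> sobolev r"
  shows "u \<in> sobolev (r - 2)" "emb (r - 2) u = Jm (Jm (emb r u))"
  using sobolev_shift[OF sobolev_shift(1)[OF assms]] sobolev_shift(2)[OF assms] by simp_all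

text \<open>Since \<open>r \<ge> 1\<close> the formal derivative is square-summable, so a weak
  derivative exists and the choice operator returns one. Any weak derivative has the expected
  coefficients, which determine the encoding.\<close>

lemma weak_partial_sobolev:
  fixes u :: "real^'d::finite \<Rightarrow> real"
  assumes u: "u \<in> sobolev r" and r: "1 \<le> r"
  shows "weak_partial i u \<in> sobolev (r - 1)" "emb (r - 1) (weak_partial i u) = Dm i (emb r u)"
proof -
  have bnd: "(\<lambda>\<xi>. (cmod (m \<xi> * fourier_coeff u \<xi>))\<^sup>2) summable_on UNIV" if m: "\<And>\<xi>. cmod (m \<xi>) \<le> jb \<xi>" for m
  proof (rule summable_on_comparison_test[OF summable_coef[of "emb r u"]])
    fix \<xi> :: "int^'d"
    have "jb \<xi> powr 1 \<le> jb \<xi> powr r" using r jb_ge_1 by (intro powr_mono) auto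
    then have "cmod (m \<xi>) \<le> jb \<xi> powr r" using m[of \<xi>] by simp
    then show "(cmod (m \<xi> * fourier_coeff u \<xi>))\<^sup>2 \<le> (cmod (coef (emb r u) \<xi>))\<^sup>2"
      unfolding coef_emb[OF u] norm_mult by (intro power_mono mult_right_mono) auto
  qed auto
  have "\<exists>h. has_weak_partial i u h"
    by (rule has_weak_partial_exists[OF sobolev_L2[OF u]])
      (use bnd[of "\<lambda>_. 1"] bnd[of "\<lambda>\<xi>. of_int (\<xi> $ i)"] abs_nth_le_jb jb_ge_1 in auto)
  then have w: "has_weak_partial i u (weak_partial i u)" unfolding weak_partial_def by (rule someI_ex)
  then have L2: "weak_partial i u \<in> L2_torus" by (simp add: has_weak_partial_def)
  show "weak_partial i u \<in> sobolev (r - 1)" "emb (r - 1) (weak_partial i u) = Dm i (emb r u)"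
    by (rule sobolevI_coef[OF L2, where a="Dm i (emb r u)"]; simp add: weak_partial_coeff[OF sobolev_L2[OF u] w] coef_emb[OF u] Dmult_def jb_powr_shift)+
qed

text \<open>Above d/2 the coefficients of \<open>u\<close> are absolutely summable and the product
  formula applies; \<open>conv_weight\<close> is exactly what remains when the plain coefficients
  are expressed by the weighted ones.\<close>

lemma sobolev_product:
  fixes u v :: "real^'d::finite \<Rightarrow> real"
  assumes u: "u \<in> sobolev r" and v: "v \<in> sobolev r" and r: "r > real CARD('d) / 2"
  shows "(\<lambda>x. u x * v x) \<in> sobolev r" "emb r (\<lambda>x. u x * v x) = conv r (emb r u) (emb r v)"
proof -
  have c: "fourier_coeff w \<xi> = complex_of_real (jb \<xi> powr (- r)) * coef (emb r w) \<xi>" if "w \<in> sobolev r" for w \<xi>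
    using jb_pos[of \<xi>] by (simp add: coef_emb[OF that] mult.assoc[symmetric] flip: of_real_mult powr_add)
  have r0: "0 \<le> r" using r by (rule order.trans[OF _ less_imp_le, rotated]) simp
  have s1: "(\<lambda>\<xi>. cmod (fourier_coeff u \<xi>)) summable_on UNIV"
    using summable_unweighted_coef[OF r, of "emb r u"] by (simp add: c[OF u])
  have s2: "(\<lambda>\<xi>. (cmod (fourier_coeff u \<xi>))\<^sup>2) summable_on UNIV"
  proof (rule summable_on_comparison_test[OF summable_coef[of "emb r u"]])
    fix \<xi> :: "int^'d"
    have "1 \<le> jb \<xi> powr r" using ge_one_powr_ge_zero[OF jb_ge_1 r0] .
    then have "1 * cmod (fourier_coeff u \<xi>) \<le> jb \<xi> powr r * cmod (fourier_coeff u \<xi>)" by (intro mult_right_mono) auto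
    then show "(cmod (fourier_coeff u \<xi>))\<^sup>2 \<le> (cmod (coef (emb r u) \<xi>))\<^sup>2"
      unfolding coef_emb[OF u] norm_mult by (intro power_mono) auto
  qed auto
  note p = fourier_coeff_product[OF sobolev_L2[OF u] sobolev_L2[OF v] s2 s1]
  have "complex_of_real (jb \<xi> powr r) * fourier_coeff (\<lambda>x. u x * v x) \<xi> = coef (conv r (emb r u) (emb r v)) \<xi>" for \<xi>
    unfolding p(2) coef_conv[OF r] infsum_cmult_right'[symmetric]
    by (rule infsum_cong) (simp add: conv_term_def conv_weight_def c[OF u] c[OF v] mult_ac)
  from sobolevI_coef[OF p(1) this]
  show "(\<lambda>x. u x * v x) \<in> sobolev r" "emb r (\<lambda>x. u x * v x) = conv r (emb r u) (emb r v)" .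
qed

text \<open>An isometry of H^r into a normed space, compatible with differences and real multiples.
  This suffices to translate continuity, boundedness and differentiability of curves, and is stated
  once for scalar and for vector-valued functions. Every property is conditional on membership,
  where \<open>sobolev_norm\<close> is meaningful.\<close>

locale sobolev_embedding =
  fixes r :: real and E :: "(real^'d::finite \<Rightarrow> 'b::euclidean_space) \<Rightarrow> 'x::real_normed_vector"
  assumes norm_E: "u \<in> sobolev r \<Longrightarrow> norm (E u) = sobolev_norm r u"
    and diff_E: "u \<in> sobolev r \<Longrightarrow> v \<in> sobolev r \<Longrightarrow>
      (\<lambda>x. u x - v x) \<in> sobolev r \<and> E (\<lambda>x. u x - v x) = E u - E v"
    and scaleR_E: "u \<in> sobolev r \<Longrightarrow> (\<lambda>x. k *\<^sub>R u x) \<in> sobolev r \<and> E (\<lambda>x. k *\<^sub>R u x) = k *\<^sub>R E u"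
begin

lemma continuous_iff:
  "sobolev_continuous_on A r u \<longleftrightarrow> (\<forall>a\<in>A. u a \<in> sobolev r) \<and> continuous_on A (\<lambda>a. E (u a))"
proof (cases "\<forall>a\<in>A. u a \<in> sobolev r")
  case True
  have "((\<lambda>b. sobolev_norm r (\<lambda>x. u b x - u a x)) \<longlongrightarrow> 0) (at a within A) \<longleftrightarrow> ((\<lambda>b. E (u b)) \<longlongrightarrow> E (u a)) (at a within A)"
    if a: "a \<in> A" for a
  proof -
    have "\<forall>\<^sub>F b in at a within A. sobolev_norm r (\<lambda>x. u b x - u a x) = norm (E (u b) - E (u a))"
      unfolding eventually_at_filter
    proof (intro always_eventually allI impI)
      fix b assume "b \<in> A"
      then have "(\<lambda>x. u b x - u a x) \<in> sobolev r \<and> E (\<lambda>x. u b x - u a x) = E (u b) - E (u a)"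
        using True a by (intro diff_E) auto
      then show "sobolev_norm r (\<lambda>x. u b x - u a x) = norm (E (u b) - E (u a))"
        using norm_E[of "\<lambda>x. u b x - u a x"] by metis
    qed
    then show ?thesis
      by (simp add: tendsto_cong tendsto_norm_zero_iff LIM_zero_iff)
  qed
  with True show ?thesis by (auto simp: sobolev_continuous_on_def continuous_on_def)
qed (auto simp: sobolev_continuous_on_def)

lemma deriv_iff:
  assumes t: "t \<in> I"
  shows "has_sobolev_deriv r I u t v \<longleftrightarrow>
    (\<forall>\<tau>\<in>I. u \<tau> \<in> sobolev r) \<and> v \<in> sobolev r \<and> ((\<lambda>\<tau>. E (u \<tau>)) has_vector_derivative E v) (at t within I)"
proof (cases "(\<forall>\<tau>\<in>I. u \<tau> \<in> sobolev r) \<and> v \<in> sobolev r")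
  case True
  have e: "sobolev_norm r (\<lambda>x. (u \<tau> x - u t x) /\<^sub>R (\<tau> - t) - v x) = norm ((E (u \<tau>) - E (u t)) /\<^sub>R (\<tau> - t) - E v)"
    if "\<tau> \<in> I" for \<tau>
  proof -
    have u: "u \<tau> \<in> sobolev r" "u t \<in> sobolev r" "v \<in> sobolev r" using True t that by auto
    note 1 = diff_E[OF u(1,2)]
    note 2 = scaleR_E[OF conjunct1[OF 1], of "inverse (\<tau> - t)"]
    note 3 = diff_E[OF conjunct1[OF 2] u(3)]
    show ?thesis
      unfolding norm_E[OF conjunct1[OF 3], symmetric] conjunct2[OF 3] conjunct2[OF 2] conjunct2[OF 1] ..
  qed
  have "\<forall>\<^sub>F \<tau> in at t within I. sobolev_norm r (\<lambda>x. (u \<tau> x - u t x) /\<^sub>R (\<tau> - t) - v x)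
      = norm ((E (u \<tau>) - E (u t)) /\<^sub>R (\<tau> - t) - E v)"
    unfolding eventually_at_filter by (rule always_eventually) (use e in blast)
  then have "((\<lambda>\<tau>. sobolev_norm r (\<lambda>x. (u \<tau> x - u t x) /\<^sub>R (\<tau> - t) - v x)) \<longlongrightarrow> 0) (at t within I) \<longleftrightarrow>
      ((\<lambda>\<tau>. E (u \<tau>)) has_vector_derivative E v) (at t within I)"
    unfolding has_vector_derivative_iff_tendsto
    by (simp add: tendsto_cong tendsto_norm_zero_iff LIM_zero_iff)
  with True show ?thesis by (simp add: has_sobolev_deriv_def)
qed (auto simp: has_sobolev_deriv_def)

lemma sobolev_derivI:
  assumes "has_sobolev_deriv r I u t v"
  shows "has_sobolev_deriv r I u t (sobolev_deriv r I u t)"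
  unfolding sobolev_deriv_def by (rule someI[of "has_sobolev_deriv r I u t", OF assms])

text \<open>The derivative is a chosen function. At a limit point of \<open>I\<close> uniqueness of
  vector derivatives pins down its encoding, which is all that later arguments look at.\<close>

lemma sobolev_deriv_eq:
  assumes t: "t \<in> I" and nt: "at t within I \<noteq> bot" and h: "has_sobolev_deriv r I u t v"
  shows "sobolev_deriv r I u t \<in> sobolev r" "E (sobolev_deriv r I u t) = E v"
  using sobolev_derivI[OF h] h vector_derivative_unique_within[OF nt]
  unfolding deriv_iff[OF t] by blast+

lemma C0b_iff:
  "sobolev_C0b I r u \<longleftrightarrow> (\<forall>t\<in>I. u t \<in> sobolev r) \<and> continuous_on I (\<lambda>t. E (u t)) \<and> (\<exists>M. \<forall>t\<in>I. norm (E (u t)) \<le> M)"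
  by (cases "\<forall>t\<in>I. u t \<in> sobolev r") (auto simp: sobolev_C0b_def continuous_iff norm_E)

end

interpretation emb: sobolev_embedding r "emb r :: (real^'d::finite \<Rightarrow> real) \<Rightarrow> _" for r
proof
  fix u v :: "real^'d \<Rightarrow> real" and k :: real
  assume u: "u \<in> sobolev r"
  show "norm (emb r u) = sobolev_norm r u" by (rule norm_emb[OF u])
  show "(\<lambda>x. k *\<^sub>R u x) \<in> sobolev r \<and> emb r (\<lambda>x. k *\<^sub>R u x) = k *\<^sub>R emb r u"
    using sobolev_linear(5,6)[OF u u] by simp
  assume v: "v \<in> sobolev r"
  show "(\<lambda>x. u x - v x) \<in> sobolev r \<and> emb r (\<lambda>x. u x - v x) = emb r u - emb r v"
    using sobolev_linear(3,4)[OF u v] by simp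
qed

section \<open>Vector-valued Sobolev functions\<close>

lemma sum_Basis_vec: "(\<Sum>b\<in>Basis. f b) = (\<Sum>i\<in>UNIV. f (axis i 1))" for f :: "real^'d::finite \<Rightarrow> 'b::comm_monoid_add"
proof -
  have "Basis = range (\<lambda>i. axis i 1 :: real^'d)" by (auto simp: Basis_vec_def)
  moreover have "inj (\<lambda>i. axis i 1 :: real^'d)" by (auto simp: inj_on_def axis_eq_axis)
  ultimately show ?thesis using sum.reindex[of "\<lambda>i. axis i 1 :: real^'d" UNIV f] by (simp add: o_def)
qed

lemma norm_vec_power2: "(norm (x :: 'a::real_normed_vector^'n))\<^sup>2 = (\<Sum>j\<in>UNIV. (norm (x $ j))\<^sup>2)"
  by (simp add: norm_vec_def L2_set_def sum_nonneg)

lemma borel_measurable_vec_iff: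
  fixes u :: "'a \<Rightarrow> real^'d::finite"
  shows "u \<in> borel_measurable M \<longleftrightarrow> (\<forall>j. (\<lambda>x. u x $ j) \<in> borel_measurable M)"
proof -
  have "u \<in> borel_measurable M \<longleftrightarrow> (\<forall>i\<in>Basis. (\<lambda>x. u x \<bullet> i) \<in> borel_measurable M)"
    by (rule borel_measurable_euclidean_space)
  then show ?thesis by (auto simp: Basis_vec_def inner_axis)
qed

lemma L2_torus_vec_iff:
  fixes u :: "real^'d::finite \<Rightarrow> real^'d"
  shows "u \<in> L2_torus \<longleftrightarrow> (\<forall>j. (\<lambda>x. u x $ j) \<in> L2_torus)"
proof
  assume u: "u \<in> L2_torus"
  then have m: "(\<lambda>x. u x $ j) \<in> borel_measurable borel" for j by (simp add: L2_torus_def borel_measurable_vec_iff)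
  have "integrable torus (\<lambda>x. (u x $ j)\<^sup>2)" for j
  proof (rule Bochner_Integration.integrable_bound)
    show "integrable torus (\<lambda>x. (norm (u x))\<^sup>2)" using u by (simp add: L2_torus_def)
    show "(\<lambda>x. (u x $ j)\<^sup>2) \<in> borel_measurable torus" by (intro measurable_torus borel_measurable_power m)
    have "(u x $ j)\<^sup>2 \<le> (norm (u x))\<^sup>2" for x
      using Finite_Cartesian_Product.norm_nth_le[of "u x" j] power_mono[of "\<bar>u x $ j\<bar>" "norm (u x)" 2] by simp
    then show "AE x in torus. norm ((u x $ j)\<^sup>2) \<le> norm ((norm (u x))\<^sup>2)" by simp
  qed
  then show "\<forall>j. (\<lambda>x. u x $ j) \<in> L2_torus" using u m by (simp add: L2_torus_def torus_periodic_def)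
next
  assume "\<forall>j. (\<lambda>x. u x $ j) \<in> L2_torus"
  then show "u \<in> L2_torus"
    by (auto simp: L2_torus_def torus_periodic_def borel_measurable_vec_iff vec_eq_iff norm_vec_power2)
qed

lemma fourier_coeff_norm_sq_vec:
  "fourier_coeff_norm_sq u \<xi> = (\<Sum>j\<in>UNIV. (cmod (fourier_coeff (\<lambda>x. u x $ j) \<xi>))\<^sup>2)"
  for u :: "real^'d::finite \<Rightarrow> real^'d"
  unfolding fourier_coeff_norm_sq_def sum_Basis_vec by (simp add: inner_axis)

lemma sobolev_vec_iff:
  fixes u :: "real^'d::finite \<Rightarrow> real^'d"
  shows "u \<in> sobolev r \<longleftrightarrow> (\<forall>j. (\<lambda>x. u x $ j) \<in> sobolev r)"
proof -
  let ?w = "\<lambda>j \<xi>. jb \<xi> powr (2 * r) * (cmod (fourier_coeff (\<lambda>x. u x $ j) \<xi>))\<^sup>2"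
  have "(\<lambda>\<xi>. \<Sum>j\<in>UNIV. ?w j \<xi>) summable_on UNIV \<longleftrightarrow> (\<forall>j. ?w j summable_on UNIV)"
  proof (intro iffI allI)
    fix j assume s: "(\<lambda>\<xi>. \<Sum>j\<in>UNIV. ?w j \<xi>) summable_on UNIV"
    show "?w j summable_on UNIV"
      by (rule summable_on_comparison_test[OF s]) (auto intro!: member_le_sum)
  qed (rule infsum_finite_sum(2), simp)
  then show ?thesis
    unfolding sobolev_def mem_Collect_eq L2_torus_vec_iff
    by (auto simp: fourier_coeff_norm_sq_vec sum_distrib_left fourier_coeff_norm_sq_def)
qed

definition embv :: "real \<Rightarrow> (real^'d::finite \<Rightarrow> real^'d) \<Rightarrow> 'd field" where
  "embv r u = (\<chi> j. emb r (\<lambda>x. u x $ j))"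

lemma embv_nth [simp]: "embv r u $ j = emb r (\<lambda>x. u x $ j)" by (simp add: embv_def)

lemma sobolev_nth: "u \<in> sobolev r \<Longrightarrow> (\<lambda>x. u x $ j) \<in> sobolev r" for u :: "real^'d::finite \<Rightarrow> real^'d"
  by (simp add: sobolev_vec_iff)

lemma norm_embv:
  fixes u :: "real^'d::finite \<Rightarrow> real^'d"
  assumes u: "u \<in> sobolev r"
  shows "norm (embv r u) = sobolev_norm r u"
proof -
  let ?w = "\<lambda>j \<xi>. jb \<xi> powr (2 * r) * (cmod (fourier_coeff (\<lambda>x. u x $ j) \<xi>))\<^sup>2"
  have s: "?w j summable_on UNIV" for j
    using sobolev_nth[OF u, of j] by (simp add: sobolev_def fourier_coeff_norm_sq_def)
  have "(norm (emb r (\<lambda>x. u x $ j)))\<^sup>2 = (\<Sum>\<^sub>\<infinity>\<xi>. ?w j \<xi>)" for j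
    unfolding norm_emb[OF sobolev_nth[OF u]] sobolev_norm_def
    by (simp add: fourier_coeff_norm_sq_def infsum_nonneg)
  then have "norm (embv r u) = sqrt (\<Sum>j\<in>UNIV. \<Sum>\<^sub>\<infinity>\<xi>. ?w j \<xi>)"
    by (simp add: norm_vec_def L2_set_def)
  also have "\<dots> = sobolev_norm r u"
    unfolding sobolev_norm_def fourier_coeff_norm_sq_vec sum_distrib_left
    by (subst infsum_finite_sum(1)) (use s in auto)
  finally show ?thesis .
qed

lemma embv_linear:
  fixes u v :: "real^'d::finite \<Rightarrow> real^'d"
  assumes u: "u \<in> sobolev r" and v: "v \<in> sobolev r"
  shows "(\<lambda>x. u x + v x) \<in> sobolev r" "embv r (\<lambda>x. u x + v x) = embv r u + embv r v"
    and "(\<lambda>x. u x - v x) \<in> sobolev r" "embv r (\<lambda>x. u x - v x) = embv r u - embv r v"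
    and "(\<lambda>x. k *\<^sub>R u x) \<in> sobolev r" "embv r (\<lambda>x. k *\<^sub>R u x) = k *\<^sub>R embv r u"
  using sobolev_linear[OF sobolev_nth[OF u] sobolev_nth[OF v]]
  by (simp_all add: sobolev_vec_iff[of _ r] vec_eq_iff)

interpretation embv: sobolev_embedding r "embv r :: (real^'d::finite \<Rightarrow> real^'d) \<Rightarrow> _" for r
  by standard (simp_all add: norm_embv embv_linear)

lemma embv_sum:
  fixes f :: "'i \<Rightarrow> real^'d::finite \<Rightarrow> real^'d"
  assumes "\<And>i. i \<in> I \<Longrightarrow> f i \<in> sobolev r"
  shows "(\<lambda>x. \<Sum>i\<in>I. f i x) \<in> sobolev r \<and> embv r (\<lambda>x. \<Sum>i\<in>I. f i x) = (\<Sum>i\<in>I. embv r (f i))"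
  using sobolev_sum[of I "\<lambda>i x. f i x $ j" r for j] assms
  by (simp add: sobolev_vec_iff[of _ r] vec_eq_iff)

lemma herf_embv: "u \<in> sobolev r \<Longrightarrow> herf (embv r u)"
  by (simp add: herf_def her_emb sobolev_nth)

lemma embv_surj:
  fixes a :: "'d::finite field"
  assumes r: "0 \<le> r" and h: "herf a"
  shows "\<exists>u. u \<in> sobolev r \<and> embv r u = a"
proof -
  have "\<forall>j. \<exists>u. u \<in> sobolev r \<and> emb r u = a $ j"
    using emb_surj[OF r] h unfolding herf_def by metis
  then obtain U where U: "\<And>j. U j \<in> sobolev r \<and> emb r (U j) = a $ j" by metis
  have "(\<lambda>x. \<chi> j. U j x) \<in> sobolev r \<and> embv r (\<lambda>x. \<chi> j. U j x) = a"
    using U by (simp add: sobolev_vec_iff vec_eq_iff)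
  then show ?thesis by blast
qed

lemma torus_eq_iff_emb:
  fixes u v :: "real^'d::finite \<Rightarrow> real"
  assumes u: "u \<in> sobolev r" and v: "v \<in> sobolev r"
  shows "torus_eq u v \<longleftrightarrow> emb r u = emb r v"
  using emb_eq_imp[OF u v] emb_cong[of u v r] sobolev_L2[OF u] sobolev_L2[OF v] by blast

lemma torus_eq_vec_iff: "torus_eq u v \<longleftrightarrow> (\<forall>j. torus_eq (\<lambda>x. u x $ j) (\<lambda>x. v x $ j))"
  for u v :: "real^'d::finite \<Rightarrow> real^'d"
proof
  assume "torus_eq u v"
  then show "\<forall>j. torus_eq (\<lambda>x. u x $ j) (\<lambda>x. v x $ j)"
    unfolding torus_eq_def by (auto elim: eventually_mono)
next
  assume "\<forall>j. torus_eq (\<lambda>x. u x $ j) (\<lambda>x. v x $ j)"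
  then show "torus_eq u v" unfolding torus_eq_def vec_eq_iff by (intro eventually_all_finite) simp
qed

lemma torus_eq_iff_embv:
  fixes u v :: "real^'d::finite \<Rightarrow> real^'d"
  assumes u: "u \<in> sobolev r" and v: "v \<in> sobolev r"
  shows "torus_eq u v \<longleftrightarrow> embv r u = embv r v"
  using torus_eq_iff_emb[OF sobolev_nth[OF u] sobolev_nth[OF v]]
  by (simp add: torus_eq_vec_iff[of u] vec_eq_iff)

lemma coef_emb_zero: "u \<in> sobolev r \<Longrightarrow> coef (emb r u) 0 = 0 \<longleftrightarrow> torus_mean_zero u"
  for u :: "real^'d::finite \<Rightarrow> real"
  using tvol_pos[where 'd='d] by (simp add: coef_emb fourier_coeff_0 torus_mean_zero_def)

text \<open>Integrability of \<open>u\<close> is established so that the vector-valued integral is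
  the genuine one, not its default value, and can be computed componentwise.\<close>

lemma coef_embv_zero:
  fixes u :: "real^'d::finite \<Rightarrow> real^'d"
  assumes u: "u \<in> sobolev r"
  shows "(\<forall>j. coef (embv r u $ j) 0 = 0) \<longleftrightarrow> torus_mean_zero u"
proof -
  note L2 = sobolev_L2[OF sobolev_nth[OF u]]
  have "integrable torus u"
  proof (rule Bochner_Integration.integrable_bound)
    show "integrable torus (\<lambda>x. \<Sum>j\<in>UNIV. \<bar>u x $ j\<bar>)" using L2_torusD(4)[OF L2] by simp
    show "u \<in> borel_measurable torus"
      by (rule measurable_torus) (use L2_torusD(1)[OF L2] borel_measurable_vec_iff in blast)
    have "norm (u x) \<le> (\<Sum>j\<in>UNIV. \<bar>u x $ j\<bar>)" for x using norm_vec_le_sum[of "u x"] by simp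
    then show "AE x in torus. norm (u x) \<le> norm (\<Sum>j\<in>UNIV. \<bar>u x $ j\<bar>)" by (simp add: sum_nonneg)
  qed
  then have "(\<integral>x. u x \<partial>torus) $ j = (\<integral>x. u x $ j \<partial>torus)" for j
    using integral_bounded_linear[OF bounded_linear_vec_nth] by metis
  then show ?thesis
    using coef_emb_zero[OF sobolev_nth[OF u]] by (simp add: torus_mean_zero_def vec_eq_iff)
qed

lemma embv_shift2:
  fixes u :: "real^'d::finite \<Rightarrow> real^'d"
  assumes u: "u \<in> sobolev r"
  shows "u \<in> sobolev (r - 2)" "embv (r - 2) u = Jf (Jf (embv r u))"
  using sobolev_shift2[OF sobolev_nth[OF u]] by (simp_all add: sobolev_vec_iff vec_eq_iff Jf_def)

section \<open>The differential operators in terms of the encodings\<close>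

lemma sobolev_laplacian:
  fixes u :: "real^'d::finite \<Rightarrow> real^'d"
  assumes u: "u \<in> sobolev s" and s: "2 \<le> s"
  shows "laplacian u \<in> sobolev (s - 2)" "embv (s - 2) (laplacian u) = Lf (embv s u)"
proof -
  have 1: "weak_partial i (weak_partial i (\<lambda>y. u y $ j)) \<in> sobolev (s - 2)"
    "emb (s - 2) (weak_partial i (weak_partial i (\<lambda>y. u y $ j))) = Dm i (Dm i (emb s (\<lambda>y. u y $ j)))" for i j
    using weak_partial_sobolev[OF sobolev_nth[OF u, of j], of i] s
      weak_partial_sobolev[of "weak_partial i (\<lambda>y. u y $ j)" "s - 1" i] by simp_all
  have 2: "(\<Sum>i\<in>UNIV. Dm i (Dm i a)) = Lm a" for a :: "(int^'d) ell2"
  proof (rule ell2_eqI)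
    fix \<xi> :: "int^'d"
    have "(\<Sum>i\<in>UNIV. Dmult i \<xi> * Dmult i \<xi>) = Lapmult \<xi>"
      unfolding Dmult_def Lapmult_def
      by (simp add: of_real_lam_eq power2_eq_square sum_divide_distrib sum_negf algebra_simps)
    then show "coef (\<Sum>i\<in>UNIV. Dm i (Dm i a)) \<xi> = coef (Lm a) \<xi>"
      by (simp add: mult.assoc[symmetric] flip: sum_distrib_right)
  qed
  show "laplacian u \<in> sobolev (s - 2)" "embv (s - 2) (laplacian u) = Lf (embv s u)"
    using sobolev_sum[of UNIV "\<lambda>i. weak_partial i (weak_partial i (\<lambda>y. u y $ j))" "s - 2" for j] 1
    by (simp_all add: sobolev_vec_iff vec_eq_iff laplacian_def Lf_def 2)
qed

text \<open>The product is formed in H^(s-1), where it is continuous; the outer \<open>Jf\<close>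
  only places the result in H^(s-2), where the equation is read.\<close>

lemma sobolev_advection:
  fixes u v :: "real^'d::finite \<Rightarrow> real^'d"
  assumes u: "u \<in> sobolev s" and v: "v \<in> sobolev s" and s: "s > real CARD('d) / 2 + 1"
  shows "advection u v \<in> sobolev (s - 2)" "embv (s - 2) (advection u v) = Jf (adv s (embv s u) (embv s v))"
proof -
  have s1: "1 \<le> s" using s by (smt (verit) divide_nonneg_nonneg of_nat_0_le_iff)
  have 1: "(\<lambda>x. u x $ i * weak_partial i (\<lambda>y. v y $ j) x) \<in> sobolev (s - 1)"
    "emb (s - 1) (\<lambda>x. u x $ i * weak_partial i (\<lambda>y. v y $ j) x)
      = conv (s - 1) (Jm (emb s (\<lambda>x. u x $ i))) (Dm i (emb s (\<lambda>x. v x $ j)))" for i j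
    using sobolev_product[OF sobolev_shift(1)[OF sobolev_nth[OF u]] weak_partial_sobolev(1)[OF sobolev_nth[OF v] s1]] s
    by (simp_all add: sobolev_shift(2)[OF sobolev_nth[OF u]] weak_partial_sobolev(2)[OF sobolev_nth[OF v] s1])
  have 2: "advection u v x $ j = (\<Sum>i\<in>UNIV. u x $ i * weak_partial i (\<lambda>y. v y $ j) x)" for x j
    by (simp add: advection_def inner_vec_def grad_def)
  have 3: "(\<lambda>x. advection u v x $ j) \<in> sobolev (s - 1)"
    "emb (s - 1) (\<lambda>x. advection u v x $ j) = adv s (embv s u) (embv s v) $ j" for j
    using sobolev_sum[of UNIV "\<lambda>i x. u x $ i * weak_partial i (\<lambda>y. v y $ j) x" "s - 1"] 1 by (simp_all add: 2 adv_def)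
  show "advection u v \<in> sobolev (s - 2)" "embv (s - 2) (advection u v) = Jf (adv s (embv s u) (embv s v))"
    using sobolev_shift[OF 3(1)] 3(2) by (simp_all add: sobolev_vec_iff vec_eq_iff Jf_def)
qed

lemma sobolev_grad:
  fixes p :: "real^'d::finite \<Rightarrow> real"
  assumes p: "p \<in> sobolev s" and s: "1 \<le> s"
  shows "grad p \<in> sobolev (s - 2)" "embv (s - 2) (grad p) = Jf (gradf (emb s p))"
  using sobolev_shift[OF weak_partial_sobolev(1)[OF p s]] weak_partial_sobolev(2)[OF p s]
  by (simp_all add: sobolev_vec_iff vec_eq_iff Jf_def gradf_def grad_def)

lemma divergence_free_iff:
  fixes u :: "real^'d::finite \<Rightarrow> real^'d"
  assumes u: "u \<in> sobolev s" and s: "1 \<le> s"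
  shows "torus_eq (divergence u) (\<lambda>x. 0) \<longleftrightarrow> divfree (embv s u)"
proof -
  note w = weak_partial_sobolev[OF sobolev_nth[OF u] s]
  have d: "divergence u \<in> sobolev (s - 1) \<and> emb (s - 1) (divergence u) = (\<Sum>i\<in>UNIV. Dm i (embv s u $ i))"
    using sobolev_sum[of UNIV "\<lambda>i. weak_partial i (\<lambda>y. u y $ i)" "s - 1"] w
    unfolding divergence_def[abs_def] by simp
  have "coef (\<Sum>i\<in>UNIV. Dm i (embv s u $ i)) \<xi>
      = \<i> / complex_of_real (jb \<xi>) * (\<Sum>i\<in>UNIV. of_int (\<xi> $ i) * coef (embv s u $ i) \<xi>)" for \<xi>
    unfolding sum_distrib_left coef_sum coef_mult Dmult_def by (simp add: mult_ac)
  then have "(\<Sum>i\<in>UNIV. Dm i (embv s u $ i)) = 0 \<longleftrightarrow> divfree (embv s u)"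
    unfolding divfree_def using ell2_eqI[of "\<Sum>i\<in>UNIV. Dm i (embv s u $ i)" 0]
    by (auto simp del: embv_nth coef_sum)
  then show ?thesis
    unfolding torus_eq_iff_emb[OF conjunct1[OF d] sobolev_0(1)] conjunct2[OF d] sobolev_0(2) .
qed

text \<open>The time derivative is a separate argument, so that one formula serves the derivative
  within the half-line and the one on the whole line.\<close>

definition momentum :: "(real^'d::finite \<Rightarrow> real^'d) \<Rightarrow> (real^'d \<Rightarrow> real^'d) \<Rightarrow> (real^'d \<Rightarrow> real) \<Rightarrow> real^'d \<Rightarrow> real^'d" where
  "momentum v u p x = v x - laplacian u x + advection u u x + grad p x"

lemma sobolev_momentum:
  fixes u v :: "real^'d::finite \<Rightarrow> real^'d"
  assumes v: "v \<in> sobolev (s - 2)" and u: "u \<in> sobolev s" and p: "p \<in> sobolev s"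
    and s: "s > real CARD('d) / 2 + 1" "2 \<le> s"
  shows "momentum v u p \<in> sobolev (s - 2)"
    "embv (s - 2) (momentum v u p) = embv (s - 2) v - Lf (embv s u)
      + Jf (adv s (embv s u) (embv s u)) + Jf (gradf (emb s p))"
proof -
  note l = sobolev_laplacian[OF u s(2)] and a = sobolev_advection[OF u u s(1)]
  have g: "grad p \<in> sobolev (s - 2)" "embv (s - 2) (grad p) = Jf (gradf (emb s p))"
    using sobolev_grad[OF p] s(2) by auto
  note 1 = embv_linear(3,4)[OF v l(1)]
  note 2 = embv_linear(1,2)[OF 1(1) a(1)]
  note 3 = embv_linear(1,2)[OF 2(1) g(1)]
  show "momentum v u p \<in> sobolev (s - 2)" using 3(1) by (simp add: momentum_def[abs_def])
  show "embv (s - 2) (momentum v u p) = embv (s - 2) v - Lf (embv s u)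
      + Jf (adv s (embv s u) (embv s u)) + Jf (gradf (emb s p))"
    using 3(2) by (simp add: momentum_def[abs_def] 1 2 l a g)
qed

text \<open>The chain rule for continuous partial derivatives, with values in a normed space.
  Coordinate directions are added one at a time, and differentiability in two variables follows from
  the partial derivatives because the one in the new direction is continuous.\<close>

lemma has_vector_derivative_along:
  fixes F :: "real^'n::finite \<Rightarrow> 'x::real_normed_vector"
  assumes d: "\<And>i \<phi>. ((\<lambda>h. F (\<phi> + h *\<^sub>R axis i 1)) has_vector_derivative G i \<phi>) (at 0)"
    and c: "\<And>i. continuous_on UNIV (G i)"
  shows "((\<lambda>t. F (t *\<^sub>R \<omega>)) has_vector_derivative (\<Sum>i\<in>UNIV. (\<omega> $ i) *\<^sub>R G i (t *\<^sub>R \<omega>))) (at t)"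
proof -
  have d': "((\<lambda>h. F (\<phi> + h *\<^sub>R axis i 1)) has_vector_derivative G i (\<phi> + h *\<^sub>R axis i 1)) (at h)" for \<phi> i h
  proof -
    have "((\<lambda>x. F ((\<phi> + h *\<^sub>R axis i 1) + x *\<^sub>R axis i 1)) \<circ> (\<lambda>x. x - h) has_vector_derivative
        1 *\<^sub>R G i (\<phi> + h *\<^sub>R axis i 1)) (at h)"
      by (rule vector_diff_chain_at) (auto intro!: derivative_eq_intros d)
    then show ?thesis by (simp add: o_def scaleR_diff_left)
  qed
  let ?w = "\<lambda>S. \<Sum>i\<in>S. (\<omega> $ i) *\<^sub>R axis i (1::real)"
  have "((\<lambda>h. F (a + h *\<^sub>R ?w S)) has_vector_derivative (\<Sum>i\<in>S. (\<omega> $ i) *\<^sub>R G i a)) (at 0)" if "finite S" for S a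
    using that
  proof (induction S)
    case (insert k S)
    \<comment> \<open>\<open>x\<close> moves along the directions already treated, \<open>y\<close>
      along the new one; the curve \<open>(h, h * (\<omega> $ k))\<close> joins them.\<close>
    let ?f = "\<lambda>x y. F (a + x *\<^sub>R ?w S + y *\<^sub>R axis k 1)"
    have "((\<lambda>(x, y). ?f x y) has_derivative (\<lambda>(tx, ty). tx *\<^sub>R (\<Sum>i\<in>S. (\<omega> $ i) *\<^sub>R G i a) +
        blinfun_scaleR_left (G k (a + 0 *\<^sub>R ?w S + 0 *\<^sub>R axis k 1)) ty)) (at (0, 0) within UNIV \<times> UNIV)"
    proof (rule has_derivative_partialsI[where f="?f" and fy="\<lambda>x y. blinfun_scaleR_left (G k (a + x *\<^sub>R ?w S + y *\<^sub>R axis k 1))"])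
      show "((\<lambda>x. ?f x 0) has_derivative (\<lambda>tx. tx *\<^sub>R (\<Sum>i\<in>S. (\<omega> $ i) *\<^sub>R G i a))) (at 0 within UNIV)"
        using insert.IH by (simp add: has_vector_derivative_def)
      show "((\<lambda>y. ?f x y) has_derivative blinfun_apply (blinfun_scaleR_left (G k (a + x *\<^sub>R ?w S + y *\<^sub>R axis k 1))))
          (at y within UNIV)" for x y
        using d'[of "a + x *\<^sub>R ?w S" k y] by (simp add: has_vector_derivative_def)
      have "continuous_on UNIV (\<lambda>(x, y). blinfun_scaleR_left (G k (a + x *\<^sub>R ?w S + y *\<^sub>R axis k 1)))"
        unfolding case_prod_unfold
        by (intro bounded_linear.continuous_on[OF bounded_linear_blinfun_scaleR_left]
            continuous_on_compose2[OF c] continuous_intros) auto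
      then show "continuous (at (0, 0) within UNIV \<times> UNIV) (\<lambda>(x, y). blinfun_scaleR_left (G k (a + x *\<^sub>R ?w S + y *\<^sub>R axis k 1)))"
        by (simp add: continuous_on_eq_continuous_at)
    qed auto
    then have "((\<lambda>(x, y). ?f x y) has_derivative (\<lambda>(tx, ty). tx *\<^sub>R (\<Sum>i\<in>S. (\<omega> $ i) *\<^sub>R G i a) + ty *\<^sub>R G k a)) (at (0, 0 * (\<omega> $ k)))"
      by simp
    moreover have "((\<lambda>h. (h, h * (\<omega> $ k))) has_derivative (\<lambda>h. (h, h * (\<omega> $ k)))) (at 0)"
      by (intro has_derivative_Pair has_derivative_ident has_derivative_mult_left)
    ultimately have "((\<lambda>h. case (h, h * (\<omega> $ k)) of (x, y) \<Rightarrow> ?f x y) has_derivative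
        (\<lambda>h. case (h, h * (\<omega> $ k)) of (tx, ty) \<Rightarrow> tx *\<^sub>R (\<Sum>i\<in>S. (\<omega> $ i) *\<^sub>R G i a) + ty *\<^sub>R G k a)) (at 0)"
      by (rule has_derivative_compose[rotated])
    then have "((\<lambda>h. ?f h (h * (\<omega> $ k))) has_derivative
        (\<lambda>h. h *\<^sub>R (\<Sum>i\<in>S. (\<omega> $ i) *\<^sub>R G i a) + (h * (\<omega> $ k)) *\<^sub>R G k a)) (at 0)"
      by (simp only: prod.case)
    moreover have "?f h (h * (\<omega> $ k)) = F (a + h *\<^sub>R ?w (insert k S))" for h
      using insert.hyps by (simp add: scaleR_add_right add_ac)
    moreover have "h *\<^sub>R (\<Sum>i\<in>S. (\<omega> $ i) *\<^sub>R G i a) + (h * (\<omega> $ k)) *\<^sub>R G k a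
        = h *\<^sub>R (\<Sum>i\<in>insert k S. (\<omega> $ i) *\<^sub>R G i a)" for h
      using insert.hyps by (simp add: scaleR_add_right add_ac)
    ultimately show ?case by (simp only: has_vector_derivative_def)
  qed simp
  note fin = this[OF finite_class.finite_UNIV, where a="t *\<^sub>R \<omega>"]
  have "(\<Sum>i\<in>UNIV. (\<omega> $ i) *\<^sub>R axis i (1::real)) = \<omega>"
    using basis_expansion[of \<omega>] by (simp only: scalar_mult_eq_scaleR)
  then have 0: "((\<lambda>h. F (t *\<^sub>R \<omega> + h *\<^sub>R \<omega>)) has_vector_derivative (\<Sum>i\<in>UNIV. (\<omega> $ i) *\<^sub>R G i (t *\<^sub>R \<omega>))) (at 0)"
    using fin by (simp only:)
  have 1: "((\<lambda>x. x - t) has_vector_derivative 1) (at t)" by (auto intro!: derivative_eq_intros)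
  have "((\<lambda>h. F (t *\<^sub>R \<omega> + h *\<^sub>R \<omega>)) \<circ> (\<lambda>x. x - t) has_vector_derivative
      1 *\<^sub>R (\<Sum>i\<in>UNIV. (\<omega> $ i) *\<^sub>R G i (t *\<^sub>R \<omega>))) (at t)"
    by (rule vector_diff_chain_at[OF 1]) (simp only: diff_self 0)
  then show ?thesis by (simp add: o_def scaleR_diff_left)
qed

section \<open>The Navier--Stokes system\<close>

lemma norm_Jf_le: "norm (Jf a) \<le> norm a"
  by (rule norm_vec_mono) (use norm_mul_le[OF Jmult_bound] in \<open>simp add: Jf_def\<close>)

lemma solution_emb:
  fixes u :: "real \<Rightarrow> real^'d::finite \<Rightarrow> real^'d"
  assumes s: "s > real CARD('d) / 2 + 1" "2 \<le> s" and sol: "solves_NS (s - 2) I F u p" and t: "t \<in> I"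
    and nt: "at t within I \<noteq> bot" and u: "\<And>\<tau>. \<tau> \<in> I \<Longrightarrow> u \<tau> \<in> sobolev s" and p: "p t \<in> sobolev s"
    and d: "has_sobolev_deriv (s - 2) I u t v"
  shows "divfree (embv s (u t))" "torus_eq (momentum (sobolev_deriv (s - 2) I u t) (u t) (p t)) (F t)"
    "sobolev_deriv (s - 2) I u t \<in> sobolev (s - 2)"
    "((\<lambda>\<tau>. Jf (Jf (embv s (u \<tau>)))) has_vector_derivative embv (s - 2) (sobolev_deriv (s - 2) I u t)) (at t within I)"
proof -
  show "divfree (embv s (u t))"
    using sol t divergence_free_iff[OF u[OF t]] s(2) unfolding solves_NS_def by auto
  show "torus_eq (momentum (sobolev_deriv (s - 2) I u t) (u t) (p t)) (F t)"
    using sol t unfolding solves_NS_def momentum_def[abs_def] by blast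
  note d' = embv.sobolev_derivI[OF d]
  show "sobolev_deriv (s - 2) I u t \<in> sobolev (s - 2)" using d' embv.deriv_iff[OF t] by blast
  have "((\<lambda>\<tau>. embv (s - 2) (u \<tau>)) has_vector_derivative embv (s - 2) (sobolev_deriv (s - 2) I u t)) (at t within I)"
    using d' embv.deriv_iff[OF t] by blast
  then show "((\<lambda>\<tau>. Jf (Jf (embv s (u \<tau>)))) has_vector_derivative embv (s - 2) (sobolev_deriv (s - 2) I u t)) (at t within I)"
    by (rule has_vector_derivative_transform[OF t, rotated]) (simp add: embv_shift2(2)[OF u])
qed

text \<open>Along the line \<open>t *\<^sub>R \<omega>\<close> the derivative is the combination of
  the partial derivatives with weights \<open>\<omega> $ i\<close>, even in H^s. Its bound depends
  on \<open>\<omega>\<close> and serves only to show that the time derivative of the solution is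
  bounded; the decay constants do not contain it.\<close>

lemma quasi_periodic_derivative:
  fixes U :: "real^'n::finite \<Rightarrow> real^'d::finite \<Rightarrow> real^'d"
  assumes U: "torus_C1 s U" and b: "\<And>i \<phi>. sobolev_norm s (sobolev_partial s U i \<phi>) \<le> B"
  shows "\<exists>V. continuous_on UNIV V \<and> (\<exists>M. \<forall>t. norm (V t) \<le> M) \<and>
    (\<forall>t. ((\<lambda>\<tau>. embv s (U (\<tau> *\<^sub>R \<omega>))) has_vector_derivative V t) (at t) \<and> (\<exists>v. v \<in> sobolev s \<and> embv s v = V t))"
proof -
  define G where "G i \<phi> = embv s (sobolev_partial s U i \<phi>)" for i \<phi>
  have part: "sobolev_partial s U i \<phi> \<in> sobolev s"
    and d: "((\<lambda>h. embv s (U (\<phi> + h *\<^sub>R axis i 1))) has_vector_derivative G i \<phi>) (at 0)" for i \<phi>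
  proof -
    obtain v where "has_sobolev_deriv s UNIV (\<lambda>h. U (\<phi> + h *\<^sub>R axis i 1)) 0 v"
      using U unfolding torus_C1_def by blast
    from embv.sobolev_derivI[OF this] show "sobolev_partial s U i \<phi> \<in> sobolev s"
      "((\<lambda>h. embv s (U (\<phi> + h *\<^sub>R axis i 1))) has_vector_derivative G i \<phi>) (at 0)"
      unfolding embv.deriv_iff[OF UNIV_I] sobolev_partial_def G_def by blast+
  qed
  have c: "continuous_on UNIV (G i)" for i
    using U unfolding torus_C1_def embv.continuous_iff G_def by blast
  define V where "V t = (\<Sum>i\<in>UNIV. (\<omega> $ i) *\<^sub>R G i (t *\<^sub>R \<omega>))" for t :: real
  have "continuous_on UNIV V" unfolding V_def
    by (intro continuous_intros continuous_on_compose2[OF c]) auto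
  moreover have "norm (V t) \<le> (\<Sum>i\<in>UNIV. \<bar>\<omega> $ i\<bar> * B)" for t unfolding V_def
  proof (rule sum_norm_le)
    fix i
    have "norm (G i (t *\<^sub>R \<omega>)) \<le> B" using b by (simp add: G_def norm_embv[OF part])
    then show "norm ((\<omega> $ i) *\<^sub>R G i (t *\<^sub>R \<omega>)) \<le> \<bar>\<omega> $ i\<bar> * B" by (simp add: mult_left_mono)
  qed
  moreover have "((\<lambda>\<tau>. embv s (U (\<tau> *\<^sub>R \<omega>))) has_vector_derivative V t) (at t)" for t
    unfolding V_def by (rule has_vector_derivative_along[OF d c])
  moreover have "\<exists>v. v \<in> sobolev s \<and> embv s v = V t" for t
  proof -
    note sc = embv_linear(5,6)[OF part part]
    have "(\<lambda>x. \<Sum>i\<in>UNIV. (\<omega> $ i) *\<^sub>R sobolev_partial s U i (t *\<^sub>R \<omega>) x) \<in> sobolev s \<and>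
      embv s (\<lambda>x. \<Sum>i\<in>UNIV. (\<omega> $ i) *\<^sub>R sobolev_partial s U i (t *\<^sub>R \<omega>) x) = V t"
      using embv_sum[of UNIV "\<lambda>i x. (\<omega> $ i) *\<^sub>R sobolev_partial s U i (t *\<^sub>R \<omega>) x" s] sc
      by (simp add: V_def G_def)
    then show ?thesis by blast
  qed
  ultimately show ?thesis by blast
qed

text \<open>Subtracting the equations removes the forcing, and the difference of the advection terms
  is \<open>adv s z u + adv s u' z\<close>. This has the form required by
  \<open>coefficient_uniqueness\<close>, with both advecting fields divergence free.\<close>

lemma global_solution_unique:
  fixes u u' :: "real \<Rightarrow> real^'d::finite \<Rightarrow> real^'d"
  assumes s: "s > real CARD('d) / 2 + 1" "2 \<le> s"
    and sol: "global_classical_solution s F u0 u p" and sol': "global_classical_solution s F u0 u' p'"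
    and u0: "u0 \<in> sobolev s" and t: "0 \<le> t"
  shows "torus_eq (u' t) (u t) \<and> torus_eq (p' t) (p t)"
proof -
  have props: "\<And>t. 0 \<le> t \<Longrightarrow> u t \<in> sobolev s" "\<And>t. 0 \<le> t \<Longrightarrow> p t \<in> sobolev s"
      "continuous_on {0..} (\<lambda>t. embv s (u t))" "\<exists>M. \<forall>t\<ge>0. norm (embv s (u t)) \<le> M"
      "embv s (u 0) = embv s u0" "\<And>t. 0 \<le> t \<Longrightarrow> coef (emb s (p t)) 0 = 0"
      "\<And>t. 0 \<le> t \<Longrightarrow> divfree (embv s (u t))"
      "\<And>t. 0 \<le> t \<Longrightarrow> torus_eq (momentum (sobolev_deriv (s - 2) {0..} u t) (u t) (p t)) (F t)"
      "\<And>t. 0 \<le> t \<Longrightarrow> sobolev_deriv (s - 2) {0..} u t \<in> sobolev (s - 2)"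
      "\<And>t. 0 \<le> t \<Longrightarrow> ((\<lambda>\<tau>. Jf (Jf (embv s (u \<tau>)))) has_vector_derivative
         embv (s - 2) (sobolev_deriv (s - 2) {0..} u t)) (at t within {0..})"
    if sol: "global_classical_solution s F u0 u p" for u p
  proof -
    have c: "sobolev_C0b {0..} s u" "sobolev_C1b {0..} (s - 2) u" "sobolev_C0b {0..} s p"
      "\<And>t. 0 \<le> t \<Longrightarrow> torus_mean_zero (p t)" "solves_NS (s - 2) {0..} F u p" "torus_eq (u 0) u0"
      using sol unfolding global_classical_solution_def by blast+
    show u: "u t \<in> sobolev s" if "0 \<le> t" for t using c(1) that by (simp add: embv.C0b_iff)
    show p: "p t \<in> sobolev s" if "0 \<le> t" for t using c(3) that by (simp add: emb.C0b_iff)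
    show "continuous_on {0..} (\<lambda>t. embv s (u t))" "\<exists>M. \<forall>t\<ge>0. norm (embv s (u t)) \<le> M"
      using c(1) unfolding embv.C0b_iff by auto
    show "embv s (u 0) = embv s u0" using c(6) torus_eq_iff_embv[OF u u0] by simp
    show "coef (emb s (p t)) 0 = 0" if "0 \<le> t" for t using c(4)[OF that] coef_emb_zero[OF p[OF that]] by simp
    fix t :: real assume t: "0 \<le> t"
    obtain v where "has_sobolev_deriv (s - 2) {0..} u t v"
      using c(2) t unfolding sobolev_C1b_def by auto
    note se = solution_emb[OF s c(5) _ at_within_Ici_neq_bot[OF t] u p[OF t] this]
    show "divfree (embv s (u t))"
      "torus_eq (momentum (sobolev_deriv (s - 2) {0..} u t) (u t) (p t)) (F t)"
      "sobolev_deriv (s - 2) {0..} u t \<in> sobolev (s - 2)"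
      "((\<lambda>\<tau>. Jf (Jf (embv s (u \<tau>)))) has_vector_derivative
         embv (s - 2) (sobolev_deriv (s - 2) {0..} u t)) (at t within {0..})"
      by (rule se; use t in simp)+
  qed
  note P = props[OF sol] and P' = props[OF sol']
  interpret A: bounded_bilinear "adv s :: 'd field \<Rightarrow> _" by (rule bounded_bilinear_adv[OF s(1)])
  interpret J: bounded_linear "Jf :: 'd field \<Rightarrow> _" by (rule bounded_linear_Jf)
  interpret L: bounded_linear "Lf :: 'd field \<Rightarrow> _" by (rule bounded_linear_Lf)
  interpret G: bounded_linear "gradf :: _ \<Rightarrow> 'd field" by (rule bounded_linear_gradf)
  obtain M M' where M: "\<And>t. 0 \<le> t \<Longrightarrow> norm (embv s (u t)) \<le> M" and M': "\<And>t. 0 \<le> t \<Longrightarrow> norm (embv s (u' t)) \<le> M'"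
    using P(4) P'(4) by blast
  let ?z = "\<lambda>t. embv s (u' t) - embv s (u t)" and ?q = "\<lambda>t. emb s (p' t) - emb s (p t)"
  have M0: "0 \<le> M" "0 \<le> M'" using M[of 0] M'[of 0] norm_ge_zero order_trans by blast+
  have cont: "continuous_on {0..} ?z" by (intro continuous_intros P P')
  have bd: "norm (?z t) \<le> M + M'" "norm (embv s (u t)) \<le> M + M'" "norm (embv s (u' t)) \<le> M + M'"
    and div: "divfree (?z t)" and q0: "coef (?q t) 0 = 0"
    and eq: "((\<lambda>\<tau>. Jf (Jf (?z \<tau>))) has_vector_derivative
        (Lf (?z t) - Jf (adv s (?z t) (embv s (u t)) + adv s (embv s (u' t)) (?z t)) - Jf (gradf (?q t)))) (at t within {0..})"
    if t: "0 \<le> t" for t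
  proof -
    show "norm (?z t) \<le> M + M'" using norm_triangle_ineq4[of "embv s (u' t)" "embv s (u t)"] M[OF t] M'[OF t] by linarith
    show "norm (embv s (u t)) \<le> M + M'" "norm (embv s (u' t)) \<le> M + M'" using M[OF t] M'[OF t] M0 by linarith+
    show "divfree (?z t)" using P'(7)[OF t] P(7)[OF t]
      by (simp add: divfree_def right_diff_distrib sum_subtractf del: embv_nth)
    show "coef (?q t) 0 = 0" using P(6)[OF t] P'(6)[OF t] by simp
    note m = sobolev_momentum[OF P(9)[OF t] P(1)[OF t] P(2)[OF t] s]
    note m' = sobolev_momentum[OF P'(9)[OF t] P'(1)[OF t] P'(2)[OF t] s]
    have "torus_eq (momentum (sobolev_deriv (s - 2) {0..} u t) (u t) (p t)) (momentum (sobolev_deriv (s - 2) {0..} u' t) (u' t) (p' t))"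
      using P(8)[OF t] P'(8)[OF t] unfolding torus_eq_def by eventually_elim simp
    then have "embv (s - 2) (momentum (sobolev_deriv (s - 2) {0..} u t) (u t) (p t)) =
        embv (s - 2) (momentum (sobolev_deriv (s - 2) {0..} u' t) (u' t) (p' t))"
      using torus_eq_iff_embv[OF m(1) m'(1)] by blast
    then have e: "embv (s - 2) (sobolev_deriv (s - 2) {0..} u' t) - embv (s - 2) (sobolev_deriv (s - 2) {0..} u t)
        = Lf (?z t) - Jf (adv s (?z t) (embv s (u t)) + adv s (embv s (u' t)) (?z t)) - Jf (gradf (?q t))"
      unfolding m(2) m'(2) L.diff G.diff A.diff_left A.diff_right J.diff J.add by (simp add: algebra_simps)
    show "((\<lambda>\<tau>. Jf (Jf (?z \<tau>))) has_vector_derivative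
        (Lf (?z t) - Jf (adv s (?z t) (embv s (u t)) + adv s (embv s (u' t)) (?z t)) - Jf (gradf (?q t)))) (at t within {0..})"
      unfolding e[symmetric] J.diff by (intro derivative_intros P(10) P'(10) t)
  qed
  have "?z 0 = 0" by (simp add: P(5) P'(5))
  note cu = coefficient_uniqueness[OF s(1) cont P(3) P'(3) bd div P'(7) this q0 eq t]
  then show ?thesis
    using torus_eq_iff_embv[OF P'(1)[OF t] P(1)[OF t]] torus_eq_iff_emb[OF P'(2)[OF t] P(2)[OF t]] cu by simp
qed

lemma C0b_sum_emb:
  fixes u v :: "real \<Rightarrow> real^'d::finite \<Rightarrow> real^'d"
  assumes "\<And>t. t \<in> I \<Longrightarrow> u t \<in> sobolev r" "\<And>t. t \<in> I \<Longrightarrow> embv r (u t) = a t"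
    and "continuous_on I a" "\<And>t. t \<in> I \<Longrightarrow> norm (a t) \<le> M"
  shows "sobolev_C0b I r u"
  unfolding embv.C0b_iff
proof (intro conjI)
  show "continuous_on I (\<lambda>t. embv r (u t))" using assms(2,3) by (simp cong: continuous_on_cong)
qed (use assms in auto)

text \<open>The solution is the background plus functions represented by \<open>w\<close> and
  \<open>q\<close>. The equation is checked by comparing encodings in H^(s-2) with the equation of
  the background, which already contains the forcing.\<close>

lemma perturbed_solution:
  fixes U :: "real^'n::finite \<Rightarrow> real^'d::finite \<Rightarrow> real^'d"
  assumes s: "s > real CARD('d) / 2 + 1" "2 \<le> s" and \<alpha>: "0 < \<alpha>"
    and qp: "quasi_periodic_solution c s f C0 \<omega> \<epsilon> U P" and u0: "u0 \<in> sobolev s"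
    and w0: "w 0 = embv s (\<lambda>x. u0 x - U 0 x)"
    and cont: "continuous_on {0..} w" "continuous_on {0..} q" "continuous_on {0..} V"
    and w: "\<And>t. 0 \<le> t \<Longrightarrow> herf (w t) \<and> divfree (w t) \<and> (\<forall>j. coef (w t $ j) 0 = 0)"
    and q: "\<And>t. 0 \<le> t \<Longrightarrow> her (q t) \<and> coef (q t) 0 = 0"
    and bd: "\<And>t. 0 \<le> t \<Longrightarrow> norm (w t) \<le> K * exp (- \<alpha> * t)" "\<And>t. 0 \<le> t \<Longrightarrow> norm (q t) \<le> K * exp (- \<alpha> * t)"
      "\<And>t. 0 \<le> t \<Longrightarrow> norm (V t) \<le> K * exp (- \<alpha> * t)"
    and V: "\<And>t. 0 \<le> t \<Longrightarrow> V t = Lf (w t) - Jf (adv s (embv s (U (t *\<^sub>R \<omega>))) (w t) + adv s (w t) (embv s (U (t *\<^sub>R \<omega>)))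
        + adv s (w t) (w t)) - Jf (gradf (q t))"
    and dw: "\<And>t. 0 \<le> t \<Longrightarrow> ((\<lambda>\<tau>. Jf (Jf (w \<tau>))) has_vector_derivative V t) (at t within {0..})"
  shows "\<exists>u p. global_classical_solution s (\<lambda>t x. \<epsilon> *\<^sub>R f (t *\<^sub>R \<omega>) x) u0 u p \<and>
    (\<forall>t\<ge>0. torus_mean_zero (\<lambda>x. u t x - U (t *\<^sub>R \<omega>) x) \<and>
       sobolev_norm s (\<lambda>x. u t x - U (t *\<^sub>R \<omega>) x) \<le> K * exp (- \<alpha> * t) \<and>
       sobolev_norm (s - 2) (\<lambda>x. sobolev_deriv (s - 2) {0..} u t x
            - sobolev_deriv (s - 2) UNIV (\<lambda>\<tau>. U (\<tau> *\<^sub>R \<omega>)) t x) \<le> K * exp (- \<alpha> * t) \<and>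
       sobolev_norm s (\<lambda>x. p t x - P (t *\<^sub>R \<omega>) x) \<le> K * exp (- \<alpha> * t))"
proof -
  interpret A: bounded_bilinear "adv s :: 'd field \<Rightarrow> _" by (rule bounded_bilinear_adv[OF s(1)])
  interpret J: bounded_linear "Jf :: 'd field \<Rightarrow> _" by (rule bounded_linear_Jf)
  interpret L: bounded_linear "Lf :: 'd field \<Rightarrow> _" by (rule bounded_linear_Lf)
  interpret G: bounded_linear "gradf :: _ \<Rightarrow> 'd field" by (rule bounded_linear_gradf)
  let ?F = "\<lambda>t x. \<epsilon> *\<^sub>R f (t *\<^sub>R \<omega>) x"
  define a where "a t = U (t *\<^sub>R \<omega>)" for t
  define b where "b t = P (t *\<^sub>R \<omega>)" for t
  have Q: "torus_C1 s U" "torus_C0 s P" "\<And>\<phi>. torus_mean_zero (P \<phi>)" "\<And>\<phi>. sobolev_norm s (U \<phi>) \<le> C0 * \<epsilon>"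
    "\<And>i \<phi>. sobolev_norm s (sobolev_partial s U i \<phi>) \<le> C0 * \<epsilon>" "\<And>\<phi>. sobolev_norm s (P \<phi>) \<le> C0 * \<epsilon>"
    "solves_NS (s - 2) UNIV ?F a b"
    using qp unfolding quasi_periodic_solution_def a_def[abs_def] b_def[abs_def] by blast+
  have Us: "U \<phi> \<in> sobolev s" and Uc: "continuous_on UNIV (\<lambda>\<phi>. embv s (U \<phi>))" for \<phi>
    using Q(1) unfolding torus_C1_def torus_C0_def embv.continuous_iff by blast+
  have Ps: "P \<phi> \<in> sobolev s" and Pc: "continuous_on UNIV (\<lambda>\<phi>. emb s (P \<phi>))" for \<phi>
    using Q(2) unfolding torus_C0_def emb.continuous_iff by blast+
  have as: "a t \<in> sobolev s" and bs: "b t \<in> sobolev s" for t by (simp_all add: a_def b_def Us Ps)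
  have na: "norm (embv s (a t)) \<le> C0 * \<epsilon>" and nb: "norm (emb s (b t)) \<le> C0 * \<epsilon>" for t
    using Q(4,6) by (simp_all add: norm_embv[OF as] norm_emb[OF bs]) (simp_all add: a_def b_def)
  have ac: "continuous_on S (\<lambda>t. embv s (a t))" and bc: "continuous_on S (\<lambda>t. emb s (b t))" for S
    unfolding a_def b_def by (intro continuous_on_compose2[OF Uc] continuous_on_compose2[OF Pc] continuous_intros; simp)+
  obtain Va Ma where Va: "continuous_on UNIV Va" "\<And>t. norm (Va t) \<le> Ma"
    "\<And>t. ((\<lambda>\<tau>. embv s (a \<tau>)) has_vector_derivative Va t) (at t)" "\<And>t. \<exists>v. v \<in> sobolev s \<and> embv s v = Va t"
    using quasi_periodic_derivative[OF Q(1,5), of \<omega>] unfolding a_def by blast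
  let ?da = "sobolev_deriv (s - 2) UNIV a"
  have da: "divfree (embv s (a t))" "torus_eq (momentum (?da t) (a t) (b t)) (?F t)" "?da t \<in> sobolev (s - 2)"
      "embv (s - 2) (?da t) = Jf (Jf (Va t))" for t
  proof -
    obtain v where v: "v \<in> sobolev s" "embv s v = Va t" using Va(4) by blast
    have JV: "((\<lambda>\<tau>. Jf (Jf (embv s (a \<tau>)))) has_vector_derivative Jf (Jf (Va t))) (at t)"
      by (intro J.has_vector_derivative Va)
    have "has_sobolev_deriv (s - 2) UNIV a t v"
      unfolding embv.deriv_iff[OF UNIV_I] using embv_shift2[OF v(1)] embv_shift2[OF as] JV by (simp add: v(2))
    note se = solution_emb[OF s Q(7) UNIV_I _ as bs this]
    show "divfree (embv s (a t))" "torus_eq (momentum (?da t) (a t) (b t)) (?F t)" "?da t \<in> sobolev (s - 2)"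
      by (rule se; simp)+
    show "embv (s - 2) (?da t) = Jf (Jf (Va t))" by (rule vector_derivative_unique_at[OF se(4) JV]) simp
  qed
  \<comment> \<open>Representatives are chosen at each time independently; regularity in time
    concerns only their encodings.\<close>
  have "\<forall>t. \<exists>y. 0 \<le> t \<longrightarrow> y \<in> sobolev s \<and> embv s y = w t" using embv_surj[of s] w s(2) by auto
  from choice[OF this] obtain y where y: "\<And>t. 0 \<le> t \<Longrightarrow> y t \<in> sobolev s" "\<And>t. 0 \<le> t \<Longrightarrow> embv s (y t) = w t" by blast
  have "\<exists>z. z \<in> sobolev s \<and> emb s z = q t" if "0 \<le> t" for t
    by (rule emb_surj[of s "q t"]) (use q[OF that] s(2) in auto)
  then have "\<forall>t. \<exists>z. 0 \<le> t \<longrightarrow> z \<in> sobolev s \<and> emb s z = q t" by blast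
  from choice[OF this] obtain z where z: "\<And>t. 0 \<le> t \<Longrightarrow> z t \<in> sobolev s" "\<And>t. 0 \<le> t \<Longrightarrow> emb s (z t) = q t" by blast
  define u where "u t x = a t x + y t x" for t x
  define p where "p t x = b t x + z t x" for t x
  have u: "u t \<in> sobolev s" "embv s (u t) = embv s (a t) + w t" if "0 \<le> t" for t
    using embv_linear(1,2)[OF as y(1)[OF that]] y(2)[OF that] unfolding u_def[abs_def] by simp_all
  have p: "p t \<in> sobolev s" "emb s (p t) = emb s (b t) + q t" if "0 \<le> t" for t
    using sobolev_linear(1,2)[OF bs z(1)[OF that]] z(2)[OF that] unfolding p_def[abs_def] by simp_all
  have K: "0 \<le> K" using order_trans[OF norm_ge_zero bd(1)[of 0]] by simp
  have le: "K * exp (- \<alpha> * t) \<le> K" if "0 \<le> t" for t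
    using mult_left_mono[OF _ K, of "exp (- \<alpha> * t)" 1] \<alpha> that by simp
  \<comment> \<open>A derivative must be exhibited as a function in H^(s-2). The equation supplies
    it: the derivative of the background plus the right-hand side of the perturbation
    equation.\<close>
  have dd: "has_sobolev_deriv (s - 2) {0..} u t (\<lambda>x. ?da t x + laplacian (y t) x - (advection (a t) (y t) x + advection (y t) (a t) x
         + advection (y t) (y t) x) - grad (z t) x)"
    and dd_emb: "embv (s - 2) (\<lambda>x. ?da t x + laplacian (y t) x - (advection (a t) (y t) x + advection (y t) (a t) x
         + advection (y t) (y t) x) - grad (z t) x) = Jf (Jf (Va t)) + V t" if t: "0 \<le> t" for t
  proof -
    note yt = y(1)[OF t] and lap = sobolev_laplacian[OF y(1)[OF t] s(2)]
      and a1 = sobolev_advection[OF as yt s(1), of t] and a2 = sobolev_advection[OF yt as s(1), of t] and a3 = sobolev_advection[OF yt yt s(1)]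
    have g: "grad (z t) \<in> sobolev (s - 2)" "embv (s - 2) (grad (z t)) = Jf (gradf (emb s (z t)))"
      using sobolev_grad[OF z(1)[OF t]] s(2) by auto
    note 1 = embv_linear(1,2)[OF da(3) lap(1), of t]
    note 2 = embv_linear(1,2)[OF a1(1) a2(1)]
    note 3 = embv_linear(1,2)[OF 2(1) a3(1)]
    note 4 = embv_linear(3,4)[OF 1(1) 3(1)]
    note 5 = embv_linear(3,4)[OF 4(1) g(1)]
    show e: "embv (s - 2) (\<lambda>x. ?da t x + laplacian (y t) x - (advection (a t) (y t) x + advection (y t) (a t) x
         + advection (y t) (y t) x) - grad (z t) x) = Jf (Jf (Va t)) + V t"
      unfolding 5(2) 4(2) 3(2) 2(2) 1(2) g(2) lap(2) a1(2) a2(2) a3(2) da(4) y(2)[OF t] z(2)[OF t] V[OF t]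
      by (simp add: J.add a_def)
    have "((\<lambda>\<tau>. Jf (Jf (embv s (a \<tau>))) + Jf (Jf (w \<tau>))) has_vector_derivative Jf (Jf (Va t)) + V t) (at t within {0..})"
      by (intro has_vector_derivative_add dw t J.has_vector_derivative has_vector_derivative_at_within[OF Va(3)])
    then have "((\<lambda>\<tau>. embv (s - 2) (u \<tau>)) has_vector_derivative Jf (Jf (Va t)) + V t) (at t within {0..})"
      by (rule has_vector_derivative_transform[rotated 2]) (use t in \<open>auto simp: embv_shift2(2)[OF u(1)] u(2) J.add\<close>)
    then show "has_sobolev_deriv (s - 2) {0..} u t (\<lambda>x. ?da t x + laplacian (y t) x - (advection (a t) (y t) x + advection (y t) (a t) x
         + advection (y t) (y t) x) - grad (z t) x)"
      using t 5(1) embv_shift2(1)[OF u(1)] unfolding embv.deriv_iff[of t "{0..}", OF atLeast_iff[THEN iffD2, OF t]] e by auto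
  qed
  let ?du = "sobolev_deriv (s - 2) {0..} u"
  have du: "?du t \<in> sobolev (s - 2)" "embv (s - 2) (?du t) = Jf (Jf (Va t)) + V t" if t: "0 \<le> t" for t
    using embv.sobolev_deriv_eq[OF _ at_within_Ici_neq_bot[OF t] dd[OF t]] t dd_emb[OF t] by auto
  have JJ: "norm (Jf (Jf x)) \<le> norm x" for x :: "'d field"
    using norm_Jf_le[of "Jf x"] norm_Jf_le[of x] by linarith
  have nu: "norm (embv s (a t) + w t) \<le> C0 * \<epsilon> + K" if t: "0 \<le> t" for t
    by (rule order_trans[OF norm_triangle_ineq add_mono[OF na order_trans[OF bd(1)[OF t] le[OF t]]]])
  have C0u: "sobolev_C0b {0..} s u"
    by (rule C0b_sum_emb[where a="\<lambda>t. embv s (a t) + w t"]) (use u nu in \<open>auto intro!: continuous_intros ac cont\<close>)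
  have C0u': "sobolev_C0b {0..} (s - 2) u"
  proof (rule C0b_sum_emb[where a="\<lambda>t. Jf (Jf (embv s (a t) + w t))"])
    show "continuous_on {0..} (\<lambda>t. Jf (Jf (embv s (a t) + w t)))" by (intro J.continuous_on continuous_intros ac cont)
    show "norm (Jf (Jf (embv s (a t) + w t))) \<le> C0 * \<epsilon> + K" if "t \<in> {0..}" for t
      using JJ[of "embv s (a t) + w t"] nu[of t] that by simp
  qed (use embv_shift2[OF u(1)] u(2) in auto)
  have C0du: "sobolev_C0b {0..} (s - 2) ?du"
  proof (rule C0b_sum_emb[where a="\<lambda>t. Jf (Jf (Va t)) + V t"])
    show "continuous_on {0..} (\<lambda>t. Jf (Jf (Va t)) + V t)"
      by (intro J.continuous_on continuous_intros cont continuous_on_subset[OF Va(1)]) auto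
    show "norm (Jf (Jf (Va t)) + V t) \<le> Ma + K" if "t \<in> {0..}" for t
      by (rule order_trans[OF norm_triangle_ineq]) (use JJ[of "Va t"] Va(2)[of t] bd(3)[of t] le[of t] that in auto)
  qed (use du in auto)
  have C1u: "sobolev_C1b {0..} (s - 2) u" unfolding sobolev_C1b_def using C0u' C0du dd by blast
  have np: "norm (emb s (b t) + q t) \<le> C0 * \<epsilon> + K" if t: "0 \<le> t" for t
    by (rule order_trans[OF norm_triangle_ineq add_mono[OF nb order_trans[OF bd(2)[OF t] le[OF t]]]])
  have C0p: "sobolev_C0b {0..} s p"
    unfolding emb.C0b_iff
  proof (intro conjI)
    have "continuous_on {0..} (\<lambda>t. emb s (b t) + q t)" by (intro continuous_intros bc cont)
    then show "continuous_on {0..} (\<lambda>t. emb s (p t))" by (rule continuous_on_eq) (simp add: p(2))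
  qed (use p np in auto)
  have mp: "torus_mean_zero (p t)" if t: "0 \<le> t" for t
  proof -
    have "coef (emb s (b t)) 0 = 0" using coef_emb_zero[OF bs] Q(3) by (simp add: b_def)
    then show ?thesis using coef_emb_zero[OF p(1)[OF t]] p(2)[OF t] q[OF t] by simp
  qed
  have NS: "solves_NS (s - 2) {0..} ?F u p"
    unfolding solves_NS_def
  proof (intro ballI conjI)
    fix t :: real assume "t \<in> {0..}" then have t: "0 \<le> t" by simp
    note mu = sobolev_momentum[OF du(1)[OF t] u(1)[OF t] p(1)[OF t] s]
    note ma = sobolev_momentum[OF da(3) as bs s, of t t t]
    \<comment> \<open>By bilinearity the advection of the sum exceeds that of the background by
      exactly the three terms in \<open>V t\<close>, so all perturbation terms cancel.\<close>
    have "embv (s - 2) (momentum (?du t) (u t) (p t)) = embv (s - 2) (momentum (?da t) (a t) (b t))"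
      unfolding mu(2) ma(2) du(2)[OF t] u(2)[OF t] p(2)[OF t] V[OF t] da(4) L.add G.add J.add A.add_left A.add_right
      by (simp add: a_def algebra_simps)
    then have "torus_eq (momentum (?du t) (u t) (p t)) (momentum (?da t) (a t) (b t))"
      using torus_eq_iff_embv[OF mu(1) ma(1)] by blast
    then have "torus_eq (momentum (?du t) (u t) (p t)) (?F t)"
      using da(2)[of t] unfolding torus_eq_def by eventually_elim simp
    then show "torus_eq (\<lambda>x. ?du t x - laplacian (u t) x + advection (u t) (u t) x + grad (p t) x) (?F t)"
      unfolding momentum_def[abs_def] .
    have "divfree (embv s (u t))"
      using da(1)[of t] w[OF t] unfolding u(2)[OF t] divfree_def
      by (simp add: ring_distribs sum.distrib del: embv_nth)
    then show "torus_eq (divergence (u t)) (\<lambda>x. 0)" using divergence_free_iff[OF u(1)[OF t]] s(2) by simp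
  qed
  have "embv s (u 0) = embv s u0"
    using u(2)[of 0] w0 embv_linear(4)[OF u0 Us[of 0]] by (simp add: a_def del: embv_nth)
  then have "torus_eq (u 0) u0" using torus_eq_iff_embv[OF u(1) u0] by simp
  then have sol: "global_classical_solution s ?F u0 u p"
    unfolding global_classical_solution_def using C0u C1u C0p mp NS by blast
  have ua: "(\<lambda>x. u t x - U (t *\<^sub>R \<omega>) x) = y t" and pb: "(\<lambda>x. p t x - P (t *\<^sub>R \<omega>) x) = z t" for t
    by (simp_all add: u_def p_def a_def b_def)
  have "torus_mean_zero (y t) \<and> sobolev_norm s (y t) \<le> K * exp (- \<alpha> * t) \<and>
       sobolev_norm (s - 2) (\<lambda>x. ?du t x - ?da t x) \<le> K * exp (- \<alpha> * t) \<and> sobolev_norm s (z t) \<le> K * exp (- \<alpha> * t)"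
    if t: "0 \<le> t" for t
  proof (intro conjI)
    show "torus_mean_zero (y t)" using coef_embv_zero[OF y(1)[OF t]] w[OF t] y(2)[OF t] by simp
    show "sobolev_norm s (y t) \<le> K * exp (- \<alpha> * t)" using bd(1)[OF t] unfolding norm_embv[OF y(1)[OF t], symmetric] y(2)[OF t] .
    show "sobolev_norm s (z t) \<le> K * exp (- \<alpha> * t)" using bd(2)[OF t] unfolding norm_emb[OF z(1)[OF t], symmetric] z(2)[OF t] .
    note e = embv_linear(3,4)[OF du(1)[OF t] da(3), of t]
    have "embv (s - 2) (\<lambda>x. ?du t x - ?da t x) = V t" unfolding e(2) du(2)[OF t] da(4) by simp
    then show "sobolev_norm (s - 2) (\<lambda>x. ?du t x - ?da t x) \<le> K * exp (- \<alpha> * t)"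
      using bd(3)[OF t] unfolding norm_embv[OF e(1), symmetric] by simp
  qed
  then show ?thesis
    using sol unfolding a_def[abs_def] by (intro exI[of _ u] exI[of _ p] conjI) (simp_all add: ua pb)
qed

theorem theorem1p2:
  fixes f :: "real^'n::finite \<Rightarrow> real^'d::finite \<Rightarrow> real^'d"
    and s \<alpha> \<epsilon>0 C0 :: real and N :: nat and c :: forcing_case
  assumes "CARD('d) \<ge> 2"
    and "s > real CARD('d) / 2 + 1"
    and "real N > 3 * real CARD('n) / 2 + s + 2"
    and "torus_C_class N f"
    and "admissible_forcing c f"
    and "0 < \<epsilon>0" and "\<epsilon>0 < 1" and "C0 > 0"
    and "0 < \<alpha>" and "\<alpha> < 1"
  shows "\<exists>\<delta> C. 0 < \<delta> \<and> \<delta> < 1 \<and> C > 0 \<and>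
    (\<forall>\<omega> \<epsilon> U P u0.
       admissible_frequency c \<omega> \<and> 0 < \<epsilon> \<and> \<epsilon> < \<epsilon>0 \<and> \<epsilon> \<le> \<delta> \<and>
       quasi_periodic_solution c s f C0 \<omega> \<epsilon> U P \<and>
       u0 \<in> sobolev s \<and> torus_eq (divergence u0) (\<lambda>x. 0) \<and>
       sobolev_norm s (\<lambda>x. u0 x - U 0 x) \<le> \<delta> \<and>
       torus_mean_zero (\<lambda>x. u0 x - U 0 x) \<longrightarrow>
       (\<exists>u p.
          global_classical_solution s (\<lambda>t x. \<epsilon> *\<^sub>R f (t *\<^sub>R \<omega>) x) u0 u p \<and>
          (\<forall>u' p'. global_classical_solution s (\<lambda>t x. \<epsilon> *\<^sub>R f (t *\<^sub>R \<omega>) x) u0 u' p' \<longrightarrow>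
             (\<forall>t\<ge>0. torus_eq (u' t) (u t) \<and> torus_eq (p' t) (p t))) \<and>
          (\<forall>t\<ge>0.
             torus_mean_zero (\<lambda>x. u t x - U (t *\<^sub>R \<omega>) x) \<and>
             sobolev_norm s (\<lambda>x. u t x - U (t *\<^sub>R \<omega>) x) \<le> C * \<delta> * exp (- \<alpha> * t) \<and>
             sobolev_norm (s - 2)
               (\<lambda>x. sobolev_deriv (s - 2) {0..} u t x
                    - sobolev_deriv (s - 2) UNIV (\<lambda>\<tau>. U (\<tau> *\<^sub>R \<omega>)) t x)
               \<le> C * \<delta> * exp (- \<alpha> * t) \<and>
             sobolev_norm s (\<lambda>x. p t x - P (t *\<^sub>R \<omega>) x) \<le> C * \<delta> * exp (- \<alpha> * t))))"
proof -
  \<comment> \<open>Dimension at least two gives \<open>s > 2\<close>, so the exponent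
    \<open>s - 2\<close> is nonnegative and H^(s-2) consists of functions.\<close>
  have s: "s > real CARD('d) / 2 + 1" "2 \<le> s" using assms(1,2) by linarith+
  \<comment> \<open>Both constants are fixed before the frequency, the amplitude, the quasi-periodic
    solution and the initial datum are introduced.\<close>
  obtain \<delta> C where \<delta>: "0 < \<delta>" "\<delta> < 1" "0 < C" and ex: "\<And>A (w0 :: 'd field).
    continuous_on {0..} A \<and> (\<forall>t\<ge>0. norm (A t) \<le> C0 * \<delta> \<and> herf (A t) \<and> divfree (A t)) \<and>
    norm w0 \<le> \<delta> \<and> herf w0 \<and> divfree w0 \<and> (\<forall>j. coef (w0 $ j) 0 = 0) \<Longrightarrow>
    (\<exists>w q V. w 0 = w0 \<and> continuous_on {0..} w \<and> continuous_on {0..} q \<and> continuous_on {0..} V \<and>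
      (\<forall>t\<ge>0. herf (w t) \<and> divfree (w t) \<and> (\<forall>j. coef (w t $ j) 0 = 0) \<and> her (q t) \<and> coef (q t) 0 = 0 \<and>
        norm (w t) \<le> C * \<delta> * exp (- \<alpha> * t) \<and> norm (q t) \<le> C * \<delta> * exp (- \<alpha> * t) \<and>
        norm (V t) \<le> C * \<delta> * exp (- \<alpha> * t) \<and>
        V t = Lf (w t) - Jf (adv s (A t) (w t) + adv s (w t) (A t) + adv s (w t) (w t)) - Jf (gradf (q t)) \<and>
        ((\<lambda>\<tau>. Jf (Jf (w \<tau>))) has_vector_derivative V t) (at t within {0..})))"
    using coefficient_existence[where 'd='d, OF s(1) assms(9,10,8)] by (elim exE conjE) (rule that; blast)
  show ?thesis
  proof (rule exI[of _ \<delta>], rule exI[of _ C], intro conjI \<delta> allI impI, elim conjE)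
    fix \<omega> :: "real^'n" and \<epsilon> :: real and U :: "real^'n \<Rightarrow> real^'d \<Rightarrow> real^'d" and P and u0 :: "real^'d \<Rightarrow> real^'d"
    assume \<epsilon>: "0 < \<epsilon>" "\<epsilon> \<le> \<delta>" and qp: "quasi_periodic_solution c s f C0 \<omega> \<epsilon> U P"
      and u0: "u0 \<in> sobolev s" and div: "torus_eq (divergence u0) (\<lambda>x. 0)"
      and small: "sobolev_norm s (\<lambda>x. u0 x - U 0 x) \<le> \<delta>" and mean: "torus_mean_zero (\<lambda>x. u0 x - U 0 x)"
    have Q: "torus_C1 s U" "\<And>\<phi>. sobolev_norm s (U \<phi>) \<le> C0 * \<epsilon>"
      "solves_NS (s - 2) UNIV (\<lambda>t x. \<epsilon> *\<^sub>R f (t *\<^sub>R \<omega>) x) (\<lambda>t. U (t *\<^sub>R \<omega>)) (\<lambda>t. P (t *\<^sub>R \<omega>))"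
      using qp unfolding quasi_periodic_solution_def by blast+
    have Us: "U \<phi> \<in> sobolev s" and Uc: "continuous_on UNIV (\<lambda>\<phi>. embv s (U \<phi>))" for \<phi>
      using Q(1) unfolding torus_C1_def torus_C0_def embv.continuous_iff by blast+
    have Ud: "divfree (embv s (U (t *\<^sub>R \<omega>)))" for t
      using Q(3) divergence_free_iff[OF Us, of "t *\<^sub>R \<omega>"] s(2) unfolding solves_NS_def by simp
    have u0d: "divfree (embv s u0)" using div divergence_free_iff[OF u0] s(2) by simp
    note d = embv_linear(3,4)[OF u0 Us[of 0]]
    let ?A = "\<lambda>t. embv s (U (t *\<^sub>R \<omega>))" and ?w0 = "embv s (\<lambda>x. u0 x - U 0 x)"
    have A: "continuous_on {0..} ?A" by (intro continuous_on_compose2[OF Uc] continuous_intros) simp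
    \<comment> \<open>The assumption \<open>\<epsilon> \<le> \<delta>\<close> turns the size of the
      background into a multiple of \<open>\<delta>\<close>, as the contraction requires.\<close>
    have An: "norm (?A t) \<le> C0 * \<delta>" for t
      unfolding norm_embv[OF Us] by (rule order_trans[OF Q(2) mult_left_mono[OF \<epsilon>(2)]]) (use assms(8) in simp)
    have w0d: "divfree ?w0" using u0d Ud[of 0] unfolding d(2) divfree_def
      by (simp add: ring_distribs sum_subtractf del: embv_nth)
    have w0n: "norm ?w0 \<le> \<delta>" using small unfolding norm_embv[OF d(1)] .
    have w0m: "\<forall>j. coef (?w0 $ j) 0 = 0" using mean coef_embv_zero[OF d(1)] by blast
    have "continuous_on {0..} ?A \<and> (\<forall>t\<ge>0. norm (?A t) \<le> C0 * \<delta> \<and> herf (?A t) \<and> divfree (?A t)) \<and>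
      norm ?w0 \<le> \<delta> \<and> herf ?w0 \<and> divfree ?w0 \<and> (\<forall>j. coef (?w0 $ j) 0 = 0)"
      by (intro conjI allI impI A An herf_embv Us Ud w0d w0n d(1) w0m)
    from ex[OF this] obtain w q V where wc: "w 0 = ?w0" "continuous_on {0..} w" "continuous_on {0..} q" "continuous_on {0..} V"
      and H: "\<forall>t\<ge>0. herf (w t) \<and> divfree (w t) \<and> (\<forall>j. coef (w t $ j) 0 = 0) \<and> her (q t) \<and> coef (q t) 0 = 0 \<and>
        norm (w t) \<le> C * \<delta> * exp (- \<alpha> * t) \<and> norm (q t) \<le> C * \<delta> * exp (- \<alpha> * t) \<and>
        norm (V t) \<le> C * \<delta> * exp (- \<alpha> * t) \<and>
        V t = Lf (w t) - Jf (adv s (?A t) (w t) + adv s (w t) (?A t) + adv s (w t) (w t)) - Jf (gradf (q t)) \<and>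
        ((\<lambda>\<tau>. Jf (Jf (w \<tau>))) has_vector_derivative V t) (at t within {0..})"
      by (elim exE conjE) (rule that; assumption)
    note H = spec[OF H, THEN mp]
    have wqV: "herf (w t) \<and> divfree (w t) \<and> (\<forall>j. coef (w t $ j) 0 = 0)" "her (q t) \<and> coef (q t) 0 = 0"
      "norm (w t) \<le> C * \<delta> * exp (- \<alpha> * t)" "norm (q t) \<le> C * \<delta> * exp (- \<alpha> * t)" "norm (V t) \<le> C * \<delta> * exp (- \<alpha> * t)"
      "V t = Lf (w t) - Jf (adv s (?A t) (w t) + adv s (w t) (?A t) + adv s (w t) (w t)) - Jf (gradf (q t))"
      "((\<lambda>\<tau>. Jf (Jf (w \<tau>))) has_vector_derivative V t) (at t within {0..})" if "0 \<le> t" for t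
      using H[OF that] by blast+
    from perturbed_solution[OF s assms(9) qp u0 wc wqV]
    obtain u p where sol: "global_classical_solution s (\<lambda>t x. \<epsilon> *\<^sub>R f (t *\<^sub>R \<omega>) x) u0 u p"
      and est: "\<forall>t\<ge>0. torus_mean_zero (\<lambda>x. u t x - U (t *\<^sub>R \<omega>) x) \<and>
       sobolev_norm s (\<lambda>x. u t x - U (t *\<^sub>R \<omega>) x) \<le> C * \<delta> * exp (- \<alpha> * t) \<and>
       sobolev_norm (s - 2) (\<lambda>x. sobolev_deriv (s - 2) {0..} u t x
            - sobolev_deriv (s - 2) UNIV (\<lambda>\<tau>. U (\<tau> *\<^sub>R \<omega>)) t x) \<le> C * \<delta> * exp (- \<alpha> * t) \<and>
       sobolev_norm s (\<lambda>x. p t x - P (t *\<^sub>R \<omega>) x) \<le> C * \<delta> * exp (- \<alpha> * t)" by blast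
    show "\<exists>u p. global_classical_solution s (\<lambda>t x. \<epsilon> *\<^sub>R f (t *\<^sub>R \<omega>) x) u0 u p \<and>
          (\<forall>u' p'. global_classical_solution s (\<lambda>t x. \<epsilon> *\<^sub>R f (t *\<^sub>R \<omega>) x) u0 u' p' \<longrightarrow>
             (\<forall>t\<ge>0. torus_eq (u' t) (u t) \<and> torus_eq (p' t) (p t))) \<and>
          (\<forall>t\<ge>0.
             torus_mean_zero (\<lambda>x. u t x - U (t *\<^sub>R \<omega>) x) \<and>
             sobolev_norm s (\<lambda>x. u t x - U (t *\<^sub>R \<omega>) x) \<le> C * \<delta> * exp (- \<alpha> * t) \<and>
             sobolev_norm (s - 2)
               (\<lambda>x. sobolev_deriv (s - 2) {0..} u t x
                    - sobolev_deriv (s - 2) UNIV (\<lambda>\<tau>. U (\<tau> *\<^sub>R \<omega>)) t x)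
               \<le> C * \<delta> * exp (- \<alpha> * t) \<and>
             sobolev_norm s (\<lambda>x. p t x - P (t *\<^sub>R \<omega>) x) \<le> C * \<delta> * exp (- \<alpha> * t))"
      by (intro exI[of _ u] exI[of _ p] conjI sol est)
        (intro allI impI global_solution_unique[OF s sol _ u0])
  qed
qed

end
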